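(* Let $\kappa>0$ be a limit ordinal, let $\mathcal E$ be a category with a $\kappa$-backdrop $\mathcal M$, and let $u:\mathcal J\to\mathcal E^{\to}$ be a diagram compatible with $\mathcal M$ such that $\mathrm{dom}(u_i)$ is $(\kappa,\mathcal M)$-small for every $i\in\mathcal J$. Then there is an algebraic weak factorization system $(\mathsf L,\mathsf R)$ on $\mathcal E$ cofibrantly generated by $u$.
   Context: **Ordinals.** An ordinal is a transitive set of transitive sets; $\alpha<\beta$ means $\alpha\in\beta$ and $\alpha\preceq\beta$ means $\alpha<\beta$ or $\alpha=\beta$. $\alpha$ is a limit ordinal if for every family $(\beta_i<\alpha)_{i\in I}$ with $I$ finite inhabited there is $\beta<\alpha$ with all $\beta_i<\beta$. An $\alpha$-chain is a diagram indexed by the poset $(\alpha,\preceq)$. **Backdrops.** $\mathcal E^{\to}$ is the arrow category. A wide subcategory $\mathcal M\hookrightarrow\mathcal E$ *has $\mathcal K$-indexed colimits in $\mathcal E$* if the category $\mathcal M$ has them and the inclusion preserves them; it is *closed under cobase change in $\mathcal E$* if for all $A\to B$ in $\mathcal M$ and $A\to X$ in $\mathcal E$ there is a pushout square in $\mathcal E$ whose map $X\to Y$ opposite $A\to B$ is in $\mathcal M$. $\mathcal M$ is a *$\kappa$-backdrop* if (a) $\mathcal M$ has colimits of $(1+\alpha)$-chains in $\mathcal E$ for $\alpha<\kappa$; (b) $\kappa$-chains in $\mathcal M$ have colimits in $\mathcal E$; (c) $\mathcal M$ is closed under cobase change in $\mathcal E$. $A\in\mathcal E$ is *$(\kappa,\mathcal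 M)$-small* if $\mathcal E(A,-)$ preserves colimits of $\kappa$-chains in $\mathcal M$. **Density comonad, compatibility.** $\mathrm D_u:\mathcal E^\to\to\mathcal E^\to$ is (when it exists) the pointwise left Kan extension of $u$ along itself, $\mathrm D_u(f)=\mathrm{colim}(u\downarrow f\to\mathcal J\xrightarrow{u}\mathcal E^\to)$. $u$ is *compatible with $\mathcal M$* if (a) $\mathrm D_u$ exists and every $\mathrm D_u(f)$ lies in $\mathcal M$; (b) for every square $(h,k):f\to g$ with $h,k\in\mathcal M$, the pushout gap map $\mathrm{cod}\,\mathrm D_uf\sqcup_{\mathrm{dom}\,\mathrm D_uf}\mathrm{dom}\,\mathrm D_ug\to\mathrm{cod}\,\mathrm D_ug$ is in $\mathcal M$. **AWFS.** An AWFS on $\mathcal E$ consists of functors $L,R:\mathcal E^\to\to\mathcal E^\to$ with $\mathrm{dom}L=\mathrm{dom}$, $\mathrm{cod}L=\mathrm{dom}R=:E$, $\mathrm{cod}R=\mathrm{cod}$, $Rf\circ Lf=f$, a comonad $\mathsf L=(L,\Phi,\Sigma)$ with counit $\Phi_f=(\mathrm{id},Rf):Lf\to f$ and a monad $\mathsf R=(R,\Lambda,\Pi)$ with unit $\Lambda_f=(Lf,\mathrm{id}):f\to Rf$; then $\Sigma_f=(\mathrm{id},\delta_f)$, $\Pi_f=(\mu_f,\mathrm{id})$ with $\delta_f:Ef\to ELf$, $\mu_f:ERf\to Ef$, and the squares $(\delta_f,\mu_f):LRf\to RLf$ are required to form a distributive law of $\mathsf L$ over $\mathsf R$. **Cofibrant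 generation.** $\mathbb S\mathrm q(\mathcal E)$ is the double category whose objects are those of $\mathcal E$, whose horizontal and vertical morphisms are both the morphisms of $\mathcal E$, and whose squares are commutative squares. $\mathsf R\text{-}\mathbb A\mathrm{lg}$ is the double category whose objects and horizontal morphisms are those of $\mathcal E$, whose vertical morphisms $A\to B$ are $\mathsf R$-algebras, i.e. maps $f:A\to B$ with $p:Ef\to A$ such that $(p,\mathrm{id}):Rf\to f$ is an algebra structure, whose squares are algebra morphisms, with identities $(\mathrm{id}_A,R(\mathrm{id}_A))$, and with composite of $(f,p):A\to B$ and $(g,q):B\to C$ the map $gf$ with structure $p\circ E(\mathrm{id}_A,q)\circ E(\mathrm{id}_A,E(f,\mathrm{id}_C))\circ\delta_{gf}$. $\mathcal J^{\pitchfork\pitchfork}$ is the double category with the same objects and horizontal morphisms, whose vertical morphisms are maps $f$ with a choice of filler $\psi(i,\alpha)$ for each lifting problem $\alpha:u_i\to f$ such that $\psi(j,\alpha u_t)=\psi(i,\alpha)\circ\mathrm{cod}(u_t)$ for all $t:j\to i$ in $\mathcal J$, whose squares are commutative squares $\beta=(x,y):f\to f'$ with $\psi'(i,\beta\alpha)=x\,\psi(i,\alpha)$, with the usual identity and composition of lifting structures. $(\mathsf L,\mathsf R)$ is *cofibrantly generated by $u$* if there is an isomorphism of double categories $\mathsf R\text{-}\mathbb A\mathrm{lg}\cong\mathcal J^{\pitchfork\pitchfork}$ commuting with the forgetful double functors to $\mathbb S\mathrm q(\mathcal E)$. *)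

theory Defs
  imports Main "HOL-Library.FuncSet"
begin

section \<open>Categories, functors, colimits\<close>

text \<open>Categories have explicit carriers of objects and arrows. All operations are
  total functions that are meaningful only on these carriers, so equations between
  functors and between transformations are always read on carriers.\<close>

record ('o, 'm) category =
  Obj :: "'o set"
  Arr :: "'m set"
  Dom :: "'m \<Rightarrow> 'o"
  Cod :: "'m \<Rightarrow> 'o"
  Ide :: "'o \<Rightarrow> 'm"
  Comp :: "'m \<Rightarrow> 'm \<Rightarrow> 'm"  (infixr "\<cdot>\<index>" 70)

definition hom :: "('o, 'm) category \<Rightarrow> 'o \<Rightarrow> 'o \<Rightarrow> 'm set" where
  "hom C X Y = {f \<in> Arr C. Dom C f = X \<and> Cod C f = Y}"

definition is_category :: "('o, 'm) category \<Rightarrow> bool" where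
  "is_category C \<longleftrightarrow>
     (\<forall>f \<in> Arr C. Dom C f \<in> Obj C \<and> Cod C f \<in> Obj C) \<and>
     (\<forall>X \<in> Obj C. Ide C X \<in> hom C X X) \<and>
     (\<forall>f \<in> Arr C. \<forall>g \<in> Arr C. Cod C f = Dom C g \<longrightarrow>
        g \<cdot>\<^bsub>C\<^esub> f \<in> hom C (Dom C f) (Cod C g)) \<and>
     (\<forall>f \<in> Arr C. f \<cdot>\<^bsub>C\<^esub> Ide C (Dom C f) = f \<and> Ide C (Cod C f) \<cdot>\<^bsub>C\<^esub> f = f) \<and>
     (\<forall>f \<in> Arr C. \<forall>g \<in> Arr C. \<forall>h \<in> Arr C. Cod C f = Dom C g \<longrightarrow> Cod C g = Dom C h \<longrightarrow>
        (h \<cdot>\<^bsub>C\<^esub> g) \<cdot>\<^bsub>C\<^esub> f = h \<cdot>\<^bsub>C\<^esub> (g \<cdot>\<^bsub>C\<^esub> f))"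

record ('o, 'm, 'p, 'n) ftor =
  omap :: "'o \<Rightarrow> 'p"
  amap :: "'m \<Rightarrow> 'n"

definition is_functor ::
  "('o, 'm) category \<Rightarrow> ('p, 'n) category \<Rightarrow> ('o, 'm, 'p, 'n) ftor \<Rightarrow> bool" where
  "is_functor C D F \<longleftrightarrow> is_category C \<and> is_category D \<and>
     (\<forall>X \<in> Obj C. omap F X \<in> Obj D) \<and>
     (\<forall>f \<in> Arr C. amap F f \<in> hom D (omap F (Dom C f)) (omap F (Cod C f))) \<and>
     (\<forall>X \<in> Obj C. amap F (Ide C X) = Ide D (omap F X)) \<and>
     (\<forall>f \<in> Arr C. \<forall>g \<in> Arr C. Cod C f = Dom C g \<longrightarrow>
        amap F (g \<cdot>\<^bsub>C\<^esub> f) = amap F g \<cdot>\<^bsub>D\<^esub> amap F f)"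

definition fid :: "('o, 'm, 'o, 'm) ftor" where
  "fid = \<lparr>omap = (\<lambda>X. X), amap = (\<lambda>f. f)\<rparr>"

definition fcomp ::
  "('p, 'n, 'q, 'l) ftor \<Rightarrow> ('o, 'm, 'p, 'n) ftor \<Rightarrow> ('o, 'm, 'q, 'l) ftor" where
  "fcomp G F = \<lparr>omap = omap G \<circ> omap F, amap = amap G \<circ> amap F\<rparr>"

definition is_nat_trans ::
  "('o, 'm) category \<Rightarrow> ('p, 'n) category \<Rightarrow>
   ('o, 'm, 'p, 'n) ftor \<Rightarrow> ('o, 'm, 'p, 'n) ftor \<Rightarrow> ('o \<Rightarrow> 'n) \<Rightarrow> bool" where
  "is_nat_trans C D F G \<tau> \<longleftrightarrow> is_functor C D F \<and> is_functor C D G \<and>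
     (\<forall>X \<in> Obj C. \<tau> X \<in> hom D (omap F X) (omap G X)) \<and>
     (\<forall>f \<in> Arr C. \<tau> (Cod C f) \<cdot>\<^bsub>D\<^esub> amap F f = amap G f \<cdot>\<^bsub>D\<^esub> \<tau> (Dom C f))"

definition is_cocone ::
  "('k, 'a) category \<Rightarrow> ('o, 'm) category \<Rightarrow> ('k, 'a, 'o, 'm) ftor \<Rightarrow>
   'o \<Rightarrow> ('k \<Rightarrow> 'm) \<Rightarrow> bool" where
  "is_cocone K C D X \<iota> \<longleftrightarrow> X \<in> Obj C \<and>
     (\<forall>k \<in> Obj K. \<iota> k \<in> hom C (omap D k) X) \<and>
     (\<forall>a \<in> Arr K. \<iota> (Cod K a) \<cdot>\<^bsub>C\<^esub> amap D a = \<iota> (Dom K a))"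

definition is_colimit ::
  "('k, 'a) category \<Rightarrow> ('o, 'm) category \<Rightarrow> ('k, 'a, 'o, 'm) ftor \<Rightarrow>
   'o \<Rightarrow> ('k \<Rightarrow> 'm) \<Rightarrow> bool" where
  "is_colimit K C D X \<iota> \<longleftrightarrow> is_functor K C D \<and> is_cocone K C D X \<iota> \<and>
     (\<forall>Y \<upsilon>. is_cocone K C D Y \<upsilon> \<longrightarrow>
        (\<exists>!m. m \<in> hom C X Y \<and> (\<forall>k \<in> Obj K. m \<cdot>\<^bsub>C\<^esub> \<iota> k = \<upsilon> k)))"

definition preserves_colimit ::
  "('k, 'a) category \<Rightarrow> ('o, 'm) category \<Rightarrow> ('p, 'n) category \<Rightarrow>
   ('o, 'm, 'p, 'n) ftor \<Rightarrow> ('k, 'a, 'o, 'm) ftor \<Rightarrow> bool" where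
  "preserves_colimit K C C' F D \<longleftrightarrow>
     (\<forall>X \<iota>. is_colimit K C D X \<iota> \<longrightarrow>
        is_colimit K C' (fcomp F D) (omap F X) (\<lambda>k. amap F (\<iota> k)))"

text \<open>The square formed by \<open>a\<close>, \<open>x\<close>, \<open>p\<close>, \<open>q\<close> with \<open>p \<cdot> a = q \<cdot> x\<close>;
  \<open>q\<close> is the side opposite to \<open>a\<close>.\<close>

definition is_pushout :: "('o, 'm) category \<Rightarrow> 'm \<Rightarrow> 'm \<Rightarrow> 'm \<Rightarrow> 'm \<Rightarrow> bool" where
  "is_pushout C a x p q \<longleftrightarrow>
     a \<in> Arr C \<and> x \<in> Arr C \<and> p \<in> Arr C \<and> q \<in> Arr C \<and>
     Dom C a = Dom C x \<and> Cod C a = Dom C p \<and> Cod C x = Dom C q \<and> Cod C p = Cod C q \<and>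
     p \<cdot>\<^bsub>C\<^esub> a = q \<cdot>\<^bsub>C\<^esub> x \<and>
     (\<forall>p' q'. p' \<in> Arr C \<and> q' \<in> Arr C \<and>
        Dom C p' = Cod C a \<and> Dom C q' = Cod C x \<and> Cod C p' = Cod C q' \<and>
        p' \<cdot>\<^bsub>C\<^esub> a = q' \<cdot>\<^bsub>C\<^esub> x \<longrightarrow>
        (\<exists>!m. m \<in> hom C (Cod C p) (Cod C p') \<and> m \<cdot>\<^bsub>C\<^esub> p = p' \<and> m \<cdot>\<^bsub>C\<^esub> q = q'))"

definition set_cat :: "('a set, 'a set \<times> 'a set \<times> ('a \<Rightarrow> 'a)) category" where
  "set_cat = \<lparr>Obj = UNIV,
     Arr = {(X, Y, f). f \<in> X \<rightarrow>\<^sub>E Y},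
     Dom = fst,
     Cod = fst \<circ> snd,
     Ide = (\<lambda>X. (X, X, \<lambda>x \<in> X. x)),
     Comp = (\<lambda>(Y, Z, g) (X, Y', f). (X, Z, compose X g f))\<rparr>"

definition hom_functor ::
  "('o, 'm) category \<Rightarrow> 'o \<Rightarrow> ('o, 'm, 'm set, 'm set \<times> 'm set \<times> ('m \<Rightarrow> 'm)) ftor" where
  "hom_functor C A = \<lparr>omap = (\<lambda>X. hom C A X),
     amap = (\<lambda>h. (hom C A (Dom C h), hom C A (Cod C h), \<lambda>f \<in> hom C A (Dom C h). h \<cdot>\<^bsub>C\<^esub> f))\<rparr>"


section \<open>Ordinals and chains\<close>

text \<open>An ordinal is given by a well-order \<open>\<kappa>\<close>. An ordinal \<open>\<alpha> < \<kappa>\<close> is given by an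
  element \<open>a \<in> Field \<kappa>\<close>, namely as the initial segment \<open>underS \<kappa> a\<close>.\<close>

definition limit_ordinal :: "'k rel \<Rightarrow> bool" where
  "limit_ordinal \<kappa> \<longleftrightarrow> Well_order \<kappa> \<and>
     (\<forall>B. finite B \<and> B \<noteq> {} \<and> B \<subseteq> Field \<kappa> \<longrightarrow>
        (\<exists>b \<in> Field \<kappa>. \<forall>c \<in> B. (c, b) \<in> \<kappa> \<and> c \<noteq> b))"

definition segment :: "'k rel \<Rightarrow> 'k \<Rightarrow> 'k rel" where
  "segment \<kappa> a = Restr \<kappa> (underS \<kappa> a)"

text \<open>The ordinal sum \<open>1 + \<alpha>\<close>: a least element \<open>None\<close> is put below \<open>\<alpha>\<close>.\<close>

definition one_plus :: "'k rel \<Rightarrow> 'k option rel" where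
  "one_plus r = insert (None, None)
     ({(None, Some a) | a. a \<in> Field r} \<union> {(Some a, Some b) | a b. (a, b) \<in> r})"

definition poset_cat :: "'k rel \<Rightarrow> ('k, 'k \<times> 'k) category" where
  "poset_cat r = \<lparr>Obj = Field r, Arr = r, Dom = fst, Cod = snd,
     Ide = (\<lambda>a. (a, a)), Comp = (\<lambda>(b, c) (a, b'). (a, c))\<rparr>"


section \<open>Backdrops and smallness\<close>

definition wide_subcategory :: "('o, 'm) category \<Rightarrow> 'm set \<Rightarrow> bool" where
  "wide_subcategory C M \<longleftrightarrow> M \<subseteq> Arr C \<and>
     (\<forall>X \<in> Obj C. Ide C X \<in> M) \<and>
     (\<forall>f \<in> M. \<forall>g \<in> M. Cod C f = Dom C g \<longrightarrow> g \<cdot>\<^bsub>C\<^esub> f \<in> M)"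

definition subcat :: "('o, 'm) category \<Rightarrow> 'm set \<Rightarrow> ('o, 'm) category" where
  "subcat C M = C\<lparr>Arr := M\<rparr>"

definition has_colimits_in ::
  "('k, 'a) category \<Rightarrow> ('o, 'm) category \<Rightarrow> 'm set \<Rightarrow> bool" where
  "has_colimits_in K C M \<longleftrightarrow>
     (\<forall>D. is_functor K (subcat C M) D \<longrightarrow>
        (\<exists>X \<iota>. is_colimit K (subcat C M) D X \<iota>) \<and>
        preserves_colimit K (subcat C M) C fid D)"

definition closed_under_cobase_change :: "('o, 'm) category \<Rightarrow> 'm set \<Rightarrow> bool" where
  "closed_under_cobase_change C M \<longleftrightarrow>
     (\<forall>a \<in> M. \<forall>x \<in> Arr C. Dom C a = Dom C x \<longrightarrow>
        (\<exists>p q. is_pushout C a x p q \<and> q \<in> M))"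

definition is_backdrop :: "'k rel \<Rightarrow> ('o, 'm) category \<Rightarrow> 'm set \<Rightarrow> bool" where
  "is_backdrop \<kappa> C M \<longleftrightarrow> wide_subcategory C M \<and>
     (\<forall>a \<in> Field \<kappa>. has_colimits_in (poset_cat (one_plus (segment \<kappa> a))) C M) \<and>
     (\<forall>D. is_functor (poset_cat \<kappa>) (subcat C M) D \<longrightarrow>
        (\<exists>X \<iota>. is_colimit (poset_cat \<kappa>) C D X \<iota>)) \<and>
     closed_under_cobase_change C M"

text \<open>The colimit of sets is tested against subsets of the type \<open>'m\<close> of arrows only. This
  is no restriction: a cocone of sets is a colimit as soon as it is universal with respect
  to one two-element set, and if \<open>'m\<close> has no two elements then any chain of hom-sets
  indexed by a non-empty poset, with its cocone, is a constant one on a singleton.\<close>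

definition is_small :: "'k rel \<Rightarrow> ('o, 'm) category \<Rightarrow> 'm set \<Rightarrow> 'o \<Rightarrow> bool" where
  "is_small \<kappa> C M A \<longleftrightarrow> A \<in> Obj C \<and>
     (\<forall>D. is_functor (poset_cat \<kappa>) (subcat C M) D \<longrightarrow>
        preserves_colimit (poset_cat \<kappa>) C set_cat (hom_functor C A) D)"


section \<open>The arrow category and the density comonad\<close>

text \<open>A square from the vertical morphism \<open>src\<close> on the left to the vertical morphism \<open>tgt\<close>
  on the right. The type \<open>'v\<close> of vertical morphisms is \<open>'m\<close> for plain squares, and a type
  of arrows with additional structure for the double categories below.\<close>

datatype ('v, 'm) sq = Sq (src: 'v) (tgt: 'v) (upper: 'm) (lower: 'm)

definition squares :: "('o, 'm) category \<Rightarrow> ('m, 'm) sq set" where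
  "squares C = {Sq f g h k | f g h k.
     f \<in> Arr C \<and> g \<in> Arr C \<and>
     h \<in> hom C (Dom C f) (Dom C g) \<and> k \<in> hom C (Cod C f) (Cod C g) \<and>
     g \<cdot>\<^bsub>C\<^esub> h = k \<cdot>\<^bsub>C\<^esub> f}"

definition arrow_cat :: "('o, 'm) category \<Rightarrow> ('m, ('m, 'm) sq) category" where
  "arrow_cat C = \<lparr>Obj = Arr C, Arr = squares C, Dom = src, Cod = tgt,
     Ide = (\<lambda>f. Sq f f (Ide C (Dom C f)) (Ide C (Cod C f))),
     Comp = (\<lambda>\<tau> \<sigma>. Sq (src \<sigma>) (tgt \<tau>) (upper \<tau> \<cdot>\<^bsub>C\<^esub> upper \<sigma>) (lower \<tau> \<cdot>\<^bsub>C\<^esub> lower \<sigma>))\<rparr>"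

text \<open>The comma category \<open>u \<down> Y\<close> and its projection to \<open>J\<close>.\<close>

definition comma ::
  "('i, 't) category \<Rightarrow> ('o, 'm) category \<Rightarrow> ('i, 't, 'o, 'm) ftor \<Rightarrow> 'o \<Rightarrow>
   ('i \<times> 'm, ('i \<times> 'm) \<times> 't \<times> ('i \<times> 'm)) category" where
  "comma J C u Y = \<lparr>Obj = {(i, \<alpha>). i \<in> Obj J \<and> \<alpha> \<in> hom C (omap u i) Y},
     Arr = {((i, \<alpha>), t, (j, \<beta>)) | i \<alpha> t j \<beta>.
        t \<in> hom J i j \<and> \<alpha> \<in> hom C (omap u i) Y \<and> \<beta> \<in> hom C (omap u j) Y \<and>
        \<beta> \<cdot>\<^bsub>C\<^esub> amap u t = \<alpha>},
     Dom = fst,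
     Cod = (\<lambda>(_, _, b). b),
     Ide = (\<lambda>a. (a, Ide J (fst a), a)),
     Comp = (\<lambda>(b, s, c) (a, t, b'). (a, s \<cdot>\<^bsub>J\<^esub> t, c))\<rparr>"

definition comma_proj :: "('i \<times> 'm, ('i \<times> 'm) \<times> 't \<times> ('i \<times> 'm), 'i, 't) ftor" where
  "comma_proj = \<lparr>omap = fst, amap = (\<lambda>(_, t, _). t)\<rparr>"

text \<open>\<open>D\<close> is a pointwise left Kan extension of \<open>u\<close> along itself, with colimit cocones
  \<open>\<iota> Y\<close>; the last clause says that \<open>D\<close> acts on arrows as induced by these cocones.\<close>

definition is_density ::
  "('i, 't) category \<Rightarrow> ('o, 'm) category \<Rightarrow> ('i, 't, 'o, 'm) ftor \<Rightarrow>
   ('o, 'm, 'o, 'm) ftor \<Rightarrow> ('o \<Rightarrow> 'i \<times> 'm \<Rightarrow> 'm) \<Rightarrow> bool" where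
  "is_density J C u D \<iota> \<longleftrightarrow> is_functor C C D \<and>
     (\<forall>Y \<in> Obj C. is_colimit (comma J C u Y) C (fcomp u comma_proj) (omap D Y) (\<iota> Y)) \<and>
     (\<forall>\<sigma> \<in> Arr C. \<forall>i \<in> Obj J. \<forall>\<alpha> \<in> hom C (omap u i) (Dom C \<sigma>).
        amap D \<sigma> \<cdot>\<^bsub>C\<^esub> \<iota> (Dom C \<sigma>) (i, \<alpha>) = \<iota> (Cod C \<sigma>) (i, \<sigma> \<cdot>\<^bsub>C\<^esub> \<alpha>))"

text \<open>\<open>D\<close> is a chosen density comonad. As \<open>M\<close> need not be closed under isomorphism, the
  pushouts \<open>(p, q)\<close> considered are those that closure of \<open>M\<close> under cobase change provides
  for \<open>omap D f \<in> M\<close>, with \<open>q\<close> in \<open>M\<close>. The gap map \<open>w\<close> is required to lie in \<open>M\<close> for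
  every such choice of the pushout. If \<open>M\<close> is closed under isomorphism, this is the same as
  for one pushout or for all pushouts.\<close>

definition compatible ::
  "('o, 'm) category \<Rightarrow> 'm set \<Rightarrow> ('i, 't) category \<Rightarrow> ('i, 't, 'm, ('m, 'm) sq) ftor \<Rightarrow> bool"
  where
  "compatible C M J u \<longleftrightarrow>
     (\<exists>D \<iota>. is_density J (arrow_cat C) u D \<iota> \<and>
        (\<forall>f \<in> Arr C. omap D f \<in> M) \<and>
        (\<forall>\<sigma> \<in> squares C. upper \<sigma> \<in> M \<and> lower \<sigma> \<in> M \<longrightarrow>
           (\<forall>p q w. is_pushout C (omap D (src \<sigma>)) (upper (amap D \<sigma>)) p q \<and> q \<in> M \<and>
              w \<in> hom C (Cod C p) (Cod C (omap D (tgt \<sigma>))) \<and>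
              w \<cdot>\<^bsub>C\<^esub> p = lower (amap D \<sigma>) \<and> w \<cdot>\<^bsub>C\<^esub> q = omap D (tgt \<sigma>) \<longrightarrow>
              w \<in> M)))"


section \<open>Algebraic weak factorization systems\<close>

definition is_comonad ::
  "('o, 'm) category \<Rightarrow> ('o, 'm, 'o, 'm) ftor \<Rightarrow> ('o \<Rightarrow> 'm) \<Rightarrow> ('o \<Rightarrow> 'm) \<Rightarrow> bool" where
  "is_comonad C L \<epsilon> \<delta> \<longleftrightarrow>
     is_nat_trans C C L fid \<epsilon> \<and> is_nat_trans C C L (fcomp L L) \<delta> \<and>
     (\<forall>X \<in> Obj C.
        \<epsilon> (omap L X) \<cdot>\<^bsub>C\<^esub> \<delta> X = Ide C (omap L X) \<and>
        amap L (\<epsilon> X) \<cdot>\<^bsub>C\<^esub> \<delta> X = Ide C (omap L X) \<and>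
        \<delta> (omap L X) \<cdot>\<^bsub>C\<^esub> \<delta> X = amap L (\<delta> X) \<cdot>\<^bsub>C\<^esub> \<delta> X)"

definition is_monad ::
  "('o, 'm) category \<Rightarrow> ('o, 'm, 'o, 'm) ftor \<Rightarrow> ('o \<Rightarrow> 'm) \<Rightarrow> ('o \<Rightarrow> 'm) \<Rightarrow> bool" where
  "is_monad C R \<eta> \<mu> \<longleftrightarrow>
     is_nat_trans C C fid R \<eta> \<and> is_nat_trans C C (fcomp R R) R \<mu> \<and>
     (\<forall>X \<in> Obj C.
        \<mu> X \<cdot>\<^bsub>C\<^esub> \<eta> (omap R X) = Ide C (omap R X) \<and>
        \<mu> X \<cdot>\<^bsub>C\<^esub> amap R (\<eta> X) = Ide C (omap R X) \<and>
        \<mu> X \<cdot>\<^bsub>C\<^esub> \<mu> (omap R X) = \<mu> X \<cdot>\<^bsub>C\<^esub> amap R (\<mu> X))"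

definition is_distributive_law ::
  "('o, 'm) category \<Rightarrow>
   ('o, 'm, 'o, 'm) ftor \<Rightarrow> ('o \<Rightarrow> 'm) \<Rightarrow> ('o \<Rightarrow> 'm) \<Rightarrow>
   ('o, 'm, 'o, 'm) ftor \<Rightarrow> ('o \<Rightarrow> 'm) \<Rightarrow> ('o \<Rightarrow> 'm) \<Rightarrow> ('o \<Rightarrow> 'm) \<Rightarrow> bool" where
  "is_distributive_law C L \<epsilon> \<delta> R \<eta> \<mu> \<theta> \<longleftrightarrow>
     is_nat_trans C C (fcomp L R) (fcomp R L) \<theta> \<and>
     (\<forall>X \<in> Obj C.
        amap R (\<epsilon> X) \<cdot>\<^bsub>C\<^esub> \<theta> X = \<epsilon> (omap R X) \<and>
        amap R (\<delta> X) \<cdot>\<^bsub>C\<^esub> \<theta> X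
          = \<theta> (omap L X) \<cdot>\<^bsub>C\<^esub> amap L (\<theta> X) \<cdot>\<^bsub>C\<^esub> \<delta> (omap R X) \<and>
        \<theta> X \<cdot>\<^bsub>C\<^esub> amap L (\<eta> X) = \<eta> (omap L X) \<and>
        \<theta> X \<cdot>\<^bsub>C\<^esub> amap L (\<mu> X)
          = \<mu> (omap L X) \<cdot>\<^bsub>C\<^esub> amap R (\<theta> X) \<cdot>\<^bsub>C\<^esub> \<theta> (omap R X))"

record 'm awfs =
  LF :: "('m, ('m, 'm) sq, 'm, ('m, 'm) sq) ftor"
  RF :: "('m, ('m, 'm) sq, 'm, ('m, 'm) sq) ftor"
  Comult :: "'m \<Rightarrow> ('m, 'm) sq"
  Mult :: "'m \<Rightarrow> ('m, 'm) sq"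

definition counit :: "('o, 'm) category \<Rightarrow> 'm awfs \<Rightarrow> 'm \<Rightarrow> ('m, 'm) sq" where
  "counit C W f = Sq (omap (LF W) f) f (Ide C (Dom C f)) (omap (RF W) f)"

definition unit :: "('o, 'm) category \<Rightarrow> 'm awfs \<Rightarrow> 'm \<Rightarrow> ('m, 'm) sq" where
  "unit C W f = Sq f (omap (RF W) f) (omap (LF W) f) (Ide C (Cod C f))"

text \<open>The maps \<open>\<delta>\<^sub>f\<close> and \<open>\<mu>\<^sub>f\<close>, and the action of the functor \<open>E = cod L = dom R\<close>
  on squares.\<close>

definition delta :: "'m awfs \<Rightarrow> 'm \<Rightarrow> 'm" where
  "delta W f = lower (Comult W f)"

definition mu :: "'m awfs \<Rightarrow> 'm \<Rightarrow> 'm" where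
  "mu W f = upper (Mult W f)"

definition Emap :: "'m awfs \<Rightarrow> ('m, 'm) sq \<Rightarrow> 'm" where
  "Emap W \<sigma> = upper (amap (RF W) \<sigma>)"

definition is_awfs :: "('o, 'm) category \<Rightarrow> 'm awfs \<Rightarrow> bool" where
  "is_awfs C W \<longleftrightarrow>
     is_functor (arrow_cat C) (arrow_cat C) (LF W) \<and>
     is_functor (arrow_cat C) (arrow_cat C) (RF W) \<and>
     (\<forall>f \<in> Arr C.
        Dom C (omap (LF W) f) = Dom C f \<and>
        Cod C (omap (LF W) f) = Dom C (omap (RF W) f) \<and>
        Cod C (omap (RF W) f) = Cod C f \<and>
        omap (RF W) f \<cdot>\<^bsub>C\<^esub> omap (LF W) f = f) \<and>
     (\<forall>\<sigma> \<in> squares C.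
        upper (amap (LF W) \<sigma>) = upper \<sigma> \<and>
        lower (amap (LF W) \<sigma>) = upper (amap (RF W) \<sigma>) \<and>
        lower (amap (RF W) \<sigma>) = lower \<sigma>) \<and>
     is_comonad (arrow_cat C) (LF W) (counit C W) (Comult W) \<and>
     is_monad (arrow_cat C) (RF W) (unit C W) (Mult W) \<and>
     is_distributive_law (arrow_cat C)
       (LF W) (counit C W) (Comult W) (RF W) (unit C W) (Mult W)
       (\<lambda>f. Sq (omap (LF W) (omap (RF W) f)) (omap (RF W) (omap (LF W) f))
              (delta W f) (mu W f))"


section \<open>Double categories\<close>

text \<open>A double category consists of objects with horizontal and vertical morphisms, and
  squares that compose horizontally (with vertical morphisms as objects) and vertically
  (with horizontal morphisms as objects).\<close>

record ('o, 'h, 'v, 's) dblcat =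
  Hor :: "('o, 'h) category"
  Ver :: "('o, 'v) category"
  SqH :: "('v, 's) category"
  SqV :: "('h, 's) category"

definition is_double_category :: "('o, 'h, 'v, 's) dblcat \<Rightarrow> bool" where
  "is_double_category A \<longleftrightarrow>
     Obj (Hor A) = Obj (Ver A) \<and>
     Obj (SqH A) = Arr (Ver A) \<and> Obj (SqV A) = Arr (Hor A) \<and>
     Arr (SqH A) = Arr (SqV A) \<and>
     is_functor (SqH A) (Hor A) \<lparr>omap = Dom (Ver A), amap = Dom (SqV A)\<rparr> \<and>
     is_functor (SqH A) (Hor A) \<lparr>omap = Cod (Ver A), amap = Cod (SqV A)\<rparr> \<and>
     is_functor (SqV A) (Ver A) \<lparr>omap = Dom (Hor A), amap = Dom (SqH A)\<rparr> \<and>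
     is_functor (SqV A) (Ver A) \<lparr>omap = Cod (Hor A), amap = Cod (SqH A)\<rparr> \<and>
     is_functor (Hor A) (SqH A) \<lparr>omap = Ide (Ver A), amap = Ide (SqV A)\<rparr> \<and>
     is_functor (Ver A) (SqV A) \<lparr>omap = Ide (Hor A), amap = Ide (SqH A)\<rparr> \<and>
     (\<forall>a \<in> Arr (SqH A). \<forall>b \<in> Arr (SqH A). \<forall>c \<in> Arr (SqH A). \<forall>d \<in> Arr (SqH A).
        Cod (SqH A) a = Dom (SqH A) b \<longrightarrow> Cod (SqH A) c = Dom (SqH A) d \<longrightarrow>
        Cod (SqV A) a = Dom (SqV A) c \<longrightarrow> Cod (SqV A) b = Dom (SqV A) d \<longrightarrow>
        (d \<cdot>\<^bsub>SqH A\<^esub> c) \<cdot>\<^bsub>SqV A\<^esub> (b \<cdot>\<^bsub>SqH A\<^esub> a)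
          = (d \<cdot>\<^bsub>SqV A\<^esub> b) \<cdot>\<^bsub>SqH A\<^esub> (c \<cdot>\<^bsub>SqV A\<^esub> a))"

record ('o, 'h, 'v, 's, 'p, 'k, 'w, 'r) dftor =
  Fobj :: "'o \<Rightarrow> 'p"
  Fhor :: "'h \<Rightarrow> 'k"
  Fver :: "'v \<Rightarrow> 'w"
  Fsq :: "'s \<Rightarrow> 'r"

definition is_double_functor ::
  "('o, 'h, 'v, 's) dblcat \<Rightarrow> ('p, 'k, 'w, 'r) dblcat \<Rightarrow>
   ('o, 'h, 'v, 's, 'p, 'k, 'w, 'r) dftor \<Rightarrow> bool" where
  "is_double_functor A B F \<longleftrightarrow> is_double_category A \<and> is_double_category B \<and>
     is_functor (Hor A) (Hor B) \<lparr>omap = Fobj F, amap = Fhor F\<rparr> \<and>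
     is_functor (Ver A) (Ver B) \<lparr>omap = Fobj F, amap = Fver F\<rparr> \<and>
     is_functor (SqH A) (SqH B) \<lparr>omap = Fver F, amap = Fsq F\<rparr> \<and>
     is_functor (SqV A) (SqV B) \<lparr>omap = Fhor F, amap = Fsq F\<rparr>"

definition did :: "('o, 'h, 'v, 's, 'o, 'h, 'v, 's) dftor" where
  "did = \<lparr>Fobj = (\<lambda>x. x), Fhor = (\<lambda>x. x), Fver = (\<lambda>x. x), Fsq = (\<lambda>x. x)\<rparr>"

definition dcomp ::
  "('p, 'k, 'w, 'r, 'p2, 'k2, 'w2, 'r2) dftor \<Rightarrow> ('o, 'h, 'v, 's, 'p, 'k, 'w, 'r) dftor \<Rightarrow>
   ('o, 'h, 'v, 's, 'p2, 'k2, 'w2, 'r2) dftor" where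
  "dcomp G F = \<lparr>Fobj = Fobj G \<circ> Fobj F, Fhor = Fhor G \<circ> Fhor F,
     Fver = Fver G \<circ> Fver F, Fsq = Fsq G \<circ> Fsq F\<rparr>"

text \<open>Equality of double functors with domain \<open>A\<close>.\<close>

definition dftor_eq ::
  "('o, 'h, 'v, 's) dblcat \<Rightarrow> ('o, 'h, 'v, 's, 'p, 'k, 'w, 'r) dftor \<Rightarrow>
   ('o, 'h, 'v, 's, 'p, 'k, 'w, 'r) dftor \<Rightarrow> bool" where
  "dftor_eq A F G \<longleftrightarrow>
     (\<forall>x \<in> Obj (Hor A). Fobj F x = Fobj G x) \<and>
     (\<forall>x \<in> Arr (Hor A). Fhor F x = Fhor G x) \<and>
     (\<forall>x \<in> Arr (Ver A). Fver F x = Fver G x) \<and>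
     (\<forall>x \<in> Arr (SqH A). Fsq F x = Fsq G x)"

definition is_double_iso ::
  "('o, 'h, 'v, 's) dblcat \<Rightarrow> ('p, 'k, 'w, 'r) dblcat \<Rightarrow>
   ('o, 'h, 'v, 's, 'p, 'k, 'w, 'r) dftor \<Rightarrow> bool" where
  "is_double_iso A B F \<longleftrightarrow> is_double_functor A B F \<and>
     (\<exists>G. is_double_functor B A G \<and> dftor_eq A (dcomp G F) did \<and> dftor_eq B (dcomp F G) did)"

text \<open>The double category with objects and horizontal morphisms those of \<open>C\<close>, with
  vertical morphisms the elements \<open>v\<close> of \<open>V\<close>, which have underlying arrow \<open>U v\<close>, with
  vertical identities and composition \<open>idV\<close> and \<open>compV\<close> (where \<open>compV w v\<close> is \<open>w\<close> after
  \<open>v\<close>), and with squares the commutative squares that satisfy \<open>P\<close>.\<close>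

definition underlying :: "('v \<Rightarrow> 'm) \<Rightarrow> ('v, 'm) sq \<Rightarrow> ('m, 'm) sq" where
  "underlying U \<beta> = Sq (U (src \<beta>)) (U (tgt \<beta>)) (upper \<beta>) (lower \<beta>)"

definition structured_dblcat ::
  "('o, 'm) category \<Rightarrow> 'v set \<Rightarrow> ('v \<Rightarrow> 'm) \<Rightarrow> ('o \<Rightarrow> 'v) \<Rightarrow> ('v \<Rightarrow> 'v \<Rightarrow> 'v) \<Rightarrow>
   (('v, 'm) sq \<Rightarrow> bool) \<Rightarrow> ('o, 'm, 'v, ('v, 'm) sq) dblcat" where
  "structured_dblcat C V U idV compV P =
     (let S = {\<beta>. src \<beta> \<in> V \<and> tgt \<beta> \<in> V \<and> underlying U \<beta> \<in> squares C \<and> P \<beta>} in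
      \<lparr>Hor = C,
       Ver = \<lparr>Obj = Obj C, Arr = V, Dom = Dom C \<circ> U, Cod = Cod C \<circ> U,
              Ide = idV, Comp = compV\<rparr>,
       SqH = \<lparr>Obj = V, Arr = S, Dom = src, Cod = tgt,
              Ide = (\<lambda>v. Sq v v (Ide C (Dom C (U v))) (Ide C (Cod C (U v)))),
              Comp = (\<lambda>\<tau> \<sigma>. Sq (src \<sigma>) (tgt \<tau>)
                (upper \<tau> \<cdot>\<^bsub>C\<^esub> upper \<sigma>) (lower \<tau> \<cdot>\<^bsub>C\<^esub> lower \<sigma>))\<rparr>,
       SqV = \<lparr>Obj = Arr C, Arr = S, Dom = upper, Cod = lower,
              Ide = (\<lambda>h. Sq (idV (Dom C h)) (idV (Cod C h)) h h),
              Comp = (\<lambda>\<tau> \<sigma>. Sq (compV (src \<tau>) (src \<sigma>)) (compV (tgt \<tau>) (tgt \<sigma>))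
                (upper \<sigma>) (lower \<tau>))\<rparr>\<rparr>)"

definition forgetful ::
  "('v \<Rightarrow> 'm) \<Rightarrow> ('o, 'm, 'v, ('v, 'm) sq, 'o, 'm, 'm, ('m, 'm) sq) dftor" where
  "forgetful U = \<lparr>Fobj = (\<lambda>x. x), Fhor = (\<lambda>x. x), Fver = U, Fsq = underlying U\<rparr>"

definition Sq_dblcat :: "('o, 'm) category \<Rightarrow> ('o, 'm, 'm, ('m, 'm) sq) dblcat" where
  "Sq_dblcat C = structured_dblcat C (Arr C) (\<lambda>f. f) (Ide C) (Comp C) (\<lambda>_. True)"


section \<open>Double categories of algebras and of lifting structures\<close>

definition is_algebra ::
  "('o, 'm) category \<Rightarrow> ('o, 'm, 'o, 'm) ftor \<Rightarrow> ('o \<Rightarrow> 'm) \<Rightarrow> ('o \<Rightarrow> 'm) \<Rightarrow> 'o \<Rightarrow> 'm \<Rightarrow> bool"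
  where
  "is_algebra C R \<eta> \<mu> X a \<longleftrightarrow> X \<in> Obj C \<and> a \<in> hom C (omap R X) X \<and>
     a \<cdot>\<^bsub>C\<^esub> \<eta> X = Ide C X \<and> a \<cdot>\<^bsub>C\<^esub> \<mu> X = a \<cdot>\<^bsub>C\<^esub> amap R a"

definition is_algebra_morphism ::
  "('o, 'm) category \<Rightarrow> ('o, 'm, 'o, 'm) ftor \<Rightarrow> 'o \<Rightarrow> 'm \<Rightarrow> 'o \<Rightarrow> 'm \<Rightarrow> 'm \<Rightarrow> bool" where
  "is_algebra_morphism C R X a Y b h \<longleftrightarrow>
     h \<in> hom C X Y \<and> h \<cdot>\<^bsub>C\<^esub> a = b \<cdot>\<^bsub>C\<^esub> amap R h"

definition alg_structure ::
  "('o, 'm) category \<Rightarrow> 'm awfs \<Rightarrow> 'm \<times> 'm \<Rightarrow> ('m, 'm) sq" where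
  "alg_structure C W = (\<lambda>(f, p). Sq (omap (RF W) f) f p (Ide C (Cod C f)))"

definition R_algebras :: "('o, 'm) category \<Rightarrow> 'm awfs \<Rightarrow> ('m \<times> 'm) set" where
  "R_algebras C W = {(f, p).
     is_algebra (arrow_cat C) (RF W) (unit C W) (Mult W) f (alg_structure C W (f, p))}"

definition alg_id :: "('o, 'm) category \<Rightarrow> 'm awfs \<Rightarrow> 'o \<Rightarrow> 'm \<times> 'm" where
  "alg_id C W A = (Ide C A, omap (RF W) (Ide C A))"

definition alg_comp :: "('o, 'm) category \<Rightarrow> 'm awfs \<Rightarrow> 'm \<times> 'm \<Rightarrow> 'm \<times> 'm \<Rightarrow> 'm \<times> 'm" where
  "alg_comp C W = (\<lambda>(g, q) (f, p).
     let gf = g \<cdot>\<^bsub>C\<^esub> f;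
         Lgf = omap (LF W) g \<cdot>\<^bsub>C\<^esub> f;
         iA = Ide C (Dom C f);
         iC = Ide C (Cod C g)
     in (gf,
         p \<cdot>\<^bsub>C\<^esub> Emap W (Sq Lgf f iA q)
           \<cdot>\<^bsub>C\<^esub> Emap W (Sq (omap (LF W) gf) Lgf iA (Emap W (Sq gf g f iC)))
           \<cdot>\<^bsub>C\<^esub> delta W gf))"

definition RAlg ::
  "('o, 'm) category \<Rightarrow> 'm awfs \<Rightarrow> ('o, 'm, 'm \<times> 'm, ('m \<times> 'm, 'm) sq) dblcat" where
  "RAlg C W = structured_dblcat C (R_algebras C W) fst (alg_id C W) (alg_comp C W)
     (\<lambda>\<beta>. is_algebra_morphism (arrow_cat C) (RF W)
        (fst (src \<beta>)) (alg_structure C W (src \<beta>))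
        (fst (tgt \<beta>)) (alg_structure C W (tgt \<beta>))
        (underlying fst \<beta>))"

text \<open>The lifting problems of \<open>u\<close> against \<open>f\<close>. A lifting structure takes the value
  \<open>undefined\<close> outside of this set, so that equality of lifting structures is equality of
  functions.\<close>

definition lifting_problems ::
  "('o, 'm) category \<Rightarrow> ('i, 't) category \<Rightarrow> ('i, 't, 'm, ('m, 'm) sq) ftor \<Rightarrow> 'm \<Rightarrow>
   ('i \<times> ('m, 'm) sq) set" where
  "lifting_problems C J u f = {(i, \<alpha>). i \<in> Obj J \<and> \<alpha> \<in> hom (arrow_cat C) (omap u i) f}"

definition lifting_structures ::
  "('o, 'm) category \<Rightarrow> ('i, 't) category \<Rightarrow> ('i, 't, 'm, ('m, 'm) sq) ftor \<Rightarrow>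
   ('m \<times> ('i \<times> ('m, 'm) sq \<Rightarrow> 'm)) set" where
  "lifting_structures C J u = {(f, \<psi>). f \<in> Arr C \<and>
     \<psi> \<in> extensional (lifting_problems C J u f) \<and>
     (\<forall>(i, \<alpha>) \<in> lifting_problems C J u f.
        \<psi> (i, \<alpha>) \<in> hom C (Cod C (omap u i)) (Dom C f) \<and>
        \<psi> (i, \<alpha>) \<cdot>\<^bsub>C\<^esub> omap u i = upper \<alpha> \<and>
        f \<cdot>\<^bsub>C\<^esub> \<psi> (i, \<alpha>) = lower \<alpha>) \<and>
     (\<forall>(i, \<alpha>) \<in> lifting_problems C J u f. \<forall>t \<in> Arr J. Cod J t = i \<longrightarrow>
        \<psi> (Dom J t, \<alpha> \<cdot>\<^bsub>arrow_cat C\<^esub> amap u t) = \<psi> (i, \<alpha>) \<cdot>\<^bsub>C\<^esub> lower (amap u t))}"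

definition lift_id ::
  "('o, 'm) category \<Rightarrow> ('i, 't) category \<Rightarrow> ('i, 't, 'm, ('m, 'm) sq) ftor \<Rightarrow>
   'o \<Rightarrow> 'm \<times> ('i \<times> ('m, 'm) sq \<Rightarrow> 'm)" where
  "lift_id C J u A =
     (Ide C A, \<lambda>(i, \<alpha>) \<in> lifting_problems C J u (Ide C A). lower \<alpha>)"

definition lift_comp ::
  "('o, 'm) category \<Rightarrow> ('i, 't) category \<Rightarrow> ('i, 't, 'm, ('m, 'm) sq) ftor \<Rightarrow>
   'm \<times> ('i \<times> ('m, 'm) sq \<Rightarrow> 'm) \<Rightarrow> 'm \<times> ('i \<times> ('m, 'm) sq \<Rightarrow> 'm) \<Rightarrow>
   'm \<times> ('i \<times> ('m, 'm) sq \<Rightarrow> 'm)" where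
  "lift_comp C J u = (\<lambda>(g, \<psi>) (f, \<phi>).
     (g \<cdot>\<^bsub>C\<^esub> f,
      \<lambda>(i, \<alpha>) \<in> lifting_problems C J u (g \<cdot>\<^bsub>C\<^esub> f).
        \<phi> (i, Sq (omap u i) f (upper \<alpha>)
                (\<psi> (i, Sq (omap u i) g (f \<cdot>\<^bsub>C\<^esub> upper \<alpha>) (lower \<alpha>))))))"

definition lift_dblcat ::
  "('o, 'm) category \<Rightarrow> ('i, 't) category \<Rightarrow> ('i, 't, 'm, ('m, 'm) sq) ftor \<Rightarrow>
   ('o, 'm, 'm \<times> ('i \<times> ('m, 'm) sq \<Rightarrow> 'm),
    ('m \<times> ('i \<times> ('m, 'm) sq \<Rightarrow> 'm), 'm) sq) dblcat" where
  "lift_dblcat C J u =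
     structured_dblcat C (lifting_structures C J u) fst (lift_id C J u) (lift_comp C J u)
       (\<lambda>\<beta>. \<forall>(i, \<alpha>) \<in> lifting_problems C J u (fst (src \<beta>)).
          snd (tgt \<beta>) (i, underlying fst \<beta> \<cdot>\<^bsub>arrow_cat C\<^esub> \<alpha>)
            = upper \<beta> \<cdot>\<^bsub>C\<^esub> snd (src \<beta>) (i, \<alpha>))"

definition cofibrantly_generated ::
  "('o, 'm) category \<Rightarrow> 'm awfs \<Rightarrow> ('i, 't) category \<Rightarrow> ('i, 't, 'm, ('m, 'm) sq) ftor \<Rightarrow> bool"
  where
  "cofibrantly_generated C W J u \<longleftrightarrow>
     is_double_functor (RAlg C W) (Sq_dblcat C) (forgetful fst) \<and>
     is_double_functor (lift_dblcat C J u) (Sq_dblcat C) (forgetful fst) \<and>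
     (\<exists>F. is_double_iso (RAlg C W) (lift_dblcat C J u) F \<and>
        dftor_eq (RAlg C W) (dcomp (forgetful fst) F) (forgetful fst))"

end

theory Submission
  imports Defs
begin

text \<open>A lifting structure on \<open>f\<close> is the same as a filler of the counit square \<open>D f \<rightarrow> f\<close> of the density
  comonad. The free lifting structure on \<open>f : A \<rightarrow> B\<close> is the colimit of a transfinite sequence of objects
  \<open>x\<^sub>\<gamma> : X\<^sub>\<gamma> \<rightarrow> B\<close> over \<open>B\<close>: at stage \<open>\<gamma>\<close> the codomain of \<open>D x\<^sub>\<gamma>\<close> is attached to \<open>X\<^sub>\<gamma>\<close>, identified with the
  codomains of \<open>D x\<^sub>\<beta>\<close> attached at the earlier stages \<open>\<beta> < \<gamma>\<close>. That is, \<open>X\<^sub>\<gamma>\<close> is extended by a cobase change of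
  \<open>Q\<^sub>\<gamma> \<rightarrow> Cod (D x\<^sub>\<gamma>)\<close>, where \<open>Q\<^sub>\<gamma>\<close> is the latching object of the chain \<open>D x\<close> at \<open>\<gamma>\<close>. By compatibility the gap
  maps of this chain lie in \<open>M\<close>; since \<open>Q\<^sub>\<gamma>\<close> is built from \<open>Dom (D x\<^sub>\<gamma>)\<close> by attaching such cells in turn,
  \<open>Q\<^sub>\<gamma> \<rightarrow> Cod (D x\<^sub>\<gamma>)\<close> lies in \<open>M\<close> as well. Hence no coequalizers are needed and the sequence is a chain in \<open>M\<close>,
  so smallness gives a lifting structure on its colimit.

  Once the free lifting structure \<open>R f\<close> with unit \<open>L f\<close> exists for every \<open>f\<close>, all data of the factorization
  system are maps out of \<open>R f\<close>; the comultiplication \<open>\<delta>\<^sub>f\<close> comes from the composite lifting structure on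
  \<open>R f \<cdot> R (L f)\<close>. Each law holds because both sides are morphisms of lifting structures that agree on \<open>L f\<close>.\<close>

section \<open>Categories and squares\<close>

text \<open>The colimit at stage \<gamma> is taken over A followed by all earlier X'_\<beta>, a
  chain of length 1 + \<gamma>. Zero, successor and limit stages are thus treated alike, and the
  backdrop gives the colimit in M and in the ambient category at once. Attaching Cod (D x_\<gamma>)
  along Dom (D x_\<gamma>) alone would add a fresh filler at each stage for problems already solved;
  identifying these would take coequalizers, about which a backdrop says nothing. Gluing over the
  latching object makes the identifications beforehand. Compatibility speaks of the gap map of one
  square, while the latching map compares with all earlier stages at once; an induction on \<gamma>
  bridges the two, and as the latching object is again a cell complex, one locale serves both
  constructions. A lifting problem against the colimit has its lower map into the fixed base, so
  only the upper map must be factored through a stage: hence smallness of Dom u_i. That \<kappa> is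
  a limit gives each X'_\<gamma> a later stage to map to. Maps into composites such as R f \<cdot> R
  (L f) are controlled by vertical composition of lifting structures.\<close>

locale cat =
  fixes C :: "('o, 'm) category" (structure)
  assumes cat: "is_category C"
begin

lemma dom_obj [simp]: "f \<in> Arr C \<Longrightarrow> Dom C f \<in> Obj C"
  and cod_obj [simp]: "f \<in> Arr C \<Longrightarrow> Cod C f \<in> Obj C"
  using cat unfolding is_category_def by blast+

lemma ide_arr [simp]: "X \<in> Obj C \<Longrightarrow> Ide C X \<in> Arr C"
  and dom_ide [simp]: "X \<in> Obj C \<Longrightarrow> Dom C (Ide C X) = X"
  and cod_ide [simp]: "X \<in> Obj C \<Longrightarrow> Cod C (Ide C X) = X"
  using cat unfolding is_category_def hom_def by blast+

lemma comp_arr [simp]: "f \<in> Arr C \<Longrightarrow> g \<in> Arr C \<Longrightarrow> Cod C f = Dom C g \<Longrightarrow> g \<cdot> f \<in> Arr C"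
  and dom_comp [simp]: "f \<in> Arr C \<Longrightarrow> g \<in> Arr C \<Longrightarrow> Cod C f = Dom C g \<Longrightarrow> Dom C (g \<cdot> f) = Dom C f"
  and cod_comp [simp]: "f \<in> Arr C \<Longrightarrow> g \<in> Arr C \<Longrightarrow> Cod C f = Dom C g \<Longrightarrow> Cod C (g \<cdot> f) = Cod C g"
  using cat unfolding is_category_def hom_def by blast+

lemma comp_ide_right [simp]: "f \<in> Arr C \<Longrightarrow> Dom C f = X \<Longrightarrow> f \<cdot> Ide C X = f"
  and comp_ide_left [simp]: "f \<in> Arr C \<Longrightarrow> Cod C f = X \<Longrightarrow> Ide C X \<cdot> f = f"
  using cat unfolding is_category_def by blast+

lemma assoc [simp]:
  "f \<in> Arr C \<Longrightarrow> g \<in> Arr C \<Longrightarrow> h \<in> Arr C \<Longrightarrow> Cod C f = Dom C g \<Longrightarrow> Cod C g = Dom C h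
    \<Longrightarrow> (h \<cdot> g) \<cdot> f = h \<cdot> (g \<cdot> f)"
  using cat unfolding is_category_def by blast

text \<open>\<open>assoc\<close> is a simp rule that brackets to the right, after which an equation
  for the composite of g and f no longer matches inside g (f h). This form and its variant for
  identities restore the match; most diagram chases below rest on them.\<close>

lemma comp_eq_assoc:
  "g \<cdot> f = k \<Longrightarrow> f \<in> Arr C \<Longrightarrow> g \<in> Arr C \<Longrightarrow> Cod C f = Dom C g \<Longrightarrow> h \<in> Arr C \<Longrightarrow> Cod C h = Dom C f
    \<Longrightarrow> g \<cdot> (f \<cdot> h) = k \<cdot> h"
  by (metis assoc)

lemma comp_eq_ide_assoc:
  "g \<cdot> f = Ide C X \<Longrightarrow> f \<in> Arr C \<Longrightarrow> g \<in> Arr C \<Longrightarrow> Cod C f = Dom C g \<Longrightarrow> X = Dom C f \<Longrightarrow> h \<in> Arr C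
    \<Longrightarrow> Cod C h = Dom C f \<Longrightarrow> g \<cdot> (f \<cdot> h) = h"
  by (metis assoc comp_ide_left)

lemma Sq_in_squares [simp]:
  "Sq f g h k \<in> squares C \<longleftrightarrow> f \<in> Arr C \<and> g \<in> Arr C \<and> h \<in> Arr C \<and> k \<in> Arr C \<and>
     Dom C h = Dom C f \<and> Cod C h = Dom C g \<and> Dom C k = Cod C f \<and> Cod C k = Cod C g \<and>
     g \<cdot> h = k \<cdot> f"
  by (auto simp: squares_def hom_def)

lemma squaresD:
  assumes "\<sigma> \<in> squares C"
  shows "src \<sigma> \<in> Arr C" "tgt \<sigma> \<in> Arr C" "upper \<sigma> \<in> Arr C" "lower \<sigma> \<in> Arr C"
    "Dom C (upper \<sigma>) = Dom C (src \<sigma>)" "Cod C (upper \<sigma>) = Dom C (tgt \<sigma>)"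
    "Dom C (lower \<sigma>) = Cod C (src \<sigma>)" "Cod C (lower \<sigma>) = Cod C (tgt \<sigma>)"
    "tgt \<sigma> \<cdot> upper \<sigma> = lower \<sigma> \<cdot> src \<sigma>"
  using assms by (cases \<sigma>; simp)+

end

lemma fcomp_sel [simp]: "omap (fcomp G F) X = omap G (omap F X)" "amap (fcomp G F) f = amap G (amap F f)"
  by (simp_all add: fcomp_def)

lemma arrow_cat_sel [simp]:
  "Obj (arrow_cat C) = Arr C" "Arr (arrow_cat C) = squares C" "Dom (arrow_cat C) = src"
  "Cod (arrow_cat C) = tgt"
  "Ide (arrow_cat C) f = Sq f f (Ide C (Dom C f)) (Ide C (Cod C f))"
  "\<tau> \<cdot>\<^bsub>arrow_cat C\<^esub> \<sigma> = Sq (src \<sigma>) (tgt \<tau>) (upper \<tau> \<cdot>\<^bsub>C\<^esub> upper \<sigma>) (lower \<tau> \<cdot>\<^bsub>C\<^esub> lower \<sigma>)"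
  by (simp_all add: arrow_cat_def)

lemma (in cat) squares_comp:
  assumes "\<sigma> \<in> squares C" "\<tau> \<in> squares C" "tgt \<sigma> = src \<tau>"
  shows "Sq (src \<sigma>) (tgt \<tau>) (upper \<tau> \<cdot> upper \<sigma>) (lower \<tau> \<cdot> lower \<sigma>) \<in> squares C"
proof -
  note s = squaresD[OF assms(1)] and t = squaresD[OF assms(2)]
  have "tgt \<tau> \<cdot> (upper \<tau> \<cdot> upper \<sigma>) = (lower \<tau> \<cdot> src \<tau>) \<cdot> upper \<sigma>"
    using s t assms(3) by (simp add: comp_eq_assoc[OF t(9)])
  also have "\<dots> = lower \<tau> \<cdot> (lower \<sigma> \<cdot> src \<sigma>)"
    using s t assms(3) by simp
  finally show ?thesis
    using s t assms(3) by simp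
qed

lemma (in cat) arrow_cat_category: "is_category (arrow_cat C)"
  unfolding is_category_def
proof (intro conjI ballI impI)
  fix \<sigma> \<tau> assume "\<sigma> \<in> Arr (arrow_cat C)" "\<tau> \<in> Arr (arrow_cat C)" "Cod (arrow_cat C) \<sigma> = Dom (arrow_cat C) \<tau>"
  then show "\<tau> \<cdot>\<^bsub>arrow_cat C\<^esub> \<sigma> \<in> hom (arrow_cat C) (Dom (arrow_cat C) \<sigma>) (Cod (arrow_cat C) \<tau>)"
    using squares_comp[of \<sigma> \<tau>] by (simp add: hom_def)
next
  fix \<sigma> assume s: "\<sigma> \<in> Arr (arrow_cat C)"
  then show "\<sigma> \<cdot>\<^bsub>arrow_cat C\<^esub> Ide (arrow_cat C) (Dom (arrow_cat C) \<sigma>) = \<sigma>"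
    using squaresD[of \<sigma>] by (cases \<sigma>) simp
  show "Ide (arrow_cat C) (Cod (arrow_cat C) \<sigma>) \<cdot>\<^bsub>arrow_cat C\<^esub> \<sigma> = \<sigma>"
    using s squaresD[of \<sigma>] by (cases \<sigma>) simp
qed (auto simp: hom_def squaresD)

section \<open>Lifting structures\<close>

locale lifting = cat C
  for C :: "('o, 'm) category" (structure) +
  fixes J :: "('i, 't) category" and u :: "('i, 't, 'm, ('m, 'm) sq) ftor"
  assumes J_cat: "is_category J"
    and u_functor: "is_functor J (arrow_cat C) u"
begin

abbreviation V :: "('m \<times> ('i \<times> ('m, 'm) sq \<Rightarrow> 'm)) set" where
  "V \<equiv> lifting_structures C J u"

text \<open>A lifting problem is handled through its two sides \<open>p\<close> and \<open>q\<close>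
  instead of as a square, so that its conditions are equations between arrows on which the
  simplifier can work. \<open>filler\<close> is the matching curried form of a lifting
  structure.\<close>

definition problem :: "'i \<Rightarrow> 'm \<Rightarrow> 'm \<Rightarrow> 'm \<Rightarrow> bool" where
  "problem i f p q \<longleftrightarrow> i \<in> Obj J \<and> Sq (omap u i) f p q \<in> squares C"

definition filler :: "'m \<times> ('i \<times> ('m, 'm) sq \<Rightarrow> 'm) \<Rightarrow> 'i \<Rightarrow> 'm \<Rightarrow> 'm \<Rightarrow> 'm" where
  "filler v i p q = snd v (i, Sq (omap u i) (fst v) p q)"

text \<open>The restriction to lifting problems makes the second component extensional, as
  membership in \<open>V\<close> demands, so that a structure is determined by its fillers.\<close>

definition lifting_of :: "'m \<Rightarrow> ('i \<Rightarrow> 'm \<Rightarrow> 'm \<Rightarrow> 'm) \<Rightarrow> 'm \<times> ('i \<times> ('m, 'm) sq \<Rightarrow> 'm)" where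
  "lifting_of f F = (f, \<lambda>(i, \<alpha>) \<in> lifting_problems C J u f. F i (upper \<alpha>) (lower \<alpha>))"

lemma u_arr [simp]: "i \<in> Obj J \<Longrightarrow> omap u i \<in> Arr C"
  using u_functor by (simp add: is_functor_def)

lemma u_sq:
  assumes "t \<in> Arr J"
  shows "amap u t \<in> squares C" "src (amap u t) = omap u (Dom J t)" "tgt (amap u t) = omap u (Cod J t)"
    "upper (amap u t) \<in> Arr C" "lower (amap u t) \<in> Arr C"
    "Dom C (upper (amap u t)) = Dom C (omap u (Dom J t))" "Cod C (upper (amap u t)) = Dom C (omap u (Cod J t))"
    "Dom C (lower (amap u t)) = Cod C (omap u (Dom J t))" "Cod C (lower (amap u t)) = Cod C (omap u (Cod J t))"
    "omap u (Cod J t) \<cdot> upper (amap u t) = lower (amap u t) \<cdot> omap u (Dom J t)"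
    "Dom J t \<in> Obj J" "Cod J t \<in> Obj J"
proof -
  show *: "amap u t \<in> squares C" "src (amap u t) = omap u (Dom J t)" "tgt (amap u t) = omap u (Cod J t)"
    using assms u_functor by (simp_all add: is_functor_def hom_def)
  show "Dom J t \<in> Obj J" "Cod J t \<in> Obj J"
    using assms J_cat by (auto simp: is_category_def)
  show "upper (amap u t) \<in> Arr C" "lower (amap u t) \<in> Arr C"
    "Dom C (upper (amap u t)) = Dom C (omap u (Dom J t))" "Cod C (upper (amap u t)) = Dom C (omap u (Cod J t))"
    "Dom C (lower (amap u t)) = Cod C (omap u (Dom J t))" "Cod C (lower (amap u t)) = Cod C (omap u (Cod J t))"
    "omap u (Cod J t) \<cdot> upper (amap u t) = lower (amap u t) \<cdot> omap u (Dom J t)"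
    using squaresD[OF *(1)] *(2,3) by simp_all
qed

lemma problem_iff:
  "problem i f p q \<longleftrightarrow> i \<in> Obj J \<and> f \<in> Arr C \<and> p \<in> Arr C \<and> q \<in> Arr C \<and>
     Dom C p = Dom C (omap u i) \<and> Cod C p = Dom C f \<and> Dom C q = Cod C (omap u i) \<and> Cod C q = Cod C f \<and>
     f \<cdot> p = q \<cdot> omap u i"
  by (auto simp: problem_def)

lemma lifting_problems_iff:
  "(i, \<alpha>) \<in> lifting_problems C J u f \<longleftrightarrow> (\<exists>p q. \<alpha> = Sq (omap u i) f p q \<and> problem i f p q)"
  by (cases \<alpha>) (auto simp: lifting_problems_def hom_def problem_def)

lemma lifting_problems_Sq [simp]: "(i, Sq (omap u i) f p q) \<in> lifting_problems C J u f \<longleftrightarrow> problem i f p q"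
  by (auto simp: lifting_problems_iff)

lemma problem_comp:
  assumes "problem i f p q" "Sq f g h k \<in> squares C"
  shows "problem i g (h \<cdot> p) (k \<cdot> q)"
  using squares_comp[of "Sq (omap u i) f p q" "Sq f g h k"] assms by (simp add: problem_def)

lemma problem_precomp:
  assumes "problem (Cod J t) f p q" "t \<in> Arr J"
  shows "problem (Dom J t) f (p \<cdot> upper (amap u t)) (q \<cdot> lower (amap u t))"
proof -
  have "Sq (src (amap u t)) f (p \<cdot> upper (amap u t)) (q \<cdot> lower (amap u t)) \<in> squares C"
    using squares_comp[of "amap u t" "Sq (omap u (Cod J t)) f p q"] u_sq(1-3)[OF assms(2)] assms(1)
    by (simp add: problem_def)
  then show ?thesis using u_sq(2,11)[OF assms(2)] by (simp add: problem_def)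
qed

lemma lifting_structures_iff:
  "v \<in> V \<longleftrightarrow> fst v \<in> Arr C \<and> snd v \<in> extensional (lifting_problems C J u (fst v)) \<and>
     (\<forall>i p q. problem i (fst v) p q \<longrightarrow>
        filler v i p q \<in> Arr C \<and> Dom C (filler v i p q) = Cod C (omap u i) \<and>
        Cod C (filler v i p q) = Dom C (fst v) \<and>
        filler v i p q \<cdot> omap u i = p \<and> fst v \<cdot> filler v i p q = q \<and>
        (\<forall>t \<in> Arr J. Cod J t = i \<longrightarrow>
           filler v (Dom J t) (p \<cdot> upper (amap u t)) (q \<cdot> lower (amap u t)) = filler v i p q \<cdot> lower (amap u t)))"
  (is "_ \<longleftrightarrow> _ \<and> _ \<and> (\<forall>i p q. problem i (fst v) p q \<longrightarrow> ?F i p q \<and> ?L i p q \<and> ?G i p q \<and> ?U i p q \<and> ?D i p q \<and> ?N i p q)")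
proof -
  obtain f \<psi> where v: "v = (f, \<psi>)" by (cases v)
  have 1: "(\<forall>(i, \<alpha>) \<in> lifting_problems C J u f. P i \<alpha>) \<longleftrightarrow> (\<forall>i p q. problem i f p q \<longrightarrow> P i (Sq (omap u i) f p q))" for P
    by (auto simp: lifting_problems_iff)
  have 2: "(\<forall>t \<in> Arr J. Cod J t = i \<longrightarrow>
        \<psi> (Dom J t, Sq (omap u i) f p q \<cdot>\<^bsub>arrow_cat C\<^esub> amap u t) = \<psi> (i, Sq (omap u i) f p q) \<cdot> lower (amap u t))
      \<longleftrightarrow> ?N i p q" for i p q
    using u_sq(2) by (auto simp: filler_def v)
  show ?thesis
    unfolding lifting_structures_def v
    apply (simp only: mem_Collect_eq prod.case 1 2[unfolded v])
    by (auto simp: filler_def hom_def)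
qed

lemma lifting_fst [simp]: "v \<in> V \<Longrightarrow> fst v \<in> Arr C"
  by (simp add: lifting_structures_iff)

lemma fillerD:
  assumes "v \<in> V" "problem i (fst v) p q"
  shows "filler v i p q \<in> Arr C" "Dom C (filler v i p q) = Cod C (omap u i)"
    "Cod C (filler v i p q) = Dom C (fst v)" "filler v i p q \<cdot> omap u i = p" "fst v \<cdot> filler v i p q = q"
  using assms by (simp_all add: lifting_structures_iff)

lemma filler_nat:
  assumes "v \<in> V" "t \<in> Arr J" "problem (Cod J t) (fst v) p q"
  shows "filler v (Dom J t) (p \<cdot> upper (amap u t)) (q \<cdot> lower (amap u t)) = filler v (Cod J t) p q \<cdot> lower (amap u t)"
  using assms by (simp add: lifting_structures_iff)

lemma lifting_eqI:
  assumes "v \<in> V" "w \<in> V" "fst v = fst w" "\<And>i p q. problem i (fst v) p q \<Longrightarrow> filler v i p q = filler w i p q"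
  shows "v = w"
proof (rule prod_eqI)
  show "snd v = snd w"
  proof (rule extensionalityI)
    show "snd v \<in> extensional (lifting_problems C J u (fst v))" "snd w \<in> extensional (lifting_problems C J u (fst v))"
      using assms(1-3) by (simp_all add: lifting_structures_iff)
    fix x assume "x \<in> lifting_problems C J u (fst v)"
    then obtain i p q where "x = (i, Sq (omap u i) (fst v) p q)" "problem i (fst v) p q"
      by (cases x) (auto simp: lifting_problems_iff)
    then show "snd v x = snd w x" using assms(3,4) by (simp add: filler_def)
  qed
qed (use assms in simp)

lemma fst_lifting_of [simp]: "fst (lifting_of f F) = f"
  by (simp add: lifting_of_def)

lemma filler_lifting_of [simp]: "problem i f p q \<Longrightarrow> filler (lifting_of f F) i p q = F i p q"
  by (simp add: filler_def lifting_of_def)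

lemma lifting_ofI:
  assumes f: "f \<in> Arr C"
    and F: "\<And>i p q. problem i f p q \<Longrightarrow> F i p q \<in> Arr C \<and> Dom C (F i p q) = Cod C (omap u i) \<and>
        Cod C (F i p q) = Dom C f \<and> F i p q \<cdot> omap u i = p \<and> f \<cdot> F i p q = q"
    and N: "\<And>t p q. t \<in> Arr J \<Longrightarrow> problem (Cod J t) f p q \<Longrightarrow>
        F (Dom J t) (p \<cdot> upper (amap u t)) (q \<cdot> lower (amap u t)) = F (Cod J t) p q \<cdot> lower (amap u t)"
  shows "lifting_of f F \<in> V"
  unfolding lifting_structures_iff
  using f F N problem_precomp by (auto simp: lifting_of_def[of f F, THEN arg_cong[where f = snd]])

text \<open>These are the squares of the double category of lifting structures, see
  \<open>lift_square_iff\<close>. Composed horizontally they make lifting structures a category over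
  the arrow category.\<close>

definition lmor :: "'m \<times> ('i \<times> ('m, 'm) sq \<Rightarrow> 'm) \<Rightarrow> 'm \<times> ('i \<times> ('m, 'm) sq \<Rightarrow> 'm) \<Rightarrow> 'm \<Rightarrow> 'm \<Rightarrow> bool" where
  "lmor v w h k \<longleftrightarrow> v \<in> V \<and> w \<in> V \<and> Sq (fst v) (fst w) h k \<in> squares C \<and>
     (\<forall>i p q. problem i (fst v) p q \<longrightarrow> filler w i (h \<cdot> p) (k \<cdot> q) = h \<cdot> filler v i p q)"

text \<open>The universal arrow from \<open>f\<close> to the forgetful functor on lifting
  structures. The lower side \<open>k\<close> is arbitrary and not only an identity: universality
  against all squares is what later makes f \<mapsto> R f a functor on the arrow category, with no
  separate argument for a change of base.\<close>

definition free_lifting :: "'m \<Rightarrow> 'm \<Rightarrow> 'm \<times> ('i \<times> ('m, 'm) sq \<Rightarrow> 'm) \<Rightarrow> bool" where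
  "free_lifting f l r \<longleftrightarrow> l \<in> Arr C \<and> Dom C l = Dom C f \<and> Cod C l = Dom C (fst r) \<and> r \<in> V \<and> fst r \<cdot> l = f \<and>
     (\<forall>w h k. w \<in> V \<longrightarrow> Sq f (fst w) h k \<in> squares C \<longrightarrow> (\<exists>e. lmor r w e k \<and> e \<cdot> l = h)) \<and>
     (\<forall>w e e' k. lmor r w e k \<longrightarrow> lmor r w e' k \<longrightarrow> e \<cdot> l = e' \<cdot> l \<longrightarrow> e = e')"

end

section \<open>Chains\<close>

locale wellorder_index =
  fixes \<kappa> :: "'k rel"
  assumes WO: "Well_order \<kappa>"
begin

abbreviation lt :: "'k \<Rightarrow> 'k \<Rightarrow> bool"  (infix "\<lless>" 50) where
  "\<beta> \<lless> \<gamma> \<equiv> \<beta> \<in> underS \<kappa> \<gamma>"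

lemma lt_iff: "\<beta> \<lless> \<gamma> \<longleftrightarrow> \<beta> \<noteq> \<gamma> \<and> (\<beta>, \<gamma>) \<in> \<kappa>"
  by (auto simp: underS_def)

lemma wo_rules:
  shows k_refl: "\<gamma> \<in> Field \<kappa> \<Longrightarrow> (\<gamma>, \<gamma>) \<in> \<kappa>"
    and k_trans: "(\<beta>, \<gamma>) \<in> \<kappa> \<Longrightarrow> (\<gamma>, \<delta>) \<in> \<kappa> \<Longrightarrow> (\<beta>, \<delta>) \<in> \<kappa>"
    and k_antisym: "(\<beta>, \<gamma>) \<in> \<kappa> \<Longrightarrow> (\<gamma>, \<beta>) \<in> \<kappa> \<Longrightarrow> \<beta> = \<gamma>"
    and k_total: "\<beta> \<in> Field \<kappa> \<Longrightarrow> \<gamma> \<in> Field \<kappa> \<Longrightarrow> (\<beta>, \<gamma>) \<in> \<kappa> \<or> (\<gamma>, \<beta>) \<in> \<kappa>"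
    and k_wf: "wf (\<kappa> - Id)"
proof -
  have lin: "Linear_order \<kappa>" and "wf (\<kappa> - Id)"
    using WO by (auto simp: well_order_on_def)
  then show "wf (\<kappa> - Id)" by simp
  have "Partial_order \<kappa>" and tot: "Total \<kappa>"
    using lin by (auto simp: linear_order_on_def)
  then have "Refl \<kappa>" "trans \<kappa>" "antisym \<kappa>"
    by (auto simp: partial_order_on_def preorder_on_def)
  then show "\<gamma> \<in> Field \<kappa> \<Longrightarrow> (\<gamma>, \<gamma>) \<in> \<kappa>" "(\<beta>, \<gamma>) \<in> \<kappa> \<Longrightarrow> (\<gamma>, \<delta>) \<in> \<kappa> \<Longrightarrow> (\<beta>, \<delta>) \<in> \<kappa>"
    "(\<beta>, \<gamma>) \<in> \<kappa> \<Longrightarrow> (\<gamma>, \<beta>) \<in> \<kappa> \<Longrightarrow> \<beta> = \<gamma>"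
    using refl_onD transD antisymD by metis+
  then show "\<beta> \<in> Field \<kappa> \<Longrightarrow> \<gamma> \<in> Field \<kappa> \<Longrightarrow> (\<beta>, \<gamma>) \<in> \<kappa> \<or> (\<gamma>, \<beta>) \<in> \<kappa>"
    using tot unfolding total_on_def by metis
qed

lemma lt_irrefl [simp]: "\<not> \<gamma> \<lless> \<gamma>"
  by (simp add: lt_iff)

lemma lt_trans: "\<beta> \<lless> \<gamma> \<Longrightarrow> \<gamma> \<lless> \<delta> \<Longrightarrow> \<beta> \<lless> \<delta>"
  by (metis k_antisym k_trans lt_iff)

lemma lt_field: "\<beta> \<lless> \<gamma> \<Longrightarrow> \<beta> \<in> Field \<kappa>" "\<beta> \<lless> \<gamma> \<Longrightarrow> \<gamma> \<in> Field \<kappa>"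
  by (auto simp: lt_iff Field_def)

lemma k_iff: "(\<beta>, \<gamma>) \<in> \<kappa> \<longleftrightarrow> \<beta> \<in> Field \<kappa> \<and> \<gamma> \<in> Field \<kappa> \<and> (\<beta> = \<gamma> \<or> \<beta> \<lless> \<gamma>)"
  using k_refl[of \<gamma>] by (auto simp: lt_iff intro: FieldI1 FieldI2)

lemma wf_lt: "wf {(\<beta>, \<gamma>). \<beta> \<lless> \<gamma>}"
proof -
  have "{(\<beta>, \<gamma>). \<beta> \<lless> \<gamma>} = \<kappa> - Id" by (auto simp: lt_iff)
  then show ?thesis using k_wf by simp
qed

lemma lt_induct [case_names less]:
  "(\<And>\<gamma>. (\<And>\<beta>. \<beta> \<lless> \<gamma> \<Longrightarrow> P \<beta>) \<Longrightarrow> P \<gamma>) \<Longrightarrow> P \<gamma>"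
  using wf_induct[OF wf_lt, of P] by auto

lemma segment_iff: "(\<beta>, \<delta>) \<in> segment \<kappa> \<gamma> \<longleftrightarrow> \<beta> \<lless> \<gamma> \<and> \<delta> \<lless> \<gamma> \<and> (\<beta> = \<delta> \<or> \<beta> \<lless> \<delta>)"
  by (auto simp: segment_def k_iff lt_field)

lemma Field_segment [simp]: "Field (segment \<kappa> \<gamma>) = underS \<kappa> \<gamma>"
  by (auto simp: Field_def segment_iff)

lemma one_plus_segment:
  "p \<in> one_plus (segment \<kappa> \<gamma>) \<longleftrightarrow>
     p = (None, None) \<or> (\<exists>\<delta>. p = (None, Some \<delta>) \<and> \<delta> \<lless> \<gamma>) \<or>
     (\<exists>\<beta> \<delta>. p = (Some \<beta>, Some \<delta>) \<and> \<beta> \<lless> \<gamma> \<and> \<delta> \<lless> \<gamma> \<and> (\<beta> = \<delta> \<or> \<beta> \<lless> \<delta>))"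
  by (auto simp: one_plus_def segment_iff)

lemma Field_one_plus_segment: "Field (one_plus (segment \<kappa> \<gamma>)) = insert None (Some ` underS \<kappa> \<gamma>)"
  unfolding Field_def by (auto simp: one_plus_segment Domain_iff Range_iff image_iff)

end

lemma poset_cat_sel [simp]:
  "Obj (poset_cat r) = Field r" "Arr (poset_cat r) = r" "Dom (poset_cat r) = fst"
  "Cod (poset_cat r) = snd" "Ide (poset_cat r) a = (a, a)"
  "q \<cdot>\<^bsub>poset_cat r\<^esub> p = (fst p, snd q)"
  by (simp_all add: poset_cat_def case_prod_beta)

lemma poset_category:
  assumes "\<And>a. a \<in> Field r \<Longrightarrow> (a, a) \<in> r" "\<And>a b c. (a, b) \<in> r \<Longrightarrow> (b, c) \<in> r \<Longrightarrow> (a, c) \<in> r"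
  shows "is_category (poset_cat r)"
  unfolding is_category_def hom_def
proof (intro conjI ballI impI)
  fix f g assume "f \<in> Arr (poset_cat r)" "g \<in> Arr (poset_cat r)" "Cod (poset_cat r) f = Dom (poset_cat r) g"
  then show "g \<cdot>\<^bsub>poset_cat r\<^esub> f
    \<in> {h \<in> Arr (poset_cat r). Dom (poset_cat r) h = Dom (poset_cat r) f \<and> Cod (poset_cat r) h = Cod (poset_cat r) g}"
    using assms(2)[of "fst f" "snd f" "snd g"] by (cases f; cases g) auto
qed (auto simp: assms(1) FieldI1 FieldI2)

lemma subcat_sel [simp]:
  "Obj (subcat C M) = Obj C" "Arr (subcat C M) = M" "Dom (subcat C M) = Dom C"
  "Cod (subcat C M) = Cod C" "Ide (subcat C M) = Ide C" "Comp (subcat C M) = Comp C"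
  "hom (subcat C M) X Y = {f \<in> M. Dom C f = X \<and> Cod C f = Y}"
  by (simp_all add: subcat_def hom_def)

lemma fcomp_fid [simp]: "fcomp fid D = D"
  by (simp add: fcomp_def fid_def o_def)

lemma fid_sel [simp]: "omap fid X = X" "amap fid f = f"
  by (simp_all add: fid_def)

lemma colimit_cocone: "is_colimit K C D X \<iota> \<Longrightarrow> is_cocone K C D X \<iota>"
  by (simp add: is_colimit_def)

lemma colimit_out:
  assumes "is_colimit K C D X \<iota>" "is_cocone K C D Y \<upsilon>"
  obtains m where "m \<in> hom C X Y" "\<And>k. k \<in> Obj K \<Longrightarrow> m \<cdot>\<^bsub>C\<^esub> \<iota> k = \<upsilon> k"
  using assms unfolding is_colimit_def by meson

text \<open>\<open>is_colimit\<close> yields uniqueness only relative to a given cocone; here the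
  cocone is the composite of the colimit cocone with \<open>m\<close>.\<close>

lemma colimit_unique:
  assumes col: "is_colimit K C D X \<iota>" and m: "m \<in> hom C X Y" and n: "n \<in> hom C X Y"
    and eq: "\<And>k. k \<in> Obj K \<Longrightarrow> m \<cdot>\<^bsub>C\<^esub> \<iota> k = n \<cdot>\<^bsub>C\<^esub> \<iota> k"
  shows "m = n"
proof -
  have ftr: "is_functor K C D" and coc: "is_cocone K C D X \<iota>"
    using col by (simp_all add: is_colimit_def)
  interpret cat C using ftr by unfold_locales (simp add: is_functor_def)
  interpret K: cat K using ftr by unfold_locales (simp add: is_functor_def)
  have "is_cocone K C D Y (\<lambda>k. m \<cdot>\<^bsub>C\<^esub> \<iota> k)"
    using m coc ftr unfolding is_cocone_def is_functor_def hom_def by auto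
  then have "\<exists>!m'. m' \<in> hom C X Y \<and> (\<forall>k \<in> Obj K. m' \<cdot>\<^bsub>C\<^esub> \<iota> k = m \<cdot>\<^bsub>C\<^esub> \<iota> k)"
    using col unfolding is_colimit_def by blast
  then show ?thesis using m n eq by metis
qed

locale backdrop = cat C + wellorder_index \<kappa>
  for C :: "('o, 'm) category" (structure) and \<kappa> :: "'k rel" +
  fixes M :: "'m set"
  assumes backdrop: "is_backdrop \<kappa> C M"
begin

lemma M_wide: "wide_subcategory C M"
  using backdrop by (simp add: is_backdrop_def)

lemma M_arr [simp]: "f \<in> M \<Longrightarrow> f \<in> Arr C"
  and M_ide [simp]: "X \<in> Obj C \<Longrightarrow> Ide C X \<in> M"
  and M_comp [simp]: "f \<in> M \<Longrightarrow> g \<in> M \<Longrightarrow> Cod C f = Dom C g \<Longrightarrow> g \<cdot> f \<in> M"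
  using M_wide by (auto simp: wide_subcategory_def)

lemma subcat_category: "is_category (subcat C M)"
  unfolding is_category_def by auto

end

record ('k, 'm) stage =
  zz :: 'm
  ii :: "'k \<Rightarrow> 'm"
  xx :: 'm
  jj :: 'm
  tt :: 'm
  yy :: 'm

context backdrop
begin

text \<open>A complex over \<open>Cod f\<^sub>0\<close> starting from \<open>A = Dom f\<^sub>0\<close>: stage \<open>\<gamma>\<close> consists of an object
  \<open>X\<^sub>\<gamma>\<close>, the colimit of the chain of \<open>A\<close> and all \<open>X'\<^sub>\<beta>\<close> for \<open>\<beta> < \<gamma>\<close>, and a cobase change
  \<open>X'\<^sub>\<gamma>\<close> of \<open>X\<^sub>\<gamma>\<close>. The fields are \<open>zz : A \<rightarrow> X\<^sub>\<gamma>\<close>, \<open>ii \<beta> : X'\<^sub>\<beta> \<rightarrow> X\<^sub>\<gamma>\<close>, \<open>xx : X\<^sub>\<gamma> \<rightarrow> Cod f\<^sub>0\<close>,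
  \<open>jj : X\<^sub>\<gamma> \<rightarrow> X'\<^sub>\<gamma>\<close>, the attached cell \<open>tt\<close> into \<open>X'\<^sub>\<gamma>\<close>, and \<open>yy : X'\<^sub>\<gamma> \<rightarrow> Cod f\<^sub>0\<close>.\<close>

definition stage_cocone ::
  "'m \<Rightarrow> ('k \<Rightarrow> ('k, 'm) stage) \<Rightarrow> 'k \<Rightarrow> 'm \<Rightarrow> ('k \<Rightarrow> 'm) \<Rightarrow> bool" where
  "stage_cocone f0 S \<gamma> g h \<longleftrightarrow> g \<in> Arr C \<and> Dom C g = Dom C f0 \<and>
     (\<forall>\<beta>. \<beta> \<lless> \<gamma> \<longrightarrow> h \<beta> \<in> Arr C \<and> Dom C (h \<beta>) = Dom C (yy (S \<beta>)) \<and> Cod C (h \<beta>) = Cod C g \<and>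
        h \<beta> \<cdot> (jj (S \<beta>) \<cdot> zz (S \<beta>)) = g) \<and>
     (\<forall>\<beta> \<delta>. \<beta> \<lless> \<delta> \<longrightarrow> \<delta> \<lless> \<gamma> \<longrightarrow> h \<delta> \<cdot> (jj (S \<delta>) \<cdot> ii (S \<delta>) \<beta>) = h \<beta>)"

text \<open>Two universal properties in one: the mediating map exists in the ambient category for
  every cocone, and it lies in \<open>M\<close> as soon as the cocone does. The second half is what
  records that the colimit is also one in \<open>M\<close>.\<close>

definition stage_colimit ::
  "'m \<Rightarrow> ('k \<Rightarrow> ('k, 'm) stage) \<Rightarrow> 'k \<Rightarrow> ('k, 'm) stage \<Rightarrow> bool" where
  "stage_colimit f0 S \<gamma> v \<longleftrightarrow>
     zz v \<in> M \<and> xx v \<in> Arr C \<and> Cod C (zz v) = Dom C (xx v) \<and> Cod C (xx v) = Cod C f0 \<and>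
     xx v \<cdot> zz v = f0 \<and>
     stage_cocone f0 S \<gamma> (zz v) (ii v) \<and>
     (\<forall>\<beta>. \<beta> \<lless> \<gamma> \<longrightarrow> ii v \<beta> \<in> M \<and> xx v \<cdot> ii v \<beta> = yy (S \<beta>)) \<and>
     (\<forall>g h. stage_cocone f0 S \<gamma> g h \<longrightarrow>
        (\<exists>y \<in> Arr C. Dom C y = Dom C (xx v) \<and> Cod C y = Cod C g \<and> y \<cdot> zz v = g \<and>
           (\<forall>\<beta>. \<beta> \<lless> \<gamma> \<longrightarrow> y \<cdot> ii v \<beta> = h \<beta>) \<and>
           (g \<in> M \<longrightarrow> (\<forall>\<beta>. \<beta> \<lless> \<gamma> \<longrightarrow> h \<beta> \<in> M) \<longrightarrow> y \<in> M))) \<and>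
     (\<forall>y \<in> Arr C. \<forall>y' \<in> Arr C. Dom C y = Dom C (xx v) \<longrightarrow> Dom C y' = Dom C (xx v) \<longrightarrow>
        Cod C y = Cod C y' \<longrightarrow> y \<cdot> zz v = y' \<cdot> zz v \<longrightarrow>
        (\<forall>\<beta>. \<beta> \<lless> \<gamma> \<longrightarrow> y \<cdot> ii v \<beta> = y' \<cdot> ii v \<beta>) \<longrightarrow> y = y')"

definition stage_extension :: "'m \<Rightarrow> ('k, 'm) stage \<Rightarrow> bool" where
  "stage_extension f0 v \<longleftrightarrow> jj v \<in> M \<and> yy v \<in> Arr C \<and> Dom C (jj v) = Dom C (xx v) \<and>
     Cod C (jj v) = Dom C (yy v) \<and> Cod C (yy v) = Cod C f0 \<and> yy v \<cdot> jj v = xx v"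

text \<open>The chain of length 1 + \<gamma>, with A at \<open>None\<close>. Equal indices need
  their own case because \<open>ii (S \<delta>) \<delta>\<close> is unspecified. No arrow leads from
  a later index to \<open>None\<close>, so the \<open>undefined\<close> branch is never met.\<close>

definition stage_diagram ::
  "'m \<Rightarrow> ('k \<Rightarrow> ('k, 'm) stage) \<Rightarrow> ('k option, 'k option \<times> 'k option, 'o, 'm) ftor" where
  "stage_diagram f0 S =
     \<lparr>omap = (\<lambda>a. case a of None \<Rightarrow> Dom C f0 | Some \<beta> \<Rightarrow> Dom C (yy (S \<beta>))),
      amap = (\<lambda>(a, b). case a of
         None \<Rightarrow> (case b of None \<Rightarrow> Ide C (Dom C f0) | Some \<delta> \<Rightarrow> jj (S \<delta>) \<cdot> zz (S \<delta>))
       | Some \<beta> \<Rightarrow> (case b of None \<Rightarrow> undefined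
          | Some \<delta> \<Rightarrow> if \<beta> = \<delta> then Ide C (Dom C (yy (S \<delta>))) else jj (S \<delta>) \<cdot> ii (S \<delta>) \<beta>))\<rparr>"

text \<open>Clause (a) of a backdrop gives the colimit in \<open>M\<close> and its preservation by
  the inclusion; the map \<open>xx\<close> to the base is induced by the maps \<open>yy\<close> of
  the earlier stages.\<close>

lemma stage_colimit_exists:
  assumes \<gamma>: "\<gamma> \<in> Field \<kappa>" and f0: "f0 \<in> Arr C"
    and hist: "\<And>\<beta>. \<beta> \<lless> \<gamma> \<Longrightarrow> stage_colimit f0 S \<beta> (S \<beta>) \<and> stage_extension f0 (S \<beta>)"
  shows "\<exists>v. stage_colimit f0 S \<gamma> v"
proof -
  let ?K = "poset_cat (one_plus (segment \<kappa> \<gamma>))" and ?D = "stage_diagram f0 S"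
  have ex: "jj (S \<beta>) \<in> M" "yy (S \<beta>) \<in> Arr C" "Dom C (jj (S \<beta>)) = Dom C (xx (S \<beta>))"
     "Cod C (jj (S \<beta>)) = Dom C (yy (S \<beta>))" "Cod C (yy (S \<beta>)) = Cod C f0"
     "yy (S \<beta>) \<cdot> jj (S \<beta>) = xx (S \<beta>)"
    if "\<beta> \<lless> \<gamma>" for \<beta> using hist[OF that] by (auto simp: stage_extension_def)
  have col: "zz (S \<beta>) \<in> M" "xx (S \<beta>) \<in> Arr C" "Cod C (zz (S \<beta>)) = Dom C (xx (S \<beta>))"
     "Cod C (xx (S \<beta>)) = Cod C f0" "xx (S \<beta>) \<cdot> zz (S \<beta>) = f0" "Dom C (zz (S \<beta>)) = Dom C f0"
    if "\<beta> \<lless> \<gamma>" for \<beta> using hist[OF that] by (auto simp: stage_colimit_def stage_cocone_def)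
  have col2: "ii (S \<delta>) \<beta> \<in> M" "Dom C (ii (S \<delta>) \<beta>) = Dom C (yy (S \<beta>))"
      "Cod C (ii (S \<delta>) \<beta>) = Dom C (xx (S \<delta>))" "xx (S \<delta>) \<cdot> ii (S \<delta>) \<beta> = yy (S \<beta>)"
      "ii (S \<delta>) \<beta> \<cdot> (jj (S \<beta>) \<cdot> zz (S \<beta>)) = zz (S \<delta>)"
    if "\<beta> \<lless> \<delta>" "\<delta> \<lless> \<gamma>" for \<beta> \<delta> using hist[OF that(2)] that(1)
    by (auto simp: stage_colimit_def stage_cocone_def)
  have col3: "ii (S \<delta>) \<epsilon> \<cdot> (jj (S \<epsilon>) \<cdot> ii (S \<epsilon>) \<beta>) = ii (S \<delta>) \<beta>"
    if "\<beta> \<lless> \<epsilon>" "\<epsilon> \<lless> \<delta>" "\<delta> \<lless> \<gamma>" for \<beta> \<delta> \<epsilon> using hist[OF that(3)] that(1,2)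
    by (auto simp: stage_colimit_def stage_cocone_def)
  have K: "is_category ?K"
    by (rule poset_category) (auto simp: one_plus_segment Field_one_plus_segment intro: lt_trans)
  have arr: "amap ?D p \<in> hom (subcat C M) (omap ?D (fst p)) (omap ?D (snd p))"
    if "p \<in> one_plus (segment \<kappa> \<gamma>)" for p
    using that f0 by (auto simp: one_plus_segment stage_diagram_def ex col col2)
  have comp: "amap ?D (fst p, snd q) = amap ?D q \<cdot> amap ?D p"
    if p: "p \<in> one_plus (segment \<kappa> \<gamma>)" and q: "q \<in> one_plus (segment \<kappa> \<gamma>)" and pq: "snd p = fst q" for p q
  proof -
    have c: "snd p \<noteq> None \<Longrightarrow> snd q \<noteq> None"
      using q pq by (auto simp: one_plus_segment)
    show ?thesis
    proof (cases "snd q")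
      case None
      then have "p = (None, None)" "q = (None, None)"
        using p q pq c by (auto simp: one_plus_segment)
      then show ?thesis using f0 by (simp add: stage_diagram_def)
    next
      case (Some \<delta>)
      then have d: "\<delta> \<lless> \<gamma>" using q by (auto simp: one_plus_segment)
      show ?thesis
      proof (cases "snd p")
        case None
        then have "p = (None, None)" "q = (None, Some \<delta>)"
          using p q pq c Some by (auto simp: one_plus_segment)
        then show ?thesis using f0 d by (simp add: stage_diagram_def ex col)
      next
        case e: (Some \<epsilon>)
        then have q': "q = (Some \<epsilon>, Some \<delta>)" "\<epsilon> \<lless> \<gamma>" "\<epsilon> = \<delta> \<or> \<epsilon> \<lless> \<delta>"
          using q pq Some by (auto simp: one_plus_segment)
        show ?thesis
        proof (cases "fst p")
          case None
          then have "p = (None, Some \<epsilon>)" using e by (cases p) simp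
          then show ?thesis using q' d
            by (auto simp: stage_diagram_def ex col col2)
        next
          case (Some \<beta>)
          then have p': "p = (Some \<beta>, Some \<epsilon>)" "\<beta> \<lless> \<gamma>" "\<beta> = \<epsilon> \<or> \<beta> \<lless> \<epsilon>"
            using p e by (auto simp: one_plus_segment)
          show ?thesis
          proof (cases "\<beta> = \<epsilon> \<or> \<epsilon> = \<delta>")
            case True
            then show ?thesis using p' q' d by (auto simp: stage_diagram_def ex col col2)
          next
            \<comment> \<open>Three distinct indices above the least one: this is the cocone
              condition of the stage at \<delta>, composed with \<open>jj\<close>.\<close>
            case False
            then have o: "\<beta> \<lless> \<epsilon>" "\<epsilon> \<lless> \<delta>" "\<beta> \<lless> \<delta>" using p' q' by (auto intro: lt_trans)
            then have "\<beta> \<noteq> \<delta>" by auto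
            then show ?thesis using p' q' d o False col3[OF o(1,2) d] by (simp add: stage_diagram_def ex col col2)
          qed
        qed
      qed
    qed
  qed
  have DM: "is_functor ?K (subcat C M) ?D"
    unfolding is_functor_def
    using K subcat_category arr comp f0
    by (auto simp: Field_one_plus_segment stage_diagram_def ex col split: option.split)
  have "has_colimits_in ?K C M"
    using backdrop \<gamma> by (simp add: is_backdrop_def)
  then obtain X \<iota> where X: "is_colimit ?K (subcat C M) ?D X \<iota>" and pres: "preserves_colimit ?K (subcat C M) C fid ?D"
    using DM unfolding has_colimits_in_def by blast
  then have XC: "is_colimit ?K C ?D X \<iota>"
    unfolding preserves_colimit_def by simp
  \<comment> \<open>\<open>case_option g h\<close> joins the leg \<open>g\<close> at the least
    element with the other legs \<open>h\<close>; in this form a cocone on the chain is exactly a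
    \<open>stage_cocone\<close>.\<close>
  have cocone_iff: "is_cocone ?K C ?D (Cod C g) (case_option g h) \<longleftrightarrow> stage_cocone f0 S \<gamma> g h"
    if "g \<in> Arr C" for g h
  proof -
    have "is_cocone ?K C ?D (Cod C g) (case_option g h) \<longleftrightarrow>
      (\<forall>k\<in>Field (one_plus (segment \<kappa> \<gamma>)). case_option g h k \<in> hom C (omap ?D k) (Cod C g)) \<and>
      (\<forall>p\<in>one_plus (segment \<kappa> \<gamma>). case_option g h (snd p) \<cdot> amap ?D p = case_option g h (fst p))"
      using that by (auto simp: is_cocone_def)
    also have "\<dots> \<longleftrightarrow> stage_cocone f0 S \<gamma> g h"
    proof (intro iffI conjI ballI)
      assume *: "(\<forall>k\<in>Field (one_plus (segment \<kappa> \<gamma>)). case_option g h k \<in> hom C (omap ?D k) (Cod C g)) \<and>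
        (\<forall>p\<in>one_plus (segment \<kappa> \<gamma>). case_option g h (snd p) \<cdot> amap ?D p = case_option g h (fst p))"
      then have 1: "\<And>k. k\<in>Field (one_plus (segment \<kappa> \<gamma>)) \<Longrightarrow> case_option g h k \<in> hom C (omap ?D k) (Cod C g)"
        and 2: "\<And>p. p\<in>one_plus (segment \<kappa> \<gamma>) \<Longrightarrow> case_option g h (snd p) \<cdot> amap ?D p = case_option g h (fst p)"
        by blast+
      show "stage_cocone f0 S \<gamma> g h"
        unfolding stage_cocone_def
      proof (intro conjI allI impI)
        show "g \<in> Arr C" "Dom C g = Dom C f0"
          using 1[of None] by (auto simp: hom_def Field_one_plus_segment stage_diagram_def)
      next
        fix \<beta> assume b: "\<beta> \<lless> \<gamma>"
        show "h \<beta> \<in> Arr C" "Dom C (h \<beta>) = Dom C (yy (S \<beta>))" "Cod C (h \<beta>) = Cod C g"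
          using 1[of "Some \<beta>"] b by (auto simp: hom_def Field_one_plus_segment stage_diagram_def)
        show "h \<beta> \<cdot> (jj (S \<beta>) \<cdot> zz (S \<beta>)) = g"
          using 2[of "(None, Some \<beta>)"] b by (auto simp: one_plus_segment stage_diagram_def)
      next
        fix \<beta> \<delta> assume b: "\<beta> \<lless> \<delta>" "\<delta> \<lless> \<gamma>"
        show "h \<delta> \<cdot> (jj (S \<delta>) \<cdot> ii (S \<delta>) \<beta>) = h \<beta>"
          using 2[of "(Some \<beta>, Some \<delta>)"] b lt_trans[OF b] by (auto simp: one_plus_segment stage_diagram_def split: if_splits)
      qed
    next
      fix k assume *: "stage_cocone f0 S \<gamma> g h" "k\<in>Field (one_plus (segment \<kappa> \<gamma>))"
      then show "case_option g h k \<in> hom C (omap ?D k) (Cod C g)"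
        by (auto simp: stage_cocone_def Field_one_plus_segment hom_def stage_diagram_def)
    next
      fix p assume *: "stage_cocone f0 S \<gamma> g h" "p\<in>one_plus (segment \<kappa> \<gamma>)"
      then show "case_option g h (snd p) \<cdot> amap ?D p = case_option g h (fst p)"
        by (auto simp: stage_cocone_def one_plus_segment hom_def stage_diagram_def f0)
    qed
    finally show ?thesis .
  qed
  have iM: "\<And>k. k \<in> Field (one_plus (segment \<kappa> \<gamma>)) \<Longrightarrow> \<iota> k \<in> M \<and> Dom C (\<iota> k) = omap ?D k \<and> Cod C (\<iota> k) = X"
    using colimit_cocone[OF X] by (auto simp: is_cocone_def)
  then have z: "\<iota> None \<in> M" "Dom C (\<iota> None) = Dom C f0" "Cod C (\<iota> None) = X"
    and i: "\<And>\<beta>. \<beta> \<lless> \<gamma> \<Longrightarrow> \<iota> (Some \<beta>) \<in> M \<and> Dom C (\<iota> (Some \<beta>)) = Dom C (yy (S \<beta>)) \<and> Cod C (\<iota> (Some \<beta>)) = X"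
    by (auto simp: Field_one_plus_segment stage_diagram_def)
  have "case_option (\<iota> None) (\<lambda>\<beta>. \<iota> (Some \<beta>)) = \<iota>"
    by (rule ext) (simp split: option.split)
  then have coc: "stage_cocone f0 S \<gamma> (\<iota> None) (\<lambda>\<beta>. \<iota> (Some \<beta>))"
    using colimit_cocone[OF XC] cocone_iff[of "\<iota> None" "\<lambda>\<beta>. \<iota> (Some \<beta>)"] z by simp
  have out: "\<exists>y \<in> Arr C. Dom C y = X \<and> Cod C y = Cod C g \<and> y \<cdot> \<iota> None = g \<and>
           (\<forall>\<beta>. \<beta> \<lless> \<gamma> \<longrightarrow> y \<cdot> \<iota> (Some \<beta>) = h \<beta>) \<and>
           (g \<in> M \<longrightarrow> (\<forall>\<beta>. \<beta> \<lless> \<gamma> \<longrightarrow> h \<beta> \<in> M) \<longrightarrow> y \<in> M)" (is "?P")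
    if gh: "stage_cocone f0 S \<gamma> g h" for g h
  proof -
    have "g \<in> Arr C" using gh by (simp add: stage_cocone_def)
    then have c: "is_cocone ?K C ?D (Cod C g) (case_option g h)"
      using gh cocone_iff by simp
    obtain y where y: "y \<in> hom C X (Cod C g)" "\<And>k. k \<in> Obj ?K \<Longrightarrow> y \<cdot> \<iota> k = case_option g h k"
      using colimit_out[OF XC c] by blast
    \<comment> \<open>The colimit in \<open>M\<close> gives some mediating arrow in
      \<open>M\<close>; it equals \<open>y\<close> by uniqueness in the ambient category.\<close>
    have "y \<in> M" if "g \<in> M" "\<forall>\<beta>. \<beta> \<lless> \<gamma> \<longrightarrow> h \<beta> \<in> M"
    proof -
      have "is_cocone ?K (subcat C M) ?D (Cod C g) (case_option g h)"
        using c that by (auto simp: is_cocone_def hom_def Field_one_plus_segment)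
      then obtain y' where y': "y' \<in> hom (subcat C M) X (Cod C g)" "\<And>k. k \<in> Obj ?K \<Longrightarrow> y' \<cdot> \<iota> k = case_option g h k"
        using colimit_out[OF X] by (metis subcat_sel(6))
      then have "y' \<in> hom C X (Cod C g)" by (auto simp: hom_def)
      then have "y = y'" using colimit_unique[OF XC y(1)] y y' by simp
      then show "y \<in> M" using y' by simp
    qed
    then show ?thesis
      using y(1) y(2)[of None] y(2)[of "Some _"]
      by (intro bexI[of _ y]) (auto simp: hom_def Field_one_plus_segment)
  qed
  have "stage_cocone f0 S \<gamma> f0 (\<lambda>\<beta>. yy (S \<beta>))"
  proof -
    have "yy (S \<beta>) \<cdot> (jj (S \<beta>) \<cdot> zz (S \<beta>)) = f0" if "\<beta> \<lless> \<gamma>" for \<beta>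
      using that col(5)[OF that] comp_eq_assoc[OF ex(6)[OF that], of "zz (S \<beta>)"] by (simp add: ex col)
    moreover have "yy (S \<delta>) \<cdot> (jj (S \<delta>) \<cdot> ii (S \<delta>) \<beta>) = yy (S \<beta>)" if "\<beta> \<lless> \<delta>" "\<delta> \<lless> \<gamma>" for \<beta> \<delta>
      using that col2(4)[OF that] comp_eq_assoc[OF ex(6)[OF that(2)], of "ii (S \<delta>) \<beta>"] by (simp add: ex col col2)
    ultimately show ?thesis
      using f0 by (auto simp: stage_cocone_def ex)
  qed
  from out[OF this] obtain x where x: "x \<in> Arr C" "Dom C x = X" "Cod C x = Cod C f0" "x \<cdot> \<iota> None = f0"
     "\<And>\<beta>. \<beta> \<lless> \<gamma> \<Longrightarrow> x \<cdot> \<iota> (Some \<beta>) = yy (S \<beta>)" by blast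
  have uni: "y = y'" if "y \<in> Arr C" "y' \<in> Arr C" "Dom C y = X" "Dom C y' = X" "Cod C y = Cod C y'"
    "y \<cdot> \<iota> None = y' \<cdot> \<iota> None" "\<forall>\<beta>. \<beta> \<lless> \<gamma> \<longrightarrow> y \<cdot> \<iota> (Some \<beta>) = y' \<cdot> \<iota> (Some \<beta>)" for y y'
    by (rule colimit_unique[OF XC, of y "Cod C y"]) (use that in \<open>auto simp: hom_def Field_one_plus_segment\<close>)
  \<comment> \<open>The fields \<open>jj\<close>, \<open>tt\<close> and \<open>yy\<close> get their
    values only when the cell is attached; until then \<open>undefined\<close> is a
    placeholder.\<close>
  show ?thesis
    by (intro exI[of _ "\<lparr>zz = \<iota> None, ii = (\<lambda>\<beta>. \<iota> (Some \<beta>)), xx = x, jj = undefined, tt = undefined, yy = undefined\<rparr>"])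
      (use z i x coc out uni in \<open>simp add: stage_colimit_def\<close>)
qed

end

section \<open>Latching objects and cell complexes\<close>

context cat
begin

lemma pushoutD:
  assumes "is_pushout C a x p q"
  shows "a \<in> Arr C" "x \<in> Arr C" "p \<in> Arr C" "q \<in> Arr C" "Dom C x = Dom C a" "Dom C p = Cod C a"
    "Dom C q = Cod C x" "Cod C q = Cod C p" "p \<cdot> a = q \<cdot> x"
  using assms by (auto simp: is_pushout_def)

lemma pushout_universal:
  assumes "is_pushout C a x p q" "p' \<in> Arr C" "q' \<in> Arr C" "Dom C p' = Cod C a" "Dom C q' = Cod C x"
    "Cod C p' = Cod C q'" "p' \<cdot> a = q' \<cdot> x"
  shows "\<exists>!m. m \<in> hom C (Cod C p) (Cod C p') \<and> m \<cdot> p = p' \<and> m \<cdot> q = q'"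
  using assms unfolding is_pushout_def by blast

lemma pushout_out:
  assumes "is_pushout C a x p q" "p' \<in> Arr C" "q' \<in> Arr C" "Dom C p' = Cod C a" "Dom C q' = Cod C x"
    "Cod C p' = Cod C q'" "p' \<cdot> a = q' \<cdot> x"
  shows "\<exists>m \<in> Arr C. Dom C m = Cod C p \<and> Cod C m = Cod C p' \<and> m \<cdot> p = p' \<and> m \<cdot> q = q'"
  using pushout_universal[OF assms] unfolding hom_def by blast

lemma pushout_unique:
  assumes po: "is_pushout C a x p q" and m: "m \<in> Arr C" "m' \<in> Arr C" "Dom C m = Cod C p" "Dom C m' = Cod C p"
    "Cod C m = Cod C m'" "m \<cdot> p = m' \<cdot> p" "m \<cdot> q = m' \<cdot> q"
  shows "m = m'"
proof -
  note P = pushoutD[OF po]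
  have "(m \<cdot> p) \<cdot> a = (m \<cdot> q) \<cdot> x" using m(1,3) P by simp
  then have "\<exists>!n. n \<in> hom C (Cod C p) (Cod C (m \<cdot> p)) \<and> n \<cdot> p = m \<cdot> p \<and> n \<cdot> q = m \<cdot> q"
    by (intro pushout_universal[OF po]) (use m(1,3) P in simp_all)
  then show ?thesis using m P by (auto simp: hom_def)
qed

end

context backdrop
begin

lemma stage_colimitD:
  assumes "stage_colimit f0 S \<gamma> v"
  shows "zz v \<in> M" "xx v \<in> Arr C" "Dom C (zz v) = Dom C f0" "Cod C (zz v) = Dom C (xx v)"
    "Cod C (xx v) = Cod C f0" "xx v \<cdot> zz v = f0"
    "\<And>\<beta>. \<beta> \<lless> \<gamma> \<Longrightarrow> ii v \<beta> \<in> M" "\<And>\<beta>. \<beta> \<lless> \<gamma> \<Longrightarrow> Dom C (ii v \<beta>) = Dom C (yy (S \<beta>))"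
    "\<And>\<beta>. \<beta> \<lless> \<gamma> \<Longrightarrow> Cod C (ii v \<beta>) = Dom C (xx v)" "\<And>\<beta>. \<beta> \<lless> \<gamma> \<Longrightarrow> xx v \<cdot> ii v \<beta> = yy (S \<beta>)"
    "\<And>\<beta>. \<beta> \<lless> \<gamma> \<Longrightarrow> ii v \<beta> \<cdot> (jj (S \<beta>) \<cdot> zz (S \<beta>)) = zz v"
    "\<And>\<beta> \<delta>. \<beta> \<lless> \<delta> \<Longrightarrow> \<delta> \<lless> \<gamma> \<Longrightarrow> ii v \<delta> \<cdot> (jj (S \<delta>) \<cdot> ii (S \<delta>) \<beta>) = ii v \<beta>"
  using assms by (simp_all add: stage_colimit_def stage_cocone_def)

lemma stage_colimit_out:
  assumes "stage_colimit f0 S \<gamma> v" "stage_cocone f0 S \<gamma> g h"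
  obtains y where "y \<in> Arr C" "Dom C y = Dom C (xx v)" "Cod C y = Cod C g" "y \<cdot> zz v = g"
    "\<And>\<beta>. \<beta> \<lless> \<gamma> \<Longrightarrow> y \<cdot> ii v \<beta> = h \<beta>"
    "g \<in> M \<Longrightarrow> (\<And>\<beta>. \<beta> \<lless> \<gamma> \<Longrightarrow> h \<beta> \<in> M) \<Longrightarrow> y \<in> M"
proof -
  have "\<exists>y \<in> Arr C. Dom C y = Dom C (xx v) \<and> Cod C y = Cod C g \<and> y \<cdot> zz v = g \<and>
           (\<forall>\<beta>. \<beta> \<lless> \<gamma> \<longrightarrow> y \<cdot> ii v \<beta> = h \<beta>) \<and>
           (g \<in> M \<longrightarrow> (\<forall>\<beta>. \<beta> \<lless> \<gamma> \<longrightarrow> h \<beta> \<in> M) \<longrightarrow> y \<in> M)"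
    using assms unfolding stage_colimit_def by (elim conjE) blast
  then show thesis using that by blast
qed

lemma stage_colimit_unique:
  assumes "stage_colimit f0 S \<gamma> v" "y \<in> Arr C" "y' \<in> Arr C" "Dom C y = Dom C (xx v)"
    "Dom C y' = Dom C (xx v)" "Cod C y = Cod C y'" "y \<cdot> zz v = y' \<cdot> zz v"
    "\<And>\<beta>. \<beta> \<lless> \<gamma> \<Longrightarrow> y \<cdot> ii v \<beta> = y' \<cdot> ii v \<beta>"
  shows "y = y'"
  using assms unfolding stage_colimit_def by (elim conjE) blast

text \<open>Dependence on \<open>S\<close> only below \<gamma> is what the choice along the
  well-order in \<open>complex_exists\<close> requires; insensitivity to the cell fields of
  \<open>v\<close> lets them be filled in afterwards.\<close>

lemma stage_colimit_cong:
  assumes "\<And>\<beta>. \<beta> \<lless> \<gamma> \<Longrightarrow> S \<beta> = S' \<beta>" "zz v = zz v'" "xx v = xx v'" "ii v = ii v'"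
  shows "stage_colimit f0 S \<gamma> v = stage_colimit f0 S' \<gamma> v'"
proof -
  have "stage_cocone f0 S \<gamma> g h = stage_cocone f0 S' \<gamma> g h" for g h
    using assms(1) unfolding stage_cocone_def by auto
  then show ?thesis
    using assms unfolding stage_colimit_def by auto
qed

text \<open>The latching object of a chain \<open>a\<close> of arrows with squares \<open>s\<close> at \<open>\<gamma>\<close>, classically
  \<open>Dom a\<^sub>\<gamma>\<close> glued along \<open>colim\<^sub>\<beta> Dom a\<^sub>\<beta>\<close> with \<open>colim\<^sub>\<beta> Cod a\<^sub>\<beta>\<close> for \<open>\<beta> < \<gamma>\<close>. It is described by
  its universal property because the two colimits need not exist.\<close>

definition latch_cocone ::
  "('k \<Rightarrow> 'm) \<Rightarrow> ('k \<Rightarrow> 'k \<Rightarrow> ('m, 'm) sq) \<Rightarrow> 'k \<Rightarrow> 'm \<Rightarrow> ('k \<Rightarrow> 'm) \<Rightarrow> bool" where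
  "latch_cocone a s \<gamma> h k \<longleftrightarrow> h \<in> Arr C \<and> Dom C h = Dom C (a \<gamma>) \<and>
     (\<forall>\<beta>. \<beta> \<lless> \<gamma> \<longrightarrow> k \<beta> \<in> Arr C \<and> Dom C (k \<beta>) = Cod C (a \<beta>) \<and> Cod C (k \<beta>) = Cod C h \<and>
        k \<beta> \<cdot> a \<beta> = h \<cdot> upper (s \<beta> \<gamma>)) \<and>
     (\<forall>\<beta> \<delta>. \<beta> \<lless> \<delta> \<longrightarrow> \<delta> \<lless> \<gamma> \<longrightarrow> k \<delta> \<cdot> lower (s \<beta> \<delta>) = k \<beta>)"

text \<open>\<open>m\<close> is the latching map from the latching object to
  \<open>Cod C (a \<gamma>)\<close>. That it lies in \<open>M\<close> is built in, since what a cell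
  complex attaches is a cobase change of \<open>m\<close>.\<close>

definition latch ::
  "('k \<Rightarrow> 'm) \<Rightarrow> ('k \<Rightarrow> 'k \<Rightarrow> ('m, 'm) sq) \<Rightarrow> 'k \<Rightarrow> 'm \<Rightarrow> ('k \<Rightarrow> 'm) \<Rightarrow> 'm \<Rightarrow> bool" where
  "latch a s \<gamma> q0 q m \<longleftrightarrow>
     m \<in> M \<and> Cod C m = Cod C (a \<gamma>) \<and> Cod C q0 = Dom C m \<and> m \<cdot> q0 = a \<gamma> \<and>
     latch_cocone a s \<gamma> q0 q \<and> (\<forall>\<beta>. \<beta> \<lless> \<gamma> \<longrightarrow> m \<cdot> q \<beta> = lower (s \<beta> \<gamma>)) \<and>
     (\<forall>h k. latch_cocone a s \<gamma> h k \<longrightarrow>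
        (\<exists>y \<in> Arr C. Dom C y = Dom C m \<and> Cod C y = Cod C h \<and> y \<cdot> q0 = h \<and>
           (\<forall>\<beta>. \<beta> \<lless> \<gamma> \<longrightarrow> y \<cdot> q \<beta> = k \<beta>))) \<and>
     (\<forall>y \<in> Arr C. \<forall>y' \<in> Arr C. Dom C y = Dom C m \<longrightarrow> Dom C y' = Dom C m \<longrightarrow>
        Cod C y = Cod C y' \<longrightarrow> y \<cdot> q0 = y' \<cdot> q0 \<longrightarrow> (\<forall>\<beta>. \<beta> \<lless> \<gamma> \<longrightarrow> y \<cdot> q \<beta> = y' \<cdot> q \<beta>) \<longrightarrow> y = y')"

lemma latch_out:
  assumes "latch a s \<gamma> q0 q m" "latch_cocone a s \<gamma> h k"
  obtains y where "y \<in> Arr C" "Dom C y = Dom C m" "Cod C y = Cod C h" "y \<cdot> q0 = h"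
    "\<And>\<beta>. \<beta> \<lless> \<gamma> \<Longrightarrow> y \<cdot> q \<beta> = k \<beta>"
proof -
  have "\<exists>y \<in> Arr C. Dom C y = Dom C m \<and> Cod C y = Cod C h \<and> y \<cdot> q0 = h \<and> (\<forall>\<beta>. \<beta> \<lless> \<gamma> \<longrightarrow> y \<cdot> q \<beta> = k \<beta>)"
    using assms unfolding latch_def by (elim conjE) blast
  then show thesis using that by blast
qed

lemma latch_unique:
  assumes "latch a s \<gamma> q0 q m" "y \<in> Arr C" "y' \<in> Arr C" "Dom C y = Dom C m" "Dom C y' = Dom C m"
    "Cod C y = Cod C y'" "y \<cdot> q0 = y' \<cdot> q0" "\<And>\<beta>. \<beta> \<lless> \<gamma> \<Longrightarrow> y \<cdot> q \<beta> = y' \<cdot> q \<beta>"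
  shows "y = y'"
  using assms unfolding latch_def by (elim conjE) blast

lemma latchD:
  assumes "latch a s \<gamma> q0 q m"
  shows "m \<in> M" "Cod C m = Cod C (a \<gamma>)" "q0 \<in> Arr C" "Dom C q0 = Dom C (a \<gamma>)"
     "Cod C q0 = Dom C m" "m \<cdot> q0 = a \<gamma>"
     "\<And>\<beta>. \<beta> \<lless> \<gamma> \<Longrightarrow> q \<beta> \<in> Arr C" "\<And>\<beta>. \<beta> \<lless> \<gamma> \<Longrightarrow> Dom C (q \<beta>) = Cod C (a \<beta>)"
     "\<And>\<beta>. \<beta> \<lless> \<gamma> \<Longrightarrow> Cod C (q \<beta>) = Dom C m"
     "\<And>\<beta>. \<beta> \<lless> \<gamma> \<Longrightarrow> q \<beta> \<cdot> a \<beta> = q0 \<cdot> upper (s \<beta> \<gamma>)" "\<And>\<beta>. \<beta> \<lless> \<gamma> \<Longrightarrow> m \<cdot> q \<beta> = lower (s \<beta> \<gamma>)"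
     "\<And>\<beta> \<delta>. \<beta> \<lless> \<delta> \<Longrightarrow> \<delta> \<lless> \<gamma> \<Longrightarrow> q \<delta> \<cdot> lower (s \<beta> \<delta>) = q \<beta>"
  using assms by (simp_all add: latch_def latch_cocone_def)

end

text \<open>For every possible stage \<open>x : X\<^sub>\<gamma> \<rightarrow> Cod f0\<close> with structure map \<open>z : Dom f0 \<rightarrow> X\<^sub>\<gamma>\<close> the locale prescribes the
  cell \<open>a \<gamma> x\<close>, its attaching map \<open>e \<gamma> z x\<close>, its map \<open>b \<gamma> x\<close> to the base, and its functorial action
  \<open>s \<beta> \<gamma> x x' h\<close> along \<open>h : x \<rightarrow> x'\<close>. For free lifting structures the cell is \<open>D x\<close>; for latching objects
  it does not depend on \<open>x\<close>.\<close>

locale cells = backdrop C \<kappa> M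
  for C :: "('o, 'm) category" (structure) and \<kappa> :: "'k rel" and M :: "'m set" +
  fixes f0 :: 'm and a :: "'k \<Rightarrow> 'm \<Rightarrow> 'm" and s :: "'k \<Rightarrow> 'k \<Rightarrow> 'm \<Rightarrow> 'm \<Rightarrow> 'm \<Rightarrow> ('m, 'm) sq"
    and e :: "'k \<Rightarrow> 'm \<Rightarrow> 'm \<Rightarrow> 'm" and b :: "'k \<Rightarrow> 'm \<Rightarrow> 'm" and I :: "'k set"
  assumes f0: "f0 \<in> Arr C"
    and I_field: "I \<subseteq> Field \<kappa>"
    and I_down: "\<gamma> \<in> I \<Longrightarrow> \<beta> \<lless> \<gamma> \<Longrightarrow> \<beta> \<in> I"
    and a_M: "\<gamma> \<in> I \<Longrightarrow> x \<in> Arr C \<Longrightarrow> Cod C x = Cod C f0 \<Longrightarrow> a \<gamma> x \<in> M"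
    and s_sq: "\<gamma> \<in> I \<Longrightarrow> \<beta> \<lless> \<gamma> \<Longrightarrow> x' \<in> Arr C \<Longrightarrow> Cod C x' = Cod C f0 \<Longrightarrow> h \<in> M \<Longrightarrow>
      Cod C h = Dom C x' \<Longrightarrow> x' \<cdot> h = x \<Longrightarrow>
      s \<beta> \<gamma> x x' h \<in> squares C \<and> src (s \<beta> \<gamma> x x' h) = a \<beta> x \<and> tgt (s \<beta> \<gamma> x x' h) = a \<gamma> x'"
    and e_arr: "\<gamma> \<in> I \<Longrightarrow> x \<in> Arr C \<Longrightarrow> Cod C x = Cod C f0 \<Longrightarrow> z \<in> Arr C \<Longrightarrow> Dom C z = Dom C f0 \<Longrightarrow>
      Cod C z = Dom C x \<Longrightarrow> x \<cdot> z = f0 \<Longrightarrow>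
      e \<gamma> z x \<in> Arr C \<and> Dom C (e \<gamma> z x) = Dom C (a \<gamma> x) \<and> Cod C (e \<gamma> z x) = Dom C x \<and>
      x \<cdot> e \<gamma> z x = b \<gamma> x \<cdot> a \<gamma> x"
    and e_nat: "\<gamma> \<in> I \<Longrightarrow> \<beta> \<lless> \<gamma> \<Longrightarrow> x' \<in> Arr C \<Longrightarrow> Cod C x' = Cod C f0 \<Longrightarrow> h \<in> M \<Longrightarrow>
      Cod C h = Dom C x' \<Longrightarrow> x' \<cdot> h = x \<Longrightarrow> z \<in> Arr C \<Longrightarrow> Dom C z = Dom C f0 \<Longrightarrow> Cod C z = Dom C h \<Longrightarrow>
      x \<cdot> z = f0 \<Longrightarrow> h \<cdot> z = z' \<Longrightarrow> h \<cdot> e \<beta> z x = e \<gamma> z' x' \<cdot> upper (s \<beta> \<gamma> x x' h)"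
    and b_arr: "\<gamma> \<in> I \<Longrightarrow> x \<in> Arr C \<Longrightarrow> Cod C x = Cod C f0 \<Longrightarrow>
      b \<gamma> x \<in> Arr C \<and> Dom C (b \<gamma> x) = Cod C (a \<gamma> x) \<and> Cod C (b \<gamma> x) = Cod C f0"
    and b_nat: "\<gamma> \<in> I \<Longrightarrow> \<beta> \<lless> \<gamma> \<Longrightarrow> x' \<in> Arr C \<Longrightarrow> Cod C x' = Cod C f0 \<Longrightarrow> h \<in> M \<Longrightarrow>
      Cod C h = Dom C x' \<Longrightarrow> x' \<cdot> h = x \<Longrightarrow> b \<gamma> x' \<cdot> lower (s \<beta> \<gamma> x x' h) = b \<beta> x"
    and latches: "\<gamma> \<in> I \<Longrightarrow>
      (\<And>\<beta>. \<beta> = \<gamma> \<or> \<beta> \<lless> \<gamma> \<Longrightarrow> X \<beta> \<in> Arr C \<and> Cod C (X \<beta>) = Cod C f0) \<Longrightarrow>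
      (\<And>\<beta> \<delta>. \<delta> = \<gamma> \<or> \<delta> \<lless> \<gamma> \<Longrightarrow> \<beta> \<lless> \<delta> \<Longrightarrow> H \<beta> \<delta> \<in> M \<and> Dom C (H \<beta> \<delta>) = Dom C (X \<beta>) \<and>
         Cod C (H \<beta> \<delta>) = Dom C (X \<delta>) \<and> X \<delta> \<cdot> H \<beta> \<delta> = X \<beta>) \<Longrightarrow>
      (\<And>\<beta> \<delta> \<epsilon>. \<epsilon> = \<gamma> \<or> \<epsilon> \<lless> \<gamma> \<Longrightarrow> \<beta> \<lless> \<delta> \<Longrightarrow> \<delta> \<lless> \<epsilon> \<Longrightarrow> H \<delta> \<epsilon> \<cdot> H \<beta> \<delta> = H \<beta> \<epsilon>) \<Longrightarrow>
      \<exists>q0 q m. latch (\<lambda>\<beta>. a \<beta> (X \<beta>)) (\<lambda>\<beta> \<delta>. s \<beta> \<delta> (X \<beta>) (X \<delta>) (H \<beta> \<delta>)) \<gamma> q0 q m"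
begin

text \<open>The stage \<open>v\<close> is an argument of its own because \<gamma> may be the stage
  under construction, whose record is not yet a value of \<open>S\<close>.\<close>

definition cell_sq :: "('k \<Rightarrow> ('k, 'm) stage) \<Rightarrow> 'k \<Rightarrow> 'k \<Rightarrow> ('k, 'm) stage \<Rightarrow> ('m, 'm) sq" where
  "cell_sq S \<beta> \<gamma> v = s \<beta> \<gamma> (xx (S \<beta>)) (xx v) (ii v \<beta> \<cdot> jj (S \<beta>))"

text \<open>The universal property of the pushout of the latching map, with the latching object
  eliminated: a map out of X'_\<gamma> is a map \<open>y\<close> out of X_\<gamma> together with a
  map \<open>k\<close> on the new cell that agrees with \<open>y\<close> along the attaching map and
  on all earlier cells.\<close>

definition stage_cell :: "('k \<Rightarrow> ('k, 'm) stage) \<Rightarrow> 'k \<Rightarrow> ('k, 'm) stage \<Rightarrow> bool" where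
  "stage_cell S \<gamma> v \<longleftrightarrow> stage_extension f0 v \<and>
     tt v \<in> Arr C \<and> Dom C (tt v) = Cod C (a \<gamma> (xx v)) \<and> Cod C (tt v) = Dom C (yy v) \<and>
     yy v \<cdot> tt v = b \<gamma> (xx v) \<and> tt v \<cdot> a \<gamma> (xx v) = jj v \<cdot> e \<gamma> (zz v) (xx v) \<and>
     (\<forall>\<beta>. \<beta> \<lless> \<gamma> \<longrightarrow> tt v \<cdot> lower (cell_sq S \<beta> \<gamma> v) = jj v \<cdot> (ii v \<beta> \<cdot> tt (S \<beta>))) \<and>
     (\<forall>y \<in> Arr C. \<forall>k \<in> Arr C. Dom C y = Dom C (xx v) \<longrightarrow> Dom C k = Cod C (a \<gamma> (xx v)) \<longrightarrow>
        Cod C k = Cod C y \<longrightarrow> k \<cdot> a \<gamma> (xx v) = y \<cdot> e \<gamma> (zz v) (xx v) \<longrightarrow>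
        (\<forall>\<beta>. \<beta> \<lless> \<gamma> \<longrightarrow> k \<cdot> lower (cell_sq S \<beta> \<gamma> v) = y \<cdot> (ii v \<beta> \<cdot> tt (S \<beta>))) \<longrightarrow>
        (\<exists>y' \<in> Arr C. Dom C y' = Dom C (yy v) \<and> Cod C y' = Cod C y \<and> y' \<cdot> jj v = y \<and> y' \<cdot> tt v = k)) \<and>
     (\<forall>y \<in> Arr C. \<forall>y' \<in> Arr C. Dom C y = Dom C (yy v) \<longrightarrow> Dom C y' = Dom C (yy v) \<longrightarrow>
        Cod C y = Cod C y' \<longrightarrow> y \<cdot> jj v = y' \<cdot> jj v \<longrightarrow> y \<cdot> tt v = y' \<cdot> tt v \<longrightarrow> y = y')"

lemma stage_cell_out:
  assumes "stage_cell S \<gamma> v" "y \<in> Arr C" "k \<in> Arr C" "Dom C y = Dom C (xx v)" "Dom C k = Cod C (a \<gamma> (xx v))"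
    "Cod C k = Cod C y" "k \<cdot> a \<gamma> (xx v) = y \<cdot> e \<gamma> (zz v) (xx v)"
    "\<And>\<beta>. \<beta> \<lless> \<gamma> \<Longrightarrow> k \<cdot> lower (cell_sq S \<beta> \<gamma> v) = y \<cdot> (ii v \<beta> \<cdot> tt (S \<beta>))"
  shows "\<exists>y' \<in> Arr C. Dom C y' = Dom C (yy v) \<and> Cod C y' = Cod C y \<and> y' \<cdot> jj v = y \<and> y' \<cdot> tt v = k"
  using assms unfolding stage_cell_def by (elim conjE) blast

lemma stage_cell_unique:
  assumes "stage_cell S \<gamma> v" "y \<in> Arr C" "y' \<in> Arr C" "Dom C y = Dom C (yy v)" "Dom C y' = Dom C (yy v)"
    "Cod C y = Cod C y'" "y \<cdot> jj v = y' \<cdot> jj v" "y \<cdot> tt v = y' \<cdot> tt v"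
  shows "y = y'"
  using assms unfolding stage_cell_def by (elim conjE) blast

definition complex :: "'k set \<Rightarrow> ('k \<Rightarrow> ('k, 'm) stage) \<Rightarrow> bool" where
  "complex I' S \<longleftrightarrow> (\<forall>\<gamma> \<in> I'. \<gamma> \<in> I \<and> stage_colimit f0 S \<gamma> (S \<gamma>) \<and> stage_cell S \<gamma> (S \<gamma>))"

lemma complexD:
  assumes "complex I' S" "\<gamma> \<in> I'"
  shows "\<gamma> \<in> I" "stage_colimit f0 S \<gamma> (S \<gamma>)" "stage_cell S \<gamma> (S \<gamma>)"
    "stage_extension f0 (S \<gamma>)"
    "zz (S \<gamma>) \<in> M" "xx (S \<gamma>) \<in> Arr C" "Dom C (zz (S \<gamma>)) = Dom C f0"
    "Cod C (zz (S \<gamma>)) = Dom C (xx (S \<gamma>))" "Cod C (xx (S \<gamma>)) = Cod C f0" "xx (S \<gamma>) \<cdot> zz (S \<gamma>) = f0"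
    "jj (S \<gamma>) \<in> M" "yy (S \<gamma>) \<in> Arr C" "Dom C (jj (S \<gamma>)) = Dom C (xx (S \<gamma>))"
    "Cod C (jj (S \<gamma>)) = Dom C (yy (S \<gamma>))" "Cod C (yy (S \<gamma>)) = Cod C f0"
    "yy (S \<gamma>) \<cdot> jj (S \<gamma>) = xx (S \<gamma>)"
    "tt (S \<gamma>) \<in> Arr C" "Dom C (tt (S \<gamma>)) = Cod C (a \<gamma> (xx (S \<gamma>)))"
    "Cod C (tt (S \<gamma>)) = Dom C (yy (S \<gamma>))" "yy (S \<gamma>) \<cdot> tt (S \<gamma>) = b \<gamma> (xx (S \<gamma>))"
    "tt (S \<gamma>) \<cdot> a \<gamma> (xx (S \<gamma>)) = jj (S \<gamma>) \<cdot> e \<gamma> (zz (S \<gamma>)) (xx (S \<gamma>))"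
    "a \<gamma> (xx (S \<gamma>)) \<in> M"
proof -
  show *: "\<gamma> \<in> I" and col: "stage_colimit f0 S \<gamma> (S \<gamma>)" and cell: "stage_cell S \<gamma> (S \<gamma>)"
    using assms by (simp_all add: complex_def)
  note stage_colimitD[OF col]
  then show  "zz (S \<gamma>) \<in> M" "xx (S \<gamma>) \<in> Arr C" "Dom C (zz (S \<gamma>)) = Dom C f0"
    "Cod C (zz (S \<gamma>)) = Dom C (xx (S \<gamma>))" "Cod C (xx (S \<gamma>)) = Cod C f0" "xx (S \<gamma>) \<cdot> zz (S \<gamma>) = f0"
    by auto
  then show "a \<gamma> (xx (S \<gamma>)) \<in> M" using a_M * by simp
qed (use assms in \<open>auto simp: complex_def stage_cell_def stage_extension_def\<close>)

lemma complex_step: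
  assumes "complex I' S" "\<gamma> \<in> I'" "\<beta> \<lless> \<gamma>"
  shows "ii (S \<gamma>) \<beta> \<in> M" "Dom C (ii (S \<gamma>) \<beta>) = Dom C (yy (S \<beta>))"
    "Cod C (ii (S \<gamma>) \<beta>) = Dom C (xx (S \<gamma>))" "xx (S \<gamma>) \<cdot> ii (S \<gamma>) \<beta> = yy (S \<beta>)"
    "ii (S \<gamma>) \<beta> \<cdot> (jj (S \<beta>) \<cdot> zz (S \<beta>)) = zz (S \<gamma>)"
    "tt (S \<gamma>) \<cdot> lower (cell_sq S \<beta> \<gamma> (S \<gamma>)) = jj (S \<gamma>) \<cdot> (ii (S \<gamma>) \<beta> \<cdot> tt (S \<beta>))"
    "\<And>\<delta>. \<delta> \<lless> \<beta> \<Longrightarrow> ii (S \<gamma>) \<beta> \<cdot> (jj (S \<beta>) \<cdot> ii (S \<beta>) \<delta>) = ii (S \<gamma>) \<delta>"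
proof -
  note stage_colimitD[OF complexD(2)[OF assms(1,2)]]
  then show "ii (S \<gamma>) \<beta> \<in> M" "Dom C (ii (S \<gamma>) \<beta>) = Dom C (yy (S \<beta>))"
    "Cod C (ii (S \<gamma>) \<beta>) = Dom C (xx (S \<gamma>))" "xx (S \<gamma>) \<cdot> ii (S \<gamma>) \<beta> = yy (S \<beta>)"
    "ii (S \<gamma>) \<beta> \<cdot> (jj (S \<beta>) \<cdot> zz (S \<beta>)) = zz (S \<gamma>)"
    "\<And>\<delta>. \<delta> \<lless> \<beta> \<Longrightarrow> ii (S \<gamma>) \<beta> \<cdot> (jj (S \<beta>) \<cdot> ii (S \<beta>) \<delta>) = ii (S \<gamma>) \<delta>"
    using assms(3) by auto
  show "tt (S \<gamma>) \<cdot> lower (cell_sq S \<beta> \<gamma> (S \<gamma>)) = jj (S \<gamma>) \<cdot> (ii (S \<gamma>) \<beta> \<cdot> tt (S \<beta>))"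
    using complexD(3)[OF assms(1,2)] assms(3) by (simp add: stage_cell_def)
qed

text \<open>Only the colimit fields of the stage at \<gamma> are assumed, so that the facts are
  available while the cell of that stage is being constructed.\<close>

lemma cell_sq:
  assumes cx: "complex (underS \<kappa> \<gamma>) S" and \<gamma>: "\<gamma> \<in> I" and col: "stage_colimit f0 S \<gamma> v" and \<beta>: "\<beta> \<lless> \<gamma>"
  shows "cell_sq S \<beta> \<gamma> v \<in> squares C" "src (cell_sq S \<beta> \<gamma> v) = a \<beta> (xx (S \<beta>))"
    "tgt (cell_sq S \<beta> \<gamma> v) = a \<gamma> (xx v)"
    "b \<gamma> (xx v) \<cdot> lower (cell_sq S \<beta> \<gamma> v) = b \<beta> (xx (S \<beta>))"
    "ii v \<beta> \<cdot> jj (S \<beta>) \<cdot> e \<beta> (zz (S \<beta>)) (xx (S \<beta>)) = e \<gamma> (zz v) (xx v) \<cdot> upper (cell_sq S \<beta> \<gamma> v)"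
proof -
  note D = complexD[OF cx \<beta>] and v = stage_colimitD[OF col] and w = stage_colimitD(7-)[OF col \<beta>]
  note e = e_arr[OF D(1,6,9) M_arr[OF D(5)] D(7,8,10)]
  have eq: "xx v \<cdot> (ii v \<beta> \<cdot> jj (S \<beta>)) = xx (S \<beta>)"
    using comp_eq_assoc[OF w(4), of "jj (S \<beta>)"] v D w by simp
  have sq: "s \<beta> \<gamma> (xx (S \<beta>)) (xx v) (ii v \<beta> \<cdot> jj (S \<beta>)) \<in> squares C \<and>
    src (s \<beta> \<gamma> (xx (S \<beta>)) (xx v) (ii v \<beta> \<cdot> jj (S \<beta>))) = a \<beta> (xx (S \<beta>)) \<and>
    tgt (s \<beta> \<gamma> (xx (S \<beta>)) (xx v) (ii v \<beta> \<cdot> jj (S \<beta>))) = a \<gamma> (xx v)"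
    by (rule s_sq[OF \<gamma> \<beta>]) (use eq v D w in simp_all)
  then show "cell_sq S \<beta> \<gamma> v \<in> squares C" "src (cell_sq S \<beta> \<gamma> v) = a \<beta> (xx (S \<beta>))"
    "tgt (cell_sq S \<beta> \<gamma> v) = a \<gamma> (xx v)" by (simp_all add: cell_sq_def)
  show "b \<gamma> (xx v) \<cdot> lower (cell_sq S \<beta> \<gamma> v) = b \<beta> (xx (S \<beta>))"
    unfolding cell_sq_def by (rule b_nat[OF \<gamma> \<beta>]) (use eq v D w in simp_all)
  have "(ii v \<beta> \<cdot> jj (S \<beta>)) \<cdot> e \<beta> (zz (S \<beta>)) (xx (S \<beta>)) = e \<gamma> (zz v) (xx v) \<cdot> upper (cell_sq S \<beta> \<gamma> v)"
    unfolding cell_sq_def by (rule e_nat[OF \<gamma> \<beta>]) (use eq v D w in simp_all)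
  then show "ii v \<beta> \<cdot> jj (S \<beta>) \<cdot> e \<beta> (zz (S \<beta>)) (xx (S \<beta>)) = e \<gamma> (zz v) (xx v) \<cdot> upper (cell_sq S \<beta> \<gamma> v)"
    using v D w e by simp
qed

text \<open>A map out of X_\<gamma> is determined on A and on the attached cells: X'_\<beta> is
  covered by X_\<beta> and its cell, X_\<gamma> by A and the X'_\<beta>, and the rest is induction.
  It serves uniqueness both for latching objects and for free lifting structures.\<close>

lemma stage_unique:
  assumes cx: "complex I' S" and I': "underS \<kappa> \<gamma> \<subseteq> I'" and col: "stage_colimit f0 S \<gamma> v"
    and y: "y \<in> Arr C" "y' \<in> Arr C" "Dom C y = Dom C (xx v)" "Dom C y' = Dom C (xx v)" "Cod C y = Cod C y'"
    and z: "y \<cdot> zz v = y' \<cdot> zz v"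
    and t: "\<And>\<beta>. \<beta> \<lless> \<gamma> \<Longrightarrow> y \<cdot> (ii v \<beta> \<cdot> tt (S \<beta>)) = y' \<cdot> (ii v \<beta> \<cdot> tt (S \<beta>))"
  shows "y = y'"
  using I' col y z t
proof (induction \<gamma> arbitrary: v y y' rule: lt_induct)
  case (less \<gamma>)
  note v = stage_colimitD[OF less.prems(2)]
  have "y \<cdot> ii v \<beta> = y' \<cdot> ii v \<beta>" if \<beta>: "\<beta> \<lless> \<gamma>" for \<beta>
  proof -
    have \<beta>I: "\<beta> \<in> I'" using less.prems(1) \<beta> by blast
    note D = complexD[OF cx \<beta>I]
    have "y \<cdot> ii v \<beta> \<cdot> jj (S \<beta>) = y' \<cdot> ii v \<beta> \<cdot> jj (S \<beta>)"
    proof (rule less.IH[OF \<beta> _ D(2)])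
      show "underS \<kappa> \<beta> \<subseteq> I'" using less.prems(1) \<beta> lt_trans by blast
      show "(y \<cdot> ii v \<beta> \<cdot> jj (S \<beta>)) \<cdot> zz (S \<beta>) = (y' \<cdot> ii v \<beta> \<cdot> jj (S \<beta>)) \<cdot> zz (S \<beta>)"
        using less.prems v D \<beta> by simp
      fix \<delta> assume \<delta>: "\<delta> \<lless> \<beta>"
      then have "\<delta> \<lless> \<gamma>" "\<delta> \<in> I'" using \<beta> lt_trans less.prems(1) by blast+
      note D' = complexD[OF cx \<open>\<delta> \<in> I'\<close>] and W = complex_step[OF cx \<beta>I \<delta>]
      \<comment> \<open>A cell attached below \<beta> reaches X_\<gamma> through X_\<beta> in the
        same way as directly, so the assumption on cells restricts to X_\<beta>.\<close>
      have "ii v \<beta> \<cdot> jj (S \<beta>) \<cdot> ii (S \<beta>) \<delta> \<cdot> tt (S \<delta>) = ii v \<delta> \<cdot> tt (S \<delta>)"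
        using v(12)[OF \<delta> \<beta>, symmetric] v(7-9)[OF \<beta>] D D' W by simp
      then show "(y \<cdot> ii v \<beta> \<cdot> jj (S \<beta>)) \<cdot> ii (S \<beta>) \<delta> \<cdot> tt (S \<delta>) = (y' \<cdot> ii v \<beta> \<cdot> jj (S \<beta>)) \<cdot> ii (S \<beta>) \<delta> \<cdot> tt (S \<delta>)"
        using less.prems(3-7) less.prems(9)[OF \<open>\<delta> \<lless> \<gamma>\<close>] v(7-9)[OF \<beta>] D D' W by simp
    qed (use less.prems v D \<beta> in simp_all)
    moreover have "y \<cdot> ii v \<beta> \<cdot> tt (S \<beta>) = y' \<cdot> ii v \<beta> \<cdot> tt (S \<beta>)"
      using less.prems(9)[OF \<beta>] .
    ultimately show ?thesis
      by - (rule stage_cell_unique[OF D(3)], use less.prems(3-7) v(7-9)[OF \<beta>] D in simp_all)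
  qed
  then show ?case
    using stage_colimit_unique[OF less.prems(2)] less.prems by blast
qed

text \<open>X'_\<gamma> is the pushout of the latching map along a map \<sigma> from the latching
  object to X_\<gamma>; closure under cobase change puts \<open>jj\<close> in \<open>M\<close>. The
  universal property of the latching object supplies \<sigma> and reduces equations of maps out of
  it to its legs.\<close>

lemma stage_cell_exists:
  assumes cx: "complex (underS \<kappa> \<gamma>) S" and \<gamma>: "\<gamma> \<in> I" and col: "stage_colimit f0 S \<gamma> (S \<gamma>)"
  shows "\<exists>j t y. stage_cell S \<gamma> ((S \<gamma>)\<lparr>jj := j, tt := t, yy := y\<rparr>)"
proof -
  let ?x = "xx (S \<gamma>)" and ?z = "zz (S \<gamma>)" and ?i = "ii (S \<gamma>)"
  let ?a = "\<lambda>\<beta>. a \<beta> (xx (S \<beta>))" and ?s = "\<lambda>\<beta> \<delta>. cell_sq S \<beta> \<delta> (S \<delta>)"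
  note D = complexD[OF cx] and v = stage_colimitD[OF col]
  have colD: "stage_colimit f0 S \<beta> (S \<beta>)" if "\<beta> = \<gamma> \<or> \<beta> \<lless> \<gamma>" for \<beta>
    using that col D(2) by auto
  have Dx: "xx (S \<beta>) \<in> Arr C \<and> Cod C (xx (S \<beta>)) = Cod C f0" if "\<beta> = \<gamma> \<or> \<beta> \<lless> \<gamma>" for \<beta>
    using stage_colimitD[OF colD[OF that]] by simp
  have "\<exists>q0 q m. latch ?a (\<lambda>\<beta> \<delta>. s \<beta> \<delta> (xx (S \<beta>)) (xx (S \<delta>)) (ii (S \<delta>) \<beta> \<cdot> jj (S \<beta>))) \<gamma> q0 q m"
  proof (rule latches[OF \<gamma> Dx])
    fix \<beta> \<delta> assume \<delta>: "\<delta> = \<gamma> \<or> \<delta> \<lless> \<gamma>" and \<beta>: "\<beta> \<lless> \<delta>"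
    then have "\<beta> \<lless> \<gamma>" using lt_trans by blast
    note B = D[OF this] and W = stage_colimitD[OF colD[OF \<delta>]]
    have "xx (S \<delta>) \<cdot> ii (S \<delta>) \<beta> \<cdot> jj (S \<beta>) = xx (S \<beta>)"
      using comp_eq_assoc[OF W(10)[OF \<beta>], of "jj (S \<beta>)"] B W \<beta> by simp
    then show "ii (S \<delta>) \<beta> \<cdot> jj (S \<beta>) \<in> M \<and> Dom C (ii (S \<delta>) \<beta> \<cdot> jj (S \<beta>)) = Dom C (xx (S \<beta>)) \<and>
       Cod C (ii (S \<delta>) \<beta> \<cdot> jj (S \<beta>)) = Dom C (xx (S \<delta>)) \<and> xx (S \<delta>) \<cdot> ii (S \<delta>) \<beta> \<cdot> jj (S \<beta>) = xx (S \<beta>)"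
      using B W \<beta> by simp
  next
    fix \<beta> \<delta> \<epsilon> assume \<epsilon>: "\<epsilon> = \<gamma> \<or> \<epsilon> \<lless> \<gamma>" and \<beta>: "\<beta> \<lless> \<delta>" and \<delta>: "\<delta> \<lless> \<epsilon>"
    then have "\<delta> \<lless> \<gamma>" "\<beta> \<lless> \<gamma>" using lt_trans by blast+
    note B = D[OF \<open>\<beta> \<lless> \<gamma>\<close>] and G = D[OF \<open>\<delta> \<lless> \<gamma>\<close>] and WG = stage_colimitD(7-)[OF G(2) \<beta>]
      and W = stage_colimitD(7-11)[OF colD[OF \<epsilon>] \<delta>]
    show "(ii (S \<epsilon>) \<delta> \<cdot> jj (S \<delta>)) \<cdot> ii (S \<delta>) \<beta> \<cdot> jj (S \<beta>) = ii (S \<epsilon>) \<beta> \<cdot> jj (S \<beta>)"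
      using B G WG(1-3) W(1-3) stage_colimitD(12)[OF colD[OF \<epsilon>] \<beta> \<delta>, symmetric] by simp
  qed
  then obtain q0 q m where Q: "latch ?a ?s \<gamma> q0 q m"
    unfolding cell_sq_def by blast
  note q = latchD[OF Q]
  note e = e_arr[OF \<gamma> v(2,5) M_arr[OF v(1)] v(3,4,6)]
  have sq: "?s \<beta> \<gamma> \<in> squares C" "src (?s \<beta> \<gamma>) = ?a \<beta>" "tgt (?s \<beta> \<gamma>) = ?a \<gamma>"
    "b \<gamma> ?x \<cdot> lower (?s \<beta> \<gamma>) = b \<beta> (xx (S \<beta>))"
    "?i \<beta> \<cdot> jj (S \<beta>) \<cdot> e \<beta> (zz (S \<beta>)) (xx (S \<beta>)) = e \<gamma> ?z ?x \<cdot> upper (?s \<beta> \<gamma>)"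
    if "\<beta> \<lless> \<gamma>" for \<beta>
    using cell_sq[OF cx \<gamma> col that] by auto
  have dE: "e \<beta> (zz (S \<beta>)) (xx (S \<beta>)) \<in> Arr C" "Dom C (e \<beta> (zz (S \<beta>)) (xx (S \<beta>))) = Dom C (?a \<beta>)"
      "Cod C (e \<beta> (zz (S \<beta>)) (xx (S \<beta>))) = Dom C (xx (S \<beta>))" if "\<beta> \<lless> \<gamma>" for \<beta>
    using D[OF that] e_arr[of \<beta> "xx (S \<beta>)" "zz (S \<beta>)"] by simp_all
  \<comment> \<open>The legs of \<sigma> are the attaching map of the new cell and the cells
    attached earlier. They fit together by \<open>e_nat\<close> and by the compatibility of the
    earlier cells with each other.\<close>
  have "latch_cocone ?a ?s \<gamma> (e \<gamma> ?z ?x) (\<lambda>\<beta>. ?i \<beta> \<cdot> tt (S \<beta>))"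
    unfolding latch_cocone_def
  proof (intro conjI allI impI)
    show "e \<gamma> ?z ?x \<in> Arr C" "Dom C (e \<gamma> ?z ?x) = Dom C (?a \<gamma>)" using e by auto
  next
    fix \<beta> assume \<beta>: "\<beta> \<lless> \<gamma>"
    have "?i \<beta> \<cdot> tt (S \<beta>) \<cdot> ?a \<beta> = ?i \<beta> \<cdot> jj (S \<beta>) \<cdot> e \<beta> (zz (S \<beta>)) (xx (S \<beta>))"
      using D(21)[OF \<beta>] by simp
    then show "?i \<beta> \<cdot> tt (S \<beta>) \<in> Arr C" "Dom C (?i \<beta> \<cdot> tt (S \<beta>)) = Cod C (?a \<beta>)"
       "Cod C (?i \<beta> \<cdot> tt (S \<beta>)) = Cod C (e \<gamma> ?z ?x)" "(?i \<beta> \<cdot> tt (S \<beta>)) \<cdot> ?a \<beta> = e \<gamma> ?z ?x \<cdot> upper (?s \<beta> \<gamma>)"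
      using D[OF \<beta>] v \<beta> e sq(5)[OF \<beta>] dE[OF \<beta>] by simp_all
  next
    fix \<beta> \<delta> assume \<beta>: "\<beta> \<lless> \<delta>" and \<delta>: "\<delta> \<lless> \<gamma>"
    then have b: "\<beta> \<lless> \<gamma>" using lt_trans by blast
    have "complex (underS \<kappa> \<delta>) S" using cx \<delta> lt_trans unfolding complex_def by blast
    note c = cell_sq[OF this D(1,2)[OF \<delta>] \<beta>] and W = complex_step[OF cx \<delta> \<beta>]
    have "?i \<delta> \<cdot> tt (S \<delta>) \<cdot> lower (?s \<beta> \<delta>) = ?i \<delta> \<cdot> jj (S \<delta>) \<cdot> ii (S \<delta>) \<beta> \<cdot> tt (S \<beta>)"
      using W(6) by simp
    also have "\<dots> = ?i \<beta> \<cdot> tt (S \<beta>)"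
      using v(12)[OF \<beta> \<delta>, symmetric] D(11-22)[OF b] D(11-22)[OF \<delta>] W(1-3) v(7-9)[OF b] v(7-9)[OF \<delta>] by simp
    finally show "(?i \<delta> \<cdot> tt (S \<delta>)) \<cdot> lower (?s \<beta> \<delta>) = ?i \<beta> \<cdot> tt (S \<beta>)"
      using squaresD[OF c(1)] c(2,3) D(11-22)[OF \<delta>] v(7-9)[OF \<delta>] by simp
  qed
  then obtain \<sigma> where \<sigma>: "\<sigma> \<in> Arr C" "Dom C \<sigma> = Dom C m" "Cod C \<sigma> = Cod C (e \<gamma> ?z ?x)" "\<sigma> \<cdot> q0 = e \<gamma> ?z ?x"
    "\<And>\<beta>. \<beta> \<lless> \<gamma> \<Longrightarrow> \<sigma> \<cdot> q \<beta> = ?i \<beta> \<cdot> tt (S \<beta>)"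
    by (rule latch_out[OF Q]) (rule that)
  have "closed_under_cobase_change C M"
    using backdrop by (simp add: is_backdrop_def)
  then obtain t j where po: "is_pushout C m \<sigma> t j" and j: "j \<in> M"
    using q(1) \<sigma> unfolding closed_under_cobase_change_def by metis
  have p: "t \<in> Arr C" "Dom C t = Cod C m" "Cod C \<sigma> = Dom C j" "Cod C t = Cod C j" "t \<cdot> m = j \<cdot> \<sigma>"
    using po by (auto simp: is_pushout_def)
  note bb = b_arr[OF \<gamma> v(2,5)]
  \<comment> \<open>Commutativity over the base, needed to induce \<open>yy\<close> out of the
    pushout.\<close>
  have bm: "b \<gamma> ?x \<cdot> m = ?x \<cdot> \<sigma>"
  proof (rule latch_unique[OF Q])
    show "(b \<gamma> ?x \<cdot> m) \<cdot> q0 = (?x \<cdot> \<sigma>) \<cdot> q0"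
      using q \<sigma> bb e v by simp
    fix \<beta> assume \<beta>: "\<beta> \<lless> \<gamma>"
    have "?x \<cdot> ?i \<beta> \<cdot> tt (S \<beta>) = b \<beta> (xx (S \<beta>))"
      using comp_eq_assoc[OF v(10)[OF \<beta>], of "tt (S \<beta>)"] v D[OF \<beta>] \<beta> by simp
    then show "(b \<gamma> ?x \<cdot> m) \<cdot> q \<beta> = (?x \<cdot> \<sigma>) \<cdot> q \<beta>"
      using q(1,2) q(7-11)[OF \<beta>] \<sigma>(1-3) \<sigma>(5)[OF \<beta>] bb e v(2,5) sq(4)[OF \<beta>] by simp
  qed (use q \<sigma> bb e v in simp_all)
  have "\<exists>y \<in> Arr C. Dom C y = Cod C t \<and> Cod C y = Cod C (b \<gamma> ?x) \<and> y \<cdot> t = b \<gamma> ?x \<and> y \<cdot> j = ?x"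
    by (rule pushout_out[OF po]) (use bm bb v p \<sigma> q e in simp_all)
  then obtain y where y: "y \<in> Arr C" "Dom C y = Cod C t" "Cod C y = Cod C f0" "y \<cdot> t = b \<gamma> ?x" "y \<cdot> j = ?x"
    using bb by auto
  have "stage_cell S \<gamma> ((S \<gamma>)\<lparr>jj := j, tt := t, yy := y\<rparr>)" (is "stage_cell S \<gamma> ?v")
    unfolding stage_cell_def
  proof (intro conjI ballI impI allI)
    show "stage_extension f0 ?v"
      using y j p e \<sigma> by (simp add: stage_extension_def)
    have "t \<cdot> ?a \<gamma> = t \<cdot> m \<cdot> q0" using q by simp
    also have "\<dots> = j \<cdot> e \<gamma> ?z ?x"
      using p \<sigma> q comp_eq_assoc[OF p(5), of q0] j by simp
    finally show "tt ?v \<cdot> a \<gamma> (xx ?v) = jj ?v \<cdot> e \<gamma> (zz ?v) (xx ?v)" by simp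
    have cs: "cell_sq S \<beta> \<gamma> ?v = cell_sq S \<beta> \<gamma> (S \<gamma>)" for \<beta> by (simp add: cell_sq_def)
    {
      fix \<beta> assume \<beta>: "\<beta> \<lless> \<gamma>"
      have "t \<cdot> m \<cdot> q \<beta> = j \<cdot> \<sigma> \<cdot> q \<beta>"
        using comp_eq_assoc[OF p(5), of "q \<beta>"] p j \<sigma>(1-3) q(1-5) q(7-9)[OF \<beta>] by simp
      then show "tt ?v \<cdot> lower (cell_sq S \<beta> \<gamma> ?v) = jj ?v \<cdot> (ii ?v \<beta> \<cdot> tt (S \<beta>))"
        using q(11)[OF \<beta>] \<sigma>(5)[OF \<beta>] by (simp add: cs)
    next
      fix w k assume w: "w \<in> Arr C" "k \<in> Arr C" "Dom C w = Dom C (xx ?v)" "Dom C k = Cod C (a \<gamma> (xx ?v))"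
        "Cod C k = Cod C w" "k \<cdot> a \<gamma> (xx ?v) = w \<cdot> e \<gamma> (zz ?v) (xx ?v)"
        "\<forall>\<beta>. \<beta> \<lless> \<gamma> \<longrightarrow> k \<cdot> lower (cell_sq S \<beta> \<gamma> ?v) = w \<cdot> (ii ?v \<beta> \<cdot> tt (S \<beta>))"
      \<comment> \<open>Here the conditions that \<open>stage_cell\<close> puts on \<open>w\<close>
        and \<open>k\<close> become a cocone on the pushout.\<close>
      have "k \<cdot> m = w \<cdot> \<sigma>"
      proof (rule latch_unique[OF Q])
        show "(k \<cdot> m) \<cdot> q0 = (w \<cdot> \<sigma>) \<cdot> q0"
          using q \<sigma> w e by simp
        fix \<beta> assume \<beta>: "\<beta> \<lless> \<gamma>"
        show "(k \<cdot> m) \<cdot> q \<beta> = (w \<cdot> \<sigma>) \<cdot> q \<beta>"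
          using q(1,2) q(7-11)[OF \<beta>] \<sigma>(1-3) \<sigma>(5)[OF \<beta>] w \<beta> e by (simp add: cs)
      qed (use q \<sigma> w e in simp_all)
      then have "\<exists>y' \<in> Arr C. Dom C y' = Cod C t \<and> Cod C y' = Cod C k \<and> y' \<cdot> t = k \<and> y' \<cdot> j = w"
        by (intro pushout_out[OF po]) (use w p \<sigma> q e y in simp_all)
      then show "\<exists>y' \<in> Arr C. Dom C y' = Dom C (yy ?v) \<and> Cod C y' = Cod C w \<and> y' \<cdot> jj ?v = w \<and> y' \<cdot> tt ?v = k"
        using w y by auto
    next
      fix n n' assume n: "n \<in> Arr C" "n' \<in> Arr C" "Dom C n = Dom C (yy ?v)" "Dom C n' = Dom C (yy ?v)"
        "Cod C n = Cod C n'" "n \<cdot> jj ?v = n' \<cdot> jj ?v" "n \<cdot> tt ?v = n' \<cdot> tt ?v"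
      show "n = n'"
        by (rule pushout_unique[OF po]) (use n y in simp_all)
    }
  qed (use y j p q in simp_all)
  then show ?thesis by blast
qed

lemma stage_cell_cong:
  assumes "\<And>\<beta>. \<beta> \<lless> \<gamma> \<Longrightarrow> S \<beta> = S' \<beta>"
  shows "stage_cell S \<gamma> v = stage_cell S' \<gamma> v"
  using assms unfolding stage_cell_def cell_sq_def by auto

text \<open>Stages are chosen by recursion along the well-order, and the two congruence lemmas
  guarantee that the conditions on a stage depend on earlier ones only. Each stage is made in two
  moves, first the colimit and then the cell.\<close>

lemma complex_exists: "\<exists>S. complex I S"
proof -
  let ?P = "\<lambda>S \<gamma> v. \<gamma> \<in> I \<longrightarrow> stage_colimit f0 S \<gamma> v \<and> stage_cell S \<gamma> v"
  have "\<exists>S. \<forall>\<gamma>. ?P S \<gamma> (S \<gamma>)"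
  proof (rule dependent_wf_choice[OF wf_lt])
    fix S S' :: "'k \<Rightarrow> ('k, 'm) stage" and \<gamma> v assume "\<And>\<beta>. (\<beta>, \<gamma>) \<in> {(\<beta>, \<gamma>). \<beta> \<lless> \<gamma>} \<Longrightarrow> S \<beta> = S' \<beta>"
    then have "\<And>\<beta>. \<beta> \<lless> \<gamma> \<Longrightarrow> S \<beta> = S' \<beta>" by simp
    then show "?P S \<gamma> v = ?P S' \<gamma> v"
      using stage_cell_cong stage_colimit_cong[of \<gamma> S S' v v] by metis
  next
    fix \<gamma> and S :: "'k \<Rightarrow> ('k, 'm) stage"
    assume H: "\<And>\<beta>. (\<beta>, \<gamma>) \<in> {(\<beta>, \<gamma>). \<beta> \<lless> \<gamma>} \<Longrightarrow> ?P S \<beta> (S \<beta>)"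
    show "\<exists>v. ?P S \<gamma> v"
    proof (cases "\<gamma> \<in> I")
      case True
      have cx: "complex (underS \<kappa> \<gamma>) S" using H True I_down by (auto simp: complex_def)
      obtain v where v: "stage_colimit f0 S \<gamma> v"
        using stage_colimit_exists[of \<gamma> f0 S] complexD(2,4)[OF cx] True I_field f0 by blast
      \<comment> \<open>\<open>stage_cell_exists\<close> reads the colimit at \<gamma> off the
        function itself, hence this update; the congruence lemmas carry the result back to
        \<open>S\<close>.\<close>
      define S' where "S' = S(\<gamma> := v)"
      have eq: "\<And>\<beta>. \<beta> \<lless> \<gamma> \<Longrightarrow> S' \<beta> = S \<beta>" by (auto simp: S'_def)
      have eq2: "\<And>\<beta> \<delta>. \<beta> \<lless> \<gamma> \<Longrightarrow> \<delta> \<lless> \<beta> \<Longrightarrow> S' \<delta> = S \<delta>" using eq lt_trans by blast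
      have "complex (underS \<kappa> \<gamma>) S'"
        unfolding complex_def
      proof (intro ballI conjI)
        fix \<beta> assume \<beta>: "\<beta> \<lless> \<gamma>"
        show "\<beta> \<in> I" using True \<beta> I_down by blast
        show "stage_colimit f0 S' \<beta> (S' \<beta>)"
          using stage_colimit_cong[of \<beta> S' S "S' \<beta>" "S' \<beta>"] eq[OF \<beta>] eq2[OF \<beta>] complexD(2)[OF cx \<beta>] by simp
        show "stage_cell S' \<beta> (S' \<beta>)"
          using stage_cell_cong[of \<beta> S' S "S' \<beta>"] eq[OF \<beta>] eq2[OF \<beta>] complexD(3)[OF cx \<beta>] by simp
      qed
      moreover have "stage_colimit f0 S' \<gamma> (S' \<gamma>)"
        using stage_colimit_cong[of \<gamma> S' S v v] eq v by (simp add: S'_def)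
      ultimately obtain j t y where "stage_cell S' \<gamma> ((S' \<gamma>)\<lparr>jj := j, tt := t, yy := y\<rparr>)" (is "stage_cell _ _ ?v")
        using stage_cell_exists True by blast
      then have "stage_cell S \<gamma> ?v" using stage_cell_cong[of \<gamma> S' S] eq by simp
      moreover have "stage_colimit f0 S \<gamma> ?v"
        using stage_colimit_cong[of \<gamma> S S v ?v] v by (simp add: S'_def)
      ultimately show ?thesis by blast
    qed simp
  qed
  then show ?thesis by (auto simp: complex_def)
qed

text \<open>Recursion for maps out of a complex, \<open>Y\<close> on X_\<gamma> and
  \<open>Y'\<close> on X'_\<gamma>: \<open>K \<gamma> y\<close> is the prescribed value on the cell
  at \<gamma> once the map is \<open>y\<close> on X_\<gamma>. That it restricts to the values of
  \<open>K\<close> at earlier stages is the compatibility for which \<open>stage_cell\<close> asks.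
  \<open>Inv\<close> is an invariant of the partial maps, carried along so that \<open>K\<close>
  need only make sense where it holds.\<close>

lemma complex_out:
  assumes cx: "complex I' S" and down: "\<And>\<beta> \<gamma>. \<gamma> \<in> I' \<Longrightarrow> \<beta> \<lless> \<gamma> \<Longrightarrow> \<beta> \<in> I'"
    and g: "g \<in> Arr C" "Dom C g = Dom C f0"
    and K: "\<And>\<gamma> y. \<gamma> \<in> I' \<Longrightarrow> y \<in> Arr C \<Longrightarrow> Dom C y = Dom C (xx (S \<gamma>)) \<Longrightarrow> Cod C y = Cod C g \<Longrightarrow>
       y \<cdot> zz (S \<gamma>) = g \<Longrightarrow> Inv \<gamma> y \<Longrightarrow>
       K \<gamma> y \<in> Arr C \<and> Dom C (K \<gamma> y) = Cod C (a \<gamma> (xx (S \<gamma>))) \<and> Cod C (K \<gamma> y) = Cod C g \<and>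
       K \<gamma> y \<cdot> a \<gamma> (xx (S \<gamma>)) = y \<cdot> e \<gamma> (zz (S \<gamma>)) (xx (S \<gamma>)) \<and>
       (\<forall>\<beta>. \<beta> \<lless> \<gamma> \<longrightarrow> K \<gamma> y \<cdot> lower (cell_sq S \<beta> \<gamma> (S \<gamma>)) = K \<beta> (y \<cdot> (ii (S \<gamma>) \<beta> \<cdot> jj (S \<beta>))))"
    and Inv: "\<And>\<gamma> y Y'. \<gamma> \<in> I' \<Longrightarrow> y \<in> Arr C \<Longrightarrow> Dom C y = Dom C (xx (S \<gamma>)) \<Longrightarrow> Cod C y = Cod C g \<Longrightarrow>
       y \<cdot> zz (S \<gamma>) = g \<Longrightarrow>
       (\<And>\<beta>. \<beta> \<lless> \<gamma> \<Longrightarrow> Y' \<beta> \<in> Arr C \<and> Dom C (Y' \<beta>) = Dom C (yy (S \<beta>)) \<and> Cod C (Y' \<beta>) = Cod C g \<and>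
          Inv \<beta> (Y' \<beta> \<cdot> jj (S \<beta>)) \<and> Y' \<beta> \<cdot> tt (S \<beta>) = K \<beta> (Y' \<beta> \<cdot> jj (S \<beta>)) \<and> y \<cdot> ii (S \<gamma>) \<beta> = Y' \<beta>) \<Longrightarrow>
       Inv \<gamma> y"
  obtains Y Y' where
    "\<And>\<gamma>. \<gamma> \<in> I' \<Longrightarrow> Y \<gamma> \<in> Arr C \<and> Dom C (Y \<gamma>) = Dom C (xx (S \<gamma>)) \<and> Cod C (Y \<gamma>) = Cod C g \<and>
       Y \<gamma> \<cdot> zz (S \<gamma>) = g \<and> Inv \<gamma> (Y \<gamma>)"
    "\<And>\<beta> \<gamma>. \<gamma> \<in> I' \<Longrightarrow> \<beta> \<lless> \<gamma> \<Longrightarrow> Y \<gamma> \<cdot> ii (S \<gamma>) \<beta> = Y' \<beta>"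
    "\<And>\<gamma>. \<gamma> \<in> I' \<Longrightarrow> Y' \<gamma> \<in> Arr C \<and> Dom C (Y' \<gamma>) = Dom C (yy (S \<gamma>)) \<and> Cod C (Y' \<gamma>) = Cod C g \<and>
       Y' \<gamma> \<cdot> jj (S \<gamma>) = Y \<gamma> \<and> Y' \<gamma> \<cdot> tt (S \<gamma>) = K \<gamma> (Y \<gamma>)"
    "\<And>\<gamma>. underS \<kappa> \<gamma> \<subseteq> I' \<Longrightarrow> stage_cocone f0 S \<gamma> g Y'"
proof -
  let ?P = "\<lambda>Z \<gamma> (y, y'). \<gamma> \<in> I' \<longrightarrow>
     (y \<in> Arr C \<and> Dom C y = Dom C (xx (S \<gamma>)) \<and> Cod C y = Cod C g \<and> y \<cdot> zz (S \<gamma>) = g \<and> Inv \<gamma> y) \<and>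
     (\<forall>\<beta>. \<beta> \<lless> \<gamma> \<longrightarrow> y \<cdot> ii (S \<gamma>) \<beta> = snd (Z \<beta>)) \<and>
     y' \<in> Arr C \<and> Dom C y' = Dom C (yy (S \<gamma>)) \<and> Cod C y' = Cod C g \<and> y' \<cdot> jj (S \<gamma>) = y \<and> y' \<cdot> tt (S \<gamma>) = K \<gamma> y"
  \<comment> \<open>Stated for any partial choice \<open>Z\<close> below \<gamma>, so that it serves
    inside the recursion and again for the cocone in the conclusion.\<close>
  have cocone: "stage_cocone f0 S \<gamma> g (\<lambda>\<beta>. snd (Z \<beta>))"
    if Z: "\<And>\<beta>. \<beta> \<lless> \<gamma> \<Longrightarrow> \<beta> \<in> I' \<and> ?P Z \<beta> (Z \<beta>)" for Z \<gamma>
    unfolding stage_cocone_def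
  proof (intro conjI allI impI)
    fix \<beta> assume \<beta>: "\<beta> \<lless> \<gamma>"
    then have \<beta>I: "\<beta> \<in> I'" using Z by blast
    note D = complexD[OF cx \<beta>I]
    have z: "snd (Z \<beta>) \<in> Arr C" "Dom C (snd (Z \<beta>)) = Dom C (yy (S \<beta>))" "Cod C (snd (Z \<beta>)) = Cod C g"
      "snd (Z \<beta>) \<cdot> jj (S \<beta>) = fst (Z \<beta>)" "fst (Z \<beta>) \<cdot> zz (S \<beta>) = g"
      using Z[OF \<beta>] by (simp_all add: case_prod_beta)
    then show "snd (Z \<beta>) \<in> Arr C" "Dom C (snd (Z \<beta>)) = Dom C (yy (S \<beta>))" "Cod C (snd (Z \<beta>)) = Cod C g"
      by auto
    show "snd (Z \<beta>) \<cdot> jj (S \<beta>) \<cdot> zz (S \<beta>) = g"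
      using comp_eq_assoc[OF z(4), of "zz (S \<beta>)"] z D by simp
  next
    fix \<beta> \<delta> assume \<beta>: "\<beta> \<lless> \<delta>" and \<delta>: "\<delta> \<lless> \<gamma>"
    then have \<delta>I: "\<delta> \<in> I'" using Z by blast
    note D = complexD[OF cx \<delta>I] and W = complex_step[OF cx \<delta>I \<beta>]
    have "snd (Z \<delta>) \<in> Arr C" "Dom C (snd (Z \<delta>)) = Dom C (yy (S \<delta>))"
      "snd (Z \<delta>) \<cdot> jj (S \<delta>) = fst (Z \<delta>)" "fst (Z \<delta>) \<cdot> ii (S \<delta>) \<beta> = snd (Z \<beta>)"
      using Z[OF \<delta>] \<beta> by (simp_all add: case_prod_beta)
    then show "snd (Z \<delta>) \<cdot> jj (S \<delta>) \<cdot> ii (S \<delta>) \<beta> = snd (Z \<beta>)"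
      using comp_eq_assoc[of "snd (Z \<delta>)" "jj (S \<delta>)" "fst (Z \<delta>)" "ii (S \<delta>) \<beta>"] D W by simp
  qed (use g in simp_all)
  have "\<exists>Z. \<forall>\<gamma>. ?P Z \<gamma> (Z \<gamma>)"
  proof (rule dependent_wf_choice[OF wf_lt])
    fix Z Z' :: "'k \<Rightarrow> 'm \<times> 'm" and \<gamma> v assume "\<And>\<beta>. (\<beta>, \<gamma>) \<in> {(\<beta>, \<gamma>). \<beta> \<lless> \<gamma>} \<Longrightarrow> Z \<beta> = Z' \<beta>"
    then have "\<And>\<beta>. \<beta> \<lless> \<gamma> \<Longrightarrow> Z \<beta> = Z' \<beta>" by simp
    then show "?P Z \<gamma> v = ?P Z' \<gamma> v" by auto
  next
    fix \<gamma> and Z :: "'k \<Rightarrow> 'm \<times> 'm"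
    assume H: "\<And>\<beta>. (\<beta>, \<gamma>) \<in> {(\<beta>, \<gamma>). \<beta> \<lless> \<gamma>} \<Longrightarrow> ?P Z \<beta> (Z \<beta>)"
    show "\<exists>v. ?P Z \<gamma> v"
    proof (cases "\<gamma> \<in> I'")
      case True
      have Z: "\<And>\<beta>. \<beta> \<lless> \<gamma> \<Longrightarrow> \<beta> \<in> I' \<and> ?P Z \<beta> (Z \<beta>)" using H down[OF True] by simp
      note D = complexD[OF cx True]
      obtain y where y: "y \<in> Arr C" "Dom C y = Dom C (xx (S \<gamma>))" "Cod C y = Cod C g" "y \<cdot> zz (S \<gamma>) = g"
        "\<And>\<beta>. \<beta> \<lless> \<gamma> \<Longrightarrow> y \<cdot> ii (S \<gamma>) \<beta> = snd (Z \<beta>)"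
        by (rule stage_colimit_out[OF D(2) cocone[of \<gamma> Z, OF Z]]) (assumption, rule that)
      have "Inv \<gamma> y"
        by (rule Inv[OF True y(1-4), of "\<lambda>\<beta>. snd (Z \<beta>)"]) (use Z y(5) in \<open>simp_all add: case_prod_beta\<close>)
      note KK = K[OF True y(1-4) this]
      \<comment> \<open>An earlier cell received the value of \<open>K \<beta>\<close> at the
        restriction of \<open>y\<close>, so the compatibility of \<open>K\<close> becomes agreement
        with \<open>y\<close> on that cell.\<close>
      have "K \<gamma> y \<cdot> lower (cell_sq S \<beta> \<gamma> (S \<gamma>)) = y \<cdot> (ii (S \<gamma>) \<beta> \<cdot> tt (S \<beta>))" if \<beta>: "\<beta> \<lless> \<gamma>" for \<beta>
      proof -
        have \<beta>I: "\<beta> \<in> I'" using down True \<beta> by blast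
        note B = complexD[OF cx \<beta>I] and W = complex_step[OF cx True \<beta>]
        have z: "snd (Z \<beta>) \<in> Arr C" "Dom C (snd (Z \<beta>)) = Dom C (yy (S \<beta>))" "snd (Z \<beta>) \<cdot> tt (S \<beta>) = K \<beta> (fst (Z \<beta>))"
           "snd (Z \<beta>) \<cdot> jj (S \<beta>) = fst (Z \<beta>)"
          using Z[OF \<beta>] by (simp_all add: case_prod_beta)
        have "y \<cdot> ii (S \<gamma>) \<beta> \<cdot> jj (S \<beta>) = fst (Z \<beta>)"
          using comp_eq_assoc[OF y(5)[OF \<beta>], of "jj (S \<beta>)"] y B W z by simp
        moreover have "y \<cdot> ii (S \<gamma>) \<beta> \<cdot> tt (S \<beta>) = K \<beta> (fst (Z \<beta>))"
          using comp_eq_assoc[OF y(5)[OF \<beta>], of "tt (S \<beta>)"] y B W z by simp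
        ultimately show ?thesis using KK \<beta> by simp
      qed
      then have "\<exists>y'\<in>Arr C. Dom C y' = Dom C (yy (S \<gamma>)) \<and> Cod C y' = Cod C y \<and> y' \<cdot> jj (S \<gamma>) = y \<and> y' \<cdot> tt (S \<gamma>) = K \<gamma> y"
        using stage_cell_out[OF D(3), of y "K \<gamma> y"] y(1-3) KK by auto
      then obtain y' where "y' \<in> Arr C" "Dom C y' = Dom C (yy (S \<gamma>))" "Cod C y' = Cod C y" "y' \<cdot> jj (S \<gamma>) = y" "y' \<cdot> tt (S \<gamma>) = K \<gamma> y"
        by blast
      then show ?thesis using y \<open>Inv \<gamma> y\<close> by (intro exI[of _ "(y, y')"]) simp
    qed simp
  qed
  then obtain Z where Z: "\<And>\<gamma>. ?P Z \<gamma> (Z \<gamma>)" by blast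
  show thesis
  proof (rule that[of "fst \<circ> Z" "snd \<circ> Z"])
    fix \<gamma> assume "underS \<kappa> \<gamma> \<subseteq> I'"
    then show "stage_cocone f0 S \<gamma> g (snd \<circ> Z)"
      using cocone[of \<gamma> Z] Z by (auto simp: o_def)
  qed (use Z in \<open>simp_all add: case_prod_beta\<close>)
qed

end

section \<open>Latching objects of chains whose gap maps lie in \<open>M\<close>\<close>

context backdrop
begin

text \<open>The condition reaches up to and including \<gamma> and restricts to every earlier index,
  which makes induction on \<gamma> possible. As in \<open>compatible\<close>, the pushouts tested
  are those whose side opposite to the cell lies in \<open>M\<close>.\<close>

definition gap_chain :: "('k \<Rightarrow> 'm) \<Rightarrow> ('k \<Rightarrow> 'k \<Rightarrow> ('m, 'm) sq) \<Rightarrow> 'k \<Rightarrow> bool" where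
  "gap_chain a s \<gamma> \<longleftrightarrow>
     (\<forall>\<beta>. \<beta> = \<gamma> \<or> \<beta> \<lless> \<gamma> \<longrightarrow> a \<beta> \<in> M) \<and>
     (\<forall>\<beta> \<delta>. \<delta> = \<gamma> \<or> \<delta> \<lless> \<gamma> \<longrightarrow> \<beta> \<lless> \<delta> \<longrightarrow>
        s \<beta> \<delta> \<in> squares C \<and> src (s \<beta> \<delta>) = a \<beta> \<and> tgt (s \<beta> \<delta>) = a \<delta> \<and>
        (\<forall>p q w. is_pushout C (a \<beta>) (upper (s \<beta> \<delta>)) p q \<longrightarrow> q \<in> M \<longrightarrow>
           w \<in> hom C (Cod C p) (Cod C (a \<delta>)) \<longrightarrow> w \<cdot> p = lower (s \<beta> \<delta>) \<longrightarrow> w \<cdot> q = a \<delta> \<longrightarrow> w \<in> M)) \<and>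
     (\<forall>\<beta> \<delta> \<epsilon>. \<epsilon> = \<gamma> \<or> \<epsilon> \<lless> \<gamma> \<longrightarrow> \<beta> \<lless> \<delta> \<longrightarrow> \<delta> \<lless> \<epsilon> \<longrightarrow>
        upper (s \<delta> \<epsilon>) \<cdot> upper (s \<beta> \<delta>) = upper (s \<beta> \<epsilon>) \<and> lower (s \<delta> \<epsilon>) \<cdot> lower (s \<beta> \<delta>) = lower (s \<beta> \<epsilon>))"

text \<open>The latching object at \<open>\<gamma>\<close> is itself a complex, over \<open>Cod a\<^sub>\<gamma>\<close>: the cells \<open>a\<^sub>\<beta>\<close> with \<open>\<beta> < \<gamma>\<close>
  are attached to \<open>Dom a\<^sub>\<gamma>\<close> in turn. In effect this makes the partial pushout \<open>X'\<^sub>\<beta>\<close> a cobase change of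
  \<open>a\<^sub>\<beta>\<close> for which the opposite side lies in \<open>M\<close>, and the gap condition applies to it.\<close>

lemma latch_exists:
  assumes "\<gamma> \<in> Field \<kappa>" "gap_chain a s \<gamma>"
  shows "\<exists>q0 q m. latch a s \<gamma> q0 q m"
  using assms
proof (induction \<gamma> rule: lt_induct)
  case (less \<gamma>)
  note gc = less.prems(2)[unfolded gap_chain_def]
  note gcM = conjunct1[OF gc, rule_format] and gcs = conjunct1[OF conjunct2[OF gc], rule_format]
    and gcc = conjunct2[OF conjunct2[OF gc], rule_format]
  have aM: "\<And>\<beta>. \<beta> = \<gamma> \<or> \<beta> \<lless> \<gamma> \<Longrightarrow> a \<beta> \<in> M" using gcM .
  have sq: "\<And>\<beta> \<delta>. \<delta> = \<gamma> \<or> \<delta> \<lless> \<gamma> \<Longrightarrow> \<beta> \<lless> \<delta> \<Longrightarrow> s \<beta> \<delta> \<in> squares C \<and> src (s \<beta> \<delta>) = a \<beta> \<and> tgt (s \<beta> \<delta>) = a \<delta>"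
    using gcs by simp
  have su: "upper (s \<beta> \<delta>) \<in> Arr C" "lower (s \<beta> \<delta>) \<in> Arr C" "Dom C (upper (s \<beta> \<delta>)) = Dom C (a \<beta>)"
    "Cod C (upper (s \<beta> \<delta>)) = Dom C (a \<delta>)" "Dom C (lower (s \<beta> \<delta>)) = Cod C (a \<beta>)"
    "Cod C (lower (s \<beta> \<delta>)) = Cod C (a \<delta>)" "a \<delta> \<cdot> upper (s \<beta> \<delta>) = lower (s \<beta> \<delta>) \<cdot> a \<beta>"
    if "\<delta> = \<gamma> \<or> \<delta> \<lless> \<gamma>" "\<beta> \<lless> \<delta>" for \<beta> \<delta>
    using sq[OF that] squaresD[of "s \<beta> \<delta>"] by simp_all
  have sc: "upper (s \<delta> \<epsilon>) \<cdot> upper (s \<beta> \<delta>) = upper (s \<beta> \<epsilon>)" "lower (s \<delta> \<epsilon>) \<cdot> lower (s \<beta> \<delta>) = lower (s \<beta> \<epsilon>)"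
    if "\<epsilon> = \<gamma> \<or> \<epsilon> \<lless> \<gamma>" "\<beta> \<lless> \<delta>" "\<delta> \<lless> \<epsilon>" for \<beta> \<delta> \<epsilon>
    using gcc[OF that] by simp_all
  have gap: "w \<in> M" if "\<beta> \<lless> \<gamma>" "is_pushout C (a \<beta>) (upper (s \<beta> \<gamma>)) p q" "q \<in> M" "w \<in> Arr C"
    "Dom C w = Cod C p" "Cod C w = Cod C (a \<gamma>)" "w \<cdot> p = lower (s \<beta> \<gamma>)" "w \<cdot> q = a \<gamma>" for \<beta> p q w
  proof -
    have "w \<in> hom C (Cod C p) (Cod C (a \<gamma>))" using that by (simp add: hom_def)
    then show ?thesis using gcs[OF _ that(1)] that(2-) by blast
  qed
  have IH: "\<exists>q0 q m. latch a s \<beta> q0 q m" if "\<beta> \<lless> \<gamma>" for \<beta>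
  proof (rule less.IH[OF that])
    show "\<beta> \<in> Field \<kappa>" using lt_field that by blast
    have *: "\<And>\<delta>. \<delta> = \<beta> \<or> \<delta> \<lless> \<beta> \<Longrightarrow> \<delta> \<lless> \<gamma>" using that lt_trans by blast
    show "gap_chain a s \<beta>"
      unfolding gap_chain_def
    proof (rule conjI[OF _ conjI], goal_cases)
      case 1
      show ?case using gcM * by simp
    next
      case 2
      show ?case by (intro allI impI, rule gcs) (use * in auto)
    next
      case 3
      show ?case by (intro allI impI, rule gcc) (use * in auto)
    qed
  qed
  \<comment> \<open>The cell a_\<beta> is attached along Dom a_\<beta> -> Dom a_\<gamma> ->
    X_\<beta>, in a complex that starts from \<open>a \<gamma>\<close>; neither the cell nor its map
    to the base depends on the stage. The latching objects required below \<gamma> come from the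
    induction hypothesis.\<close>
  interpret K: cells C \<kappa> M "a \<gamma>" "\<lambda>\<beta> x. a \<beta>" "\<lambda>\<beta> \<delta> x x' h. s \<beta> \<delta>" "\<lambda>\<beta> z x. z \<cdot> upper (s \<beta> \<gamma>)"
    "\<lambda>\<beta> x. lower (s \<beta> \<gamma>)" "underS \<kappa> \<gamma>"
  proof (unfold_locales, goal_cases)
    case (5 \<delta> \<beta> x' h x)
    then show ?case using su[of \<gamma> \<delta>] comp_eq_assoc[of x' h x] by (simp add: sq)
  next
    case (6 \<delta> x z)
    then show ?case using su[of \<gamma> \<delta>] comp_eq_assoc[of x z "a \<gamma>" "upper (s \<delta> \<gamma>)"] by simp
  next
    case (7 \<delta> \<beta> x' h x z z')
    have b: "\<beta> \<lless> \<gamma>" using 7 lt_trans by blast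
    show ?case using 7 su[OF _ 7(1)] su[OF _ b] su[OF disjI2[OF 7(1)] 7(2)] sc(1)[OF _ 7(2,1)]
        comp_eq_assoc[of h z z' "upper (s \<beta> \<gamma>)"] by auto
  next
    case (9 \<delta> \<beta> x' h x)
    then show ?case using sc by blast
  next
    case 1
    show ?case using aM by simp
  next
    case 2
    show ?case using lt_field(1) by blast
  next
    case (3 \<delta> \<beta>)
    then show ?case using lt_trans by blast
  next
    case (4 \<delta> x)
    then show ?case using aM by simp
  next
    case (8 \<delta> x)
    then show ?case using su[of \<gamma> \<delta>] by simp
  next
    case (10 \<delta> X H)
    then show ?case using IH by simp
  qed
  have cell_sq_eq: "K.cell_sq S \<beta> \<delta> v = s \<beta> \<delta>" for S \<beta> \<delta> v
    by (simp add: K.cell_sq_def)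
  obtain S where S: "K.complex (underS \<kappa> \<gamma>) S"
    using K.complex_exists by blast
  note D = K.complexD[OF S] and W = K.complex_step[OF S, unfolded cell_sq_eq]
  obtain v where v: "stage_colimit (a \<gamma>) S \<gamma> v"
    using stage_colimit_exists[OF less.prems(1), of "a \<gamma>" S] aM D(2,4) by auto
  note v' = stage_colimitD[OF v]
  \<comment> \<open>X'_\<beta> is the pushout of a_\<beta> along Dom a_\<beta> -> Dom a_\<gamma>:
    every cell attached before \<beta> factors through the cell at \<beta>, so the earlier
    attachments leave no trace. Hence \<open>yy (S \<beta>)\<close> is the gap map of the square
    from \<beta> to \<gamma>.\<close>
  have yyM: "yy (S \<beta>) \<in> M" if \<beta>: "\<beta> \<lless> \<gamma>" for \<beta>
  proof -
    note B = D[OF \<beta>]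
    have \<beta>s: "\<And>\<delta>. \<delta> \<lless> \<beta> \<Longrightarrow> \<delta> \<lless> \<gamma>" using \<beta> lt_trans by blast
    have "is_pushout C (a \<beta>) (upper (s \<beta> \<gamma>)) (tt (S \<beta>)) (jj (S \<beta>) \<cdot> zz (S \<beta>))"
      unfolding is_pushout_def
    proof (intro conjI allI impI ex_ex1I)
      show "tt (S \<beta>) \<cdot> a \<beta> = (jj (S \<beta>) \<cdot> zz (S \<beta>)) \<cdot> upper (s \<beta> \<gamma>)"
        using B su \<beta> by simp
    next
      fix p' q'
      assume pq: "p' \<in> Arr C \<and> q' \<in> Arr C \<and> Dom C p' = Cod C (a \<beta>) \<and>
        Dom C q' = Cod C (upper (s \<beta> \<gamma>)) \<and> Cod C p' = Cod C q' \<and> p' \<cdot> a \<beta> = q' \<cdot> upper (s \<beta> \<gamma>)"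
      let ?I = "insert \<beta> (underS \<kappa> \<beta>)"
      have cx: "K.complex ?I S" using S \<beta> \<beta>s by (auto simp: K.complex_def)
      have q': "q' \<in> Arr C" "Dom C q' = Dom C (a \<gamma>)" using pq su \<beta> by auto
      \<comment> \<open>A map \<open>p'\<close> on the cell at \<beta> forces the values on all
        earlier cells.\<close>
      let ?K = "\<lambda>\<delta> y. if \<delta> = \<beta> then p' else p' \<cdot> lower (s \<delta> \<beta>)"
      have K: "?K \<delta> y \<in> Arr C \<and> Dom C (?K \<delta> y) = Cod C (a \<delta>) \<and> Cod C (?K \<delta> y) = Cod C q' \<and>
         ?K \<delta> y \<cdot> a \<delta> = y \<cdot> (zz (S \<delta>) \<cdot> upper (s \<delta> \<gamma>)) \<and>
         (\<forall>\<epsilon>. \<epsilon> \<lless> \<delta> \<longrightarrow> ?K \<delta> y \<cdot> lower (K.cell_sq S \<epsilon> \<delta> (S \<delta>)) = ?K \<epsilon> (y \<cdot> (ii (S \<delta>) \<epsilon> \<cdot> jj (S \<epsilon>))))"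
        if \<delta>: "\<delta> \<in> ?I" and y: "y \<in> Arr C" "Dom C y = Dom C (xx (S \<delta>))" "Cod C y = Cod C q'" "y \<cdot> zz (S \<delta>) = q'"
        for \<delta> y
      proof (cases "\<delta> = \<beta>")
        case True
        have "p' \<cdot> a \<beta> = y \<cdot> zz (S \<beta>) \<cdot> upper (s \<beta> \<gamma>)"
          using comp_eq_assoc[OF y(4), of "upper (s \<beta> \<gamma>)"] pq y B su \<beta> True by simp
        moreover have "\<And>\<epsilon>. \<epsilon> \<lless> \<beta> \<Longrightarrow> \<epsilon> \<noteq> \<beta>" by auto
        ultimately show ?thesis using True pq by (simp add: cell_sq_eq)
      next
        case False
        then have d: "\<delta> \<lless> \<beta>" "\<delta> \<lless> \<gamma>" using \<delta> \<beta>s by auto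
        note B' = D[OF d(2)]
        have "(p' \<cdot> lower (s \<delta> \<beta>)) \<cdot> a \<delta> = p' \<cdot> a \<beta> \<cdot> upper (s \<delta> \<beta>)"
          using pq su[OF disjI2[OF \<beta>] d(1)] B B' by simp
        also have "\<dots> = q' \<cdot> upper (s \<beta> \<gamma>) \<cdot> upper (s \<delta> \<beta>)"
          using pq su[OF disjI2[OF \<beta>] d(1)] su[of \<gamma> \<beta>] \<beta> B B' comp_eq_assoc[of p' "a \<beta>" "q' \<cdot> upper (s \<beta> \<gamma>)" "upper (s \<delta> \<beta>)"] by simp
        also have "\<dots> = y \<cdot> zz (S \<delta>) \<cdot> upper (s \<delta> \<gamma>)"
          using comp_eq_assoc[OF y(4), of "upper (s \<delta> \<gamma>)"] sc(1)[of \<gamma>, OF _ d(1) \<beta>] y B' su[of \<gamma>, OF _ d(2)] by simp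
        finally have "(p' \<cdot> lower (s \<delta> \<beta>)) \<cdot> a \<delta> = y \<cdot> zz (S \<delta>) \<cdot> upper (s \<delta> \<gamma>)" .
        moreover have "(p' \<cdot> lower (s \<delta> \<beta>)) \<cdot> lower (s \<epsilon> \<delta>) = p' \<cdot> lower (s \<epsilon> \<beta>) \<and> \<epsilon> \<noteq> \<beta>" if "\<epsilon> \<lless> \<delta>" for \<epsilon>
          using sc(2)[OF disjI2[OF \<beta>] that d(1)] su[OF disjI2[OF \<beta>] d(1)] su[OF disjI2[OF d(2)] that] pq lt_trans[OF that d(1)]
          by auto
        ultimately show ?thesis using False pq su[OF disjI2[OF \<beta>] d(1)] by (simp add: cell_sq_eq)
      qed
      obtain Y Y' where Y: "Y \<beta> \<cdot> zz (S \<beta>) = q'"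
        "Y' \<beta> \<in> Arr C" "Dom C (Y' \<beta>) = Dom C (yy (S \<beta>))" "Cod C (Y' \<beta>) = Cod C q'" "Y' \<beta> \<cdot> jj (S \<beta>) = Y \<beta>"
        "Y' \<beta> \<cdot> tt (S \<beta>) = p'"
      proof (rule K.complex_out[where Inv = "\<lambda>_ _. True", OF cx _ q' K])
        fix Y Y' assume "\<And>\<delta>. \<delta> \<in> ?I \<Longrightarrow> Y \<delta> \<in> Arr C \<and> Dom C (Y \<delta>) = Dom C (xx (S \<delta>)) \<and> Cod C (Y \<delta>) = Cod C q' \<and>
          Y \<delta> \<cdot> zz (S \<delta>) = q' \<and> True"
          "\<And>\<delta>. \<delta> \<in> ?I \<Longrightarrow> Y' \<delta> \<in> Arr C \<and> Dom C (Y' \<delta>) = Dom C (yy (S \<delta>)) \<and> Cod C (Y' \<delta>) = Cod C q' \<and>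
          Y' \<delta> \<cdot> jj (S \<delta>) = Y \<delta> \<and> Y' \<delta> \<cdot> tt (S \<delta>) = (if \<delta> = \<beta> then p' else p' \<cdot> lower (s \<delta> \<beta>))"
        from this[of \<beta>] show thesis using that[of Y Y'] by simp
      qed (auto intro: lt_trans)
      show "\<exists>m. m \<in> hom C (Cod C (tt (S \<beta>))) (Cod C p') \<and> m \<cdot> tt (S \<beta>) = p' \<and> m \<cdot> jj (S \<beta>) \<cdot> zz (S \<beta>) = q'"
        using Y B pq comp_eq_assoc[OF Y(5), of "zz (S \<beta>)"] by (intro exI[of _ "Y' \<beta>"]) (simp add: hom_def)
      fix m m' assume m: "m \<in> hom C (Cod C (tt (S \<beta>))) (Cod C p') \<and> m \<cdot> tt (S \<beta>) = p' \<and> m \<cdot> jj (S \<beta>) \<cdot> zz (S \<beta>) = q'"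
         and m': "m' \<in> hom C (Cod C (tt (S \<beta>))) (Cod C p') \<and> m' \<cdot> tt (S \<beta>) = p' \<and> m' \<cdot> jj (S \<beta>) \<cdot> zz (S \<beta>) = q'"
      \<comment> \<open>On an earlier cell both maps take the value that \<open>p'\<close> forces,
        so they agree on X_\<beta>; on the cell at \<beta> both are \<open>p'\<close>.\<close>
      have "m \<cdot> jj (S \<beta>) = m' \<cdot> jj (S \<beta>)"
      proof (rule K.stage_unique[OF S _ B(2)])
        show "underS \<kappa> \<beta> \<subseteq> underS \<kappa> \<gamma>" using \<beta>s by blast
        show "(m \<cdot> jj (S \<beta>)) \<cdot> zz (S \<beta>) = (m' \<cdot> jj (S \<beta>)) \<cdot> zz (S \<beta>)"
          using m m' B by (simp add: hom_def)
        fix \<delta> assume d: "\<delta> \<lless> \<beta>"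
        note B' = D[OF \<beta>s[OF d]] and W' = W[OF \<beta> d]
        have "n \<cdot> jj (S \<beta>) \<cdot> ii (S \<beta>) \<delta> \<cdot> tt (S \<delta>) = p' \<cdot> lower (s \<delta> \<beta>)"
          if n: "n \<in> hom C (Cod C (tt (S \<beta>))) (Cod C p') \<and> n \<cdot> tt (S \<beta>) = p'" for n
          using comp_eq_assoc[of n "tt (S \<beta>)" p' "lower (s \<delta> \<beta>)"] n W'(6) B su[OF disjI2[OF \<beta>] d] by (simp add: hom_def)
        then show "(m \<cdot> jj (S \<beta>)) \<cdot> ii (S \<beta>) \<delta> \<cdot> tt (S \<delta>) = (m' \<cdot> jj (S \<beta>)) \<cdot> ii (S \<beta>) \<delta> \<cdot> tt (S \<delta>)"
          using m m' B B' W'(1-3) by (simp add: hom_def)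
      qed (use m m' B in \<open>simp_all add: hom_def\<close>)
      then show "m = m'"
        by - (rule K.stage_cell_unique[OF B(3)], use m m' B in \<open>simp_all add: hom_def\<close>)
    qed (use B su \<beta> in simp_all)
    then show ?thesis
    proof (rule gap[OF \<beta>])
      show "yy (S \<beta>) \<cdot> jj (S \<beta>) \<cdot> zz (S \<beta>) = a \<gamma>"
        using comp_eq_assoc[OF B(16), of "zz (S \<beta>)"] B by simp
    qed (use B in simp_all)
  qed
  \<comment> \<open>The arrows \<open>a \<gamma>\<close> and \<open>yy (S \<beta>)\<close> form a
    cocone in \<open>M\<close>, and its mediating arrow is \<open>xx v\<close>. This is where the
    chain colimit has to be one in \<open>M\<close> too.\<close>
  have "xx v \<in> M"
  proof -
    have "stage_cocone (a \<gamma>) S \<gamma> (a \<gamma>) (\<lambda>\<beta>. yy (S \<beta>))"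
      unfolding stage_cocone_def
    proof (intro conjI allI impI)
      fix \<beta> assume \<beta>: "\<beta> \<lless> \<gamma>"
      show "yy (S \<beta>) \<cdot> jj (S \<beta>) \<cdot> zz (S \<beta>) = a \<gamma>"
        using comp_eq_assoc[OF D(16)[OF \<beta>], of "zz (S \<beta>)"] D[OF \<beta>] by simp
    next
      fix \<beta> \<delta> assume \<beta>: "\<beta> \<lless> \<delta>" and \<delta>: "\<delta> \<lless> \<gamma>"
      show "yy (S \<delta>) \<cdot> jj (S \<delta>) \<cdot> ii (S \<delta>) \<beta> = yy (S \<beta>)"
        using comp_eq_assoc[OF D(16)[OF \<delta>], of "ii (S \<delta>) \<beta>"] D[OF \<delta>] W[OF \<delta> \<beta>] by simp
    qed (use D aM in auto)
    then obtain y where y: "y \<in> Arr C" "Dom C y = Dom C (xx v)" "Cod C y = Cod C (a \<gamma>)" "y \<cdot> zz v = a \<gamma>"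
      "\<And>\<beta>. \<beta> \<lless> \<gamma> \<Longrightarrow> y \<cdot> ii v \<beta> = yy (S \<beta>)" "y \<in> M"
      using stage_colimit_out[OF v, of "a \<gamma>" "\<lambda>\<beta>. yy (S \<beta>)"] yyM aM by metis
    have "y = xx v"
      by (rule stage_colimit_unique[OF v]) (use y v' in simp_all)
    then show ?thesis using y by simp
  qed
  \<comment> \<open>X_\<gamma>, with the cells attached below \<gamma> as legs, is the latching
    object.\<close>
  have "latch a s \<gamma> (zz v) (\<lambda>\<beta>. ii v \<beta> \<cdot> tt (S \<beta>)) (xx v)"
    unfolding latch_def
  proof (intro conjI allI impI ballI)
    show "latch_cocone a s \<gamma> (zz v) (\<lambda>\<beta>. ii v \<beta> \<cdot> tt (S \<beta>))"
      unfolding latch_cocone_def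
    proof (intro conjI allI impI)
      fix \<beta> assume \<beta>: "\<beta> \<lless> \<gamma>"
      note B = D[OF \<beta>] and W' = v'(7-11)[OF \<beta>]
      show "(ii v \<beta> \<cdot> tt (S \<beta>)) \<cdot> a \<beta> = zz v \<cdot> upper (s \<beta> \<gamma>)"
        using W'(5)[symmetric] W'(1-3) B su[of \<gamma>, OF _ \<beta>] by simp
    next
      fix \<beta> \<delta> assume \<beta>: "\<beta> \<lless> \<delta>" and \<delta>: "\<delta> \<lless> \<gamma>"
      then have b: "\<beta> \<lless> \<gamma>" using lt_trans by blast
      show "(ii v \<delta> \<cdot> tt (S \<delta>)) \<cdot> lower (s \<beta> \<delta>) = ii v \<beta> \<cdot> tt (S \<beta>)"
        using W(1-3,6)[OF \<delta> \<beta>] v'(7-9)[OF \<delta>] v'(12)[OF \<beta> \<delta>, symmetric] D[OF \<delta>] D[OF b] su[OF disjI2[OF \<delta>] \<beta>] by simp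
    qed (use v' D in auto)
  next
    fix \<beta> assume \<beta>: "\<beta> \<lless> \<gamma>"
    show "xx v \<cdot> ii v \<beta> \<cdot> tt (S \<beta>) = lower (s \<beta> \<gamma>)"
      using comp_eq_assoc[OF v'(10)[OF \<beta>], of "tt (S \<beta>)"] v' v'(7-9)[OF \<beta>] D[OF \<beta>] by simp
  next
    fix h k assume hk: "latch_cocone a s \<gamma> h k"
    then have h: "h \<in> Arr C" "Dom C h = Dom C (a \<gamma>)"
      and k: "\<And>\<beta>. \<beta> \<lless> \<gamma> \<Longrightarrow> k \<beta> \<in> Arr C \<and> Dom C (k \<beta>) = Cod C (a \<beta>) \<and> Cod C (k \<beta>) = Cod C h \<and>
        k \<beta> \<cdot> a \<beta> = h \<cdot> upper (s \<beta> \<gamma>)"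
      and kk: "\<And>\<beta> \<delta>. \<beta> \<lless> \<delta> \<Longrightarrow> \<delta> \<lless> \<gamma> \<Longrightarrow> k \<delta> \<cdot> lower (s \<beta> \<delta>) = k \<beta>"
      by (auto simp: latch_cocone_def)
    have K: "k \<delta> \<in> Arr C \<and> Dom C (k \<delta>) = Cod C (a \<delta>) \<and> Cod C (k \<delta>) = Cod C h \<and>
         k \<delta> \<cdot> a \<delta> = y \<cdot> (zz (S \<delta>) \<cdot> upper (s \<delta> \<gamma>)) \<and>
         (\<forall>\<epsilon>. \<epsilon> \<lless> \<delta> \<longrightarrow> k \<delta> \<cdot> lower (K.cell_sq S \<epsilon> \<delta> (S \<delta>)) = k \<epsilon>)"
      if \<delta>: "\<delta> \<lless> \<gamma>" and y: "y \<in> Arr C" "Dom C y = Dom C (xx (S \<delta>))" "Cod C y = Cod C h" "y \<cdot> zz (S \<delta>) = h"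
      for \<delta> y
      using comp_eq_assoc[OF y(4), of "upper (s \<delta> \<gamma>)"] k[OF \<delta>] kk[OF _ \<delta>] y D[OF \<delta>] su[of \<gamma>, OF _ \<delta>] by (simp add: cell_sq_eq)
    obtain Y Y' where Y:
      "\<And>\<beta>. \<beta> \<lless> \<gamma> \<Longrightarrow> Y' \<beta> \<in> Arr C \<and> Dom C (Y' \<beta>) = Dom C (yy (S \<beta>)) \<and> Cod C (Y' \<beta>) = Cod C h \<and>
       Y' \<beta> \<cdot> jj (S \<beta>) = Y \<beta> \<and> Y' \<beta> \<cdot> tt (S \<beta>) = k \<beta>"
      "stage_cocone (a \<gamma>) S \<gamma> h Y'"
    proof (rule K.complex_out[where Inv = "\<lambda>_ _. True", OF S _ h K])
      fix Y Y' assume "\<And>\<delta>. \<delta> \<lless> \<gamma> \<Longrightarrow> Y' \<delta> \<in> Arr C \<and> Dom C (Y' \<delta>) = Dom C (yy (S \<delta>)) \<and> Cod C (Y' \<delta>) = Cod C h \<and>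
          Y' \<delta> \<cdot> jj (S \<delta>) = Y \<delta> \<and> Y' \<delta> \<cdot> tt (S \<delta>) = k \<delta>"
        "\<And>\<delta>. underS \<kappa> \<delta> \<subseteq> underS \<kappa> \<gamma> \<Longrightarrow> stage_cocone (a \<gamma>) S \<delta> h Y'"
      then show thesis using that[of Y' Y] by blast
    qed (auto intro: lt_trans)
    obtain y where y: "y \<in> Arr C" "Dom C y = Dom C (xx v)" "Cod C y = Cod C h" "y \<cdot> zz v = h"
      "\<And>\<beta>. \<beta> \<lless> \<gamma> \<Longrightarrow> y \<cdot> ii v \<beta> = Y' \<beta>"
      using stage_colimit_out[OF v Y(2)] by metis
    have "y \<cdot> ii v \<beta> \<cdot> tt (S \<beta>) = k \<beta>" if \<beta>: "\<beta> \<lless> \<gamma>" for \<beta>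
      using comp_eq_assoc[OF y(5)[OF \<beta>], of "tt (S \<beta>)"] y v' v'(7-9)[OF \<beta>] D[OF \<beta>] Y(1)[OF \<beta>] by simp
    then show "\<exists>y \<in> Arr C. Dom C y = Dom C (xx v) \<and> Cod C y = Cod C h \<and> y \<cdot> zz v = h \<and>
      (\<forall>\<beta>. \<beta> \<lless> \<gamma> \<longrightarrow> y \<cdot> ii v \<beta> \<cdot> tt (S \<beta>) = k \<beta>)"
      using y by blast
  next
    fix y y' assume "y \<in> Arr C" "y' \<in> Arr C" "Dom C y = Dom C (xx v)" "Dom C y' = Dom C (xx v)"
      "Cod C y = Cod C y'" "y \<cdot> zz v = y' \<cdot> zz v" "\<forall>\<beta>. \<beta> \<lless> \<gamma> \<longrightarrow> y \<cdot> ii v \<beta> \<cdot> tt (S \<beta>) = y' \<cdot> ii v \<beta> \<cdot> tt (S \<beta>)"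
    then show "y = y'" using K.stage_unique[OF S subset_refl v] by blast
  qed (use v' \<open>xx v \<in> M\<close> in simp_all)
  then show ?case by blast
qed

end

section \<open>Smallness\<close>

lemma set_cat_sel [simp]:
  "Obj set_cat = UNIV" "Dom set_cat x = fst x" "Cod set_cat x = fst (snd x)"
  "(Y, Z, g) \<cdot>\<^bsub>set_cat\<^esub> (X, Y', f) = (X, Z, compose X g f)"
  by (simp_all add: set_cat_def)

lemma set_cat_hom: "(X', Y', f) \<in> hom set_cat X Y \<longleftrightarrow> X' = X \<and> Y' = Y \<and> f \<in> X \<rightarrow>\<^sub>E Y"
  by (auto simp: hom_def set_cat_def)

lemma hom_functor_sel [simp]:
  "omap (hom_functor C A) X = hom C A X"
  "amap (hom_functor C A) h = (hom C A (Dom C h), hom C A (Cod C h), \<lambda>f \<in> hom C A (Dom C h). h \<cdot>\<^bsub>C\<^esub> f)"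
  by (simp_all add: hom_functor_def)

context backdrop
begin

lemma chain_functorD:
  assumes "is_functor (poset_cat \<kappa>) (subcat C M) F"
  shows "\<gamma> \<in> Field \<kappa> \<Longrightarrow> omap F \<gamma> \<in> Obj C"
    "(\<beta>, \<gamma>) \<in> \<kappa> \<Longrightarrow> amap F (\<beta>, \<gamma>) \<in> M" "(\<beta>, \<gamma>) \<in> \<kappa> \<Longrightarrow> Dom C (amap F (\<beta>, \<gamma>)) = omap F \<beta>"
    "(\<beta>, \<gamma>) \<in> \<kappa> \<Longrightarrow> Cod C (amap F (\<beta>, \<gamma>)) = omap F \<gamma>"
    "\<gamma> \<in> Field \<kappa> \<Longrightarrow> amap F (\<gamma>, \<gamma>) = Ide C (omap F \<gamma>)"
    "(\<beta>, \<gamma>) \<in> \<kappa> \<Longrightarrow> (\<gamma>, \<delta>) \<in> \<kappa> \<Longrightarrow> amap F (\<gamma>, \<delta>) \<cdot> amap F (\<beta>, \<gamma>) = amap F (\<beta>, \<delta>)"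
  using assms by (force simp: is_functor_def)+

lemma chain_coconeD:
  assumes "is_cocone (poset_cat \<kappa>) C F X \<iota>"
  shows "X \<in> Obj C"
    "\<gamma> \<in> Field \<kappa> \<Longrightarrow> \<iota> \<gamma> \<in> Arr C" "\<gamma> \<in> Field \<kappa> \<Longrightarrow> Dom C (\<iota> \<gamma>) = omap F \<gamma>" "\<gamma> \<in> Field \<kappa> \<Longrightarrow> Cod C (\<iota> \<gamma>) = X"
    "(\<beta>, \<gamma>) \<in> \<kappa> \<Longrightarrow> \<iota> \<gamma> \<cdot> amap F (\<beta>, \<gamma>) = \<iota> \<beta>"
  using assms by (force simp: is_cocone_def hom_def)+

lemma small_colimit:
  assumes "is_small \<kappa> C M A" "is_functor (poset_cat \<kappa>) (subcat C M) F" "is_colimit (poset_cat \<kappa>) C F X \<iota>"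
  shows "is_colimit (poset_cat \<kappa>) set_cat (fcomp (hom_functor C A) F) (hom C A X)
    (\<lambda>\<gamma>. amap (hom_functor C A) (\<iota> \<gamma>))"
proof -
  have "preserves_colimit (poset_cat \<kappa>) C set_cat (hom_functor C A) F"
    using assms(1,2) unfolding is_small_def by blast
  then show ?thesis
    using assms(3) unfolding preserves_colimit_def hom_functor_sel(1)[symmetric] by blast
qed

text \<open>The maps between hom-sets induced by the legs are jointly surjective: if
  \<open>p\<close> were missed, the constant map at \<open>c\<close> and the map that singles out
  \<open>p\<close> would agree on all legs.\<close>

lemma small_factor:
  assumes small: "is_small \<kappa> C M A" and F: "is_functor (poset_cat \<kappa>) (subcat C M) F"
    and col: "is_colimit (poset_cat \<kappa>) C F X \<iota>" and ne: "Field \<kappa> \<noteq> {}"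
    and p: "p \<in> Arr C" "Dom C p = A" "Cod C p = X"
  shows "\<exists>\<gamma> p'. \<gamma> \<in> Field \<kappa> \<and> p' \<in> Arr C \<and> Dom C p' = A \<and> Cod C p' = omap F \<gamma> \<and> \<iota> \<gamma> \<cdot> p' = p"
proof (cases "\<exists>c :: 'm. c \<noteq> p")
  \<comment> \<open>The test set is the type of arrows itself. If it has a single element, all
    arrows are equal and \<open>p\<close> is its own factor.\<close>
  case False
  then have one: "\<And>c c' :: 'm. c = c'" by metis
  obtain \<gamma> where \<gamma>: "\<gamma> \<in> Field \<kappa>" using ne by blast
  have o: "omap F \<gamma> \<in> Obj C" using chain_functorD(1)[OF F \<gamma>] .
  then have "Ide C (omap F \<gamma>) \<in> Arr C" "Cod C (Ide C (omap F \<gamma>)) = omap F \<gamma>" by simp_all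
  then have "Cod C p = omap F \<gamma>" using one[of "Ide C (omap F \<gamma>)" p] by simp
  then show ?thesis using \<gamma> p one by blast
next
  case True
  then obtain c where c: "c \<noteq> p" by blast
  show ?thesis
  proof (rule ccontr)
    assume no: "\<not> ?thesis"
    let ?m = "(hom C A X, UNIV :: 'm set, \<lambda>f \<in> hom C A X. c)"
    let ?n = "(hom C A X, UNIV :: 'm set, \<lambda>f \<in> hom C A X. if f = p then p else c)"
    have "?m = ?n"
    proof (rule colimit_unique[OF small_colimit[OF small F col]])
      show "?m \<in> hom set_cat (hom C A X) UNIV" "?n \<in> hom set_cat (hom C A X) UNIV"
        by (auto simp: set_cat_hom)
      fix \<gamma> assume "\<gamma> \<in> Obj (poset_cat \<kappa>)"
      then have \<gamma>: "\<gamma> \<in> Field \<kappa>" by simp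
      note i = chain_coconeD(2-4)[OF colimit_cocone[OF col] \<gamma>]
      have "\<iota> \<gamma> \<cdot> f \<noteq> p" if "f \<in> hom C A (Dom C (\<iota> \<gamma>))" for f
        using no that i \<gamma> by (auto simp: hom_def)
      then show "?m \<cdot>\<^bsub>set_cat\<^esub> amap (hom_functor C A) (\<iota> \<gamma>) = ?n \<cdot>\<^bsub>set_cat\<^esub> amap (hom_functor C A) (\<iota> \<gamma>)"
        by (auto simp: compose_def fun_eq_iff restrict_def)
    qed
    then have "(\<lambda>f \<in> hom C A X. c) p = (\<lambda>f \<in> hom C A X. if f = p then p else c) p"
      by (simp only: prod.inject)
    then show False using c p by (simp add: hom_def)
  qed
qed

text \<open>The property of eventually becoming equal to \<open>p\<close> is stable along the chain,
  so it defines a cocone of two-valued functions on the hom-sets; the distinct arrows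
  \<open>p\<close> and \<open>q\<close> serve as the two truth values.\<close>

lemma small_equal:
  assumes small: "is_small \<kappa> C M A" and F: "is_functor (poset_cat \<kappa>) (subcat C M) F"
    and col: "is_colimit (poset_cat \<kappa>) C F X \<iota>" and \<gamma>: "\<gamma> \<in> Field \<kappa>"
    and p: "p \<in> Arr C" "Dom C p = A" "Cod C p = omap F \<gamma>"
    and q: "q \<in> Arr C" "Dom C q = A" "Cod C q = omap F \<gamma>" and eq: "\<iota> \<gamma> \<cdot> p = \<iota> \<gamma> \<cdot> q"
  shows "\<exists>\<delta>. (\<gamma>, \<delta>) \<in> \<kappa> \<and> amap F (\<gamma>, \<delta>) \<cdot> p = amap F (\<gamma>, \<delta>) \<cdot> q"
proof (cases "p = q")
  case True
  then show ?thesis using k_refl[OF \<gamma>] by blast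
next
  case False
  note F' = chain_functorD[OF F] and i = chain_coconeD[OF colimit_cocone[OF col]]
  define P where "P = (\<lambda>\<beta> g. \<exists>\<delta>. (\<gamma>, \<delta>) \<in> \<kappa> \<and> (\<beta>, \<delta>) \<in> \<kappa> \<and> amap F (\<beta>, \<delta>) \<cdot> g = amap F (\<gamma>, \<delta>) \<cdot> p)"
  define \<upsilon> where "\<upsilon> = (\<lambda>\<beta>. (hom C A (omap F \<beta>), UNIV :: 'm set, \<lambda>g \<in> hom C A (omap F \<beta>). if P \<beta> g then p else q))"
  have step: "P \<epsilon> (amap F (\<beta>, \<epsilon>) \<cdot> g) \<longleftrightarrow> P \<beta> g"
    if be: "(\<beta>, \<epsilon>) \<in> \<kappa>" and g: "g \<in> Arr C" "Cod C g = omap F \<beta>" for \<beta> \<epsilon> g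
  proof
    assume "P \<epsilon> (amap F (\<beta>, \<epsilon>) \<cdot> g)"
    then obtain \<delta> where d: "(\<gamma>, \<delta>) \<in> \<kappa>" "(\<epsilon>, \<delta>) \<in> \<kappa>" "amap F (\<epsilon>, \<delta>) \<cdot> amap F (\<beta>, \<epsilon>) \<cdot> g = amap F (\<gamma>, \<delta>) \<cdot> p"
      by (auto simp: P_def)
    then have "amap F (\<beta>, \<delta>) \<cdot> g = amap F (\<gamma>, \<delta>) \<cdot> p"
      using comp_eq_assoc[OF F'(6)[OF be d(2)], of g] F'(2-4)[OF be] F'(2-4)[OF d(2)] g by simp
    then show "P \<beta> g" using d be k_trans unfolding P_def by blast
  next
    assume "P \<beta> g"
    then obtain \<delta> where d: "(\<gamma>, \<delta>) \<in> \<kappa>" "(\<beta>, \<delta>) \<in> \<kappa>" "amap F (\<beta>, \<delta>) \<cdot> g = amap F (\<gamma>, \<delta>) \<cdot> p"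
      by (auto simp: P_def)
    have "\<epsilon> \<in> Field \<kappa>" "\<delta> \<in> Field \<kappa>" using be d by (auto simp: Field_def)
    \<comment> \<open>Compare at a common upper bound of the two indices, which exists because the
      order is total.\<close>
    then obtain \<zeta> where z: "(\<delta>, \<zeta>) \<in> \<kappa>" "(\<epsilon>, \<zeta>) \<in> \<kappa>" using k_total k_refl by blast
    have "amap F (\<epsilon>, \<zeta>) \<cdot> amap F (\<beta>, \<epsilon>) \<cdot> g = amap F (\<beta>, \<zeta>) \<cdot> g"
      using comp_eq_assoc[OF F'(6)[OF be z(2)], of g] F'(2-4)[OF be] F'(2-4)[OF z(2)] g by simp
    also have "\<dots> = amap F (\<delta>, \<zeta>) \<cdot> amap F (\<beta>, \<delta>) \<cdot> g"
      using comp_eq_assoc[OF F'(6)[OF d(2) z(1)], of g] F'(2-4)[OF d(2)] F'(2-4)[OF z(1)] g by simp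
    also have "\<dots> = amap F (\<gamma>, \<zeta>) \<cdot> p"
      using comp_eq_assoc[OF F'(6)[OF d(1) z(1)], of p] F'(2-4)[OF d(1)] F'(2-4)[OF z(1)] p d(3) by simp
    finally show "P \<epsilon> (amap F (\<beta>, \<epsilon>) \<cdot> g)"
      using z d k_trans unfolding P_def by blast
  qed
  have "is_cocone (poset_cat \<kappa>) set_cat (fcomp (hom_functor C A) F) UNIV \<upsilon>"
    unfolding is_cocone_def
  proof (intro conjI ballI)
    fix \<beta> assume "\<beta> \<in> Obj (poset_cat \<kappa>)"
    show "\<upsilon> \<beta> \<in> hom set_cat (omap (fcomp (hom_functor C A) F) \<beta>) UNIV"
      by (auto simp: \<upsilon>_def set_cat_hom)
  next
    fix b assume "b \<in> Arr (poset_cat \<kappa>)"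
    then obtain \<beta> \<epsilon> where b: "b = (\<beta>, \<epsilon>)" "(\<beta>, \<epsilon>) \<in> \<kappa>" by (cases b) auto
    have "P \<epsilon> (amap F (\<beta>, \<epsilon>) \<cdot> g) = P \<beta> g \<and> amap F (\<beta>, \<epsilon>) \<cdot> g \<in> hom C A (omap F \<epsilon>)" if "g \<in> hom C A (omap F \<beta>)" for g
      using that step[OF b(2)] F'(2-4)[OF b(2)] by (simp add: hom_def)
    then show "\<upsilon> (Cod (poset_cat \<kappa>) b) \<cdot>\<^bsub>set_cat\<^esub> amap (fcomp (hom_functor C A) F) b = \<upsilon> (Dom (poset_cat \<kappa>) b)"
      using b F'(2-4)[OF b(2)] by (auto simp: \<upsilon>_def compose_def fun_eq_iff restrict_def)
  qed simp
  then obtain m where m: "m \<in> hom set_cat (hom C A X) UNIV"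
    "\<And>\<beta>. \<beta> \<in> Obj (poset_cat \<kappa>) \<Longrightarrow> m \<cdot>\<^bsub>set_cat\<^esub> amap (hom_functor C A) (\<iota> \<beta>) = \<upsilon> \<beta>"
    using colimit_out[OF small_colimit[OF small F col]] by blast
  obtain m' where m': "m = (hom C A X, UNIV, m')"
    using m(1) by (cases m) (auto simp: set_cat_hom)
  \<comment> \<open>The induced map on the colimit decides \<open>P \<gamma>\<close> from the
    composite with \<iota> \<gamma> alone, so \<open>p\<close> and \<open>q\<close> receive the same
    truth value.\<close>
  have val: "m' (\<iota> \<gamma> \<cdot> g) = (if P \<gamma> g then p else q)" if g: "g \<in> hom C A (omap F \<gamma>)" for g
  proof -
    have "compose (hom C A (omap F \<gamma>)) m' (\<lambda>f \<in> hom C A (omap F \<gamma>). \<iota> \<gamma> \<cdot> f)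
       = (\<lambda>g \<in> hom C A (omap F \<gamma>). if P \<gamma> g then p else q)"
      using m(2)[of \<gamma>] \<gamma> i(3)[of \<gamma>] unfolding m' by (simp add: \<upsilon>_def)
    from fun_cong[OF this, of g] show ?thesis using g by (simp add: compose_def)
  qed
  have "P \<gamma> p" unfolding P_def using k_refl[OF \<gamma>] by blast
  then have "m' (\<iota> \<gamma> \<cdot> p) = p" using val[of p] p by (simp add: hom_def)
  moreover have "m' (\<iota> \<gamma> \<cdot> q) = (if P \<gamma> q then p else q)" using val[of q] q by (simp add: hom_def)
  ultimately have "P \<gamma> q" using False eq by (metis (full_types))
  then show ?thesis unfolding P_def by metis
qed

end

section \<open>The density comonad\<close>

locale density = lifting C J u
  for C :: "('o, 'm) category" (structure) and J :: "('i, 't) category" and u :: "('i, 't, 'm, ('m, 'm) sq) ftor" +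
  fixes D :: "('m, ('m, 'm) sq, 'm, ('m, 'm) sq) ftor" and \<iota> :: "'m \<Rightarrow> 'i \<times> ('m, 'm) sq \<Rightarrow> ('m, 'm) sq"
  assumes dens: "is_density J (arrow_cat C) u D \<iota>"
begin

abbreviation coproj :: "'m \<Rightarrow> 'i \<Rightarrow> 'm \<Rightarrow> 'm \<Rightarrow> ('m, 'm) sq" where
  "coproj x i p q \<equiv> \<iota> x (i, Sq (omap u i) x p q)"

lemma D_functor: "is_functor (arrow_cat C) (arrow_cat C) D"
  using dens by (simp add: is_density_def)

lemma D_colimit:
  "x \<in> Arr C \<Longrightarrow>
    is_colimit (comma J (arrow_cat C) u x) (arrow_cat C) (fcomp u comma_proj) (omap D x) (\<iota> x)"
  using dens by (simp add: is_density_def)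

lemma D_arr [simp]: "x \<in> Arr C \<Longrightarrow> omap D x \<in> Arr C"
  using D_functor by (simp add: is_functor_def)

lemma D_sq:
  assumes "\<sigma> \<in> squares C"
  shows "amap D \<sigma> \<in> squares C" "src (amap D \<sigma>) = omap D (src \<sigma>)" "tgt (amap D \<sigma>) = omap D (tgt \<sigma>)"
  using D_functor assms by (simp_all add: is_functor_def hom_def)

lemma D_comp:
  assumes "Sq x y h k \<in> squares C" "Sq y z h' k' \<in> squares C"
  shows "upper (amap D (Sq x z (h' \<cdot> h) (k' \<cdot> k))) = upper (amap D (Sq y z h' k')) \<cdot> upper (amap D (Sq x y h k))"
    "lower (amap D (Sq x z (h' \<cdot> h) (k' \<cdot> k))) = lower (amap D (Sq y z h' k')) \<cdot> lower (amap D (Sq x y h k))"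
proof -
  have "\<forall>f \<in> Arr (arrow_cat C). \<forall>g \<in> Arr (arrow_cat C). Cod (arrow_cat C) f = Dom (arrow_cat C) g \<longrightarrow>
    amap D (g \<cdot>\<^bsub>arrow_cat C\<^esub> f) = amap D g \<cdot>\<^bsub>arrow_cat C\<^esub> amap D f"
    using D_functor unfolding is_functor_def by blast
  from this[THEN bspec, of "Sq x y h k", THEN bspec, of "Sq y z h' k'"]
  show "upper (amap D (Sq x z (h' \<cdot> h) (k' \<cdot> k))) = upper (amap D (Sq y z h' k')) \<cdot> upper (amap D (Sq x y h k))"
    "lower (amap D (Sq x z (h' \<cdot> h) (k' \<cdot> k))) = lower (amap D (Sq y z h' k')) \<cdot> lower (amap D (Sq x y h k))"
    using assms by (simp_all del: Sq_in_squares)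
qed

lemma comma_Obj: "(i, \<alpha>) \<in> Obj (comma J (arrow_cat C) u x) \<longleftrightarrow> (\<exists>p q. \<alpha> = Sq (omap u i) x p q \<and> problem i x p q)"
  using lifting_problems_iff[of i \<alpha> x] by (simp add: comma_def lifting_problems_def)

text \<open>A cocone in the arrow category is read as two families of arrows indexed by lifting
  problems. An arrow of the comma category is determined by its arrow in J and the problem at its
  target, so the source problem is no separate datum in the naturality clause.\<close>

lemma comma_cocone_iff:
  "is_cocone (comma J (arrow_cat C) u x) (arrow_cat C) (fcomp u comma_proj) g \<phi> \<longleftrightarrow> g \<in> Arr C \<and>
     (\<forall>i p q. problem i x p q \<longrightarrow> \<phi> (i, Sq (omap u i) x p q) \<in> squares C \<and>
        src (\<phi> (i, Sq (omap u i) x p q)) = omap u i \<and> tgt (\<phi> (i, Sq (omap u i) x p q)) = g) \<and>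
     (\<forall>t p q. t \<in> Arr J \<longrightarrow> problem (Cod J t) x p q \<longrightarrow>
        upper (\<phi> (Dom J t, Sq (omap u (Dom J t)) x (p \<cdot> upper (amap u t)) (q \<cdot> lower (amap u t))))
          = upper (\<phi> (Cod J t, Sq (omap u (Cod J t)) x p q)) \<cdot> upper (amap u t) \<and>
        lower (\<phi> (Dom J t, Sq (omap u (Dom J t)) x (p \<cdot> upper (amap u t)) (q \<cdot> lower (amap u t))))
          = lower (\<phi> (Cod J t, Sq (omap u (Cod J t)) x p q)) \<cdot> lower (amap u t))"
  (is "?L \<longleftrightarrow> _ \<and> ?A \<and> ?B")
proof
  assume L: ?L
  then have g: "g \<in> Arr C"
    and 1: "\<And>k. k \<in> Obj (comma J (arrow_cat C) u x) \<Longrightarrow> \<phi> k \<in> hom (arrow_cat C) (omap u (fst k)) g"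
    and 2: "\<And>a. a \<in> Arr (comma J (arrow_cat C) u x) \<Longrightarrow>
      \<phi> (Cod (comma J (arrow_cat C) u x) a) \<cdot>\<^bsub>arrow_cat C\<^esub> amap u (fst (snd a)) = \<phi> (Dom (comma J (arrow_cat C) u x) a)"
    by (auto simp: is_cocone_def comma_proj_def case_prod_beta)
  have A: ?A using 1 comma_Obj by (fastforce simp: hom_def)
  have ?B
  proof (intro allI impI)
    fix t p q assume t: "t \<in> Arr J" and pr: "problem (Cod J t) x p q"
    let ?\<beta> = "Sq (omap u (Cod J t)) x p q"
    let ?\<alpha> = "Sq (omap u (Dom J t)) x (p \<cdot> upper (amap u t)) (q \<cdot> lower (amap u t))"
    have "((Dom J t, ?\<alpha>), t, (Cod J t, ?\<beta>)) \<in> Arr (comma J (arrow_cat C) u x)"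
      using t pr problem_precomp[OF pr t] u_sq[OF t] by (simp add: comma_def hom_def problem_def)
    from 2[OF this] have "\<phi> (Dom J t, ?\<alpha>) = Sq (src (amap u t)) (tgt (\<phi> (Cod J t, ?\<beta>)))
       (upper (\<phi> (Cod J t, ?\<beta>)) \<cdot> upper (amap u t)) (lower (\<phi> (Cod J t, ?\<beta>)) \<cdot> lower (amap u t))"
      by (simp add: comma_def)
    then show "upper (\<phi> (Dom J t, ?\<alpha>)) = upper (\<phi> (Cod J t, ?\<beta>)) \<cdot> upper (amap u t) \<and>
      lower (\<phi> (Dom J t, ?\<alpha>)) = lower (\<phi> (Cod J t, ?\<beta>)) \<cdot> lower (amap u t)" by simp
  qed
  with g A show "g \<in> Arr C \<and> ?A \<and> ?B" by blast
next
  assume R: "g \<in> Arr C \<and> ?A \<and> ?B"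
  then have RA: "src (\<phi> (i, Sq (omap u i) x p q)) = omap u i \<and> tgt (\<phi> (i, Sq (omap u i) x p q)) = g"
    if "problem i x p q" for i p q using that by blast
  have RB: "upper (\<phi> (Dom J t, Sq (omap u (Dom J t)) x (p \<cdot> upper (amap u t)) (q \<cdot> lower (amap u t))))
          = upper (\<phi> (Cod J t, Sq (omap u (Cod J t)) x p q)) \<cdot> upper (amap u t) \<and>
        lower (\<phi> (Dom J t, Sq (omap u (Dom J t)) x (p \<cdot> upper (amap u t)) (q \<cdot> lower (amap u t))))
          = lower (\<phi> (Cod J t, Sq (omap u (Cod J t)) x p q)) \<cdot> lower (amap u t)"
    if "t \<in> Arr J" "problem (Cod J t) x p q" for t p q using R that by blast
  show ?L
    unfolding is_cocone_def
  proof (intro conjI ballI)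
    show "g \<in> Obj (arrow_cat C)" using R by simp
    fix k assume "k \<in> Obj (comma J (arrow_cat C) u x)"
    then show "\<phi> k \<in> hom (arrow_cat C) (omap (fcomp u comma_proj) k) g"
      using R by (cases k) (auto simp: comma_Obj comma_proj_def hom_def)
  next
    fix a assume "a \<in> Arr (comma J (arrow_cat C) u x)"
    then have "\<exists>i \<alpha> t j \<beta>. a = ((i, \<alpha>), t, (j, \<beta>)) \<and> t \<in> hom J i j \<and> \<alpha> \<in> hom (arrow_cat C) (omap u i) x \<and>
      \<beta> \<in> hom (arrow_cat C) (omap u j) x \<and> \<beta> \<cdot>\<^bsub>arrow_cat C\<^esub> amap u t = \<alpha>"
      unfolding comma_def by (simp only: category.simps mem_Collect_eq)
    then obtain i \<alpha> t j \<beta> where a: "a = ((i, \<alpha>), t, (j, \<beta>))" "t \<in> hom J i j"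
      "\<alpha> \<in> hom (arrow_cat C) (omap u i) x" "\<beta> \<in> hom (arrow_cat C) (omap u j) x" "\<beta> \<cdot>\<^bsub>arrow_cat C\<^esub> amap u t = \<alpha>"
      by blast
    then have t: "t \<in> Arr J" "i = Dom J t" "j = Cod J t" by (auto simp: hom_def)
    have "(j, \<beta>) \<in> Obj (comma J (arrow_cat C) u x)"
      using a(4) t u_sq(12)[OF t(1)] by (simp add: comma_def)
    then obtain p q where \<beta>: "\<beta> = Sq (omap u j) x p q" "problem j x p q" using comma_Obj by blast
    have \<alpha>: "\<alpha> = Sq (omap u i) x (p \<cdot> upper (amap u t)) (q \<cdot> lower (amap u t))"
      using a(5) \<beta> u_sq[OF t(1)] t by simp
    have pr: "problem i x (p \<cdot> upper (amap u t)) (q \<cdot> lower (amap u t))"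
      using problem_precomp \<beta> t by simp
    have eqs: "upper (\<phi> (i, \<alpha>)) = upper (\<phi> (j, \<beta>)) \<cdot> upper (amap u t)" "lower (\<phi> (i, \<alpha>)) = lower (\<phi> (j, \<beta>)) \<cdot> lower (amap u t)"
      "src (\<phi> (i, \<alpha>)) = omap u i" "tgt (\<phi> (i, \<alpha>)) = g" "tgt (\<phi> (j, \<beta>)) = g"
      using RA[OF pr] RA[OF \<beta>(2)] RB[OF t(1), of p q] \<beta>(2) unfolding \<alpha> \<beta>(1) t(2,3) by simp_all
    show "\<phi> (Cod (comma J (arrow_cat C) u x) a) \<cdot>\<^bsub>arrow_cat C\<^esub> amap (fcomp u comma_proj) a = \<phi> (Dom (comma J (arrow_cat C) u x) a)"
      unfolding a(1) using eqs u_sq(2)[OF t(1)] t(2)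
      by (cases "\<phi> (i, \<alpha>)") (simp add: comma_def comma_proj_def)
  qed
qed

lemma coproj_sq:
  assumes "problem i x p q"
  shows "coproj x i p q \<in> squares C" "src (coproj x i p q) = omap u i" "tgt (coproj x i p q) = omap D x"
    "upper (coproj x i p q) \<in> Arr C" "lower (coproj x i p q) \<in> Arr C"
    "Dom C (upper (coproj x i p q)) = Dom C (omap u i)" "Cod C (upper (coproj x i p q)) = Dom C (omap D x)"
    "Dom C (lower (coproj x i p q)) = Cod C (omap u i)" "Cod C (lower (coproj x i p q)) = Cod C (omap D x)"
    "omap D x \<cdot> upper (coproj x i p q) = lower (coproj x i p q) \<cdot> omap u i"
proof -
  have "x \<in> Arr C" using assms by (simp add: problem_iff)
  then have "is_cocone (comma J (arrow_cat C) u x) (arrow_cat C) (fcomp u comma_proj) (omap D x) (\<iota> x)"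
    by (rule colimit_cocone[OF D_colimit])
  then show *: "coproj x i p q \<in> squares C" "src (coproj x i p q) = omap u i" "tgt (coproj x i p q) = omap D x"
    using assms unfolding comma_cocone_iff by blast+
  show "upper (coproj x i p q) \<in> Arr C" "lower (coproj x i p q) \<in> Arr C"
    "Dom C (upper (coproj x i p q)) = Dom C (omap u i)" "Cod C (upper (coproj x i p q)) = Dom C (omap D x)"
    "Dom C (lower (coproj x i p q)) = Cod C (omap u i)" "Cod C (lower (coproj x i p q)) = Cod C (omap D x)"
    "omap D x \<cdot> upper (coproj x i p q) = lower (coproj x i p q) \<cdot> omap u i"
    using squaresD[OF *(1)] *(2,3) by simp_all
qed

lemma coproj_precomp:
  assumes "t \<in> Arr J" "problem (Cod J t) x p q"
  shows "lower (coproj x (Dom J t) (p \<cdot> upper (amap u t)) (q \<cdot> lower (amap u t))) = lower (coproj x (Cod J t) p q) \<cdot> lower (amap u t)"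
proof -
  have "x \<in> Arr C" using assms by (simp add: problem_iff)
  then have "is_cocone (comma J (arrow_cat C) u x) (arrow_cat C) (fcomp u comma_proj) (omap D x) (\<iota> x)"
    by (rule colimit_cocone[OF D_colimit])
  then show ?thesis using assms unfolding comma_cocone_iff by blast
qed

lemma D_coproj:
  assumes "Sq x y h k \<in> squares C" "problem i x p q"
  shows "upper (amap D (Sq x y h k)) \<cdot> upper (coproj x i p q) = upper (coproj y i (h \<cdot> p) (k \<cdot> q))"
    "lower (amap D (Sq x y h k)) \<cdot> lower (coproj x i p q) = lower (coproj y i (h \<cdot> p) (k \<cdot> q))"
proof -
  have "\<forall>\<sigma> \<in> Arr (arrow_cat C). \<forall>i \<in> Obj J. \<forall>\<alpha> \<in> hom (arrow_cat C) (omap u i) (Dom (arrow_cat C) \<sigma>).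
        amap D \<sigma> \<cdot>\<^bsub>arrow_cat C\<^esub> \<iota> (Dom (arrow_cat C) \<sigma>) (i, \<alpha>) = \<iota> (Cod (arrow_cat C) \<sigma>) (i, \<sigma> \<cdot>\<^bsub>arrow_cat C\<^esub> \<alpha>)"
    using dens unfolding is_density_def by blast
  from this[THEN bspec, of "Sq x y h k", THEN bspec, of i, THEN bspec, of "Sq (omap u i) x p q"]
  have "amap D (Sq x y h k) \<cdot>\<^bsub>arrow_cat C\<^esub> coproj x i p q = coproj y i (h \<cdot> p) (k \<cdot> q)"
    using assms by (simp add: hom_def problem_def del: Sq_in_squares)
  then show "upper (amap D (Sq x y h k)) \<cdot> upper (coproj x i p q) = upper (coproj y i (h \<cdot> p) (k \<cdot> q))"
    "lower (amap D (Sq x y h k)) \<cdot> lower (coproj x i p q) = lower (coproj y i (h \<cdot> p) (k \<cdot> q))"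
    by (metis arrow_cat_sel(6) sq.sel(3,4))+
qed

lemma D_unique:
  assumes x: "x \<in> Arr C" and \<sigma>: "\<sigma> \<in> squares C" "src \<sigma> = omap D x" and \<tau>: "\<tau> \<in> squares C" "src \<tau> = omap D x"
    and tgt: "tgt \<sigma> = tgt \<tau>"
    and eq: "\<And>i p q. problem i x p q \<Longrightarrow> upper \<sigma> \<cdot> upper (coproj x i p q) = upper \<tau> \<cdot> upper (coproj x i p q) \<and>
       lower \<sigma> \<cdot> lower (coproj x i p q) = lower \<tau> \<cdot> lower (coproj x i p q)"
  shows "\<sigma> = \<tau>"
proof (rule colimit_unique[OF D_colimit[OF x]])
  show "\<sigma> \<in> hom (arrow_cat C) (omap D x) (tgt \<sigma>)" "\<tau> \<in> hom (arrow_cat C) (omap D x) (tgt \<sigma>)"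
    using assms by (simp_all add: hom_def)
  fix k assume "k \<in> Obj (comma J (arrow_cat C) u x)"
  then obtain i p q where "k = (i, Sq (omap u i) x p q)" "problem i x p q"
    by (cases k) (auto simp: comma_Obj)
  then show "\<sigma> \<cdot>\<^bsub>arrow_cat C\<^esub> \<iota> x k = \<tau> \<cdot>\<^bsub>arrow_cat C\<^esub> \<iota> x k"
    using eq tgt by simp
qed

text \<open>The codomain functor preserves colimits, being left adjoint to the functor that sends an
  object to its identity arrow. Accordingly, maps out of \<open>Cod C (omap D x)\<close> are treated
  as squares into an identity.\<close>

lemma D_cod_unique:
  assumes x: "x \<in> Arr C" and K: "K \<in> Arr C" "Dom C K = Cod C (omap D x)" and K': "K' \<in> Arr C" "Dom C K' = Cod C (omap D x)"
    and cod: "Cod C K = Cod C K'"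
    and eq: "\<And>i p q. problem i x p q \<Longrightarrow> K \<cdot> lower (coproj x i p q) = K' \<cdot> lower (coproj x i p q)"
  shows "K = K'"
proof -
  have "Sq (omap D x) (Ide C (Cod C K)) (K \<cdot> omap D x) K = Sq (omap D x) (Ide C (Cod C K)) (K' \<cdot> omap D x) K'"
  proof (rule D_unique[OF x])
    fix i p q assume pr: "problem i x p q"
    note I = coproj_sq[OF pr]
    have "K \<cdot> lower (coproj x i p q) \<cdot> omap u i = K' \<cdot> lower (coproj x i p q) \<cdot> omap u i"
      using comp_eq_assoc[OF eq[OF pr], of "omap u i"] I K K' pr by (simp add: problem_iff)
    then show "upper (Sq (omap D x) (Ide C (Cod C K)) (K \<cdot> omap D x) K) \<cdot> upper (coproj x i p q) =
          upper (Sq (omap D x) (Ide C (Cod C K)) (K' \<cdot> omap D x) K') \<cdot> upper (coproj x i p q) \<and>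
          lower (Sq (omap D x) (Ide C (Cod C K)) (K \<cdot> omap D x) K) \<cdot> lower (coproj x i p q) =
          lower (Sq (omap D x) (Ide C (Cod C K)) (K' \<cdot> omap D x) K') \<cdot> lower (coproj x i p q)"
      using eq[OF pr] I K K' x cod by simp
  qed (use K K' x cod in simp_all)
  then show ?thesis by simp
qed

lemma D_out:
  assumes x: "x \<in> Arr C" and coc: "is_cocone (comma J (arrow_cat C) u x) (arrow_cat C) (fcomp u comma_proj) g \<phi>"
  shows "\<exists>\<sigma> \<in> squares C. src \<sigma> = omap D x \<and> tgt \<sigma> = g \<and>
    (\<forall>i p q. problem i x p q \<longrightarrow> upper \<sigma> \<cdot> upper (coproj x i p q) = upper (\<phi> (i, Sq (omap u i) x p q)) \<and>
       lower \<sigma> \<cdot> lower (coproj x i p q) = lower (\<phi> (i, Sq (omap u i) x p q)))"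
proof -
  obtain \<sigma> where \<sigma>: "\<sigma> \<in> hom (arrow_cat C) (omap D x) g"
    "\<And>k. k \<in> Obj (comma J (arrow_cat C) u x) \<Longrightarrow> \<sigma> \<cdot>\<^bsub>arrow_cat C\<^esub> \<iota> x k = \<phi> k"
    using colimit_out[OF D_colimit[OF x] coc] by blast
  have "upper \<sigma> \<cdot> upper (coproj x i p q) = upper (\<phi> (i, Sq (omap u i) x p q)) \<and>
       lower \<sigma> \<cdot> lower (coproj x i p q) = lower (\<phi> (i, Sq (omap u i) x p q))" if "problem i x p q" for i p q
    using \<sigma>(2)[of "(i, Sq (omap u i) x p q)", symmetric] that by (simp add: comma_Obj)
  then show ?thesis using \<sigma>(1) by (auto simp: hom_def)
qed

text \<open>The counit of the density comonad, induced by the tautological cocone that assigns to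
  each lifting problem the problem itself.\<close>

definition eps :: "'m \<Rightarrow> ('m, 'm) sq" where
  "eps x = (SOME \<sigma>. \<sigma> \<in> squares C \<and> src \<sigma> = omap D x \<and> tgt \<sigma> = x \<and>
    (\<forall>i p q. problem i x p q \<longrightarrow> upper \<sigma> \<cdot> upper (coproj x i p q) = p \<and> lower \<sigma> \<cdot> lower (coproj x i p q) = q))"

lemma eps:
  assumes "x \<in> Arr C"
  shows "eps x \<in> squares C" "src (eps x) = omap D x" "tgt (eps x) = x"
    "upper (eps x) \<in> Arr C" "lower (eps x) \<in> Arr C"
    "Dom C (upper (eps x)) = Dom C (omap D x)" "Cod C (upper (eps x)) = Dom C x"
    "Dom C (lower (eps x)) = Cod C (omap D x)" "Cod C (lower (eps x)) = Cod C x"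
    "x \<cdot> upper (eps x) = lower (eps x) \<cdot> omap D x"
    and eps_coproj: "problem i x p q \<Longrightarrow> upper (eps x) \<cdot> upper (coproj x i p q) = p"
      "problem i x p q \<Longrightarrow> lower (eps x) \<cdot> lower (coproj x i p q) = q"
proof -
  have "is_cocone (comma J (arrow_cat C) u x) (arrow_cat C) (fcomp u comma_proj) x snd"
    unfolding comma_cocone_iff using assms by (auto simp: problem_def simp del: Sq_in_squares)
  from D_out[OF assms this] have "\<exists>\<sigma>. \<sigma> \<in> squares C \<and> src \<sigma> = omap D x \<and> tgt \<sigma> = x \<and>
    (\<forall>i p q. problem i x p q \<longrightarrow> upper \<sigma> \<cdot> upper (coproj x i p q) = p \<and> lower \<sigma> \<cdot> lower (coproj x i p q) = q)"
    by auto
  from someI_ex[OF this, folded eps_def]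
  have e: "eps x \<in> squares C" "src (eps x) = omap D x" "tgt (eps x) = x"
    and i: "\<forall>i p q. problem i x p q \<longrightarrow> upper (eps x) \<cdot> upper (coproj x i p q) = p \<and> lower (eps x) \<cdot> lower (coproj x i p q) = q"
    by blast+
  show "eps x \<in> squares C" "src (eps x) = omap D x" "tgt (eps x) = x" using e by auto
  show "upper (eps x) \<in> Arr C" "lower (eps x) \<in> Arr C"
    "Dom C (upper (eps x)) = Dom C (omap D x)" "Cod C (upper (eps x)) = Dom C x"
    "Dom C (lower (eps x)) = Cod C (omap D x)" "Cod C (lower (eps x)) = Cod C x"
    "x \<cdot> upper (eps x) = lower (eps x) \<cdot> omap D x"
    using squaresD[OF e(1)] e(2,3) by simp_all
  show "problem i x p q \<Longrightarrow> upper (eps x) \<cdot> upper (coproj x i p q) = p"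
    "problem i x p q \<Longrightarrow> lower (eps x) \<cdot> lower (coproj x i p q) = q"
    using i by blast+
qed

lemma eps_nat:
  assumes sq: "Sq x y h k \<in> squares C"
  shows "h \<cdot> upper (eps x) = upper (eps y) \<cdot> upper (amap D (Sq x y h k))"
    "k \<cdot> lower (eps x) = lower (eps y) \<cdot> lower (amap D (Sq x y h k))"
proof -
  have x: "x \<in> Arr C" and y: "y \<in> Arr C" using sq by auto
  note ex = eps[OF x] and ey = eps[OF y] and d = D_sq[OF sq] and d' = squaresD[OF D_sq(1)[OF sq]]
  have "Sq (omap D x) y (h \<cdot> upper (eps x)) (k \<cdot> lower (eps x))
     = Sq (omap D x) y (upper (eps y) \<cdot> upper (amap D (Sq x y h k))) (lower (eps y) \<cdot> lower (amap D (Sq x y h k)))"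
  proof (rule D_unique[OF x])
    show "Sq (omap D x) y (h \<cdot> upper (eps x)) (k \<cdot> lower (eps x)) \<in> squares C"
      using squares_comp[OF ex(1) sq] ex(2,3) by (simp del: Sq_in_squares)
    show "Sq (omap D x) y (upper (eps y) \<cdot> upper (amap D (Sq x y h k))) (lower (eps y) \<cdot> lower (amap D (Sq x y h k))) \<in> squares C"
      using squares_comp[OF d(1) ey(1)] ey(2,3) d(2,3) by (simp del: Sq_in_squares)
    fix i p q assume pr: "problem i x p q"
    note I = coproj_sq[OF pr] and E = eps_coproj[OF x pr] and E' = eps_coproj[OF y problem_comp[OF pr sq]]
      and DI = D_coproj[OF sq pr]
    show "upper (Sq (omap D x) y (h \<cdot> upper (eps x)) (k \<cdot> lower (eps x))) \<cdot> upper (coproj x i p q) =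
       upper (Sq (omap D x) y (upper (eps y) \<cdot> upper (amap D (Sq x y h k))) (lower (eps y) \<cdot> lower (amap D (Sq x y h k)))) \<cdot> upper (coproj x i p q) \<and>
       lower (Sq (omap D x) y (h \<cdot> upper (eps x)) (k \<cdot> lower (eps x))) \<cdot> lower (coproj x i p q) =
       lower (Sq (omap D x) y (upper (eps y) \<cdot> upper (amap D (Sq x y h k))) (lower (eps y) \<cdot> lower (amap D (Sq x y h k)))) \<cdot> lower (coproj x i p q)"
      using sq I(4-9) E E' DI ex(4-9) ey(4-9) d(2,3) d'(3-8) by simp
  qed simp_all
  then show "h \<cdot> upper (eps x) = upper (eps y) \<cdot> upper (amap D (Sq x y h k))"
    "k \<cdot> lower (eps x) = lower (eps y) \<cdot> lower (amap D (Sq x y h k))" by simp_all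
qed

text \<open>The passage from one filler for each i to a single filler against D: the fillers of the
  composed problems form a cocone on the codomains, and the map they induce out of
  \<open>Cod C (omap D x)\<close> is a diagonal of the square D x -> x ->
  \<open>fst v\<close>.\<close>

lemma D_lift:
  assumes v: "v \<in> V" and sq: "Sq x (fst v) y k \<in> squares C"
  shows "\<exists>K \<in> Arr C. Dom C K = Cod C (omap D x) \<and> Cod C K = Dom C (fst v) \<and>
    K \<cdot> omap D x = y \<cdot> upper (eps x) \<and> fst v \<cdot> K = k \<cdot> lower (eps x) \<and>
    (\<forall>i p q. problem i x p q \<longrightarrow> K \<cdot> lower (coproj x i p q) = filler v i (y \<cdot> p) (k \<cdot> q))"
proof -
  have x: "x \<in> Arr C" and g: "fst v \<in> Arr C" using sq by auto
  let ?i = "Ide C (Dom C (fst v))"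
  let ?F = "\<lambda>i \<alpha>. filler v i (y \<cdot> upper \<alpha>) (k \<cdot> lower \<alpha>)"
  have fill: "filler v i (y \<cdot> p) (k \<cdot> q) \<in> Arr C" "Dom C (filler v i (y \<cdot> p) (k \<cdot> q)) = Cod C (omap u i)"
    "Cod C (filler v i (y \<cdot> p) (k \<cdot> q)) = Dom C (fst v)" "filler v i (y \<cdot> p) (k \<cdot> q) \<cdot> omap u i = y \<cdot> p"
    "fst v \<cdot> filler v i (y \<cdot> p) (k \<cdot> q) = k \<cdot> q" if "problem i x p q" for i p q
    using fillerD[OF v problem_comp[OF that sq]] by auto
  have nat: "filler v (Dom J t) (y \<cdot> p \<cdot> upper (amap u t)) (k \<cdot> q \<cdot> lower (amap u t)) = filler v (Cod J t) (y \<cdot> p) (k \<cdot> q) \<cdot> lower (amap u t)"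
    if "t \<in> Arr J" "problem (Cod J t) x p q" for t p q
    using filler_nat[OF v that(1) problem_comp[OF that(2) sq]] sq that(2) u_sq[OF that(1)] by (simp add: problem_iff)
  \<comment> \<open>Each filler becomes a square from \<open>omap u i\<close> to the identity of
    \<open>Dom C (fst v)\<close>, which turns a cocone of codomains into one in the arrow
    category.\<close>
  have "is_cocone (comma J (arrow_cat C) u x) (arrow_cat C) (fcomp u comma_proj) ?i
     (\<lambda>(i, \<alpha>). Sq (omap u i) ?i (?F i \<alpha> \<cdot> omap u i) (?F i \<alpha>))"
    unfolding comma_cocone_iff
  proof (intro conjI allI impI, goal_cases)
    case (2 i p q)
    then show ?case using fill[OF 2] g sq by (simp add: problem_iff)
  next
    case (5 t p q)
    then show ?case using fill(1-4)[OF 5(2)] fill(1-4)[OF problem_precomp[OF 5(2,1)]] u_sq[OF 5(1)] sq by (simp add: problem_iff)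
  next
    case (6 t p q)
    then show ?case using nat by simp
  qed (use g in simp_all)
  from D_out[OF x this] obtain \<sigma> where \<sigma>: "\<sigma> \<in> squares C" "src \<sigma> = omap D x" "tgt \<sigma> = ?i"
    "\<And>i p q. problem i x p q \<Longrightarrow> lower \<sigma> \<cdot> lower (coproj x i p q) = filler v i (y \<cdot> p) (k \<cdot> q)"
    by auto
  note s = squaresD[OF \<sigma>(1), unfolded \<sigma>(2,3)]
  have K: "lower \<sigma> \<in> Arr C" "Dom C (lower \<sigma>) = Cod C (omap D x)" "Cod C (lower \<sigma>) = Dom C (fst v)"
    using s g by simp_all
  note e = eps[OF x]
  \<comment> \<open>Both triangles at once: they are the two components of an equation of squares
    out of D x, checked on coprojections.\<close>
  have "Sq (omap D x) (fst v) (lower \<sigma> \<cdot> omap D x) (fst v \<cdot> lower \<sigma>) = Sq (omap D x) (fst v) (y \<cdot> upper (eps x)) (k \<cdot> lower (eps x))"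
  proof (rule D_unique[OF x])
    show "Sq (omap D x) (fst v) (lower \<sigma> \<cdot> omap D x) (fst v \<cdot> lower \<sigma>) \<in> squares C"
      using K g x by simp
    show "Sq (omap D x) (fst v) (y \<cdot> upper (eps x)) (k \<cdot> lower (eps x)) \<in> squares C"
      using squares_comp[OF e(1) sq] e(2,3) by (simp del: Sq_in_squares)
    fix i p q assume pr: "problem i x p q"
    note I = coproj_sq[OF pr] and E = eps_coproj[OF x pr]
    have "lower \<sigma> \<cdot> omap D x \<cdot> upper (coproj x i p q) = lower \<sigma> \<cdot> lower (coproj x i p q) \<cdot> omap u i"
      using I(10) by simp
    also have "\<dots> = y \<cdot> p"
      using comp_eq_assoc[OF \<sigma>(4)[OF pr], of "omap u i"] I K fill(4)[OF pr] pr by (simp add: problem_iff)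
    finally have 1: "lower \<sigma> \<cdot> omap D x \<cdot> upper (coproj x i p q) = y \<cdot> p" .
    have 2: "fst v \<cdot> lower \<sigma> \<cdot> lower (coproj x i p q) = k \<cdot> q"
      using \<sigma>(4)[OF pr] fill(5)[OF pr] by simp
    show "upper (Sq (omap D x) (fst v) (lower \<sigma> \<cdot> omap D x) (fst v \<cdot> lower \<sigma>)) \<cdot> upper (coproj x i p q) =
       upper (Sq (omap D x) (fst v) (y \<cdot> upper (eps x)) (k \<cdot> lower (eps x))) \<cdot> upper (coproj x i p q) \<and>
       lower (Sq (omap D x) (fst v) (lower \<sigma> \<cdot> omap D x) (fst v \<cdot> lower \<sigma>)) \<cdot> lower (coproj x i p q) =
       lower (Sq (omap D x) (fst v) (y \<cdot> upper (eps x)) (k \<cdot> lower (eps x))) \<cdot> lower (coproj x i p q)"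
      using 1 2 E I(4-9) K g x e(4-9) sq by simp
  qed simp_all
  then show ?thesis using K \<sigma>(4) by (intro bexI[of _ "lower \<sigma>"]) simp_all
qed

end

section \<open>Free lifting structures\<close>

locale small_density = density C J u D \<iota> + backdrop C \<kappa> M
  for C :: "('o, 'm) category" (structure) and J :: "('i, 't) category" and u :: "('i, 't, 'm, ('m, 'm) sq) ftor"
    and D :: "('m, ('m, 'm) sq, 'm, ('m, 'm) sq) ftor" and \<iota> :: "'m \<Rightarrow> 'i \<times> ('m, 'm) sq \<Rightarrow> ('m, 'm) sq"
    and \<kappa> :: "'k rel" and M :: "'m set" +
  assumes limit: "limit_ordinal \<kappa>" and nonempty: "Field \<kappa> \<noteq> {}"
    and D_M: "x \<in> Arr C \<Longrightarrow> omap D x \<in> M"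
    and gap: "\<sigma> \<in> squares C \<Longrightarrow> upper \<sigma> \<in> M \<Longrightarrow> lower \<sigma> \<in> M \<Longrightarrow>
       is_pushout C (omap D (src \<sigma>)) (upper (amap D \<sigma>)) p q \<Longrightarrow> q \<in> M \<Longrightarrow>
       w \<in> hom C (Cod C p) (Cod C (omap D (tgt \<sigma>))) \<Longrightarrow> w \<cdot> p = lower (amap D \<sigma>) \<Longrightarrow>
       w \<cdot> q = omap D (tgt \<sigma>) \<Longrightarrow> w \<in> M"
    and small: "i \<in> Obj J \<Longrightarrow> is_small \<kappa> C M (Dom C (omap u i))"
begin

text \<open>Needed so that each X'_\<gamma>, and with it the cell attached at \<gamma>, maps to the
  colimit of all stages.\<close>

lemma successor: "\<gamma> \<in> Field \<kappa> \<Longrightarrow> \<exists>\<delta>. \<gamma> \<lless> \<delta>"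
proof -
  assume \<gamma>: "\<gamma> \<in> Field \<kappa>"
  have "\<forall>B. finite B \<and> B \<noteq> {} \<and> B \<subseteq> Field \<kappa> \<longrightarrow> (\<exists>b \<in> Field \<kappa>. \<forall>c \<in> B. (c, b) \<in> \<kappa> \<and> c \<noteq> b)"
    using limit by (simp add: limit_ordinal_def)
  from this[rule_format, of "{\<gamma>}"] show ?thesis using \<gamma> by (auto simp: lt_iff)
qed

text \<open>Over a fixed base the squares have an identity as lower side. With an upper side in
  \<open>M\<close> they are of the kind to which the gap condition of compatibility applies, so the
  chain D x is a \<open>gap_chain\<close> and its latching objects exist.\<close>

lemma density_cells:
  assumes f0: "f0 \<in> Arr C"
  shows "cells C \<kappa> M f0 (\<lambda>\<gamma>. omap D) (\<lambda>\<beta> \<gamma> x x' h. amap D (Sq x x' h (Ide C (Cod C f0))))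
     (\<lambda>\<gamma> z x. upper (eps x)) (\<lambda>\<gamma> x. lower (eps x)) (Field \<kappa>)"
proof (unfold_locales, goal_cases)
  case 1 then show ?case by (rule f0)
next
  case 2 then show ?case by simp
next
  case (3 \<gamma> \<beta>) then show ?case using lt_field by blast
next
  case (4 \<gamma> x) then show ?case by (simp add: D_M)
next
  case (5 \<gamma> \<beta> x' h x)
  then show ?case using D_sq[of "Sq x x' h (Ide C (Cod C f0))"] f0 by auto
next
  case (6 \<gamma> x z) then show ?case using eps[of x] by simp
next
  case (7 \<gamma> \<beta> x' h x z z')
  then show ?case using eps_nat(1)[of x x' h "Ide C (Cod C f0)"] f0 by auto
next
  case (8 \<gamma> x) then show ?case using eps[of x] by simp
next
  case (9 \<gamma> \<beta> x' h x)
  have x: "x \<in> Arr C" "Cod C x = Cod C f0" using 9 by auto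
  have sq: "Sq x x' h (Ide C (Cod C f0)) \<in> squares C" using 9 x f0 by auto
  show ?case using eps_nat(2)[OF sq] eps[OF x(1)] x by simp
next
  case (10 \<gamma> X H)
  let ?s = "\<lambda>\<beta> \<delta>. Sq (X \<beta>) (X \<delta>) (H \<beta> \<delta>) (Ide C (Cod C f0))"
  have X: "X \<beta> \<in> Arr C" "Cod C (X \<beta>) = Cod C f0" if "\<beta> = \<gamma> \<or> \<beta> \<lless> \<gamma>" for \<beta> using 10(2)[OF that] by auto
  have sq: "?s \<beta> \<delta> \<in> squares C" if "\<delta> = \<gamma> \<or> \<delta> \<lless> \<gamma>" "\<beta> \<lless> \<delta>" for \<beta> \<delta>
  proof -
    have "\<beta> = \<gamma> \<or> \<beta> \<lless> \<gamma>" using that lt_trans by blast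
    then show ?thesis using 10(3)[OF that] X f0 that by simp
  qed
  have "gap_chain (\<lambda>\<beta>. omap D (X \<beta>)) (\<lambda>\<beta> \<delta>. amap D (?s \<beta> \<delta>)) \<gamma>"
    unfolding gap_chain_def
  proof (intro conjI allI impI)
    fix \<beta> assume "\<beta> = \<gamma> \<or> \<beta> \<lless> \<gamma>"
    then show "omap D (X \<beta>) \<in> M" using X D_M by blast
  next
    fix \<beta> \<delta> assume d: "\<delta> = \<gamma> \<or> \<delta> \<lless> \<gamma>" and b: "\<beta> \<lless> \<delta>"
    show "amap D (?s \<beta> \<delta>) \<in> squares C" "src (amap D (?s \<beta> \<delta>)) = omap D (X \<beta>)" "tgt (amap D (?s \<beta> \<delta>)) = omap D (X \<delta>)"
      using D_sq[OF sq[OF d b]] by simp_all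
    fix p q w assume "is_pushout C (omap D (X \<beta>)) (upper (amap D (?s \<beta> \<delta>))) p q" "q \<in> M"
      "w \<in> hom C (Cod C p) (Cod C (omap D (X \<delta>)))" "w \<cdot> p = lower (amap D (?s \<beta> \<delta>))" "w \<cdot> q = omap D (X \<delta>)"
    then show "w \<in> M" using gap[OF sq[OF d b], of p q w] 10(3)[OF d b] f0 by simp
  next
    fix \<beta> \<delta> \<epsilon> assume e: "\<epsilon> = \<gamma> \<or> \<epsilon> \<lless> \<gamma>" and b: "\<beta> \<lless> \<delta>" and d: "\<delta> \<lless> \<epsilon>"
    then have d': "\<delta> = \<gamma> \<or> \<delta> \<lless> \<gamma>" using lt_trans by blast
    show "upper (amap D (?s \<delta> \<epsilon>)) \<cdot> upper (amap D (?s \<beta> \<delta>)) = upper (amap D (?s \<beta> \<epsilon>))"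
      "lower (amap D (?s \<delta> \<epsilon>)) \<cdot> lower (amap D (?s \<beta> \<delta>)) = lower (amap D (?s \<beta> \<epsilon>))"
      using D_comp[OF sq[OF d' b] sq[OF e d]] 10(4)[OF e b d] f0 by simp_all
  qed
  then show ?case using latch_exists[OF 10(1)] by blast
qed

text \<open>The colimit of the stages has a filler for each lifting problem: by smallness the upper
  side factors through some stage, and the cell attached there solves the problem one step later.
  Freeness comes from \<open>complex_out\<close> for existence and from \<open>stage_unique\<close>
  for uniqueness.\<close>

lemma free_lifting_exists:
  assumes f0: "f0 \<in> Arr C"
  shows "\<exists>l r. free_lifting f0 l r"
proof -
  let ?B = "Ide C (Cod C f0)"
  interpret K: cells C \<kappa> M f0 "\<lambda>\<gamma>. omap D" "\<lambda>\<beta> \<gamma> x x' h. amap D (Sq x x' h ?B)"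
     "\<lambda>\<gamma> z x. upper (eps x)" "\<lambda>\<gamma> x. lower (eps x)" "Field \<kappa>"
    by (rule density_cells[OF f0])
  obtain S where S: "K.complex (Field \<kappa>) S" using K.complex_exists by blast
  note cx = K.complexD[OF S] and st = K.complex_step[OF S]
  define x where "x = (\<lambda>\<gamma>. xx (S \<gamma>))"
  have x_app: "xx (S \<gamma>) = x \<gamma>" for \<gamma> by (simp add: x_def)
  define tr where "tr = (\<lambda>\<beta> \<gamma>. if \<beta> = \<gamma> then Ide C (Dom C (x \<gamma>)) else ii (S \<gamma>) \<beta> \<cdot> jj (S \<beta>))"
  have trs: "tr \<beta> \<gamma> = ii (S \<gamma>) \<beta> \<cdot> jj (S \<beta>)" if "\<beta> \<lless> \<gamma>" for \<beta> \<gamma> using that by (auto simp: tr_def)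
  have x: "x \<gamma> \<in> Arr C" "Cod C (x \<gamma>) = Cod C f0" if "\<gamma> \<in> Field \<kappa>" for \<gamma>
    using cx[OF that] by (simp_all add: x_def)
  have tr: "tr \<beta> \<gamma> \<in> M" "Dom C (tr \<beta> \<gamma>) = Dom C (x \<beta>)" "Cod C (tr \<beta> \<gamma>) = Dom C (x \<gamma>)"
    "x \<gamma> \<cdot> tr \<beta> \<gamma> = x \<beta>" "Sq (x \<beta>) (x \<gamma>) (tr \<beta> \<gamma>) ?B \<in> squares C" if bg: "(\<beta>, \<gamma>) \<in> \<kappa>" for \<beta> \<gamma>
  proof -
    have f: "\<beta> \<in> Field \<kappa>" "\<gamma> \<in> Field \<kappa>" "\<beta> = \<gamma> \<or> \<beta> \<lless> \<gamma>" using bg k_iff by auto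
    note B = cx[OF f(1)] and G = cx[OF f(2)] and W = st[OF f(2)]
    have "xx (S \<gamma>) \<cdot> ii (S \<gamma>) \<beta> \<cdot> jj (S \<beta>) = xx (S \<beta>)" if "\<beta> \<lless> \<gamma>"
      using comp_eq_assoc[OF W(4)[OF that], of "jj (S \<beta>)"] B G W(1-4)[OF that] by simp
    then show 1: "tr \<beta> \<gamma> \<in> M" "Dom C (tr \<beta> \<gamma>) = Dom C (x \<beta>)" "Cod C (tr \<beta> \<gamma>) = Dom C (x \<gamma>)" "x \<gamma> \<cdot> tr \<beta> \<gamma> = x \<beta>"
      using f(3) B(5-16) G(5-16) W(1-4) by (auto simp: tr_def x_def)
    show "Sq (x \<beta>) (x \<gamma>) (tr \<beta> \<gamma>) ?B \<in> squares C" using 1 x f f0 by simp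
  qed
  have trtr: "tr \<gamma> \<delta> \<cdot> tr \<beta> \<gamma> = tr \<beta> \<delta>" if bg: "(\<beta>, \<gamma>) \<in> \<kappa>" and gd: "(\<gamma>, \<delta>) \<in> \<kappa>" for \<beta> \<gamma> \<delta>
  proof (cases "\<beta> = \<gamma> \<or> \<gamma> = \<delta>")
    case True
    then show ?thesis using tr(1-3)[OF bg] tr(1-3)[OF gd] tr_def by auto
  next
    case False
    then have o: "\<beta> \<lless> \<gamma>" "\<gamma> \<lless> \<delta>" using bg gd by (auto simp: lt_iff)
    note o = o lt_trans[OF o]
    note f = lt_field[OF o(1)] lt_field(2)[OF o(2)]
    note W = st[OF f(3) o(2)] and W' = st[OF f(2) o(1)]
    show ?thesis
      using W(7)[OF o(1), symmetric] W(1-3) W'(1-3) cx(5-16)[OF f(1)] cx(5-16)[OF f(2)] trs o by simp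
  qed
  define F where "F = \<lparr>omap = (\<lambda>\<gamma>. Dom C (x \<gamma>)), amap = (\<lambda>(\<beta>, \<gamma>). tr \<beta> \<gamma>)\<rparr>"
  have F: "is_functor (poset_cat \<kappa>) (subcat C M) F"
    unfolding is_functor_def
  proof (intro conjI ballI impI)
    show "is_category (poset_cat \<kappa>)" by (rule poset_category) (use k_refl k_trans in blast)+
    show "is_category (subcat C M)" by (rule subcat_category)
    fix p assume p: "p \<in> Arr (poset_cat \<kappa>)"
    then show "amap F p \<in> hom (subcat C M) (omap F (Dom (poset_cat \<kappa>) p)) (omap F (Cod (poset_cat \<kappa>) p))"
      using tr[of "fst p" "snd p"] by (simp add: F_def case_prod_beta)
    fix q assume q: "q \<in> Arr (poset_cat \<kappa>)" "Cod (poset_cat \<kappa>) p = Dom (poset_cat \<kappa>) q"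
    then show "amap F (q \<cdot>\<^bsub>poset_cat \<kappa>\<^esub> p) = amap F q \<cdot>\<^bsub>subcat C M\<^esub> amap F p"
      using trtr[of "fst p" "snd p" "snd q"] p by (cases p; cases q) (auto simp: F_def)
  qed (use x in \<open>auto simp: F_def tr_def\<close>)
  have "\<exists>X \<iota>. is_colimit (poset_cat \<kappa>) C F X \<iota>"
    using backdrop F unfolding is_backdrop_def by blast
  then obtain X inc where col: "is_colimit (poset_cat \<kappa>) C F X inc" by blast
  note incs = chain_coconeD[OF colimit_cocone[OF col]]
  have inc: "inc \<gamma> \<in> Arr C" "Dom C (inc \<gamma>) = Dom C (x \<gamma>)" "Cod C (inc \<gamma>) = X" if "\<gamma> \<in> Field \<kappa>" for \<gamma>
    using incs(2-4)[OF that] by (simp_all add: F_def)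
  have inctr: "inc \<gamma> \<cdot> tr \<beta> \<gamma> = inc \<beta>" if "(\<beta>, \<gamma>) \<in> \<kappa>" for \<beta> \<gamma>
    using incs(5)[OF that] by (simp add: F_def)
  have X: "X \<in> Obj C" by (rule incs(1))
  have cocone_iff: "is_cocone (poset_cat \<kappa>) C F Y h"
    if "Y \<in> Obj C" "\<And>\<gamma>. \<gamma> \<in> Field \<kappa> \<Longrightarrow> h \<gamma> \<in> Arr C \<and> Dom C (h \<gamma>) = Dom C (x \<gamma>) \<and> Cod C (h \<gamma>) = Y"
       "\<And>\<beta> \<gamma>. (\<beta>, \<gamma>) \<in> \<kappa> \<Longrightarrow> h \<gamma> \<cdot> tr \<beta> \<gamma> = h \<beta>" for Y h
    using that by (auto simp: is_cocone_def F_def hom_def)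
  obtain xk where "xk \<in> hom C X (Cod C f0)" "\<And>\<gamma>. \<gamma> \<in> Obj (poset_cat \<kappa>) \<Longrightarrow> xk \<cdot> inc \<gamma> = x \<gamma>"
    using colimit_out[OF col cocone_iff[of "Cod C f0" x]] x tr(4) f0 by auto
  then have xk: "xk \<in> Arr C" "Dom C xk = X" "Cod C xk = Cod C f0" "\<And>\<gamma>. \<gamma> \<in> Field \<kappa> \<Longrightarrow> xk \<cdot> inc \<gamma> = x \<gamma>"
    by (auto simp: hom_def)
  \<comment> \<open>The leg at X'_\<gamma> is routed through some later stage;
    \<open>inc'_eq\<close> shows that the choice does not matter.\<close>
  define inc' where "inc' = (\<lambda>\<gamma>. let \<delta> = SOME \<delta>. \<gamma> \<lless> \<delta> in inc \<delta> \<cdot> ii (S \<delta>) \<gamma>)"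
  have inc'_eq: "inc' \<beta> = inc \<gamma> \<cdot> ii (S \<gamma>) \<beta>" if bg: "\<beta> \<lless> \<gamma>" for \<beta> \<gamma>
  proof -
    have *: "inc \<gamma> \<cdot> ii (S \<gamma>) \<beta> = inc \<delta> \<cdot> ii (S \<delta>) \<beta>" if bg: "\<beta> \<lless> \<gamma>" and gd: "\<gamma> \<lless> \<delta>" for \<gamma> \<delta>
    proof -
      note f = lt_field[OF bg] lt_field(2)[OF gd]
      have "inc \<gamma> \<cdot> ii (S \<gamma>) \<beta> = inc \<delta> \<cdot> tr \<gamma> \<delta> \<cdot> ii (S \<gamma>) \<beta>"
        using comp_eq_assoc[OF inctr, of \<gamma> \<delta> "ii (S \<gamma>) \<beta>"] gd f inc[OF f(3)] st(1-3)[OF f(2) bg] tr[of \<gamma> \<delta>]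
        by (simp add: lt_iff x_def)
      also have "\<dots> = inc \<delta> \<cdot> ii (S \<delta>) \<beta>"
        using st(7)[OF f(3) gd bg] st(1-3)[OF f(3) gd] st(1-3)[OF f(2) bg] cx(11-16)[OF f(2)] trs[OF gd] by simp
      finally show ?thesis .
    qed
    define \<delta> where "\<delta> = (SOME \<delta>. \<beta> \<lless> \<delta>)"
    have d: "\<beta> \<lless> \<delta>" unfolding \<delta>_def by (rule someI[of _ \<gamma>]) (rule bg)
    have "\<gamma> = \<delta> \<or> \<gamma> \<lless> \<delta> \<or> \<delta> \<lless> \<gamma>"
      using k_total[OF lt_field(2)[OF bg] lt_field(2)[OF d]] by (auto simp: lt_iff)
    then have "inc \<delta> \<cdot> ii (S \<delta>) \<beta> = inc \<gamma> \<cdot> ii (S \<gamma>) \<beta>"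
      using *[OF bg] *[OF d] by metis
    then show ?thesis by (simp add: inc'_def \<delta>_def[symmetric] Let_def)
  qed
  have inc': "inc' \<gamma> \<in> Arr C" "Dom C (inc' \<gamma>) = Dom C (yy (S \<gamma>))" "Cod C (inc' \<gamma>) = X"
    "inc' \<gamma> \<cdot> jj (S \<gamma>) = inc \<gamma>" "xk \<cdot> inc' \<gamma> = yy (S \<gamma>)" if g: "\<gamma> \<in> Field \<kappa>" for \<gamma>
  proof -
    obtain \<delta> where d: "\<gamma> \<lless> \<delta>" using successor[OF g] by blast
    note e = inc'_eq[OF d] and f = lt_field(2)[OF d]
    note W = st[OF f d] and i = inc[OF f]
    have "(\<gamma>, \<delta>) \<in> \<kappa>" using d by (simp add: lt_iff)
    note T = inctr[OF this]
    show "inc' \<gamma> \<in> Arr C" "Dom C (inc' \<gamma>) = Dom C (yy (S \<gamma>))" "Cod C (inc' \<gamma>) = X"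
      using W(1-3) i e by (simp_all add: x_def)
    show "inc' \<gamma> \<cdot> jj (S \<gamma>) = inc \<gamma>"
      using T W(1-3) i cx(11-16)[OF g] trs[OF d] by (simp add: e x_def)
    show "xk \<cdot> inc' \<gamma> = yy (S \<gamma>)"
      using comp_eq_assoc[OF xk(4)[OF f], of "ii (S \<delta>) \<gamma>"] W(1-4) i xk by (simp add: e x_def)
  qed
  \<comment> \<open>The cell at stage \<gamma>, pushed into the colimit. It is a diagonal of the
    counit square D x_\<gamma> -> x_\<gamma> followed by the inclusion into X, hence a filler of all
    problems at stage \<gamma> at once.\<close>
  define \<tau> where "\<tau> = (\<lambda>\<gamma>. inc' \<gamma> \<cdot> tt (S \<gamma>))"
  have \<tau>: "\<tau> \<gamma> \<in> Arr C" "Dom C (\<tau> \<gamma>) = Cod C (omap D (x \<gamma>))" "Cod C (\<tau> \<gamma>) = X"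
    "\<tau> \<gamma> \<cdot> omap D (x \<gamma>) = inc \<gamma> \<cdot> upper (eps (x \<gamma>))" "xk \<cdot> \<tau> \<gamma> = lower (eps (x \<gamma>))" if g: "\<gamma> \<in> Field \<kappa>" for \<gamma>
  proof -
    note i = inc'[OF g] and c = cx[OF g, folded x_def] and e = eps[OF x(1)[OF g]]
    show "\<tau> \<gamma> \<in> Arr C" "Dom C (\<tau> \<gamma>) = Cod C (omap D (x \<gamma>))" "Cod C (\<tau> \<gamma>) = X"
      using i c(17-19) by (simp_all add: \<tau>_def x_def)
    have "inc' \<gamma> \<cdot> tt (S \<gamma>) \<cdot> omap D (x \<gamma>) = inc' \<gamma> \<cdot> jj (S \<gamma>) \<cdot> upper (eps (x \<gamma>))"
      using c(21) by (simp add: x_def)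
    also have "\<dots> = inc \<gamma> \<cdot> upper (eps (x \<gamma>))"
      using comp_eq_assoc[OF i(4), of "upper (eps (x \<gamma>))"] i(1-3) e c(11-16) by (simp add: x_def)
    finally show "\<tau> \<gamma> \<cdot> omap D (x \<gamma>) = inc \<gamma> \<cdot> upper (eps (x \<gamma>))"
      using i(1-3) c(17-19) x[OF g] by (simp add: \<tau>_def x_def)
    show "xk \<cdot> \<tau> \<gamma> = lower (eps (x \<gamma>))"
      using comp_eq_assoc[OF i(5), of "tt (S \<gamma>)"] i(1-3) c(17-20) xk by (simp add: \<tau>_def x_def)
  qed
  \<comment> \<open>Moving a problem to a later stage does not change its filler. This is exactly
    what attaching over the latching object has enforced.\<close>
  have \<tau>tr: "\<tau> \<gamma> \<cdot> lower (coproj (x \<gamma>) i (tr \<beta> \<gamma> \<cdot> p) q) = \<tau> \<beta> \<cdot> lower (coproj (x \<beta>) i p q)"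
    if bg: "(\<beta>, \<gamma>) \<in> \<kappa>" and pr: "problem i (x \<beta>) p q" for \<beta> \<gamma> i p q
  proof (cases "\<beta> = \<gamma>")
    case True
    then show ?thesis using pr by (simp add: tr_def problem_iff)
  next
    case False
    then have lt: "\<beta> \<lless> \<gamma>" using bg by (simp add: lt_iff)
    note f = lt_field[OF lt] and t = tr[OF bg]
    note W = st[OF f(2) lt] and I = coproj_sq[OF pr] and dI = D_coproj(2)[OF t(5) pr] and ds = D_sq[OF t(5)]
    note d = squaresD[OF ds(1), unfolded ds(2,3)]
    have "K.cell_sq S \<beta> \<gamma> (S \<gamma>) = amap D (Sq (x \<beta>) (x \<gamma>) (tr \<beta> \<gamma>) ?B)"
      using lt by (simp add: K.cell_sq_def x_def trs)
    then have "tt (S \<gamma>) \<cdot> lower (amap D (Sq (x \<beta>) (x \<gamma>) (tr \<beta> \<gamma>) ?B)) = jj (S \<gamma>) \<cdot> ii (S \<gamma>) \<beta> \<cdot> tt (S \<beta>)"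
      using W(6) by simp
    then have "\<tau> \<gamma> \<cdot> lower (amap D (Sq (x \<beta>) (x \<gamma>) (tr \<beta> \<gamma>) ?B)) = inc' \<gamma> \<cdot> jj (S \<gamma>) \<cdot> ii (S \<gamma>) \<beta> \<cdot> tt (S \<beta>)"
      using inc'(1-3)[OF f(2)] cx(17-19)[OF f(2)] d(4,7,8) by (simp add: \<tau>_def x_def)
    also have "\<dots> = inc \<gamma> \<cdot> ii (S \<gamma>) \<beta> \<cdot> tt (S \<beta>)"
      using comp_eq_assoc[OF inc'(4)[OF f(2)], of "ii (S \<gamma>) \<beta> \<cdot> tt (S \<beta>)"] inc'(1-3)[OF f(2)] cx(11-19)[OF f(2)]
        cx(17-19)[OF f(1)] W(1-3) by (simp add: x_def)
    also have "\<dots> = \<tau> \<beta>"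
      using inc'_eq[OF lt] inc[OF f(2)] cx(17-19)[OF f(1)] W(1-3) by (simp add: \<tau>_def x_def)
    finally have "\<tau> \<gamma> \<cdot> lower (amap D (Sq (x \<beta>) (x \<gamma>) (tr \<beta> \<gamma>) ?B)) = \<tau> \<beta>" .
    from comp_eq_assoc[OF this, of "lower (coproj (x \<beta>) i p q)"]
    have "\<tau> \<gamma> \<cdot> lower (coproj (x \<gamma>) i (tr \<beta> \<gamma> \<cdot> p) (?B \<cdot> q)) = \<tau> \<beta> \<cdot> lower (coproj (x \<beta>) i p q)"
      using dI d(4,7,8) I \<tau>(1-3)[OF f(2)] by simp
    moreover have "?B \<cdot> q = q" using pr x[OF f(1)] f0 by (simp add: problem_iff)
    ultimately show ?thesis by simp
  qed
  \<comment> \<open>Only the upper side is factored; the lower side maps to the common base of all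
    stages and stays \<open>q\<close>.\<close>
  have factor: "\<exists>\<gamma> p'. \<gamma> \<in> Field \<kappa> \<and> problem i (x \<gamma>) p' q \<and> inc \<gamma> \<cdot> p' = p" if pr: "problem i xk p q" for i p q
  proof -
    have i: "i \<in> Obj J" and p: "p \<in> Arr C" "Dom C p = Dom C (omap u i)" "Cod C p = X"
      using pr xk by (auto simp: problem_iff)
    obtain \<gamma> p' where g: "\<gamma> \<in> Field \<kappa>" "p' \<in> Arr C" "Dom C p' = Dom C (omap u i)" "Cod C p' = Dom C (x \<gamma>)" "inc \<gamma> \<cdot> p' = p"
      using small_factor[OF small[OF i] F col nonempty p] by (auto simp: F_def)
    have "x \<gamma> \<cdot> p' = xk \<cdot> p"
      using comp_eq_assoc[OF xk(4)[OF g(1)], of p'] g xk inc[OF g(1)] by simp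
    then have "problem i (x \<gamma>) p' q" using g pr xk x[OF g(1)] by (simp add: problem_iff)
    then show ?thesis using g by blast
  qed
  have lift_problem: "problem i xk (inc \<gamma> \<cdot> p) q" if "\<gamma> \<in> Field \<kappa>" "problem i (x \<gamma>) p q" for \<gamma> i p q
    using that comp_eq_assoc[OF xk(4)[OF that(1)], of p] xk x[OF that(1)] inc[OF that(1)] by (simp add: problem_iff)
  \<comment> \<open>The upper sides of two factorizations become equal at some later stage by
    \<open>small_equal\<close>, and fillers are stable under passing to later stages.\<close>
  have indep: "\<tau> \<gamma> \<cdot> lower (coproj (x \<gamma>) i p q) = \<tau> \<gamma>' \<cdot> lower (coproj (x \<gamma>') i p' q)"
    if g: "\<gamma> \<in> Field \<kappa>" "problem i (x \<gamma>) p q" and g': "\<gamma>' \<in> Field \<kappa>" "problem i (x \<gamma>') p' q"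
      and eq: "inc \<gamma> \<cdot> p = inc \<gamma>' \<cdot> p'" for \<gamma> \<gamma>' i p p' q
  proof -
    obtain \<delta> where d: "(\<gamma>, \<delta>) \<in> \<kappa>" "(\<gamma>', \<delta>) \<in> \<kappa>" using g(1) g'(1) k_total k_refl by metis
    then have df: "\<delta> \<in> Field \<kappa>" using k_iff by blast
    have i: "i \<in> Obj J" using g by (simp add: problem_iff)
    let ?p = "tr \<gamma> \<delta> \<cdot> p" and ?p' = "tr \<gamma>' \<delta> \<cdot> p'"
    have qq: "?B \<cdot> q = q" using g x[OF g(1)] by (simp add: problem_iff)
    have pr: "problem i (x \<delta>) ?p q" "problem i (x \<delta>) ?p' q"
      using problem_comp[OF g(2) tr(5)[OF d(1)]] problem_comp[OF g'(2) tr(5)[OF d(2)]] qq by simp_all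
    have "inc \<delta> \<cdot> ?p = inc \<delta> \<cdot> ?p'"
      using comp_eq_assoc[OF inctr[OF d(1)], of p] comp_eq_assoc[OF inctr[OF d(2)], of p'] eq g g' tr[OF d(1)] tr[OF d(2)] inc[OF df]
      by (simp add: problem_iff)
    then obtain \<epsilon> where e: "(\<delta>, \<epsilon>) \<in> \<kappa>" "tr \<delta> \<epsilon> \<cdot> ?p = tr \<delta> \<epsilon> \<cdot> ?p'"
      using small_equal[OF small[OF i] F col df, of ?p ?p'] pr by (auto simp: F_def problem_iff)
    have "\<tau> \<gamma> \<cdot> lower (coproj (x \<gamma>) i p q) = \<tau> \<epsilon> \<cdot> lower (coproj (x \<epsilon>) i (tr \<delta> \<epsilon> \<cdot> ?p) q)"
      using \<tau>tr[OF d(1) g(2)] \<tau>tr[OF e(1) pr(1)] by simp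
    also have "\<dots> = \<tau> \<gamma>' \<cdot> lower (coproj (x \<gamma>') i p' q)"
      unfolding e(2) using \<tau>tr[OF d(2) g'(2)] \<tau>tr[OF e(1) pr(2)] by simp
    finally show ?thesis .
  qed
  define \<Theta> where "\<Theta> = (\<lambda>i p q. SOME r. \<exists>\<gamma> p'. \<gamma> \<in> Field \<kappa> \<and> problem i (x \<gamma>) p' q \<and> inc \<gamma> \<cdot> p' = p \<and>
     r = \<tau> \<gamma> \<cdot> lower (coproj (x \<gamma>) i p' q))"
  have \<Theta>: "\<Theta> i (inc \<gamma> \<cdot> p) q = \<tau> \<gamma> \<cdot> lower (coproj (x \<gamma>) i p q)" if g: "\<gamma> \<in> Field \<kappa>" "problem i (x \<gamma>) p q" for \<gamma> i p q
    unfolding \<Theta>_def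
  proof (rule someI2)
    show "\<exists>\<gamma>' p'. \<gamma>' \<in> Field \<kappa> \<and> problem i (x \<gamma>') p' q \<and> inc \<gamma>' \<cdot> p' = inc \<gamma> \<cdot> p \<and>
       \<tau> \<gamma> \<cdot> lower (coproj (x \<gamma>) i p q) = \<tau> \<gamma>' \<cdot> lower (coproj (x \<gamma>') i p' q)"
      using g by blast
  next
    fix r assume "\<exists>\<gamma>' p'. \<gamma>' \<in> Field \<kappa> \<and> problem i (x \<gamma>') p' q \<and> inc \<gamma>' \<cdot> p' = inc \<gamma> \<cdot> p \<and> r = \<tau> \<gamma>' \<cdot> lower (coproj (x \<gamma>') i p' q)"
    then show "r = \<tau> \<gamma> \<cdot> lower (coproj (x \<gamma>) i p q)" using indep[OF g] by metis
  qed
  define r where "r = lifting_of xk \<Theta>"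
  have fstr [simp]: "fst r = xk" by (simp add: r_def)
  have rfill: "filler r i (inc \<gamma> \<cdot> p) q = \<tau> \<gamma> \<cdot> lower (coproj (x \<gamma>) i p q)" if g: "\<gamma> \<in> Field \<kappa>" "problem i (x \<gamma>) p q" for \<gamma> i p q
    using \<Theta>[OF g] lift_problem[OF g] by (simp add: r_def)
  \<comment> \<open>The two triangles hold by the equations for \<tau>, naturality in J by
    \<open>coproj_precomp\<close>.\<close>
  have rV: "r \<in> V"
    unfolding r_def
  proof (rule lifting_ofI[OF xk(1)])
    fix i p q assume "problem i xk p q"
    then obtain \<gamma> p' where g: "\<gamma> \<in> Field \<kappa>" and pr: "problem i (x \<gamma>) p' q" and p: "p = inc \<gamma> \<cdot> p'" using factor by metis
    note I = coproj_sq[OF pr] and t = \<tau>[OF g] and e = eps[OF x(1)[OF g]] and ei = eps_coproj[OF x(1)[OF g] pr]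
    have xx: "x \<gamma> \<in> Arr C" using x g by blast
    have "\<tau> \<gamma> \<cdot> lower (coproj (x \<gamma>) i p' q) \<cdot> omap u i = \<tau> \<gamma> \<cdot> omap D (x \<gamma>) \<cdot> upper (coproj (x \<gamma>) i p' q)"
      using I(10) by simp
    also have "\<dots> = inc \<gamma> \<cdot> p'"
      using comp_eq_assoc[OF t(4), of "upper (coproj (x \<gamma>) i p' q)"] t(1-3) I(4-9) e(4-9) inc[OF g] ei xx by simp
    finally have 1: "\<tau> \<gamma> \<cdot> lower (coproj (x \<gamma>) i p' q) \<cdot> omap u i = inc \<gamma> \<cdot> p'" .
    have 2: "xk \<cdot> \<tau> \<gamma> \<cdot> lower (coproj (x \<gamma>) i p' q) = q"
      using comp_eq_assoc[OF t(5), of "lower (coproj (x \<gamma>) i p' q)"] t(1-3) I(4-9) xk(1-3) ei by simp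
    show "\<Theta> i p q \<in> Arr C \<and> Dom C (\<Theta> i p q) = Cod C (omap u i) \<and> Cod C (\<Theta> i p q) = Dom C xk \<and>
      \<Theta> i p q \<cdot> omap u i = p \<and> xk \<cdot> \<Theta> i p q = q"
      unfolding p \<Theta>[OF g pr] using 1 2 t(1-3) I(4-9) xk(1-3) pr by (simp add: problem_iff)
  next
    fix t p q assume t: "t \<in> Arr J" and "problem (Cod J t) xk p q"
    then obtain \<gamma> p' where g: "\<gamma> \<in> Field \<kappa>" and pr: "problem (Cod J t) (x \<gamma>) p' q" and p: "p = inc \<gamma> \<cdot> p'" using factor by metis
    note pr' = problem_precomp[OF pr t] and ut = u_sq[OF t]
    have "p \<cdot> upper (amap u t) = inc \<gamma> \<cdot> p' \<cdot> upper (amap u t)"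
      using pr ut inc[OF g] by (simp add: p problem_iff)
    then show "\<Theta> (Dom J t) (p \<cdot> upper (amap u t)) (q \<cdot> lower (amap u t)) = \<Theta> (Cod J t) p q \<cdot> lower (amap u t)"
      using \<Theta>[OF g pr'] \<Theta>[OF g pr] coproj_precomp[OF t pr] \<tau>(1-3)[OF g] coproj_sq[OF pr] ut by (simp add: p)
  qed
  obtain \<gamma>0 where g0: "\<gamma>0 \<in> Field \<kappa>" using nonempty by blast
  \<comment> \<open>Any index gives the same arrow by \<open>l_eq\<close>, but one must exist:
    \<kappa> > 0.\<close>
  define l where "l = inc \<gamma>0 \<cdot> zz (S \<gamma>0)"
  have l_eq: "inc \<gamma> \<cdot> zz (S \<gamma>) = l" if g: "\<gamma> \<in> Field \<kappa>" for \<gamma>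
  proof -
    have *: "inc \<gamma> \<cdot> zz (S \<gamma>) = inc \<delta> \<cdot> zz (S \<delta>)" if gd: "\<gamma> \<lless> \<delta>" for \<gamma> \<delta>
    proof -
      note f = lt_field[OF gd]
      have "(\<gamma>, \<delta>) \<in> \<kappa>" using gd by (simp add: lt_iff)
      note T = inctr[OF this]
      show ?thesis
        using comp_eq_assoc[OF T, of "zz (S \<gamma>)"] st(5)[OF f(2) gd] st(1-3)[OF f(2) gd] trs[OF gd] cx(5-16)[OF f(1)] inc[OF f(2)]
        by (simp add: x_def)
    qed
    have "\<gamma> = \<gamma>0 \<or> \<gamma> \<lless> \<gamma>0 \<or> \<gamma>0 \<lless> \<gamma>" using k_total[OF g g0] by (auto simp: lt_iff)
    then show ?thesis unfolding l_def using * by metis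
  qed
  have l: "l \<in> Arr C" "Dom C l = Dom C f0" "Cod C l = X" "xk \<cdot> l = f0"
    using comp_eq_assoc[OF xk(4)[OF g0], of "zz (S \<gamma>0)"] cx(5-10)[OF g0] inc[OF g0] xk by (simp_all add: l_def x_def)
  have "free_lifting f0 l r"
    unfolding free_lifting_def
  proof (intro conjI allI impI)
    fix w h k assume w: "w \<in> V" and sq: "Sq f0 (fst w) h k \<in> squares C"
    have h: "h \<in> Arr C" "Dom C h = Dom C f0" and hh: "Cod C h = Dom C (fst w)" using sq by auto
    have k: "k \<in> Arr C" "Dom C k = Cod C f0" "Cod C k = Cod C (fst w)" "fst w \<cdot> h = k \<cdot> f0" and fw: "fst w \<in> Arr C" using sq by auto
    \<comment> \<open>\<open>?Inv\<close> says that the partial map \<open>y\<close> lies over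
      \<open>k\<close>; then \<open>D_lift\<close> provides a value on the cell. The last clause of
      \<open>?Q\<close> determines this value by \<open>D_cod_unique\<close>, so choosing it with
      \<open>SOME\<close> does no harm.\<close>
    let ?Inv = "\<lambda>\<gamma> y. fst w \<cdot> y = k \<cdot> x \<gamma>"
    let ?Q = "\<lambda>\<gamma> y K. K \<in> Arr C \<and> Dom C K = Cod C (omap D (x \<gamma>)) \<and> Cod C K = Dom C (fst w) \<and>
       K \<cdot> omap D (x \<gamma>) = y \<cdot> upper (eps (x \<gamma>)) \<and> fst w \<cdot> K = k \<cdot> lower (eps (x \<gamma>)) \<and>
       (\<forall>i p q. problem i (x \<gamma>) p q \<longrightarrow> K \<cdot> lower (coproj (x \<gamma>) i p q) = filler w i (y \<cdot> p) (k \<cdot> q))"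
    define Kf where "Kf = (\<lambda>\<gamma> y. SOME K. ?Q \<gamma> y K)"
    have Q: "?Q \<gamma> y (Kf \<gamma> y)" if "\<gamma> \<in> Field \<kappa>" "y \<in> Arr C" "Dom C y = Dom C (x \<gamma>)" "Cod C y = Cod C h" "?Inv \<gamma> y" for \<gamma> y
    proof -
      have "Sq (x \<gamma>) (fst w) y k \<in> squares C" using that x[OF that(1)] k fw hh by simp
      then have "\<exists>K. ?Q \<gamma> y K" using D_lift[OF w] by blast
      then show ?thesis unfolding Kf_def by (rule someI_ex)
    qed
    obtain Y Y' where
      Y: "\<And>\<gamma>. \<gamma> \<in> Field \<kappa> \<Longrightarrow> Y \<gamma> \<in> Arr C \<and> Dom C (Y \<gamma>) = Dom C (xx (S \<gamma>)) \<and> Cod C (Y \<gamma>) = Cod C h \<and>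
         Y \<gamma> \<cdot> zz (S \<gamma>) = h \<and> ?Inv \<gamma> (Y \<gamma>)"
      and YY: "\<And>\<beta> \<gamma>. \<gamma> \<in> Field \<kappa> \<Longrightarrow> \<beta> \<lless> \<gamma> \<Longrightarrow> Y \<gamma> \<cdot> ii (S \<gamma>) \<beta> = Y' \<beta>"
      and Y': "\<And>\<gamma>. \<gamma> \<in> Field \<kappa> \<Longrightarrow> Y' \<gamma> \<in> Arr C \<and> Dom C (Y' \<gamma>) = Dom C (yy (S \<gamma>)) \<and> Cod C (Y' \<gamma>) = Cod C h \<and>
         Y' \<gamma> \<cdot> jj (S \<gamma>) = Y \<gamma> \<and> Y' \<gamma> \<cdot> tt (S \<gamma>) = Kf \<gamma> (Y \<gamma>)"
    proof (rule K.complex_out[where Inv = ?Inv and K = Kf, OF S _ h], goal_cases)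
      case (1 \<beta> \<gamma>) then show ?case using lt_field by blast
    next
      case (2 \<gamma> y)
      note q = Q[OF 2(2,3) 2(4)[unfolded x_app] 2(5,7)]
      have "Kf \<gamma> y \<cdot> lower (K.cell_sq S \<beta> \<gamma> (S \<gamma>)) = Kf \<beta> (y \<cdot> ii (S \<gamma>) \<beta> \<cdot> jj (S \<beta>))" if b: "\<beta> \<lless> \<gamma>" for \<beta>
      proof -
        have bg: "(\<beta>, \<gamma>) \<in> \<kappa>" using b by (simp add: lt_iff)
        note f = lt_field[OF b] and t = tr[OF bg]
        note ds = D_sq[OF t(5)]
        note d = squaresD[OF ds(1), unfolded ds(2,3)]
        have cs: "K.cell_sq S \<beta> \<gamma> (S \<gamma>) = amap D (Sq (x \<beta>) (x \<gamma>) (tr \<beta> \<gamma>) ?B)"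
          using b by (simp add: K.cell_sq_def x_def trs)
        have y: "y \<cdot> tr \<beta> \<gamma> \<in> Arr C" "Dom C (y \<cdot> tr \<beta> \<gamma>) = Dom C (x \<beta>)" "Cod C (y \<cdot> tr \<beta> \<gamma>) = Cod C h"
          using 2 t by (simp_all add: x_def)
        have inv: "?Inv \<beta> (y \<cdot> tr \<beta> \<gamma>)"
          using comp_eq_assoc[OF 2(7), of "tr \<beta> \<gamma>"] 2 t fw hh k x[OF f(2)] by (simp add: x_def)
        note q' = Q[OF f(1) y inv]
        \<comment> \<open>Both sides are tested on coprojections, where each is the filler in
          \<open>w\<close> of the same problem.\<close>
        have "Kf \<gamma> y \<cdot> lower (amap D (Sq (x \<beta>) (x \<gamma>) (tr \<beta> \<gamma>) ?B)) = Kf \<beta> (y \<cdot> tr \<beta> \<gamma>)"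
        proof (rule D_cod_unique[OF x(1)[OF f(1)]])
          fix i p q assume pr: "problem i (x \<beta>) p q"
          note I = coproj_sq[OF pr]
          have B: "?B \<cdot> q = q" using pr x[OF f(1)] by (simp add: problem_iff)
          have pr': "problem i (x \<gamma>) (tr \<beta> \<gamma> \<cdot> p) q" using problem_comp[OF pr t(5)] B by simp
          have "Kf \<gamma> y \<cdot> lower (amap D (Sq (x \<beta>) (x \<gamma>) (tr \<beta> \<gamma>) ?B)) \<cdot> lower (coproj (x \<beta>) i p q)
             = filler w i (y \<cdot> tr \<beta> \<gamma> \<cdot> p) (k \<cdot> q)"
            using D_coproj(2)[OF t(5) pr] B q pr' by simp
          also have "\<dots> = Kf \<beta> (y \<cdot> tr \<beta> \<gamma>) \<cdot> lower (coproj (x \<beta>) i p q)"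
            using q' pr 2 t by (simp add: problem_iff x_def)
          finally show "(Kf \<gamma> y \<cdot> lower (amap D (Sq (x \<beta>) (x \<gamma>) (tr \<beta> \<gamma>) ?B))) \<cdot> lower (coproj (x \<beta>) i p q)
             = Kf \<beta> (y \<cdot> tr \<beta> \<gamma>) \<cdot> lower (coproj (x \<beta>) i p q)"
            using I d(4,7,8) q by simp
        qed (use d(4,7,8) q q' in simp_all)
        then show ?thesis using cs trs[OF b] by simp
      qed
      then show ?case using q hh by (simp add: x_def)
    next
      \<comment> \<open>Lying over \<open>k\<close> passes to X'_\<beta> by the lower triangle of
        the value on the cell, and from all X'_\<beta> to the colimit X_\<gamma>.\<close>
      case (3 \<gamma> y Y')
      note c = cx[OF 3(2)] and W = st[OF 3(2)]
      have "fst w \<cdot> y = k \<cdot> xx (S \<gamma>)"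
      proof (rule stage_colimit_unique[OF c(2)])
        show "(fst w \<cdot> y) \<cdot> zz (S \<gamma>) = (k \<cdot> xx (S \<gamma>)) \<cdot> zz (S \<gamma>)"
          using 3 c k fw hh by simp
        fix \<beta> assume b: "\<beta> \<lless> \<gamma>"
        note f = lt_field[OF b] and B = 3(7)[OF b] and cb = cx[OF lt_field(1)[OF b]]
        have yj: "Y' \<beta> \<cdot> jj (S \<beta>) \<in> Arr C" "Dom C (Y' \<beta> \<cdot> jj (S \<beta>)) = Dom C (x \<beta>)" "Cod C (Y' \<beta> \<cdot> jj (S \<beta>)) = Cod C h"
          using B cb by (simp_all add: x_def)
        note q = Q[OF f(1) yj]
        have "fst w \<cdot> Y' \<beta> = k \<cdot> yy (S \<beta>)"
          by (rule K.stage_cell_unique[OF cb(3)]) (use B cb k fw hh q in \<open>simp_all add: x_def\<close>)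
        then show "(fst w \<cdot> y) \<cdot> ii (S \<gamma>) \<beta> = (k \<cdot> xx (S \<gamma>)) \<cdot> ii (S \<gamma>) \<beta>"
          using B W(1-4)[OF b] 3 c k fw hh by simp
      qed (use 3 c k fw hh in simp_all)
      then show ?case by (simp add: x_def)
    next
      case (4 Y Y')
      show ?case by (rule 4(1)[of Y Y']) (use 4(2-4) in simp_all)
    qed
    have "is_cocone (poset_cat \<kappa>) C F (Cod C h) Y"
    proof (rule cocone_iff)
      fix \<beta> \<gamma> assume bg: "(\<beta>, \<gamma>) \<in> \<kappa>"
      then have f: "\<beta> \<in> Field \<kappa>" "\<gamma> \<in> Field \<kappa>" using k_iff by auto
      show "Y \<gamma> \<cdot> tr \<beta> \<gamma> = Y \<beta>"
      proof (cases "\<beta> = \<gamma>")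
        case True
        then show ?thesis using Y[OF f(1)] by (simp add: tr_def x_def)
      next
        case False
        then have b: "\<beta> \<lless> \<gamma>" using bg by (simp add: lt_iff)
        show ?thesis
          using comp_eq_assoc[OF YY[OF f(2) b], of "jj (S \<beta>)"] Y'[OF f(1)] Y[OF f(2)] st(1-3)[OF f(2) b] cx(11-16)[OF f(1)] trs[OF b] by simp
      qed
    qed (use h Y in \<open>simp_all add: x_def\<close>)
    then obtain e where e: "e \<in> hom C X (Cod C h)" "\<And>\<gamma>. \<gamma> \<in> Obj (poset_cat \<kappa>) \<Longrightarrow> e \<cdot> inc \<gamma> = Y \<gamma>"
      using colimit_out[OF col] by blast
    then have e': "e \<in> Arr C" "Dom C e = X" "Cod C e = Dom C (fst w)" "\<And>\<gamma>. \<gamma> \<in> Field \<kappa> \<Longrightarrow> e \<cdot> inc \<gamma> = Y \<gamma>"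
      using hh by (auto simp: hom_def)
    have el: "e \<cdot> l = h"
      using comp_eq_assoc[OF e'(4)[OF g0], of "zz (S \<gamma>0)"] e' inc[OF g0] cx(5-10)[OF g0] Y[OF g0] by (simp add: l_def x_def)
    have wek: "fst w \<cdot> e = k \<cdot> xk"
    proof (rule colimit_unique[OF col])
      show "fst w \<cdot> e \<in> hom C X (Cod C (fst w))" "k \<cdot> xk \<in> hom C X (Cod C (fst w))"
        using e' k fw xk by (simp_all add: hom_def)
      fix \<gamma> assume "\<gamma> \<in> Obj (poset_cat \<kappa>)"
      then have g: "\<gamma> \<in> Field \<kappa>" by simp
      show "(fst w \<cdot> e) \<cdot> inc \<gamma> = (k \<cdot> xk) \<cdot> inc \<gamma>"
        using e' k fw xk inc[OF g] Y[OF g] g by simp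
    qed
    \<comment> \<open>The value on the cell survives in the colimit because X'_\<gamma> maps to a
      later stage.\<close>
    have e\<tau>: "e \<cdot> \<tau> \<gamma> = Kf \<gamma> (Y \<gamma>)" if g: "\<gamma> \<in> Field \<kappa>" for \<gamma>
    proof -
      obtain \<delta> where d: "\<gamma> \<lless> \<delta>" using successor[OF g] by blast
      note f = lt_field(2)[OF d]
      have ei: "e \<cdot> inc' \<gamma> = Y' \<gamma>"
        using comp_eq_assoc[OF e'(4)[OF f], of "ii (S \<delta>) \<gamma>"] inc'_eq[OF d] YY[OF f d] st(1-3)[OF f d] inc[OF f] e' by (simp add: x_def)
      show ?thesis
        using comp_eq_assoc[OF ei, of "tt (S \<gamma>)"] Y'[OF g] inc'(1-3)[OF g] cx(17-19)[OF g] e' by (simp add: \<tau>_def)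
    qed
    have "filler w i (e \<cdot> p) (k \<cdot> q) = e \<cdot> filler r i p q" if "problem i xk p q" for i p q
    proof -
      obtain \<gamma> p' where g: "\<gamma> \<in> Field \<kappa>" and pr: "problem i (x \<gamma>) p' q" and p: "p = inc \<gamma> \<cdot> p'" using factor[OF \<open>problem i xk p q\<close>] by metis
      note I = coproj_sq[OF pr]
      have ep: "e \<cdot> inc \<gamma> \<cdot> p' = Y \<gamma> \<cdot> p'"
        using comp_eq_assoc[OF e'(4)[OF g], of p'] e' inc[OF g] pr by (simp add: problem_iff)
      have "Y \<gamma> \<in> Arr C" "Dom C (Y \<gamma>) = Dom C (x \<gamma>)" "Cod C (Y \<gamma>) = Cod C h" "?Inv \<gamma> (Y \<gamma>)" using Y[OF g] by (auto simp: x_def)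
      from Q[OF g this] have "Kf \<gamma> (Y \<gamma>) \<cdot> lower (coproj (x \<gamma>) i p' q) = filler w i (Y \<gamma> \<cdot> p') (k \<cdot> q)" using pr by blast
      then have "e \<cdot> \<tau> \<gamma> \<cdot> lower (coproj (x \<gamma>) i p' q) = filler w i (Y \<gamma> \<cdot> p') (k \<cdot> q)"
        using comp_eq_assoc[OF e\<tau>[OF g], of "lower (coproj (x \<gamma>) i p' q)"] e' \<tau>(1-3)[OF g] I by simp
      then show ?thesis using ep rfill[OF g pr] by (simp add: p)
    qed
    then have "lmor r w e k"
      using rV w wek e' xk k fw by (simp add: lmor_def)
    then show "\<exists>e. lmor r w e k \<and> e \<cdot> l = h" using el by blast
  next
    fix w e e' k assume m: "lmor r w e k" and m': "lmor r w e' k" and el: "e \<cdot> l = e' \<cdot> l"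
    have e: "e \<in> Arr C" "Dom C e = X" "Cod C e = Dom C (fst w)" and e': "e' \<in> Arr C" "Dom C e' = X" "Cod C e' = Dom C (fst w)"
      using m m' xk by (auto simp: lmor_def)
    have mf: "filler w i (e \<cdot> p) (k \<cdot> q) = e \<cdot> filler r i p q" "filler w i (e' \<cdot> p) (k \<cdot> q) = e' \<cdot> filler r i p q"
      if "problem i xk p q" for i p q
      using m m' that by (auto simp: lmor_def)
    \<comment> \<open>Agreement spreads along the stages: if \<open>e\<close> and \<open>e'\<close>
      agree on X_\<beta>, they agree on the cell attached there, because its coprojections become
      fillers and both morphisms preserve fillers.\<close>
    have "e \<cdot> inc \<gamma> = e' \<cdot> inc \<gamma>" if "\<gamma> \<in> Field \<kappa>" for \<gamma>
      using that
    proof (induction \<gamma> rule: lt_induct)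
      case (less \<gamma>)
      note g = less.prems
      note c = cx[OF g]
      show ?case
      proof (rule K.stage_unique[OF S _ c(2)])
        show "underS \<kappa> \<gamma> \<subseteq> Field \<kappa>" using lt_field by blast
        show "(e \<cdot> inc \<gamma>) \<cdot> zz (S \<gamma>) = (e' \<cdot> inc \<gamma>) \<cdot> zz (S \<gamma>)"
          using e e' inc[OF g] c l_eq[OF g] el by (simp add: x_def)
        fix \<beta> assume b: "\<beta> \<lless> \<gamma>"
        note f = lt_field[OF b] and ih = less.IH[OF b lt_field(1)[OF b]]
        have "e \<cdot> \<tau> \<beta> = e' \<cdot> \<tau> \<beta>"
        proof (rule D_cod_unique[OF x(1)[OF f(1)]])
          fix i p q assume pr: "problem i (x \<beta>) p q"
          note I = coproj_sq[OF pr] and lp = lift_problem[OF f(1) pr]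
          have "e \<cdot> inc \<beta> \<cdot> p = e' \<cdot> inc \<beta> \<cdot> p"
            using comp_eq_assoc[OF ih, of p] e e' inc[OF f(1)] pr by (simp add: problem_iff)
          then have "e \<cdot> \<tau> \<beta> \<cdot> lower (coproj (x \<beta>) i p q) = e' \<cdot> \<tau> \<beta> \<cdot> lower (coproj (x \<beta>) i p q)"
            using mf[OF lp] rfill[OF f(1) pr] by simp
          then show "(e \<cdot> \<tau> \<beta>) \<cdot> lower (coproj (x \<beta>) i p q) = (e' \<cdot> \<tau> \<beta>) \<cdot> lower (coproj (x \<beta>) i p q)"
            using e e' \<tau>(1-3)[OF f(1)] I by simp
        qed (use e e' \<tau>(1-3)[OF f(1)] in simp_all)
        moreover have "inc \<gamma> \<cdot> ii (S \<gamma>) \<beta> \<cdot> tt (S \<beta>) = \<tau> \<beta>"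
          using inc'_eq[OF b] inc[OF g] st(1-3)[OF g b] cx(17-19)[OF f(1)] by (simp add: \<tau>_def x_def)
        ultimately show "(e \<cdot> inc \<gamma>) \<cdot> ii (S \<gamma>) \<beta> \<cdot> tt (S \<beta>) = (e' \<cdot> inc \<gamma>) \<cdot> ii (S \<gamma>) \<beta> \<cdot> tt (S \<beta>)"
          using e e' inc[OF g] st(1-3)[OF g b] cx(17-19)[OF f(1)] by (simp add: x_def)
      qed (use e e' inc[OF g] in \<open>simp_all add: x_def\<close>)
    qed
    then show "e = e'"
      using colimit_unique[OF col, of e "Cod C e" e'] e e' by (simp add: hom_def)
  qed (use l rV xk in simp_all)
  then show ?thesis by blast
qed

end

section \<open>Double categories of structured arrows\<close>

lemma (in cat) squares_vcomp:
  assumes "Sq f g h k \<in> squares C" "Sq f' g' k m \<in> squares C"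
  shows "Sq (f' \<cdot> f) (g' \<cdot> g) h m \<in> squares C"
proof -
  have "g' \<cdot> g \<cdot> h = g' \<cdot> k \<cdot> f" using assms by simp
  also have "\<dots> = m \<cdot> f' \<cdot> f" using assms comp_eq_assoc[of g' k "m \<cdot> f'" f] by simp
  finally show ?thesis using assms by simp
qed

text \<open>Conditions on vertical arrows and on the square predicate under which
  \<open>structured_dblcat\<close> is a double category. They are verified for the squares of C, for
  lifting structures and for algebras.\<close>

locale structured = cat C
  for C :: "('o, 'm) category" (structure) +
  fixes V :: "'v set" and U :: "'v \<Rightarrow> 'm" and idV :: "'o \<Rightarrow> 'v" and compV :: "'v \<Rightarrow> 'v \<Rightarrow> 'v"
    and P :: "('v, 'm) sq \<Rightarrow> bool"
  assumes U_arr: "v \<in> V \<Longrightarrow> U v \<in> Arr C"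
    and idV: "A \<in> Obj C \<Longrightarrow> idV A \<in> V" "A \<in> Obj C \<Longrightarrow> U (idV A) = Ide C A"
    and compV: "v \<in> V \<Longrightarrow> w \<in> V \<Longrightarrow> Cod C (U v) = Dom C (U w) \<Longrightarrow> compV w v \<in> V"
      "v \<in> V \<Longrightarrow> w \<in> V \<Longrightarrow> Cod C (U v) = Dom C (U w) \<Longrightarrow> U (compV w v) = U w \<cdot> U v"
    and compV_id: "v \<in> V \<Longrightarrow> compV v (idV (Dom C (U v))) = v" "v \<in> V \<Longrightarrow> compV (idV (Cod C (U v))) v = v"
    and compV_assoc: "v \<in> V \<Longrightarrow> w \<in> V \<Longrightarrow> x \<in> V \<Longrightarrow> Cod C (U v) = Dom C (U w) \<Longrightarrow>
      Cod C (U w) = Dom C (U x) \<Longrightarrow> compV (compV x w) v = compV x (compV w v)"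
    and P_id: "v \<in> V \<Longrightarrow> P (Sq v v (Ide C (Dom C (U v))) (Ide C (Cod C (U v))))"
    and P_hcomp: "v \<in> V \<Longrightarrow> w \<in> V \<Longrightarrow> x \<in> V \<Longrightarrow> Sq (U v) (U w) h k \<in> squares C \<Longrightarrow>
      Sq (U w) (U x) h' k' \<in> squares C \<Longrightarrow> P (Sq v w h k) \<Longrightarrow> P (Sq w x h' k') \<Longrightarrow>
      P (Sq v x (h' \<cdot> h) (k' \<cdot> k))"
    and P_vid: "h \<in> Arr C \<Longrightarrow> P (Sq (idV (Dom C h)) (idV (Cod C h)) h h)"
    and P_vcomp: "v \<in> V \<Longrightarrow> w \<in> V \<Longrightarrow> v' \<in> V \<Longrightarrow> w' \<in> V \<Longrightarrow> Sq (U v) (U w) h k \<in> squares C \<Longrightarrow>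
      Sq (U v') (U w') k m \<in> squares C \<Longrightarrow> P (Sq v w h k) \<Longrightarrow> P (Sq v' w' k m) \<Longrightarrow>
      P (Sq (compV v' v) (compV w' w) h m)"
begin

definition S :: "('v, 'm) sq set" where
  "S = {\<beta>. src \<beta> \<in> V \<and> tgt \<beta> \<in> V \<and> underlying U \<beta> \<in> squares C \<and> P \<beta>}"

abbreviation dbl :: "('o, 'm, 'v, ('v, 'm) sq) dblcat" where
  "dbl \<equiv> structured_dblcat C V U idV compV P"

lemma S_Sq: "Sq v w h k \<in> S \<longleftrightarrow> v \<in> V \<and> w \<in> V \<and> Sq (U v) (U w) h k \<in> squares C \<and> P (Sq v w h k)"
  by (simp add: S_def underlying_def del: Sq_in_squares)

lemma SD:
  assumes "\<sigma> \<in> S"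
  shows "src \<sigma> \<in> V" "tgt \<sigma> \<in> V" "upper \<sigma> \<in> Arr C" "lower \<sigma> \<in> Arr C"
    "Dom C (upper \<sigma>) = Dom C (U (src \<sigma>))" "Cod C (upper \<sigma>) = Dom C (U (tgt \<sigma>))"
    "Dom C (lower \<sigma>) = Cod C (U (src \<sigma>))" "Cod C (lower \<sigma>) = Cod C (U (tgt \<sigma>))"
  using assms by (simp_all add: S_def underlying_def)

lemma dbl_sel:
  "Hor dbl = C"
  "Obj (Ver dbl) = Obj C" "Arr (Ver dbl) = V" "Dom (Ver dbl) v = Dom C (U v)" "Cod (Ver dbl) v = Cod C (U v)"
  "Ide (Ver dbl) = idV" "w \<cdot>\<^bsub>Ver dbl\<^esub> v = compV w v"
  "Obj (SqH dbl) = V" "Arr (SqH dbl) = S" "Dom (SqH dbl) = src" "Cod (SqH dbl) = tgt"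
  "Ide (SqH dbl) v = Sq v v (Ide C (Dom C (U v))) (Ide C (Cod C (U v)))"
  "\<tau> \<cdot>\<^bsub>SqH dbl\<^esub> \<sigma> = Sq (src \<sigma>) (tgt \<tau>) (upper \<tau> \<cdot> upper \<sigma>) (lower \<tau> \<cdot> lower \<sigma>)"
  "Obj (SqV dbl) = Arr C" "Arr (SqV dbl) = S" "Dom (SqV dbl) = upper" "Cod (SqV dbl) = lower"
  "Ide (SqV dbl) h = Sq (idV (Dom C h)) (idV (Cod C h)) h h"
  "\<tau> \<cdot>\<^bsub>SqV dbl\<^esub> \<sigma> = Sq (compV (src \<tau>) (src \<sigma>)) (compV (tgt \<tau>) (tgt \<sigma>)) (upper \<sigma>) (lower \<tau>)"
  by (simp_all add: structured_dblcat_def Let_def S_def)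

lemma S_hcomp:
  assumes "\<sigma> \<in> S" "\<tau> \<in> S" "tgt \<sigma> = src \<tau>"
  shows "Sq (src \<sigma>) (tgt \<tau>) (upper \<tau> \<cdot> upper \<sigma>) (lower \<tau> \<cdot> lower \<sigma>) \<in> S"
proof (cases \<sigma>; cases \<tau>)
  fix v w h k v' w' h' k' assume "\<sigma> = Sq v w h k" "\<tau> = Sq v' w' h' k'"
  then show ?thesis using assms P_hcomp[of v w w' h k h' k'] squares_comp[of "Sq (U v) (U w) h k" "Sq (U w) (U w') h' k'"]
    by (simp add: S_Sq del: Sq_in_squares)
qed

lemma S_vcomp:
  assumes "\<sigma> \<in> S" "\<tau> \<in> S" "lower \<sigma> = upper \<tau>"
  shows "Sq (compV (src \<tau>) (src \<sigma>)) (compV (tgt \<tau>) (tgt \<sigma>)) (upper \<sigma>) (lower \<tau>) \<in> S"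
proof (cases \<sigma>; cases \<tau>)
  fix v w h k v' w' h' k' assume e: "\<sigma> = Sq v w h k" "\<tau> = Sq v' w' h' k'"
  then have 1: "v \<in> V" "w \<in> V" "v' \<in> V" "w' \<in> V" "Sq (U v) (U w) h k \<in> squares C" "Sq (U v') (U w') k k' \<in> squares C"
    "P (Sq v w h k)" "P (Sq v' w' k k')" using assms by (simp_all add: S_Sq del: Sq_in_squares)
  then have "Cod C (U v) = Dom C (U v')" "Cod C (U w) = Dom C (U w')" by auto
  then show ?thesis using e assms(3) 1 P_vcomp[OF 1] squares_vcomp[OF 1(5,6)] compV
    by (simp add: S_Sq del: Sq_in_squares)
qed

lemma S_id: "v \<in> V \<Longrightarrow> Sq v v (Ide C (Dom C (U v))) (Ide C (Cod C (U v))) \<in> S"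
  using P_id U_arr by (simp add: S_Sq)

lemma S_vid: "h \<in> Arr C \<Longrightarrow> Sq (idV (Dom C h)) (idV (Cod C h)) h h \<in> S"
  using P_vid idV by (simp add: S_Sq)

lemma Ver_category: "is_category (Ver dbl)"
  unfolding is_category_def hom_def dbl_sel
  using idV compV compV_id compV_assoc U_arr by simp

lemma SqH_category: "is_category (SqH dbl)"
  unfolding is_category_def hom_def dbl_sel
proof (intro conjI ballI impI)
  fix \<sigma> assume s: "\<sigma> \<in> S"
  note d = SD[OF s]
  show "Sq (src (Sq (src \<sigma>) (src \<sigma>) (Ide C (Dom C (U (src \<sigma>)))) (Ide C (Cod C (U (src \<sigma>)))))) (tgt \<sigma>)
        (upper \<sigma> \<cdot> upper (Sq (src \<sigma>) (src \<sigma>) (Ide C (Dom C (U (src \<sigma>)))) (Ide C (Cod C (U (src \<sigma>))))))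
        (lower \<sigma> \<cdot> lower (Sq (src \<sigma>) (src \<sigma>) (Ide C (Dom C (U (src \<sigma>)))) (Ide C (Cod C (U (src \<sigma>)))))) = \<sigma>"
    using d by (cases \<sigma>) simp
  show "Sq (src \<sigma>) (tgt (Sq (tgt \<sigma>) (tgt \<sigma>) (Ide C (Dom C (U (tgt \<sigma>)))) (Ide C (Cod C (U (tgt \<sigma>))))))
        (upper (Sq (tgt \<sigma>) (tgt \<sigma>) (Ide C (Dom C (U (tgt \<sigma>)))) (Ide C (Cod C (U (tgt \<sigma>))))) \<cdot> upper \<sigma>)
        (lower (Sq (tgt \<sigma>) (tgt \<sigma>) (Ide C (Dom C (U (tgt \<sigma>)))) (Ide C (Cod C (U (tgt \<sigma>))))) \<cdot> lower \<sigma>) = \<sigma>"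
    using d by (cases \<sigma>) simp
qed (use SD S_id S_hcomp in simp_all)

lemma SqV_category: "is_category (SqV dbl)"
  unfolding is_category_def hom_def dbl_sel
proof (intro conjI ballI impI)
  fix \<sigma> assume s: "\<sigma> \<in> S"
  note d = SD[OF s]
  show "Sq (compV (src \<sigma>) (src (Sq (idV (Dom C (upper \<sigma>))) (idV (Cod C (upper \<sigma>))) (upper \<sigma>) (upper \<sigma>))))
        (compV (tgt \<sigma>) (tgt (Sq (idV (Dom C (upper \<sigma>))) (idV (Cod C (upper \<sigma>))) (upper \<sigma>) (upper \<sigma>))))
        (upper (Sq (idV (Dom C (upper \<sigma>))) (idV (Cod C (upper \<sigma>))) (upper \<sigma>) (upper \<sigma>))) (lower \<sigma>) = \<sigma>"
    using d compV_id by (cases \<sigma>) simp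
  show "Sq (compV (src (Sq (idV (Dom C (lower \<sigma>))) (idV (Cod C (lower \<sigma>))) (lower \<sigma>) (lower \<sigma>))) (src \<sigma>))
        (compV (tgt (Sq (idV (Dom C (lower \<sigma>))) (idV (Cod C (lower \<sigma>))) (lower \<sigma>) (lower \<sigma>))) (tgt \<sigma>))
        (upper \<sigma>) (lower (Sq (idV (Dom C (lower \<sigma>))) (idV (Cod C (lower \<sigma>))) (lower \<sigma>) (lower \<sigma>))) = \<sigma>"
    using d compV_id by (cases \<sigma>) simp
next
  fix f g h assume a: "f \<in> S" "g \<in> S" "h \<in> S" "lower f = upper g" "lower g = upper h"
  note d = SD[OF a(1)] SD[OF a(2)] SD[OF a(3)]
  have "compV (compV (src h) (src g)) (src f) = compV (src h) (compV (src g) (src f))"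
    "compV (compV (tgt h) (tgt g)) (tgt f) = compV (tgt h) (compV (tgt g) (tgt f))"
    by (rule compV_assoc; use d a(4,5) in metis)+
  then show "Sq (compV (src (Sq (compV (src h) (src g)) (compV (tgt h) (tgt g)) (upper g) (lower h))) (src f))
        (compV (tgt (Sq (compV (src h) (src g)) (compV (tgt h) (tgt g)) (upper g) (lower h))) (tgt f)) (upper f)
        (lower (Sq (compV (src h) (src g)) (compV (tgt h) (tgt g)) (upper g) (lower h))) =
       Sq (compV (src h) (src (Sq (compV (src g) (src f)) (compV (tgt g) (tgt f)) (upper f) (lower g))))
        (compV (tgt h) (tgt (Sq (compV (src g) (src f)) (compV (tgt g) (tgt f)) (upper f) (lower g))))
        (upper (Sq (compV (src g) (src f)) (compV (tgt g) (tgt f)) (upper f) (lower g))) (lower h)" by simp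
qed (use SD S_vid S_vcomp in simp_all)

text \<open>A square is determined by its four sides, so interchange compares two squares with the
  same entries.\<close>

lemma double_category: "is_double_category dbl"
proof -
  have c: "Cod C (U (src \<sigma>)) = Dom C (U (src \<tau>))" "Cod C (U (tgt \<sigma>)) = Dom C (U (tgt \<tau>))"
    if "\<sigma> \<in> S" "\<tau> \<in> S" "lower \<sigma> = upper \<tau>" for \<sigma> \<tau>
    using SD[OF that(1)] SD[OF that(2)] that(3) by metis+
  show ?thesis
    unfolding is_double_category_def is_functor_def
    using Ver_category SqH_category SqV_category cat
    by (auto simp: dbl_sel hom_def SD S_id S_vid S_hcomp S_vcomp U_arr idV compV c)
qed

end

text \<open>When objects and horizontal arrows are fixed, the action on squares is forced by the
  action on vertical arrows; what remains is to transport the square predicate.\<close>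

lemma structured_double_functor:
  assumes A: "structured C V U idV compV P" and B: "structured C V' U' idV' compV' P'"
    and V: "\<And>v. v \<in> V \<Longrightarrow> \<Phi> v \<in> V'" "\<And>v. v \<in> V \<Longrightarrow> U' (\<Phi> v) = U v"
    and id: "\<And>A. A \<in> Obj C \<Longrightarrow> \<Phi> (idV A) = idV' A"
    and comp: "\<And>v w. v \<in> V \<Longrightarrow> w \<in> V \<Longrightarrow> Cod C (U v) = Dom C (U w) \<Longrightarrow> \<Phi> (compV w v) = compV' (\<Phi> w) (\<Phi> v)"
    and P: "\<And>v w h k. v \<in> V \<Longrightarrow> w \<in> V \<Longrightarrow> Sq (U v) (U w) h k \<in> squares C \<Longrightarrow> P (Sq v w h k) \<Longrightarrow> P' (Sq (\<Phi> v) (\<Phi> w) h k)"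
  shows "is_double_functor (structured_dblcat C V U idV compV P) (structured_dblcat C V' U' idV' compV' P')
    \<lparr>Fobj = (\<lambda>x. x), Fhor = (\<lambda>x. x), Fver = \<Phi>, Fsq = (\<lambda>\<beta>. Sq (\<Phi> (src \<beta>)) (\<Phi> (tgt \<beta>)) (upper \<beta>) (lower \<beta>))\<rparr>"
proof -
  interpret A: structured C V U idV compV P by (rule A)
  interpret B: structured C V' U' idV' compV' P' by (rule B)
  have S: "Sq (\<Phi> (src \<sigma>)) (\<Phi> (tgt \<sigma>)) (upper \<sigma>) (lower \<sigma>) \<in> B.S" if "\<sigma> \<in> A.S" for \<sigma>
    using that V P by (cases \<sigma>) (simp add: A.S_Sq B.S_Sq del: A.Sq_in_squares)
  have c: "Cod C (U (src \<sigma>)) = Dom C (U (src \<tau>))" "Cod C (U (tgt \<sigma>)) = Dom C (U (tgt \<tau>))"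
    if "\<sigma> \<in> A.S" "\<tau> \<in> A.S" "lower \<sigma> = upper \<tau>" for \<sigma> \<tau>
    using A.SD[OF that(1)] A.SD[OF that(2)] that(3) by metis+
  show ?thesis
    unfolding is_double_functor_def is_functor_def
    using A.double_category B.double_category A.cat A.Ver_category A.SqH_category A.SqV_category
      B.Ver_category B.SqH_category B.SqV_category
    by (auto simp: A.dbl_sel B.dbl_sel hom_def A.SD S V id comp c)
qed

lemma (in cat) Sq_structured: "structured C (Arr C) (\<lambda>f. f) (Ide C) (Comp C) (\<lambda>_. True)"
  by unfold_locales simp_all

lemma (in structured) forgetful_double_functor: "is_double_functor dbl (Sq_dblcat C) (forgetful U)"
proof -
  have "is_double_functor dbl (structured_dblcat C (Arr C) (\<lambda>f. f) (Ide C) (Comp C) (\<lambda>_. True))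
    \<lparr>Fobj = (\<lambda>x. x), Fhor = (\<lambda>x. x), Fver = U, Fsq = (\<lambda>\<beta>. Sq (U (src \<beta>)) (U (tgt \<beta>)) (upper \<beta>) (lower \<beta>))\<rparr>"
    by (rule structured_double_functor[OF structured_axioms Sq_structured]) (simp_all add: U_arr idV compV)
  then show ?thesis
    by (simp add: Sq_dblcat_def forgetful_def underlying_def[abs_def])
qed

section \<open>The double category of lifting structures\<close>

context lifting
begin

abbreviation vcomp where "vcomp \<equiv> lift_comp C J u"

lemma lmorD:
  assumes "lmor v w h k"
  shows "v \<in> V" "w \<in> V" "Sq (fst v) (fst w) h k \<in> squares C" "h \<in> Arr C" "k \<in> Arr C"
    "Dom C h = Dom C (fst v)" "Cod C h = Dom C (fst w)" "Dom C k = Cod C (fst v)" "Cod C k = Cod C (fst w)"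
    "fst w \<cdot> h = k \<cdot> fst v"
    "problem i (fst v) p q \<Longrightarrow> filler w i (h \<cdot> p) (k \<cdot> q) = h \<cdot> filler v i p q"
  using assms unfolding lmor_def by auto

lemma lmor_id: "v \<in> V \<Longrightarrow> lmor v v (Ide C (Dom C (fst v))) (Ide C (Cod C (fst v)))"
  using fillerD[of v] by (auto simp: lmor_def problem_iff)

lemma lmor_comp:
  assumes a: "lmor v w h k" and b: "lmor w x h' k'"
  shows "lmor v x (h' \<cdot> h) (k' \<cdot> k)"
  unfolding lmor_def
proof (intro conjI allI impI)
  note A = lmorD[OF a] and B = lmorD[OF b]
  show "v \<in> V" "x \<in> V" using A B by auto
  show "Sq (fst v) (fst x) (h' \<cdot> h) (k' \<cdot> k) \<in> squares C"
    using squares_comp[OF A(3) B(3)] by (simp del: Sq_in_squares)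
  fix i p q assume pr: "problem i (fst v) p q"
  have "filler x i (h' \<cdot> h \<cdot> p) (k' \<cdot> k \<cdot> q) = h' \<cdot> h \<cdot> filler v i p q"
    using B(11)[OF problem_comp[OF pr A(3)]] A(11)[OF pr] by simp
  then show "filler x i ((h' \<cdot> h) \<cdot> p) ((k' \<cdot> k) \<cdot> q) = (h' \<cdot> h) \<cdot> filler v i p q"
    using A(4-9) B(4-9) fillerD[OF A(1) pr] pr by (simp add: problem_iff)
qed

lemma vcomp_eq: "vcomp w v = lifting_of (fst w \<cdot> fst v) (\<lambda>i p q. filler v i p (filler w i (fst v \<cdot> p) q))"
  by (cases w; cases v) (simp add: lift_comp_def lifting_of_def filler_def)

lemma fst_vcomp [simp]: "fst (vcomp w v) = fst w \<cdot> fst v"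
  by (simp add: vcomp_eq)

lemma vcomp_problem:
  assumes "v \<in> V" "w \<in> V" "Cod C (fst v) = Dom C (fst w)" "problem i (fst w \<cdot> fst v) p q"
  shows "problem i (fst w) (fst v \<cdot> p) q" "problem i (fst v) p (filler w i (fst v \<cdot> p) q)"
    "filler (vcomp w v) i p q = filler v i p (filler w i (fst v \<cdot> p) q)"
proof -
  show 1: "problem i (fst w) (fst v \<cdot> p) q" using assms by (auto simp: problem_iff)
  show "problem i (fst v) p (filler w i (fst v \<cdot> p) q)"
    using fillerD[OF assms(2) 1] assms by (simp add: problem_iff)
  show "filler (vcomp w v) i p q = filler v i p (filler w i (fst v \<cdot> p) q)"
    using assms(4) by (simp add: vcomp_eq)
qed

lemma vcomp_in:
  assumes v: "v \<in> V" and w: "w \<in> V" and c: "Cod C (fst v) = Dom C (fst w)"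
  shows "vcomp w v \<in> V"
  unfolding vcomp_eq
proof (rule lifting_ofI)
  show "fst w \<cdot> fst v \<in> Arr C" using v w c by simp
next
  fix i p q assume pr: "problem i (fst w \<cdot> fst v) p q"
  note P = vcomp_problem[OF v w c pr]
  show "filler v i p (filler w i (fst v \<cdot> p) q) \<in> Arr C \<and>
       Dom C (filler v i p (filler w i (fst v \<cdot> p) q)) = Cod C (omap u i) \<and>
       Cod C (filler v i p (filler w i (fst v \<cdot> p) q)) = Dom C (fst w \<cdot> fst v) \<and>
       filler v i p (filler w i (fst v \<cdot> p) q) \<cdot> omap u i = p \<and>
       (fst w \<cdot> fst v) \<cdot> filler v i p (filler w i (fst v \<cdot> p) q) = q"
    using fillerD[OF v P(2)] fillerD[OF w P(1)] v w c by simp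
next
  fix t p q assume t: "t \<in> Arr J" and pr: "problem (Cod J t) (fst w \<cdot> fst v) p q"
  note P = vcomp_problem[OF v w c pr] and T = u_sq[OF t]
  have "fst v \<cdot> p \<cdot> upper (amap u t) = (fst v \<cdot> p) \<cdot> upper (amap u t)"
    using v pr T c w by (simp add: problem_iff)
  then show "filler v (Dom J t) (p \<cdot> upper (amap u t))
         (filler w (Dom J t) (fst v \<cdot> p \<cdot> upper (amap u t)) (q \<cdot> lower (amap u t))) =
        filler v (Cod J t) p (filler w (Cod J t) (fst v \<cdot> p) q) \<cdot> lower (amap u t)"
    using filler_nat[OF w t P(1)] filler_nat[OF v t P(2)] by simp
qed

text \<open>The source of most morphisms between composite structures below, both in the laws for
  \<delta> and in the composition of algebras.\<close>

lemma lmor_vcomp: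
  assumes a: "lmor v v' h k" and b: "lmor w w' k m"
  shows "lmor (vcomp w v) (vcomp w' v') h m"
proof -
  note A = lmorD[OF a] and B = lmorD[OF b]
  have c: "Cod C (fst v) = Dom C (fst w)" "Cod C (fst v') = Dom C (fst w')" using A B by metis+
  have sq: "Sq (fst w \<cdot> fst v) (fst w' \<cdot> fst v') h m \<in> squares C"
    by (rule squares_vcomp[OF A(3) B(3)])
  show ?thesis
    unfolding lmor_def
  proof (intro conjI allI impI)
    show "vcomp w v \<in> V" "vcomp w' v' \<in> V" using vcomp_in A B c by auto
    show "Sq (fst (vcomp w v)) (fst (vcomp w' v')) h m \<in> squares C" using sq by (simp del: Sq_in_squares)
    fix i p q assume "problem i (fst (vcomp w v)) p q"
    then have pr: "problem i (fst w \<cdot> fst v) p q" by simp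
    note P = vcomp_problem[OF A(1) B(1) c(1) pr]
      and P' = vcomp_problem[OF A(2) B(2) c(2) problem_comp[OF pr sq]]
    have p: "fst v' \<cdot> h \<cdot> p = k \<cdot> fst v \<cdot> p"
      using comp_eq_assoc[OF A(10), of p] A pr c B by (simp add: problem_iff)
    then have "filler w' i (fst v' \<cdot> h \<cdot> p) (m \<cdot> q) = k \<cdot> filler w i (fst v \<cdot> p) q"
      using B(11)[OF P(1)] by simp
    then show "filler (vcomp w' v') i (h \<cdot> p) (m \<cdot> q) = h \<cdot> filler (vcomp w v) i p q"
      using P(3) P'(3) A(11)[OF P(2)] by simp
  qed
qed

lemma vcomp_assoc:
  assumes v: "v \<in> V" and w: "w \<in> V" and x: "x \<in> V" and c: "Cod C (fst v) = Dom C (fst w)" "Cod C (fst w) = Dom C (fst x)"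
  shows "vcomp (vcomp x w) v = vcomp x (vcomp w v)"
proof (rule lifting_eqI)
  have xw: "vcomp x w \<in> V" and wv: "vcomp w v \<in> V" using vcomp_in assms by auto
  have c1: "Cod C (fst v) = Dom C (fst (vcomp x w))" and c2: "Cod C (fst (vcomp w v)) = Dom C (fst x)"
    using assms by simp_all
  show "vcomp (vcomp x w) v \<in> V" "vcomp x (vcomp w v) \<in> V"
    using vcomp_in[OF v xw c1] vcomp_in[OF wv x c2] by auto
  show "fst (vcomp (vcomp x w) v) = fst (vcomp x (vcomp w v))" using assms by simp
  fix i p q assume "problem i (fst (vcomp (vcomp x w) v)) p q"
  then have pr: "problem i (fst (vcomp x w) \<cdot> fst v) p q" and pr': "problem i (fst x \<cdot> fst (vcomp w v)) p q"
    using assms by simp_all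
  note P = vcomp_problem[OF v xw c1 pr] and P' = vcomp_problem[OF wv x c2 pr']
  have prr: "problem i (fst x \<cdot> fst w) (fst v \<cdot> p) q" using P(1) by simp
  have prr': "problem i (fst w \<cdot> fst v) p (filler x i (fst (vcomp w v) \<cdot> p) q)" using P'(2) by simp
  have e: "(fst w \<cdot> fst v) \<cdot> p = fst w \<cdot> fst v \<cdot> p" using assms pr by (simp add: problem_iff)
  show "filler (vcomp (vcomp x w) v) i p q = filler (vcomp x (vcomp w v)) i p q"
    using P(3) P'(3) vcomp_problem(3)[OF w x c(2) prr] vcomp_problem(3)[OF v w c(1) prr'] e by simp
qed

lemma lift_id_eq: "lift_id C J u A = lifting_of (Ide C A) (\<lambda>i p q. q)"
  by (simp add: lift_id_def lifting_of_def)

lemma lift_id_in: "A \<in> Obj C \<Longrightarrow> lift_id C J u A \<in> V"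
  unfolding lift_id_eq
proof (rule lifting_ofI)
  fix i p q assume A: "A \<in> Obj C" and pr: "problem i (Ide C A) p q"
  have "Ide C A \<cdot> p = q \<cdot> omap u i" "p \<in> Arr C" "Cod C p = Dom C (Ide C A)" using pr unfolding problem_iff by blast+
  then have "q \<cdot> omap u i = p" using A by simp
  moreover have "q \<in> Arr C" "Dom C q = Cod C (omap u i)" "Cod C q = A"
    using A pr by (simp_all add: problem_iff)
  ultimately show "q \<in> Arr C \<and> Dom C q = Cod C (omap u i) \<and> Cod C q = Dom C (Ide C A) \<and> q \<cdot> omap u i = p \<and> Ide C A \<cdot> q = q"
    using A by simp
qed simp_all

lemma fst_lift_id [simp]: "fst (lift_id C J u A) = Ide C A"
  by (simp add: lift_id_eq)

lemma filler_lift_id: "problem i (Ide C A) p q \<Longrightarrow> filler (lift_id C J u A) i p q = q"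
  by (simp add: lift_id_eq)

lemma lmor_lift_id: "h \<in> Arr C \<Longrightarrow> lmor (lift_id C J u (Dom C h)) (lift_id C J u (Cod C h)) h h"
  unfolding lmor_def
proof (intro conjI allI impI)
  fix i p q assume h: "h \<in> Arr C" and "problem i (fst (lift_id C J u (Dom C h))) p q"
  then have pr: "problem i (Ide C (Dom C h)) p q" by simp
  have "Sq (Ide C (Dom C h)) (Ide C (Cod C h)) h h \<in> squares C" using h by simp
  from filler_lift_id[OF problem_comp[OF pr this]] filler_lift_id[OF pr]
  show "filler (lift_id C J u (Cod C h)) i (h \<cdot> p) (h \<cdot> q) = h \<cdot> filler (lift_id C J u (Dom C h)) i p q" by simp
qed (simp_all add: lift_id_in)

lemma vcomp_id:
  assumes v: "v \<in> V"
  shows "vcomp v (lift_id C J u (Dom C (fst v))) = v" "vcomp (lift_id C J u (Cod C (fst v))) v = v"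
proof -
  let ?d = "lift_id C J u (Dom C (fst v))" and ?c = "lift_id C J u (Cod C (fst v))"
  have d: "?d \<in> V" "?c \<in> V" using v by (simp_all add: lift_id_in)
  show "vcomp v ?d = v"
  proof (rule lifting_eqI)
    show "vcomp v ?d \<in> V" using vcomp_in[OF d(1) v] v by simp
    fix i p q assume "problem i (fst (vcomp v ?d)) p q"
    then have pr: "problem i (fst v \<cdot> fst ?d) p q" by simp
    note P = vcomp_problem[OF d(1) v _ pr]
    have "Ide C (Dom C (fst v)) \<cdot> p = p" using pr v by (simp add: problem_iff)
    then show "filler (vcomp v ?d) i p q = filler v i p q"
      using P filler_lift_id v by simp
  qed (use v in simp_all)
  show "vcomp ?c v = v"
  proof (rule lifting_eqI)
    show "vcomp ?c v \<in> V" using vcomp_in[OF v d(2)] v by simp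
    fix i p q assume "problem i (fst (vcomp ?c v)) p q"
    then have pr: "problem i (fst ?c \<cdot> fst v) p q" by simp
    note P = vcomp_problem[OF v d(2) _ pr]
    show "filler (vcomp ?c v) i p q = filler v i p q"
      using P filler_lift_id v by simp
  qed (use v in simp_all)
qed

text \<open>The filler of the composite is a lift, along the arrow of \<open>v\<close>, of the
  filler in \<open>w\<close>; so this arrow sends the one filler to the other. It yields a counit
  law for \<delta>.\<close>

lemma lmor_vcomp_fst:
  assumes v: "v \<in> V" and w: "w \<in> V" and c: "Cod C (fst v) = Dom C (fst w)"
  shows "lmor (vcomp w v) w (fst v) (Ide C (Cod C (fst w)))"
  unfolding lmor_def
proof (intro conjI allI impI)
  show "vcomp w v \<in> V" using vcomp_in assms by blast
  fix i p q assume "problem i (fst (vcomp w v)) p q"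
  then have pr: "problem i (fst w \<cdot> fst v) p q" by simp
  note P = vcomp_problem[OF v w c pr]
  have "Ide C (Cod C (fst w)) \<cdot> q = q" using pr assms by (simp add: problem_iff)
  then show "filler w i (fst v \<cdot> p) (Ide C (Cod C (fst w)) \<cdot> q) = fst v \<cdot> filler (vcomp w v) i p q"
    using P(3) fillerD(5)[OF v P(2)] by simp
qed (use assms in simp_all)

lemma lift_square_iff:
  assumes "v \<in> V" "w \<in> V" "Sq (fst v) (fst w) h k \<in> squares C"
  shows "(\<forall>(i, \<alpha>) \<in> lifting_problems C J u (fst v).
          snd w (i, underlying fst (Sq v w h k) \<cdot>\<^bsub>arrow_cat C\<^esub> \<alpha>) = h \<cdot> snd v (i, \<alpha>)) \<longleftrightarrow> lmor v w h k"
proof -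
  have "(\<forall>(i, \<alpha>) \<in> lifting_problems C J u (fst v). R i \<alpha>) \<longleftrightarrow> (\<forall>i p q. problem i (fst v) p q \<longrightarrow> R i (Sq (omap u i) (fst v) p q))" for R
    by (auto simp: lifting_problems_iff)
  then show ?thesis
    using assms by (simp add: lmor_def filler_def underlying_def del: Sq_in_squares)
qed

lemma lift_structured:
  "structured C V fst (lift_id C J u) vcomp
     (\<lambda>\<beta>. \<forall>(i, \<alpha>) \<in> lifting_problems C J u (fst (src \<beta>)).
          snd (tgt \<beta>) (i, underlying fst \<beta> \<cdot>\<^bsub>arrow_cat C\<^esub> \<alpha>) = upper \<beta> \<cdot> snd (src \<beta>) (i, \<alpha>))" (is "structured _ _ _ _ _ ?P")
proof -
  have P: "?P (Sq v w h k) \<longleftrightarrow> lmor v w h k" if "v \<in> V" "w \<in> V" "Sq (fst v) (fst w) h k \<in> squares C" for v w h k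
    using lift_square_iff[OF that] by simp
  show ?thesis
  proof (unfold_locales, goal_cases)
    case (9 v)
    then show ?case using P[OF 9 9] lmor_id by simp
  next
    case (10 v w x h k h' k')
    have "lmor v x (h' \<cdot> h) (k' \<cdot> k)" using lmor_comp P 10 by blast
    then show ?case using P lmorD(1-3) by blast
  next
    case (11 h)
    have "lmor (lift_id C J u (Dom C h)) (lift_id C J u (Cod C h)) h h" using lmor_lift_id 11 by blast
    then show ?case using P lmorD(1-3) by blast
  next
    case (12 v w v' w' h k m)
    have "lmor (vcomp v' v) (vcomp w' w) h m" using lmor_vcomp P 12 by blast
    then show ?case using P lmorD(1-3) by blast
  qed (simp_all add: lift_id_in vcomp_in vcomp_id vcomp_assoc)
qed

end

section \<open>Functors and natural transformations on the arrow category\<close>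

lemma functor_id: "is_category A \<Longrightarrow> is_functor A A fid"
  by (simp add: is_functor_def fid_def hom_def is_category_def)

lemma functor_comp:
  assumes F: "is_functor A B F" and G: "is_functor B D G"
  shows "is_functor A D (fcomp G F)"
  unfolding is_functor_def
proof (intro conjI ballI impI)
  show "is_category A" "is_category D" using F G by (simp_all add: is_functor_def)
next
  fix X assume "X \<in> Obj A"
  then show "omap (fcomp G F) X \<in> Obj D" "amap (fcomp G F) (Ide A X) = Ide D (omap (fcomp G F) X)"
    using F G by (simp_all add: is_functor_def fcomp_def)
next
  fix f assume f: "f \<in> Arr A"
  then have "amap F f \<in> Arr B" "Dom B (amap F f) = omap F (Dom A f)" "Cod B (amap F f) = omap F (Cod A f)"
    using F by (simp_all add: is_functor_def hom_def)
  then show "amap (fcomp G F) f \<in> hom D (omap (fcomp G F) (Dom A f)) (omap (fcomp G F) (Cod A f))"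
    using G by (simp add: is_functor_def fcomp_def hom_def)
  fix g assume g: "g \<in> Arr A" "Cod A f = Dom A g"
  then show "amap (fcomp G F) (g \<cdot>\<^bsub>A\<^esub> f) = amap (fcomp G F) g \<cdot>\<^bsub>D\<^esub> amap (fcomp G F) f"
    using F G f by (simp add: is_functor_def fcomp_def hom_def)
qed

lemma (in cat) arrow_functorI:
  assumes "\<And>f. f \<in> Arr C \<Longrightarrow> omap F f \<in> Arr C"
    and "\<And>f g h k. Sq f g h k \<in> squares C \<Longrightarrow> amap F (Sq f g h k) \<in> hom (arrow_cat C) (omap F f) (omap F g)"
    and "\<And>f. f \<in> Arr C \<Longrightarrow> amap F (Ide (arrow_cat C) f) = Ide (arrow_cat C) (omap F f)"
    and comp: "\<And>f g h k g' h' k'. Sq f g h k \<in> squares C \<Longrightarrow> Sq g g' h' k' \<in> squares C \<Longrightarrow>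
      amap F (Sq f g' (h' \<cdot> h) (k' \<cdot> k)) = amap F (Sq g g' h' k') \<cdot>\<^bsub>arrow_cat C\<^esub> amap F (Sq f g h k)"
  shows "is_functor (arrow_cat C) (arrow_cat C) F"
  unfolding is_functor_def
proof (intro conjI ballI impI arrow_cat_category)
  fix \<sigma> assume s: "\<sigma> \<in> Arr (arrow_cat C)"
  then show "amap F \<sigma> \<in> hom (arrow_cat C) (omap F (Dom (arrow_cat C) \<sigma>)) (omap F (Cod (arrow_cat C) \<sigma>))"
    using assms(2) by (cases \<sigma>) (simp del: Sq_in_squares)
  fix \<tau> assume "\<tau> \<in> Arr (arrow_cat C)" "Cod (arrow_cat C) \<sigma> = Dom (arrow_cat C) \<tau>"
  then show "amap F (\<tau> \<cdot>\<^bsub>arrow_cat C\<^esub> \<sigma>) = amap F \<tau> \<cdot>\<^bsub>arrow_cat C\<^esub> amap F \<sigma>"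
    using comp s by (cases \<sigma>; cases \<tau>) (simp del: Sq_in_squares)
qed (use assms in simp_all)

lemma (in cat) arrow_nat_transI:
  assumes "is_functor (arrow_cat C) (arrow_cat C) F" "is_functor (arrow_cat C) (arrow_cat C) G"
    and "\<And>f. f \<in> Arr C \<Longrightarrow> \<tau> f \<in> hom (arrow_cat C) (omap F f) (omap G f)"
    and nat: "\<And>f g h k. Sq f g h k \<in> squares C \<Longrightarrow>
      \<tau> g \<cdot>\<^bsub>arrow_cat C\<^esub> amap F (Sq f g h k) = amap G (Sq f g h k) \<cdot>\<^bsub>arrow_cat C\<^esub> \<tau> f"
  shows "is_nat_trans (arrow_cat C) (arrow_cat C) F G \<tau>"
  unfolding is_nat_trans_def
proof (intro conjI ballI)
  fix \<sigma> assume "\<sigma> \<in> Arr (arrow_cat C)"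
  then show "\<tau> (Cod (arrow_cat C) \<sigma>) \<cdot>\<^bsub>arrow_cat C\<^esub> amap F \<sigma> = amap G \<sigma> \<cdot>\<^bsub>arrow_cat C\<^esub> \<tau> (Dom (arrow_cat C) \<sigma>)"
    using nat by (cases \<sigma>) (simp only: arrow_cat_sel(2-4) sq.sel)
qed (use assms in simp_all)

section \<open>The algebraic weak factorization system\<close>

text \<open>The factorization system depends on the preceding construction only through the
  existence of free lifting structures; how they were obtained is forgotten here.\<close>

locale free_liftings = lifting C J u
  for C :: "('o, 'm) category" (structure) and J :: "('i, 't) category" and u :: "('i, 't, 'm, ('m, 'm) sq) ftor" +
  assumes free: "f \<in> Arr C \<Longrightarrow> \<exists>l r. free_lifting f l r"
begin

text \<open>\<open>Lo f\<close>, \<open>Ro f\<close>, \<open>dlt f\<close>, \<open>mlt f\<close> are \<open>L f\<close>, \<open>R f\<close>, \<open>\<delta>\<^sub>f\<close>, \<open>\<mu>\<^sub>f\<close>, and \<open>Em f g h k\<close> is the map \<open>E (h, k)\<close>. \<open>Rv f\<close> is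
  \<open>Ro f\<close> with its free lifting structure, \<open>Rv2 f\<close> the composite lifting structure on \<open>Ro f \<cdot> Ro (Lo f)\<close>.\<close>

definition Lo :: "'m \<Rightarrow> 'm" where
  "Lo f = fst (SOME x. free_lifting f (fst x) (snd x))"

definition Rv :: "'m \<Rightarrow> 'm \<times> ('i \<times> ('m, 'm) sq \<Rightarrow> 'm)" where
  "Rv f = snd (SOME x. free_lifting f (fst x) (snd x))"

definition Ro :: "'m \<Rightarrow> 'm" where
  "Ro f = fst (Rv f)"

lemma free_Lo_Rv: "f \<in> Arr C \<Longrightarrow> free_lifting f (Lo f) (Rv f)"
proof -
  assume "f \<in> Arr C"
  then obtain l r where "free_lifting f l r" using free by blast
  then have "free_lifting f (fst (l, r)) (snd (l, r))" by simp
  then show ?thesis unfolding Lo_def Rv_def by (rule someI)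
qed

lemma LR:
  assumes "f \<in> Arr C"
  shows "Lo f \<in> Arr C" "Dom C (Lo f) = Dom C f" "Cod C (Lo f) = Dom C (Ro f)" "Rv f \<in> V" "fst (Rv f) = Ro f"
    "Ro f \<in> Arr C" "Cod C (Ro f) = Cod C f" "Ro f \<cdot> Lo f = f"
proof -
  show *: "Lo f \<in> Arr C" "Dom C (Lo f) = Dom C f" "Cod C (Lo f) = Dom C (Ro f)" "Rv f \<in> V" "fst (Rv f) = Ro f"
    "Ro f \<cdot> Lo f = f"
    using free_Lo_Rv[OF assms] by (simp_all add: free_lifting_def Ro_def)
  show "Ro f \<in> Arr C" using *(4) by (simp add: Ro_def)
  then show "Cod C (Ro f) = Cod C f" using * cod_comp[of "Lo f" "Ro f"] by metis
qed

definition extend :: "'m \<Rightarrow> 'm \<times> ('i \<times> ('m, 'm) sq \<Rightarrow> 'm) \<Rightarrow> 'm \<Rightarrow> 'm \<Rightarrow> 'm" where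
  "extend f w h k = (SOME e. lmor (Rv f) w e k \<and> e \<cdot> Lo f = h)"

lemma extend:
  assumes "w \<in> V" "Sq f (fst w) h k \<in> squares C"
  shows "lmor (Rv f) w (extend f w h k) k" "extend f w h k \<cdot> Lo f = h"
proof -
  have "f \<in> Arr C" using assms by simp
  then have "\<exists>e. lmor (Rv f) w e k \<and> e \<cdot> Lo f = h"
    using free_Lo_Rv assms unfolding free_lifting_def by blast
  from someI_ex[OF this] show "lmor (Rv f) w (extend f w h k) k" "extend f w h k \<cdot> Lo f = h"
    by (simp_all add: extend_def)
qed

lemma free_unique:
  assumes "f \<in> Arr C" "lmor (Rv f) w e k" "lmor (Rv f) w e' k" "e \<cdot> Lo f = e' \<cdot> Lo f"
  shows "e = e'"
proof -
  have "\<forall>w e e' k. lmor (Rv f) w e k \<longrightarrow> lmor (Rv f) w e' k \<longrightarrow> e \<cdot> Lo f = e' \<cdot> Lo f \<longrightarrow> e = e'"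
    using free_Lo_Rv[OF assms(1)] unfolding free_lifting_def by blast
  then show ?thesis using assms by blast
qed

definition Em :: "'m \<Rightarrow> 'm \<Rightarrow> 'm \<Rightarrow> 'm \<Rightarrow> 'm" where
  "Em f g h k = extend f (Rv g) (Lo g \<cdot> h) k"

lemma Em:
  assumes "Sq f g h k \<in> squares C"
  shows "lmor (Rv f) (Rv g) (Em f g h k) k" "Em f g h k \<cdot> Lo f = Lo g \<cdot> h"
    "Em f g h k \<in> Arr C" "Dom C (Em f g h k) = Dom C (Ro f)" "Cod C (Em f g h k) = Dom C (Ro g)"
    "Ro g \<cdot> Em f g h k = k \<cdot> Ro f"
proof -
  have fg: "f \<in> Arr C" "g \<in> Arr C" using assms by auto
  note F = LR[OF fg(1)] and G = LR[OF fg(2)]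
  have "Sq f (fst (Rv g)) (Lo g \<cdot> h) k \<in> squares C"
    using assms G comp_eq_assoc[OF G(8), of h] by simp
  from extend[OF G(4) this]
  show *: "lmor (Rv f) (Rv g) (Em f g h k) k" "Em f g h k \<cdot> Lo f = Lo g \<cdot> h"
    by (simp_all add: Em_def)
  show "Em f g h k \<in> Arr C" "Dom C (Em f g h k) = Dom C (Ro f)" "Cod C (Em f g h k) = Dom C (Ro g)"
    "Ro g \<cdot> Em f g h k = k \<cdot> Ro f"
    using lmorD[OF *(1)] F(5) G(5) by simp_all
qed

definition mlt :: "'m \<Rightarrow> 'm" where
  "mlt f = extend (Ro f) (Rv f) (Ide C (Dom C (Ro f))) (Ide C (Cod C f))"

lemma mlt:
  assumes f: "f \<in> Arr C"
  shows "lmor (Rv (Ro f)) (Rv f) (mlt f) (Ide C (Cod C f))" "mlt f \<cdot> Lo (Ro f) = Ide C (Dom C (Ro f))"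
    "mlt f \<in> Arr C" "Dom C (mlt f) = Dom C (Ro (Ro f))" "Cod C (mlt f) = Dom C (Ro f)"
    "Ro f \<cdot> mlt f = Ro (Ro f)"
proof -
  note F = LR[OF f] and FF = LR[OF LR(6)[OF f]]
  have "Sq (Ro f) (fst (Rv f)) (Ide C (Dom C (Ro f))) (Ide C (Cod C f)) \<in> squares C"
    using F f by simp
  from extend[OF F(4) this]
  show *: "lmor (Rv (Ro f)) (Rv f) (mlt f) (Ide C (Cod C f))" "mlt f \<cdot> Lo (Ro f) = Ide C (Dom C (Ro f))"
    by (simp_all add: mlt_def)
  show "mlt f \<in> Arr C" "Dom C (mlt f) = Dom C (Ro (Ro f))" "Cod C (mlt f) = Dom C (Ro f)"
    "Ro f \<cdot> mlt f = Ro (Ro f)"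
    using lmorD[OF *(1)] F FF f by simp_all
qed

definition Rv2 :: "'m \<Rightarrow> 'm \<times> ('i \<times> ('m, 'm) sq \<Rightarrow> 'm)" where
  "Rv2 f = vcomp (Rv f) (Rv (Lo f))"

definition dlt :: "'m \<Rightarrow> 'm" where
  "dlt f = extend f (Rv2 f) (Lo (Lo f)) (Ide C (Cod C f))"

lemma Rv2:
  assumes f: "f \<in> Arr C"
  shows "Rv2 f \<in> V" "fst (Rv2 f) = Ro f \<cdot> Ro (Lo f)"
proof -
  note F = LR[OF f] and FF = LR[OF LR(1)[OF f]]
  show "Rv2 f \<in> V" "fst (Rv2 f) = Ro f \<cdot> Ro (Lo f)"
    using vcomp_in[OF FF(4) F(4)] F FF by (simp_all add: Rv2_def)
qed

lemma dlt:
  assumes f: "f \<in> Arr C"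
  shows "lmor (Rv f) (Rv2 f) (dlt f) (Ide C (Cod C f))" "dlt f \<cdot> Lo f = Lo (Lo f)"
    "dlt f \<in> Arr C" "Dom C (dlt f) = Dom C (Ro f)" "Cod C (dlt f) = Dom C (Ro (Lo f))"
proof -
  note F = LR[OF f] and FF = LR[OF LR(1)[OF f]] and R2 = Rv2[OF f]
  have "Sq f (fst (Rv2 f)) (Lo (Lo f)) (Ide C (Cod C f)) \<in> squares C"
    using F FF f R2 by simp
  from extend[OF R2(1) this]
  show *: "lmor (Rv f) (Rv2 f) (dlt f) (Ide C (Cod C f))" "dlt f \<cdot> Lo f = Lo (Lo f)"
    by (simp_all add: dlt_def)
  show "dlt f \<in> Arr C" "Dom C (dlt f) = Dom C (Ro f)" "Cod C (dlt f) = Dom C (Ro (Lo f))"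
    using lmorD[OF *(1)] F FF f R2 by simp_all
qed

lemma Em_id:
  assumes f: "f \<in> Arr C"
  shows "Em f f (Ide C (Dom C f)) (Ide C (Cod C f)) = Ide C (Dom C (Ro f))"
proof (rule free_unique[OF f])
  note F = LR[OF f]
  have sq: "Sq f f (Ide C (Dom C f)) (Ide C (Cod C f)) \<in> squares C" using f by simp
  show "lmor (Rv f) (Rv f) (Em f f (Ide C (Dom C f)) (Ide C (Cod C f))) (Ide C (Cod C f))"
    using Em(1)[OF sq] .
  show "lmor (Rv f) (Rv f) (Ide C (Dom C (Ro f))) (Ide C (Cod C f))"
    using lmor_id[OF F(4)] F by simp
  show "Em f f (Ide C (Dom C f)) (Ide C (Cod C f)) \<cdot> Lo f = Ide C (Dom C (Ro f)) \<cdot> Lo f"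
    using Em(2)[OF sq] F by simp
qed

lemma Em_comp:
  assumes s: "Sq f g h k \<in> squares C" and t: "Sq g g' h' k' \<in> squares C"
  shows "Em f g' (h' \<cdot> h) (k' \<cdot> k) = Em g g' h' k' \<cdot> Em f g h k"
proof (rule free_unique)
  have fg: "f \<in> Arr C" "g \<in> Arr C" "g' \<in> Arr C" using s t by auto
  show "f \<in> Arr C" by fact
  note F = LR[OF fg(1)] and G = LR[OF fg(2)] and G' = LR[OF fg(3)]
  have st: "Sq f g' (h' \<cdot> h) (k' \<cdot> k) \<in> squares C"
    using squares_comp[OF s t] by (simp del: Sq_in_squares)
  show "lmor (Rv f) (Rv g') (Em f g' (h' \<cdot> h) (k' \<cdot> k)) (k' \<cdot> k)" using Em(1)[OF st] .
  show "lmor (Rv f) (Rv g') (Em g g' h' k' \<cdot> Em f g h k) (k' \<cdot> k)"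
    using lmor_comp[OF Em(1)[OF s] Em(1)[OF t]] .
  show "Em f g' (h' \<cdot> h) (k' \<cdot> k) \<cdot> Lo f = (Em g g' h' k' \<cdot> Em f g h k) \<cdot> Lo f"
    using Em[OF st] Em[OF s] Em[OF t] comp_eq_assoc[OF Em(2)[OF t], of h] s t F G G' by simp
qed

lemma mlt_unit:
  assumes f: "f \<in> Arr C"
  shows "mlt f \<cdot> Em f (Ro f) (Lo f) (Ide C (Cod C f)) = Ide C (Dom C (Ro f))"
proof (rule free_unique[OF f])
  note F = LR[OF f] and FF = LR[OF LR(6)[OF f]] and m = mlt[OF f]
  have sq: "Sq f (Ro f) (Lo f) (Ide C (Cod C f)) \<in> squares C" using f F by simp
  show "lmor (Rv f) (Rv f) (mlt f \<cdot> Em f (Ro f) (Lo f) (Ide C (Cod C f))) (Ide C (Cod C f))"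
    using lmor_comp[OF Em(1)[OF sq] m(1)] f by simp
  show "lmor (Rv f) (Rv f) (Ide C (Dom C (Ro f))) (Ide C (Cod C f))"
    using lmor_id[OF F(4)] F by simp
  show "(mlt f \<cdot> Em f (Ro f) (Lo f) (Ide C (Cod C f))) \<cdot> Lo f = Ide C (Dom C (Ro f)) \<cdot> Lo f"
    using Em[OF sq] F FF m comp_eq_ide_assoc[OF m(2), of "Lo f"] by simp
qed

lemma mlt_assoc:
  assumes f: "f \<in> Arr C"
  shows "mlt f \<cdot> mlt (Ro f) = mlt f \<cdot> Em (Ro (Ro f)) (Ro f) (mlt f) (Ide C (Cod C f))"
proof -
  note F = LR[OF f] and m = mlt[OF f] and m' = mlt[OF LR(6)[OF f]] and FF = LR[OF LR(6)[OF f]]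
    and FFF = LR[OF LR(6)[OF LR(6)[OF f]]]
  have sq: "Sq (Ro (Ro f)) (Ro f) (mlt f) (Ide C (Cod C f)) \<in> squares C" using f F FF m by simp
  note e = Em[OF sq]
  show ?thesis
  proof (rule free_unique[OF FF(6)])
    show "lmor (Rv (Ro (Ro f))) (Rv f) (mlt f \<cdot> mlt (Ro f)) (Ide C (Cod C f))"
      using lmor_comp[OF m'(1) m(1)] F f by simp
    show "lmor (Rv (Ro (Ro f))) (Rv f) (mlt f \<cdot> Em (Ro (Ro f)) (Ro f) (mlt f) (Ide C (Cod C f))) (Ide C (Cod C f))"
      using lmor_comp[OF e(1) m(1)] F f by simp
    show "(mlt f \<cdot> mlt (Ro f)) \<cdot> Lo (Ro (Ro f)) =
      (mlt f \<cdot> Em (Ro (Ro f)) (Ro f) (mlt f) (Ide C (Cod C f))) \<cdot> Lo (Ro (Ro f))"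
      using m m' e F FF FFF comp_eq_ide_assoc[OF m(2), of "mlt f"] by simp
  qed
qed

lemma mlt_nat:
  assumes s: "Sq f g h k \<in> squares C"
  shows "mlt g \<cdot> Em (Ro f) (Ro g) (Em f g h k) k = Em f g h k \<cdot> mlt f"
proof -
  have fg: "f \<in> Arr C" "g \<in> Arr C" using s by auto
  note F = LR[OF fg(1)] and G = LR[OF fg(2)] and FF = LR[OF LR(6)[OF fg(1)]] and GG = LR[OF LR(6)[OF fg(2)]]
    and mf = mlt[OF fg(1)] and mg = mlt[OF fg(2)] and e = Em[OF s]
  have sq: "Sq (Ro f) (Ro g) (Em f g h k) k \<in> squares C" using s F G e by simp
  note e' = Em[OF sq]
  show ?thesis
  proof (rule free_unique[OF F(6)])
    have "Ide C (Cod C g) \<cdot> k = k" "k \<cdot> Ide C (Cod C f) = k" using s by simp_all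
    then show "lmor (Rv (Ro f)) (Rv g) (mlt g \<cdot> Em (Ro f) (Ro g) (Em f g h k) k) k"
      "lmor (Rv (Ro f)) (Rv g) (Em f g h k \<cdot> mlt f) k"
      using lmor_comp[OF e'(1) mg(1)] lmor_comp[OF mf(1) e(1)] by simp_all
    show "(mlt g \<cdot> Em (Ro f) (Ro g) (Em f g h k) k) \<cdot> Lo (Ro f) = (Em f g h k \<cdot> mlt f) \<cdot> Lo (Ro f)"
      using e e' mf mg F G FF GG comp_eq_ide_assoc[OF mg(2), of "Em f g h k"] by simp
  qed
qed

text \<open>For the first law, the first factor of a composite structure is a morphism by
  \<open>lmor_vcomp_fst\<close>. For the second, E (id, R f) has to be a morphism from the composite
  structure on R f \<cdot> R (L f) to the free one; it collapses two factors to one and is no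
  vertical composite, so this is checked on fillers.\<close>

lemma dlt_counit:
  assumes f: "f \<in> Arr C"
  shows "Ro (Lo f) \<cdot> dlt f = Ide C (Dom C (Ro f))"
    "Em (Lo f) f (Ide C (Dom C f)) (Ro f) \<cdot> dlt f = Ide C (Dom C (Ro f))"
proof -
  note F = LR[OF f] and FF = LR[OF LR(1)[OF f]] and d = dlt[OF f]
  have id: "lmor (Rv f) (Rv f) (Ide C (Dom C (Ro f))) (Ide C (Cod C f))"
    using lmor_id[OF F(4)] F by simp
  show "Ro (Lo f) \<cdot> dlt f = Ide C (Dom C (Ro f))"
  proof (rule free_unique[OF f _ id])
    have "lmor (Rv2 f) (Rv f) (Ro (Lo f)) (Ide C (Cod C f))"
      using lmor_vcomp_fst[OF FF(4) F(4)] F FF by (simp add: Rv2_def)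
    from lmor_comp[OF d(1) this] show "lmor (Rv f) (Rv f) (Ro (Lo f) \<cdot> dlt f) (Ide C (Cod C f))"
      using f by simp
    show "(Ro (Lo f) \<cdot> dlt f) \<cdot> Lo f = Ide C (Dom C (Ro f)) \<cdot> Lo f"
      using d F FF by simp
  qed
  have sq: "Sq (Lo f) f (Ide C (Dom C f)) (Ro f) \<in> squares C" using F f by simp
  note e = Em[OF sq]
  show "Em (Lo f) f (Ide C (Dom C f)) (Ro f) \<cdot> dlt f = Ide C (Dom C (Ro f))" (is "?e \<cdot> _ = _")
  proof (rule free_unique[OF f _ id])
    have "lmor (Rv2 f) (Rv f) ?e (Ide C (Cod C f))"
      unfolding lmor_def
    proof (intro conjI allI impI)
      show "Rv2 f \<in> V" by (rule Rv2(1)[OF f])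
      show "Rv f \<in> V" by (rule F(4))
      show "Sq (fst (Rv2 f)) (fst (Rv f)) ?e (Ide C (Cod C f)) \<in> squares C"
        using e F FF f Rv2[OF f] by simp
      fix i p q assume "problem i (fst (Rv2 f)) p q"
      then have pr: "problem i (fst (Rv f) \<cdot> fst (Rv (Lo f))) p q" using Rv2[OF f] F FF by simp
      have c: "Cod C (fst (Rv (Lo f))) = Dom C (fst (Rv f))" using F FF by simp
      note P = vcomp_problem[OF FF(4) F(4) c pr]
      have q: "Ide C (Cod C f) \<cdot> q = q" using pr F FF by (simp add: problem_iff)
      \<comment> \<open>The lower side of the inner problem is itself a filler of R f. As
        \<open>?e\<close> has lower side R f, the new lower side is R f applied to that filler,
        which is \<open>q\<close> again.\<close>
      have "?e \<cdot> filler (Rv2 f) i p q = filler (Rv f) i (?e \<cdot> p) (Ro f \<cdot> filler (Rv f) i (fst (Rv (Lo f)) \<cdot> p) q)"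
        using lmorD(11)[OF e(1) P(2)] P(3) by (simp add: Rv2_def)
      also have "\<dots> = filler (Rv f) i (?e \<cdot> p) q"
        using fillerD(5)[OF F(4) P(1)] F by simp
      finally show "filler (Rv f) i (?e \<cdot> p) (Ide C (Cod C f) \<cdot> q) = ?e \<cdot> filler (Rv2 f) i p q"
        using q by simp
    qed
    from lmor_comp[OF d(1) this] show "lmor (Rv f) (Rv f) (?e \<cdot> dlt f) (Ide C (Cod C f))"
      using f by simp
    show "(?e \<cdot> dlt f) \<cdot> Lo f = Ide C (Dom C (Ro f)) \<cdot> Lo f"
      using d e F FF f by simp
  qed
qed

text \<open>E (h, E (h, k)) is a morphism for the factor R (L f) whose lower side is the morphism E
  (h, k) for the factor R f; stacked, they make E (h, E (h, k)) a morphism of composite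
  structures.\<close>

lemma dlt_nat:
  assumes s: "Sq f g h k \<in> squares C"
  shows "dlt g \<cdot> Em f g h k = Em (Lo f) (Lo g) h (Em f g h k) \<cdot> dlt f"
proof -
  have fg: "f \<in> Arr C" "g \<in> Arr C" using s by auto
  note F = LR[OF fg(1)] and G = LR[OF fg(2)] and FF = LR[OF LR(1)[OF fg(1)]] and GG = LR[OF LR(1)[OF fg(2)]]
    and df = dlt[OF fg(1)] and dg = dlt[OF fg(2)] and e = Em[OF s]
  have sq: "Sq (Lo f) (Lo g) h (Em f g h k) \<in> squares C" using s F G e by simp
  note e' = Em[OF sq]
  have 2: "lmor (Rv2 f) (Rv2 g) (Em (Lo f) (Lo g) h (Em f g h k)) k"
    unfolding Rv2_def by (rule lmor_vcomp[OF e'(1) e(1)])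
  show ?thesis
  proof (rule free_unique[OF fg(1)])
    have "Ide C (Cod C g) \<cdot> k = k" "k \<cdot> Ide C (Cod C f) = k" using s by simp_all
    then show "lmor (Rv f) (Rv2 g) (dlt g \<cdot> Em f g h k) k"
      "lmor (Rv f) (Rv2 g) (Em (Lo f) (Lo g) h (Em f g h k) \<cdot> dlt f) k"
      using lmor_comp[OF e(1) dg(1)] lmor_comp[OF df(1) 2] by simp_all
    show "(dlt g \<cdot> Em f g h k) \<cdot> Lo f = (Em (Lo f) (Lo g) h (Em f g h k) \<cdot> dlt f) \<cdot> Lo f"
      using s e e' df dg F G FF GG comp_eq_assoc[OF dg(2), of h] by simp
  qed
qed

text \<open>Both sides are morphisms into the threefold composite on R f \<cdot> R (L f) \<cdot> R
  (L (L f)), reached with different bracketings; associativity of vertical composition identifies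
  the targets.\<close>

lemma dlt_coassoc:
  assumes f: "f \<in> Arr C"
  shows "dlt (Lo f) \<cdot> dlt f = Em (Lo f) (Lo (Lo f)) (Ide C (Dom C f)) (dlt f) \<cdot> dlt f"
proof -
  note F = LR[OF f] and FF = LR[OF LR(1)[OF f]] and FFF = LR[OF LR(1)[OF LR(1)[OF f]]]
    and d = dlt[OF f] and d' = dlt[OF LR(1)[OF f]] and R2 = Rv2[OF LR(1)[OF f]]
  have sq: "Sq (Lo f) (Lo (Lo f)) (Ide C (Dom C f)) (dlt f) \<in> squares C" using F FF f d by simp
  note e = Em[OF sq]
  let ?w = "vcomp (Rv f) (Rv2 (Lo f))"
  show ?thesis
  proof (rule free_unique[OF f])
    have "lmor (Rv2 f) ?w (dlt (Lo f)) (Ide C (Cod C f))"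
      unfolding Rv2_def[of f] by (rule lmor_vcomp[where k = "Ide C (Dom C (Ro f))"])
        (use d'(1) lmor_id[OF F(4)] F in simp_all)
    from lmor_comp[OF d(1) this] show "lmor (Rv f) ?w (dlt (Lo f) \<cdot> dlt f) (Ide C (Cod C f))" using f by simp
    have "lmor (Rv2 f) (vcomp (Rv2 f) (Rv (Lo (Lo f)))) (Em (Lo f) (Lo (Lo f)) (Ide C (Dom C f)) (dlt f)) (Ide C (Cod C f))"
      unfolding Rv2_def[of f] by (rule lmor_vcomp[OF e(1) d(1)[unfolded Rv2_def]])
    moreover have "vcomp (Rv2 f) (Rv (Lo (Lo f))) = ?w"
      unfolding Rv2_def by (rule vcomp_assoc) (use F FF FFF in simp_all)
    ultimately have "lmor (Rv2 f) ?w (Em (Lo f) (Lo (Lo f)) (Ide C (Dom C f)) (dlt f)) (Ide C (Cod C f))" by simp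
    from lmor_comp[OF d(1) this]
    show "lmor (Rv f) ?w (Em (Lo f) (Lo (Lo f)) (Ide C (Dom C f)) (dlt f) \<cdot> dlt f) (Ide C (Cod C f))" using f by simp
    show "(dlt (Lo f) \<cdot> dlt f) \<cdot> Lo f = (Em (Lo f) (Lo (Lo f)) (Ide C (Dom C f)) (dlt f) \<cdot> dlt f) \<cdot> Lo f"
      using d d' e F FF FFF by simp
  qed
qed

text \<open>Both sides go from the free structure on R (R f) to the composite one on R f \<cdot> R
  (L f). On the right each of the three maps is a morphism: \<delta> of R f, then E (\<delta>,
  \<mu>) stacked on \<mu>, then \<mu> of L f stacked on an identity.\<close>

lemma distributive:
  assumes f: "f \<in> Arr C"
  shows "dlt f \<cdot> mlt f = mlt (Lo f) \<cdot> Em (Lo (Ro f)) (Ro (Lo f)) (dlt f) (mlt f) \<cdot> dlt (Ro f)"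
proof -
  note F = LR[OF f] and L = LR[OF LR(1)[OF f]] and R = LR[OF LR(6)[OF f]]
    and LRf = LR[OF LR(1)[OF LR(6)[OF f]]] and RL = LR[OF LR(6)[OF LR(1)[OF f]]]
    and d = dlt[OF f] and m = mlt[OF f] and dR = dlt[OF LR(6)[OF f]] and mL = mlt[OF LR(1)[OF f]]
  have sq: "Sq (Lo (Ro f)) (Ro (Lo f)) (dlt f) (mlt f) \<in> squares C"
    using F L R d m dlt_counit(1)[OF f] by simp
  note e = Em[OF sq]
  show ?thesis
  proof (rule free_unique[OF F(6)])
    show "lmor (Rv (Ro f)) (Rv2 f) (dlt f \<cdot> mlt f) (Ide C (Cod C f))"
      using lmor_comp[OF m(1) d(1)] f by simp
    let ?w = "vcomp (Rv f) (Rv (Ro (Lo f)))"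
    have 1: "lmor (Rv2 (Ro f)) ?w (Em (Lo (Ro f)) (Ro (Lo f)) (dlt f) (mlt f)) (Ide C (Cod C f))"
      unfolding Rv2_def by (rule lmor_vcomp[OF e(1) m(1)])
    have 2: "lmor ?w (Rv2 f) (mlt (Lo f)) (Ide C (Cod C f))"
      unfolding Rv2_def by (rule lmor_vcomp[where k = "Ide C (Dom C (Ro f))"])
        (use mL(1) lmor_id[OF F(4)] F in simp_all)
    show "lmor (Rv (Ro f)) (Rv2 f) (mlt (Lo f) \<cdot> Em (Lo (Ro f)) (Ro (Lo f)) (dlt f) (mlt f) \<cdot> dlt (Ro f)) (Ide C (Cod C f))"
      using lmor_comp[OF lmor_comp[OF dR(1) 1] 2] F f by simp
    show "(dlt f \<cdot> mlt f) \<cdot> Lo (Ro f) =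
      (mlt (Lo f) \<cdot> Em (Lo (Ro f)) (Ro (Lo f)) (dlt f) (mlt f) \<cdot> dlt (Ro f)) \<cdot> Lo (Ro f)"
      using d m dR mL e F L R LRf RL comp_eq_ide_assoc[OF mL(2), of "dlt f"] by simp
  qed
qed

definition W :: "'m awfs" where
  "W = \<lparr>LF = \<lparr>omap = Lo, amap = (\<lambda>\<sigma>. Sq (Lo (src \<sigma>)) (Lo (tgt \<sigma>)) (upper \<sigma>) (Em (src \<sigma>) (tgt \<sigma>) (upper \<sigma>) (lower \<sigma>)))\<rparr>,
        RF = \<lparr>omap = Ro, amap = (\<lambda>\<sigma>. Sq (Ro (src \<sigma>)) (Ro (tgt \<sigma>)) (Em (src \<sigma>) (tgt \<sigma>) (upper \<sigma>) (lower \<sigma>)) (lower \<sigma>))\<rparr>,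
        Comult = (\<lambda>f. Sq (Lo f) (Lo (Lo f)) (Ide C (Dom C f)) (dlt f)),
        Mult = (\<lambda>f. Sq (Ro (Ro f)) (Ro f) (mlt f) (Ide C (Cod C f)))\<rparr>"

lemma W_sel [simp]:
  "omap (LF W) = Lo" "omap (RF W) = Ro"
  "amap (LF W) (Sq f g h k) = Sq (Lo f) (Lo g) h (Em f g h k)"
  "amap (RF W) (Sq f g h k) = Sq (Ro f) (Ro g) (Em f g h k) k"
  "Comult W f = Sq (Lo f) (Lo (Lo f)) (Ide C (Dom C f)) (dlt f)"
  "Mult W f = Sq (Ro (Ro f)) (Ro f) (mlt f) (Ide C (Cod C f))"
  "counit C W f = Sq (Lo f) f (Ide C (Dom C f)) (Ro f)"
  "unit C W f = Sq f (Ro f) (Lo f) (Ide C (Cod C f))"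
  "delta W f = dlt f" "mu W f = mlt f" "Emap W (Sq f g h k) = Em f g h k"
  by (simp_all add: W_def counit_def unit_def delta_def mu_def Emap_def)

lemma L_square: "Sq f g h k \<in> squares C \<Longrightarrow> Sq (Lo f) (Lo g) h (Em f g h k) \<in> squares C"
  using Em[of f g h k] LR[of f] LR[of g] by auto

lemma R_square: "Sq f g h k \<in> squares C \<Longrightarrow> Sq (Ro f) (Ro g) (Em f g h k) k \<in> squares C"
  using Em[of f g h k] LR[of f] LR[of g] by auto

lemma L_functor: "is_functor (arrow_cat C) (arrow_cat C) (LF W)"
proof (rule arrow_functorI)
  fix f g h k g' h' k' assume "Sq f g h k \<in> squares C" "Sq g g' h' k' \<in> squares C"
  then show "amap (LF W) (Sq f g' (h' \<cdot> h) (k' \<cdot> k)) = amap (LF W) (Sq g g' h' k') \<cdot>\<^bsub>arrow_cat C\<^esub> amap (LF W) (Sq f g h k)"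
    using Em_comp[of f g h k g' h' k'] by (simp del: Sq_in_squares)
qed (use L_square Em_id LR in \<open>auto simp: hom_def simp del: Sq_in_squares\<close>)

lemma R_functor: "is_functor (arrow_cat C) (arrow_cat C) (RF W)"
proof (rule arrow_functorI)
  fix f g h k g' h' k' assume "Sq f g h k \<in> squares C" "Sq g g' h' k' \<in> squares C"
  then show "amap (RF W) (Sq f g' (h' \<cdot> h) (k' \<cdot> k)) = amap (RF W) (Sq g g' h' k') \<cdot>\<^bsub>arrow_cat C\<^esub> amap (RF W) (Sq f g h k)"
    using Em_comp[of f g h k g' h' k'] by (simp del: Sq_in_squares)
qed (use R_square Em_id LR in \<open>auto simp: hom_def simp del: Sq_in_squares\<close>)

end

text \<open>Carries all axioms across a surjection that respects the structure. The unit and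
  associativity laws for the composition of algebras, whose formula involves \<delta>, are thereby
  inherited from lifting structures instead of being computed.\<close>

lemma structured_transfer:
  fixes C :: "('o, 'm) category" (structure)
  assumes str: "structured C V U idV compV P"
    and to: "\<And>v. v \<in> V \<Longrightarrow> \<Psi> v \<in> V'" "\<And>v. v \<in> V \<Longrightarrow> U' (\<Psi> v) = U v"
    and onto: "\<And>x. x \<in> V' \<Longrightarrow> \<exists>v \<in> V. x = \<Psi> v"
    and id: "\<And>A. A \<in> Obj C \<Longrightarrow> \<Psi> (idV A) = idV' A"
    and comp: "\<And>v w. v \<in> V \<Longrightarrow> w \<in> V \<Longrightarrow> Cod C (U v) = Dom C (U w) \<Longrightarrow> \<Psi> (compV w v) = compV' (\<Psi> w) (\<Psi> v)"
    and P: "\<And>v w h k. v \<in> V \<Longrightarrow> w \<in> V \<Longrightarrow> Sq (U v) (U w) h k \<in> squares C \<Longrightarrow> P' (Sq (\<Psi> v) (\<Psi> w) h k) \<longleftrightarrow> P (Sq v w h k)"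
  shows "structured C V' U' idV' compV' P'"
proof -
  interpret structured C V U idV compV P by (rule str)
  show ?thesis
  proof (unfold_locales, goal_cases)
    case (1 x)
    then show ?case using onto to U_arr by force
  next
    case (2 A)
    then show ?case using id[of A] to(1)[OF idV(1)[OF 2]] by simp
  next
    case (3 A)
    then show ?case using id[of A] to(2)[OF idV(1)[OF 3]] idV(2) by simp
  next
    case (4 x y)
    obtain v w where v: "v \<in> V" "x = \<Psi> v" "w \<in> V" "y = \<Psi> w" using onto 4 by metis
    then have c: "Cod C (U v) = Dom C (U w)" using 4 to by simp
    show ?case using comp[OF v(1,3) c] to(1)[OF compV(1)[OF v(1,3) c]] v by simp
  next
    case (5 x y)
    obtain v w where v: "v \<in> V" "x = \<Psi> v" "w \<in> V" "y = \<Psi> w" using onto 5 by metis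
    then have c: "Cod C (U v) = Dom C (U w)" using 5 to by simp
    show ?case using comp[OF v(1,3) c] to(2)[OF compV(1)[OF v(1,3) c]] compV(2)[OF v(1,3) c] v to by simp
  next
    case (6 x)
    obtain v where v: "v \<in> V" "x = \<Psi> v" using onto 6 by metis
    show ?case using comp[OF idV(1) v(1), of "Dom C (U v)"] compV_id(1)[OF v(1)] id[of "Dom C (U v)"] v to U_arr[OF v(1)] idV(2) by simp
  next
    case (7 x)
    obtain v where v: "v \<in> V" "x = \<Psi> v" using onto 7 by metis
    show ?case using comp[OF v(1) idV(1), of "Cod C (U v)"] compV_id(2)[OF v(1)] id[of "Cod C (U v)"] v to U_arr[OF v(1)] idV(2) by simp
  next
    case (8 x y z)
    obtain a b c where v: "a \<in> V" "x = \<Psi> a" "b \<in> V" "y = \<Psi> b" "c \<in> V" "z = \<Psi> c" using onto 8 by metis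
    then have e: "Cod C (U a) = Dom C (U b)" "Cod C (U b) = Dom C (U c)" using 8 to by simp_all
    have f: "Cod C (U a) = Dom C (U (compV c b))" "Cod C (U (compV b a)) = Dom C (U c)"
      using e v compV(2) U_arr by simp_all
    show ?case
      using comp[OF v(1) compV(1)[OF v(3,5) e(2)] f(1)] comp[OF compV(1)[OF v(1,3) e(1)] v(5) f(2)]
        comp[OF v(1,3) e(1)] comp[OF v(3,5) e(2)] compV_assoc[OF v(1,3,5) e] v by simp
  next
    case (9 x)
    obtain v where v: "v \<in> V" "x = \<Psi> v" using onto 9 by metis
    have "Sq (U v) (U v) (Ide C (Dom C (U v))) (Ide C (Cod C (U v))) \<in> squares C" using U_arr v by simp
    then show ?case using P[OF v(1,1)] P_id[OF v(1)] v to by simp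
  next
    case (10 x y z h k h' k')
    obtain a b c where v: "a \<in> V" "x = \<Psi> a" "b \<in> V" "y = \<Psi> b" "c \<in> V" "z = \<Psi> c" using onto 10 by metis
    have s: "Sq (U a) (U b) h k \<in> squares C" "Sq (U b) (U c) h' k' \<in> squares C" using 10(4,5) v to by simp_all
    then have "Sq (U a) (U c) (h' \<cdot> h) (k' \<cdot> k) \<in> squares C" using squares_comp[OF s] by (simp del: Sq_in_squares)
    then show ?case using P_hcomp[OF v(1,3,5) s] P v s 10(6,7) by simp
  next
    case (11 h)
    have "Sq (U (idV (Dom C h))) (U (idV (Cod C h))) h h \<in> squares C" using 11 idV by simp
    then show ?case using P[OF idV(1) idV(1), of "Dom C h" "Cod C h" h h] P_vid[OF 11] 11 id by simp
  next
    case (12 x y x' y' h k m)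
    obtain a b a' b' where v: "a \<in> V" "x = \<Psi> a" "b \<in> V" "y = \<Psi> b" "a' \<in> V" "x' = \<Psi> a'" "b' \<in> V" "y' = \<Psi> b'"
      using onto 12 by metis
    have s: "Sq (U a) (U b) h k \<in> squares C" "Sq (U a') (U b') k m \<in> squares C" using 12(5,6) v to by simp_all
    then have c: "Cod C (U a) = Dom C (U a')" "Cod C (U b) = Dom C (U b')" by auto
    have "Sq (U (compV a' a)) (U (compV b' b)) h m \<in> squares C"
      using squares_vcomp[OF s] compV(2) v c by (simp del: Sq_in_squares)
    then have "P' (Sq (\<Psi> (compV a' a)) (\<Psi> (compV b' b)) h m)"
      using P[OF compV(1)[OF v(1,5) c(1)] compV(1)[OF v(3,7) c(2)]] P_vcomp[OF v(1,3,5,7) s] P[OF v(1,3) s(1)] P[OF v(5,7) s(2)] 12(7,8) v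
      by simp
    then show ?case using comp[OF v(1,5) c(1)] comp[OF v(3,7) c(2)] v by simp
  qed
qed

section \<open>Comonad, monad and distributive law of the factorization\<close>

context free_liftings
begin

lemma counit_nat_trans: "is_nat_trans (arrow_cat C) (arrow_cat C) (LF W) fid (counit C W)"
proof (rule arrow_nat_transI[OF L_functor functor_id[OF arrow_cat_category]])
  fix f assume f: "f \<in> Arr C"
  show "counit C W f \<in> hom (arrow_cat C) (omap (LF W) f) (omap fid f)"
    using LR[OF f] f by (simp add: hom_def fid_def)
next
  fix f g h k assume s: "Sq f g h k \<in> squares C"
  show "counit C W g \<cdot>\<^bsub>arrow_cat C\<^esub> amap (LF W) (Sq f g h k) = amap fid (Sq f g h k) \<cdot>\<^bsub>arrow_cat C\<^esub> counit C W f"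
    using Em[OF s] s by (simp add: fid_def)
qed

lemma unit_nat_trans: "is_nat_trans (arrow_cat C) (arrow_cat C) fid (RF W) (unit C W)"
proof (rule arrow_nat_transI[OF functor_id[OF arrow_cat_category] R_functor])
  fix f assume f: "f \<in> Arr C"
  show "unit C W f \<in> hom (arrow_cat C) (omap fid f) (omap (RF W) f)"
    using LR[OF f] f by (simp add: hom_def fid_def)
next
  fix f g h k assume s: "Sq f g h k \<in> squares C"
  show "unit C W g \<cdot>\<^bsub>arrow_cat C\<^esub> amap fid (Sq f g h k) = amap (RF W) (Sq f g h k) \<cdot>\<^bsub>arrow_cat C\<^esub> unit C W f"
    using Em[OF s] s by (simp add: fid_def)
qed

lemma Comult_nat_trans: "is_nat_trans (arrow_cat C) (arrow_cat C) (LF W) (fcomp (LF W) (LF W)) (Comult W)"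
proof (rule arrow_nat_transI[OF L_functor functor_comp[OF L_functor L_functor]])
  fix f assume f: "f \<in> Arr C"
  show "Comult W f \<in> hom (arrow_cat C) (omap (LF W) f) (omap (fcomp (LF W) (LF W)) f)"
    using LR[OF f] LR[OF LR(1)[OF f]] f dlt[OF f] by (simp add: hom_def)
next
  fix f g h k assume s: "Sq f g h k \<in> squares C"
  then show "Comult W g \<cdot>\<^bsub>arrow_cat C\<^esub> amap (LF W) (Sq f g h k) =
      amap (fcomp (LF W) (LF W)) (Sq f g h k) \<cdot>\<^bsub>arrow_cat C\<^esub> Comult W f"
    using dlt_nat[OF s] by simp
qed

lemma Mult_nat_trans: "is_nat_trans (arrow_cat C) (arrow_cat C) (fcomp (RF W) (RF W)) (RF W) (Mult W)"
proof (rule arrow_nat_transI[OF functor_comp[OF R_functor R_functor] R_functor])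
  fix f assume f: "f \<in> Arr C"
  show "Mult W f \<in> hom (arrow_cat C) (omap (fcomp (RF W) (RF W)) f) (omap (RF W) f)"
    using LR[OF f] LR[OF LR(6)[OF f]] f mlt[OF f] by (simp add: hom_def)
next
  fix f g h k assume s: "Sq f g h k \<in> squares C"
  then show "Mult W g \<cdot>\<^bsub>arrow_cat C\<^esub> amap (fcomp (RF W) (RF W)) (Sq f g h k) =
      amap (RF W) (Sq f g h k) \<cdot>\<^bsub>arrow_cat C\<^esub> Mult W f"
    using mlt_nat[OF s] by simp
qed

lemma comonad: "is_comonad (arrow_cat C) (LF W) (counit C W) (Comult W)"
  unfolding is_comonad_def
proof (intro conjI ballI counit_nat_trans Comult_nat_trans)
  fix f assume "f \<in> Obj (arrow_cat C)"
  then have f: "f \<in> Arr C" by simp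
  note F = LR[OF f] and d = dlt[OF f]
  show "counit C W (omap (LF W) f) \<cdot>\<^bsub>arrow_cat C\<^esub> Comult W f = Ide (arrow_cat C) (omap (LF W) f)"
    "amap (LF W) (counit C W f) \<cdot>\<^bsub>arrow_cat C\<^esub> Comult W f = Ide (arrow_cat C) (omap (LF W) f)"
    using dlt_counit[OF f] F f by simp_all
  show "Comult W (omap (LF W) f) \<cdot>\<^bsub>arrow_cat C\<^esub> Comult W f = amap (LF W) (Comult W f) \<cdot>\<^bsub>arrow_cat C\<^esub> Comult W f"
    using dlt_coassoc[OF f] F f by simp
qed

lemma monad: "is_monad (arrow_cat C) (RF W) (unit C W) (Mult W)"
  unfolding is_monad_def
proof (intro conjI ballI unit_nat_trans Mult_nat_trans)
  fix f assume "f \<in> Obj (arrow_cat C)"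
  then have f: "f \<in> Arr C" by simp
  note F = LR[OF f] and m = mlt[OF f]
  show "Mult W f \<cdot>\<^bsub>arrow_cat C\<^esub> unit C W (omap (RF W) f) = Ide (arrow_cat C) (omap (RF W) f)"
    "Mult W f \<cdot>\<^bsub>arrow_cat C\<^esub> amap (RF W) (unit C W f) = Ide (arrow_cat C) (omap (RF W) f)"
    using m mlt_unit[OF f] F f by simp_all
  show "Mult W f \<cdot>\<^bsub>arrow_cat C\<^esub> Mult W (omap (RF W) f) = Mult W f \<cdot>\<^bsub>arrow_cat C\<^esub> amap (RF W) (Mult W f)"
    using mlt_assoc[OF f] F f by simp
qed

text \<open>Each square of the family commutes because both composites are identities, by a counit
  law of \<delta> and a unit law of \<mu>. The equation \<open>distributive\<close> is the lower
  component of the axiom for \<delta> and also the upper component of the axiom for \<mu>; the other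
  components are laws or boundary equations of the comonad and the monad.\<close>

lemma distributive_law:
  "is_distributive_law (arrow_cat C) (LF W) (counit C W) (Comult W) (RF W) (unit C W) (Mult W)
     (\<lambda>f. Sq (omap (LF W) (omap (RF W) f)) (omap (RF W) (omap (LF W) f)) (delta W f) (mu W f))"
    (is "is_distributive_law _ _ _ _ _ _ _ ?\<theta>")
proof -
  have sq: "Sq (Lo (Ro f)) (Ro (Lo f)) (dlt f) (mlt f) \<in> squares C" if f: "f \<in> Arr C" for f
    using LR[OF f] dlt[OF f] mlt[OF f] LR[OF LR(1)[OF f]] LR[OF LR(6)[OF f]] dlt_counit(1)[OF f] by simp
  have "is_nat_trans (arrow_cat C) (arrow_cat C) (fcomp (LF W) (RF W)) (fcomp (RF W) (LF W)) ?\<theta>"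
  proof (rule arrow_nat_transI[OF functor_comp[OF R_functor L_functor] functor_comp[OF L_functor R_functor]])
    fix f assume "f \<in> Arr C"
    then show "?\<theta> f \<in> hom (arrow_cat C) (omap (fcomp (LF W) (RF W)) f) (omap (fcomp (RF W) (LF W)) f)"
      using sq by (simp add: hom_def del: Sq_in_squares)
  next
    fix f g h k assume s: "Sq f g h k \<in> squares C"
    show "?\<theta> g \<cdot>\<^bsub>arrow_cat C\<^esub> amap (fcomp (LF W) (RF W)) (Sq f g h k) =
        amap (fcomp (RF W) (LF W)) (Sq f g h k) \<cdot>\<^bsub>arrow_cat C\<^esub> ?\<theta> f"
      using dlt_nat[OF s] mlt_nat[OF s] by simp
  qed
  moreover have
    "amap (RF W) (counit C W f) \<cdot>\<^bsub>arrow_cat C\<^esub> ?\<theta> f = counit C W (omap (RF W) f) \<and>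
     amap (RF W) (Comult W f) \<cdot>\<^bsub>arrow_cat C\<^esub> ?\<theta> f
       = ?\<theta> (omap (LF W) f) \<cdot>\<^bsub>arrow_cat C\<^esub> amap (LF W) (?\<theta> f) \<cdot>\<^bsub>arrow_cat C\<^esub> Comult W (omap (RF W) f) \<and>
     ?\<theta> f \<cdot>\<^bsub>arrow_cat C\<^esub> amap (LF W) (unit C W f) = unit C W (omap (LF W) f) \<and>
     ?\<theta> f \<cdot>\<^bsub>arrow_cat C\<^esub> amap (LF W) (Mult W f)
       = Mult W (omap (LF W) f) \<cdot>\<^bsub>arrow_cat C\<^esub> amap (RF W) (?\<theta> f) \<cdot>\<^bsub>arrow_cat C\<^esub> ?\<theta> (omap (RF W) f)"
    if "f \<in> Obj (arrow_cat C)" for f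
  proof -
    have f: "f \<in> Arr C" using that by simp
    note F = LR[OF f] and d = dlt[OF f] and m = mlt[OF f] and dR = dlt[OF LR(6)[OF f]]
      and mL = mlt[OF LR(1)[OF f]] and mR = mlt[OF LR(6)[OF f]] and L = LR[OF LR(1)[OF f]] and R = LR[OF LR(6)[OF f]]
    have "Sq (Ro (Ro f)) (Ro f) (mlt f) (Ide C (Cod C f)) \<in> squares C" using f F R m by simp
    note e = Em(3-5)[OF this]
    show ?thesis
      using F d m dR mL mR L R e dlt_counit[OF f] dlt_coassoc[OF f] distributive[OF f] mlt_unit[OF f] mlt_assoc[OF f] by simp
  qed
  ultimately show ?thesis unfolding is_distributive_law_def by blast
qed

lemma awfs: "is_awfs C W"
  unfolding is_awfs_def
proof (intro conjI ballI L_functor R_functor comonad monad distributive_law)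
  fix \<sigma> assume "\<sigma> \<in> squares C"
  show "upper (amap (LF W) \<sigma>) = upper \<sigma>" "lower (amap (LF W) \<sigma>) = upper (amap (RF W) \<sigma>)"
    "lower (amap (RF W) \<sigma>) = lower \<sigma>"
    by (cases \<sigma>; simp)+
qed (use LR in simp_all)

section \<open>Algebras and lifting structures\<close>

lemma R_algebras_iff:
  "(f, p) \<in> R_algebras C W \<longleftrightarrow> f \<in> Arr C \<and> p \<in> Arr C \<and> Dom C p = Dom C (Ro f) \<and> Cod C p = Dom C f \<and>
     f \<cdot> p = Ro f \<and> p \<cdot> Lo f = Ide C (Dom C f) \<and> p \<cdot> mlt f = p \<cdot> Em (Ro f) f p (Ide C (Cod C f))"
proof (cases "f \<in> Arr C")
  case True
  then show ?thesis
    using LR[OF True] by (auto simp: R_algebras_def is_algebra_def alg_structure_def hom_def)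
next
  case False
  then show ?thesis by (simp add: R_algebras_def is_algebra_def)
qed

text \<open>The counit at \<open>v\<close> of the adjunction between free and underlying arrows,
  hence the structure map that \<open>v\<close> induces for the monad R.\<close>

definition str :: "'m \<times> ('i \<times> ('m, 'm) sq \<Rightarrow> 'm) \<Rightarrow> 'm" where
  "str v = extend (fst v) v (Ide C (Dom C (fst v))) (Ide C (Cod C (fst v)))"

definition alg_of :: "'m \<times> ('i \<times> ('m, 'm) sq \<Rightarrow> 'm) \<Rightarrow> 'm \<times> 'm" where
  "alg_of v = (fst v, str v)"

definition lift_of :: "'m \<times> 'm \<Rightarrow> 'm \<times> ('i \<times> ('m, 'm) sq \<Rightarrow> 'm)" where
  "lift_of x = lifting_of (fst x) (\<lambda>i p q. snd x \<cdot> filler (Rv (fst x)) i (Lo (fst x) \<cdot> p) q)"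

lemma str:
  assumes v: "v \<in> V"
  shows "lmor (Rv (fst v)) v (str v) (Ide C (Cod C (fst v)))" "str v \<cdot> Lo (fst v) = Ide C (Dom C (fst v))"
    "str v \<in> Arr C" "Dom C (str v) = Dom C (Ro (fst v))" "Cod C (str v) = Dom C (fst v)" "fst v \<cdot> str v = Ro (fst v)"
proof -
  have f: "fst v \<in> Arr C" using v by simp
  have "Sq (fst v) (fst v) (Ide C (Dom C (fst v))) (Ide C (Cod C (fst v))) \<in> squares C" using f by simp
  from extend[OF v this]
  show *: "lmor (Rv (fst v)) v (str v) (Ide C (Cod C (fst v)))" "str v \<cdot> Lo (fst v) = Ide C (Dom C (fst v))"
    by (simp_all add: str_def)
  show "str v \<in> Arr C" "Dom C (str v) = Dom C (Ro (fst v))" "Cod C (str v) = Dom C (fst v)" "fst v \<cdot> str v = Ro (fst v)"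
    using lmorD[OF *(1)] LR[OF f] by simp_all
qed

lemma fst_alg_of [simp]: "fst (alg_of v) = fst v" and snd_alg_of [simp]: "snd (alg_of v) = str v"
  by (simp_all add: alg_of_def)

lemma fst_lift_of [simp]: "fst (lift_of x) = fst x"
  by (simp add: lift_of_def)

lemma alg_of_in:
  assumes v: "v \<in> V"
  shows "alg_of v \<in> R_algebras C W"
proof -
  have f: "fst v \<in> Arr C" using v by simp
  let ?f = "fst v" and ?i = "Ide C (Cod C (fst v))"
  note s = str[OF v] and F = LR[OF f] and m = mlt[OF f] and R = LR[OF LR(6)[OF f]]
  have sq: "Sq (Ro ?f) ?f (str v) ?i \<in> squares C" using s F f by simp
  note e = Em[OF sq]
  have "str v \<cdot> mlt ?f = str v \<cdot> Em (Ro ?f) ?f (str v) ?i"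
  proof (rule free_unique[OF F(6)])
    show "lmor (Rv (Ro ?f)) v (str v \<cdot> mlt ?f) ?i" "lmor (Rv (Ro ?f)) v (str v \<cdot> Em (Ro ?f) ?f (str v) ?i) ?i"
      using lmor_comp[OF m(1) s(1)] lmor_comp[OF e(1) s(1)] f by simp_all
    show "(str v \<cdot> mlt ?f) \<cdot> Lo (Ro ?f) = (str v \<cdot> Em (Ro ?f) ?f (str v) ?i) \<cdot> Lo (Ro ?f)"
      using s m e F R comp_eq_ide_assoc[OF s(2), of "str v"] by simp
  qed
  then show ?thesis unfolding alg_of_def R_algebras_iff using s f by simp
qed

text \<open>The structure map retracts L f and lies over \<open>f\<close>, which yields the two
  triangles. That it is moreover a morphism out of the free structure is where associativity of the
  algebra enters.\<close>

lemma lift_of_in: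
  assumes x: "x \<in> R_algebras C W"
  shows "lift_of x \<in> V" "lmor (Rv (fst x)) (lift_of x) (snd x) (Ide C (Cod C (fst x)))"
proof -
  obtain f p where xe: "x = (f, p)" by (cases x)
  have f: "f \<in> Arr C" and p: "p \<in> Arr C" "Dom C p = Dom C (Ro f)" "Cod C p = Dom C f" "f \<cdot> p = Ro f"
    "p \<cdot> Lo f = Ide C (Dom C f)" "p \<cdot> mlt f = p \<cdot> Em (Ro f) f p (Ide C (Cod C f))"
    using x unfolding xe R_algebras_iff by auto
  note F = LR[OF f] and R = LR[OF LR(6)[OF f]] and m = mlt[OF f]
  have L: "problem i (Ro f) (Lo f \<cdot> a) b" if "problem i f a b" for i a b
  proof -
    have "Sq f (Ro f) (Lo f) (Ide C (Cod C f)) \<in> squares C" using f F by simp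
    from problem_comp[OF that this] show ?thesis using that by (simp add: problem_iff)
  qed
  have PL: "problem i f (p \<cdot> a) b" if "problem i (Ro f) a b" for i a b
  proof -
    have "Sq (Ro f) f p (Ide C (Cod C f)) \<in> squares C" using f F p by simp
    from problem_comp[OF that this] show ?thesis using that F by (simp add: problem_iff)
  qed
  show *: "lift_of x \<in> V"
    unfolding lift_of_def xe fst_conv snd_conv
  proof (rule lifting_ofI[OF f])
    fix i a b assume pr: "problem i f a b"
    have "problem i (fst (Rv f)) (Lo f \<cdot> a) b" using L[OF pr] F by simp
    note D = fillerD[OF F(4) this]
    have a: "a \<in> Arr C" "Cod C a = Dom C f" using pr by (auto simp: problem_iff)
    show "p \<cdot> filler (Rv f) i (Lo f \<cdot> a) b \<in> Arr C \<and> Dom C (p \<cdot> filler (Rv f) i (Lo f \<cdot> a) b) = Cod C (omap u i) \<and>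
       Cod C (p \<cdot> filler (Rv f) i (Lo f \<cdot> a) b) = Dom C f \<and> (p \<cdot> filler (Rv f) i (Lo f \<cdot> a) b) \<cdot> omap u i = a \<and>
       f \<cdot> p \<cdot> filler (Rv f) i (Lo f \<cdot> a) b = b"
      using D p f F a comp_eq_ide_assoc[OF p(5), of a] comp_eq_assoc[OF p(4), of "filler (Rv f) i (Lo f \<cdot> a) b"] pr
      by (simp add: problem_def del: Sq_in_squares)
  next
    fix t a b assume t: "t \<in> Arr J" and pr: "problem (Cod J t) f a b"
    have 1: "problem (Cod J t) (fst (Rv f)) (Lo f \<cdot> a) b" using L[OF pr] F by simp
    have "(Lo f \<cdot> a) \<cdot> upper (amap u t) = Lo f \<cdot> a \<cdot> upper (amap u t)"
      using pr F u_sq[OF t] by (simp add: problem_iff)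
    then show "p \<cdot> filler (Rv f) (Dom J t) (Lo f \<cdot> a \<cdot> upper (amap u t)) (b \<cdot> lower (amap u t)) =
       (p \<cdot> filler (Rv f) (Cod J t) (Lo f \<cdot> a) b) \<cdot> lower (amap u t)"
      using filler_nat[OF F(4) t 1] fillerD[OF F(4) 1] p F u_sq[OF t] by simp
  qed
  show "lmor (Rv (fst x)) (lift_of x) (snd x) (Ide C (Cod C (fst x)))"
    unfolding lmor_def
  proof (intro conjI allI impI *)
    show "Rv (fst x) \<in> V" using F xe by simp
    show "Sq (fst (Rv (fst x))) (fst (lift_of x)) (snd x) (Ide C (Cod C (fst x))) \<in> squares C"
      using F p f xe by simp
    fix i a b assume "problem i (fst (Rv (fst x))) a b"
    then have pr: "problem i (Ro f) a b" using F xe by simp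
    have b: "Ide C (Cod C f) \<cdot> b = b" and ba: "Ide C (Cod C (Ro f)) \<cdot> b = b" using pr F by (simp_all add: problem_iff)
    have a: "a \<in> Arr C" "Cod C a = Dom C (Ro f)" using pr by (auto simp: problem_iff)
    have sqL: "Sq (Ro f) (Ro (Ro f)) (Lo (Ro f)) (Ide C (Cod C f)) \<in> squares C" using f F R by simp
    have prL: "problem i (Ro (Ro f)) (Lo (Ro f) \<cdot> a) b" using problem_comp[OF pr sqL] b by simp
    have prL': "problem i (fst (Rv (Ro f))) (Lo (Ro f) \<cdot> a) b" using prL R by simp
    note D = fillerD[OF R(4) prL']
    have sqp: "Sq (Ro f) f p (Ide C (Cod C f)) \<in> squares C" using f F p by simp
    note e = Em[OF sqp]
    \<comment> \<open>By the unit law, a filler of R f is the image under \<mu> of a filler of R (R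
      f). Associativity then replaces \<mu> by E (p, id), which moves the problem along
      \<open>p\<close>.\<close>
    have "filler (Rv f) i a b = mlt f \<cdot> filler (Rv (Ro f)) i (Lo (Ro f) \<cdot> a) b"
      using lmorD(11)[OF m(1) prL'] comp_eq_ide_assoc[OF m(2), of a] a m R F b by simp
    then have "p \<cdot> filler (Rv f) i a b = (p \<cdot> mlt f) \<cdot> filler (Rv (Ro f)) i (Lo (Ro f) \<cdot> a) b"
      using p(1-5) m D R by simp
    also have "\<dots> = p \<cdot> Em (Ro f) f p (Ide C (Cod C f)) \<cdot> filler (Rv (Ro f)) i (Lo (Ro f) \<cdot> a) b"
      unfolding p(6) using p e D R by simp
    also have "\<dots> = p \<cdot> filler (Rv f) i (Lo f \<cdot> p \<cdot> a) b"
      using lmorD(11)[OF e(1) prL'] comp_eq_assoc[OF e(2), of a] a e R F p b by simp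
    finally have "p \<cdot> filler (Rv f) i a b = p \<cdot> filler (Rv f) i (Lo f \<cdot> p \<cdot> a) b" .
    then show "filler (lift_of x) i (snd x \<cdot> a) (Ide C (Cod C (fst x)) \<cdot> b) = snd x \<cdot> filler (Rv (fst x)) i a b"
      using PL[OF pr] b by (simp add: lift_of_def xe)
  qed
qed

lemma str_unique:
  assumes v: "v \<in> V" and p: "lmor (Rv (fst v)) v p (Ide C (Cod C (fst v)))" "p \<cdot> Lo (fst v) = Ide C (Dom C (fst v))"
  shows "str v = p"
  by (rule free_unique[OF _ str(1)[OF v] p(1)]) (use v p(2) str(2)[OF v] in simp_all)

lemma alg_of_lift_of:
  assumes x: "x \<in> R_algebras C W"
  shows "alg_of (lift_of x) = x"
proof -
  obtain f p where xe: "x = (f, p)" by (cases x)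
  have "str (lift_of x) = snd x"
    by (rule str_unique) (use lift_of_in[OF x] x in \<open>simp_all add: xe R_algebras_iff\<close>)
  then show ?thesis by (simp add: alg_of_def)
qed

text \<open>\<open>str v\<close> preserves fillers and retracts L f, so pushing a problem along L f
  and bringing the filler back returns the original filler.\<close>

lemma lift_of_alg_of:
  assumes v: "v \<in> V"
  shows "lift_of (alg_of v) = v"
proof (rule lifting_eqI[OF lift_of_in(1)[OF alg_of_in[OF v]] v])
  note s = str[OF v] and F = LR[OF lifting_fst[OF v]]
  fix i p q assume "problem i (fst (lift_of (alg_of v))) p q"
  then have pr: "problem i (fst v) p q" by simp
  have "Sq (fst v) (fst (Rv (fst v))) (Lo (fst v)) (Ide C (Cod C (fst v))) \<in> squares C" using F v by simp
  from problem_comp[OF pr this] have pr': "problem i (fst (Rv (fst v))) (Lo (fst v) \<cdot> p) q"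
    using pr by (simp add: problem_iff)
  have "p \<in> Arr C" "Cod C p = Dom C (fst v)" "Ide C (Cod C (fst v)) \<cdot> q = q" using pr by (auto simp: problem_iff)
  then have "str v \<cdot> filler (Rv (fst v)) i (Lo (fst v) \<cdot> p) q = filler v i p q"
    using lmorD(11)[OF s(1) pr'] comp_eq_ide_assoc[OF s(2), of p] s F by simp
  then show "filler (lift_of (alg_of v)) i p q = filler v i p q"
    using pr by (simp add: lift_of_def)
qed simp

text \<open>Algebra morphisms are the squares that commute with \<open>str\<close>. Morphisms of
  lifting structures do so by freeness. Conversely, every filler in \<open>v\<close> is the image
  under \<open>str v\<close> of a filler of the free structure, so commuting with \<open>str\<close>
  forces fillers to be preserved.\<close>

lemma algebra_morphism_iff:
  assumes v: "v \<in> V" and w: "w \<in> V" and sq: "Sq (fst v) (fst w) h k \<in> squares C"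
  shows "is_algebra_morphism (arrow_cat C) (RF W) (fst (alg_of v)) (alg_structure C W (alg_of v))
      (fst (alg_of w)) (alg_structure C W (alg_of w)) (Sq (fst v) (fst w) h k) \<longleftrightarrow> lmor v w h k"
proof -
  note s = str[OF v] and t = str[OF w] and F = LR[OF lifting_fst[OF v]] and G = LR[OF lifting_fst[OF w]] and e = Em[OF sq]
  have "is_algebra_morphism (arrow_cat C) (RF W) (fst (alg_of v)) (alg_structure C W (alg_of v))
      (fst (alg_of w)) (alg_structure C W (alg_of w)) (Sq (fst v) (fst w) h k)
    \<longleftrightarrow> h \<cdot> str v = str w \<cdot> Em (fst v) (fst w) h k"
    using sq by (auto simp: is_algebra_morphism_def alg_structure_def alg_of_def hom_def)
  also have "\<dots> \<longleftrightarrow> lmor v w h k"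
  proof
    assume m: "lmor v w h k"
    have k: "k \<cdot> Ide C (Cod C (fst v)) = k" "Ide C (Cod C (fst w)) \<cdot> k = k" using sq by simp_all
    show "h \<cdot> str v = str w \<cdot> Em (fst v) (fst w) h k"
    proof (rule free_unique[OF lifting_fst[OF v]])
      show "lmor (Rv (fst v)) w (h \<cdot> str v) k" "lmor (Rv (fst v)) w (str w \<cdot> Em (fst v) (fst w) h k) k"
        using lmor_comp[OF s(1) m] lmor_comp[OF e(1) t(1)] k by simp_all
      show "(h \<cdot> str v) \<cdot> Lo (fst v) = (str w \<cdot> Em (fst v) (fst w) h k) \<cdot> Lo (fst v)"
        using s t e F G sq comp_eq_ide_assoc[OF t(2), of h] by simp
    qed
  next
    assume eq: "h \<cdot> str v = str w \<cdot> Em (fst v) (fst w) h k"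
    show "lmor v w h k"
      unfolding lmor_def
    proof (intro conjI allI impI v w sq)
      fix i p q assume pr: "problem i (fst v) p q"
      have "Sq (fst v) (fst (Rv (fst v))) (Lo (fst v)) (Ide C (Cod C (fst v))) \<in> squares C" using F v by simp
      from problem_comp[OF pr this] have pr': "problem i (fst (Rv (fst v))) (Lo (fst v) \<cdot> p) q"
        using pr by (simp add: problem_iff)
      have p: "p \<in> Arr C" "Cod C p = Dom C (fst v)" "Ide C (Cod C (fst v)) \<cdot> q = q" using pr by (auto simp: problem_iff)
      note D = fillerD[OF F(4) pr']
      have prw: "problem i (fst (Rv (fst w))) (Em (fst v) (fst w) h k \<cdot> Lo (fst v) \<cdot> p) (k \<cdot> q)"
        using problem_comp[OF pr' lmorD(3)[OF e(1)]] .
      have kq: "Ide C (Cod C (fst w)) \<cdot> k \<cdot> q = k \<cdot> q" using problem_comp[OF pr sq] by (simp add: problem_iff)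
      have "h \<cdot> filler v i p q = h \<cdot> str v \<cdot> filler (Rv (fst v)) i (Lo (fst v) \<cdot> p) q"
        using lmorD(11)[OF s(1) pr'] comp_eq_ide_assoc[OF s(2), of p] p s F by simp
      also have "\<dots> = str w \<cdot> Em (fst v) (fst w) h k \<cdot> filler (Rv (fst v)) i (Lo (fst v) \<cdot> p) q"
        using comp_eq_assoc[OF eq, of "filler (Rv (fst v)) i (Lo (fst v) \<cdot> p) q"] s t e D F sq by simp
      also have "\<dots> = filler w i (str w \<cdot> Em (fst v) (fst w) h k \<cdot> Lo (fst v) \<cdot> p) (k \<cdot> q)"
        using lmorD(11)[OF e(1) pr'] lmorD(11)[OF t(1) prw] kq by simp
      also have "str w \<cdot> Em (fst v) (fst w) h k \<cdot> Lo (fst v) \<cdot> p = h \<cdot> p"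
        using comp_eq_assoc[OF e(2), of p] comp_eq_ide_assoc[OF t(2), of "h \<cdot> p"] p e t F G sq by simp
      finally show "filler w i (h \<cdot> p) (k \<cdot> q) = h \<cdot> filler v i p q" by simp
    qed
  qed
  finally show ?thesis .
qed

lemma alg_of_lift_id:
  assumes A: "A \<in> Obj C"
  shows "alg_of (lift_id C J u A) = alg_id C W A"
proof -
  note s = str[OF lift_id_in[OF A]]
  have "str (lift_id C J u A) = Ro (Ide C A)" using s A by simp
  then show ?thesis by (simp add: alg_of_def alg_id_def)
qed

text \<open>The formula for the composite algebra, read from right to left, is a chain of morphisms
  of lifting structures that starts at the free structure on gf: \<delta> into the composite on R
  (gf) \<cdot> R (L (gf)), then into the one on R g \<cdot> R (L g \<cdot> f), then into the
  composite of \<open>w\<close> and \<open>v\<close>. It restricts to the identity along L (gf), so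
  \<open>str_unique\<close> applies.\<close>

lemma alg_of_vcomp:
  assumes v: "v \<in> V" and w: "w \<in> V" and c: "Cod C (fst v) = Dom C (fst w)"
  shows "alg_of (vcomp w v) = alg_comp C W (alg_of w) (alg_of v)"
proof -
  let ?f = "fst v" and ?g = "fst w"
  let ?gf = "?g \<cdot> ?f" and ?iA = "Ide C (Dom C (fst v))" and ?iC = "Ide C (Cod C (fst w))"
  let ?l = "Lo ?g \<cdot> ?f"
  have f: "?f \<in> Arr C" and g: "?g \<in> Arr C" using v w by simp_all
  then have gf: "?gf \<in> Arr C" using c by simp
  have wv: "vcomp w v \<in> V" using vcomp_in[OF v w c] .
  note F = LR[OF f] and G = LR[OF g] and GF = LR[OF gf] and s = str[OF v] and t = str[OF w]
    and d = dlt[OF gf] and LGF = LR[OF LR(1)[OF gf]]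
  have l: "?l \<in> Arr C" "Dom C ?l = Dom C ?f" "Cod C ?l = Dom C (Ro ?g)" using F G f g c by simp_all
  note Ll = LR[OF l(1)]
  have s1: "Sq ?gf ?g ?f ?iC \<in> squares C" using f g c by simp
  note e1 = Em[OF s1]
  let ?e1 = "Em ?gf ?g ?f ?iC"
  have s2: "Sq (Lo ?gf) ?l ?iA ?e1 \<in> squares C" using e1 l GF f g c by simp
  note e2 = Em[OF s2]
  let ?e2 = "Em (Lo ?gf) ?l ?iA ?e1"
  have s3: "Sq ?l ?f ?iA (str w) \<in> squares C" using l f g c t G comp_eq_ide_assoc[OF t(2), of ?f] by simp
  note e3 = Em[OF s3]
  let ?e3 = "Em ?l ?f ?iA (str w)"
  have m1: "lmor (Rv2 ?gf) (vcomp (Rv ?g) (Rv ?l)) ?e2 ?iC"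
    unfolding Rv2_def by (rule lmor_vcomp[OF e2(1) e1(1)])
  \<comment> \<open>The lower side \<open>str w\<close> of this morphism is the upper side of the
    morphism from the free structure on g to \<open>w\<close>; hence the two can be stacked.\<close>
  have "lmor (Rv ?l) v (str v \<cdot> ?e3) (str w)"
    using lmor_comp[OF e3(1) s(1)] t c by simp
  then have m2: "lmor (vcomp (Rv ?g) (Rv ?l)) (vcomp w v) (str v \<cdot> ?e3) ?iC"
    by (rule lmor_vcomp[OF _ t(1)])
  have "str (vcomp w v) = str v \<cdot> ?e3 \<cdot> ?e2 \<cdot> dlt ?gf"
  proof (rule str_unique[OF wv])
    show "lmor (Rv (fst (vcomp w v))) (vcomp w v) (str v \<cdot> ?e3 \<cdot> ?e2 \<cdot> dlt ?gf) (Ide C (Cod C (fst (vcomp w v))))"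
      using lmor_comp[OF lmor_comp[OF d(1) m1] m2] f g c s e3 e2 d l Ll F LGF by simp
    show "(str v \<cdot> ?e3 \<cdot> ?e2 \<cdot> dlt ?gf) \<cdot> Lo (fst (vcomp w v)) = Ide C (Dom C (fst (vcomp w v)))"
      using d e2 e3 s l Ll F LGF GF f g c by simp
  qed
  then show ?thesis
    using f g c by (simp add: alg_of_def alg_comp_def Let_def)
qed

lemma RAlg_structured:
  "structured C (R_algebras C W) fst (alg_id C W) (alg_comp C W)
     (\<lambda>\<beta>. is_algebra_morphism (arrow_cat C) (RF W) (fst (src \<beta>)) (alg_structure C W (src \<beta>))
        (fst (tgt \<beta>)) (alg_structure C W (tgt \<beta>)) (underlying fst \<beta>))"
proof (rule structured_transfer[OF lift_structured, where \<Psi> = alg_of])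
  fix x assume "x \<in> R_algebras C W"
  then show "\<exists>v \<in> V. x = alg_of v" using lift_of_in(1) alg_of_lift_of by metis
next
  fix v w h k assume a: "v \<in> V" "w \<in> V" "Sq (fst v) (fst w) h k \<in> squares C"
  show "is_algebra_morphism (arrow_cat C) (RF W) (fst (src (Sq (alg_of v) (alg_of w) h k)))
      (alg_structure C W (src (Sq (alg_of v) (alg_of w) h k))) (fst (tgt (Sq (alg_of v) (alg_of w) h k)))
      (alg_structure C W (tgt (Sq (alg_of v) (alg_of w) h k))) (underlying fst (Sq (alg_of v) (alg_of w) h k)) \<longleftrightarrow>
    (\<forall>(i, \<alpha>) \<in> lifting_problems C J u (fst (src (Sq v w h k))).
       snd (tgt (Sq v w h k)) (i, underlying fst (Sq v w h k) \<cdot>\<^bsub>arrow_cat C\<^esub> \<alpha>)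
         = upper (Sq v w h k) \<cdot> snd (src (Sq v w h k)) (i, \<alpha>))"
    using algebra_morphism_iff[OF a] lift_square_iff[OF a] by (simp add: underlying_def)
qed (simp_all add: alg_of_in alg_of_lift_id alg_of_vcomp)

text \<open>\<open>lift_of\<close> and \<open>alg_of\<close> are mutually inverse over the
  underlying arrows, and squares correspond by \<open>algebra_morphism_iff\<close>. That
  \<open>lift_of\<close> respects vertical identities and composition is deduced from the same
  property of \<open>alg_of\<close>.\<close>

lemma cofibrantly_generated: "cofibrantly_generated C W J u"
proof -
  let ?F = "\<lparr>Fobj = (\<lambda>x. x), Fhor = (\<lambda>x. x), Fver = lift_of,
    Fsq = (\<lambda>\<beta>. Sq (lift_of (src \<beta>)) (lift_of (tgt \<beta>)) (upper \<beta>) (lower \<beta>))\<rparr>"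
  let ?G = "\<lparr>Fobj = (\<lambda>x. x), Fhor = (\<lambda>x. x), Fver = alg_of,
    Fsq = (\<lambda>\<beta>. Sq (alg_of (src \<beta>)) (alg_of (tgt \<beta>)) (upper \<beta>) (lower \<beta>))\<rparr>"
  interpret A: structured C "R_algebras C W" fst "alg_id C W" "alg_comp C W"
    "\<lambda>\<beta>. is_algebra_morphism (arrow_cat C) (RF W) (fst (src \<beta>)) (alg_structure C W (src \<beta>))
        (fst (tgt \<beta>)) (alg_structure C W (tgt \<beta>)) (underlying fst \<beta>)"
    by (rule RAlg_structured)
  interpret B: structured C V fst "lift_id C J u" vcomp
     "\<lambda>\<beta>. \<forall>(i, \<alpha>) \<in> lifting_problems C J u (fst (src \<beta>)).
          snd (tgt \<beta>) (i, underlying fst \<beta> \<cdot>\<^bsub>arrow_cat C\<^esub> \<alpha>) = upper \<beta> \<cdot> snd (src \<beta>) (i, \<alpha>)"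
    by (rule lift_structured)
  have G: "is_double_functor (lift_dblcat C J u) (RAlg C W) ?G"
    unfolding RAlg_def lift_dblcat_def
  proof (rule structured_double_functor[OF lift_structured RAlg_structured])
    fix v w h k assume a: "v \<in> V" "w \<in> V" "Sq (fst v) (fst w) h k \<in> squares C"
      and p: "\<forall>(i, \<alpha>) \<in> lifting_problems C J u (fst (src (Sq v w h k))).
       snd (tgt (Sq v w h k)) (i, underlying fst (Sq v w h k) \<cdot>\<^bsub>arrow_cat C\<^esub> \<alpha>)
         = upper (Sq v w h k) \<cdot> snd (src (Sq v w h k)) (i, \<alpha>)"
    then show "is_algebra_morphism (arrow_cat C) (RF W) (fst (src (Sq (alg_of v) (alg_of w) h k)))
      (alg_structure C W (src (Sq (alg_of v) (alg_of w) h k))) (fst (tgt (Sq (alg_of v) (alg_of w) h k)))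
      (alg_structure C W (tgt (Sq (alg_of v) (alg_of w) h k))) (underlying fst (Sq (alg_of v) (alg_of w) h k))"
      using algebra_morphism_iff[OF a] lift_square_iff[OF a] by (simp add: underlying_def)
  qed (simp_all add: alg_of_in alg_of_lift_id alg_of_vcomp)
  have F: "is_double_functor (RAlg C W) (lift_dblcat C J u) ?F"
    unfolding RAlg_def lift_dblcat_def
  proof (rule structured_double_functor[OF RAlg_structured lift_structured])
    fix A assume "A \<in> Obj C"
    then show "lift_of (alg_id C W A) = lift_id C J u A"
      using alg_of_lift_id lift_of_alg_of lift_id_in by metis
  next
    fix x y assume a: "x \<in> R_algebras C W" "y \<in> R_algebras C W" "Cod C (fst x) = Dom C (fst y)"
    then show "lift_of (alg_comp C W y x) = vcomp (lift_of y) (lift_of x)"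
      using alg_of_vcomp[OF lift_of_in(1)[OF a(1)] lift_of_in(1)[OF a(2)]] lift_of_alg_of[OF vcomp_in[OF lift_of_in(1)[OF a(1)] lift_of_in(1)[OF a(2)]]]
      by (simp add: alg_of_lift_of)
  next
    fix x y h k assume a: "x \<in> R_algebras C W" "y \<in> R_algebras C W" "Sq (fst x) (fst y) h k \<in> squares C"
      and p: "is_algebra_morphism (arrow_cat C) (RF W) (fst (src (Sq x y h k))) (alg_structure C W (src (Sq x y h k)))
        (fst (tgt (Sq x y h k))) (alg_structure C W (tgt (Sq x y h k))) (underlying fst (Sq x y h k))"
    have b: "lift_of x \<in> V" "lift_of y \<in> V" "Sq (fst (lift_of x)) (fst (lift_of y)) h k \<in> squares C"
      using a lift_of_in(1) by (simp_all del: Sq_in_squares)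
    show "\<forall>(i, \<alpha>) \<in> lifting_problems C J u (fst (src (Sq (lift_of x) (lift_of y) h k))).
       snd (tgt (Sq (lift_of x) (lift_of y) h k)) (i, underlying fst (Sq (lift_of x) (lift_of y) h k) \<cdot>\<^bsub>arrow_cat C\<^esub> \<alpha>)
         = upper (Sq (lift_of x) (lift_of y) h k) \<cdot> snd (src (Sq (lift_of x) (lift_of y) h k)) (i, \<alpha>)"
      using algebra_morphism_iff[OF b] lift_square_iff[OF b] p a by (simp add: underlying_def alg_of_lift_of)
  qed (simp_all add: lift_of_in)
  have "is_double_iso (RAlg C W) (lift_dblcat C J u) ?F"
    unfolding is_double_iso_def
  proof (intro conjI exI[of _ ?G] F G)
    show "dftor_eq (RAlg C W) (dcomp ?G ?F) did"
      by (simp add: dftor_eq_def dcomp_def did_def RAlg_def A.dbl_sel A.SD alg_of_lift_of)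
    show "dftor_eq (lift_dblcat C J u) (dcomp ?F ?G) did"
      by (simp add: dftor_eq_def dcomp_def did_def lift_dblcat_def B.dbl_sel B.SD lift_of_alg_of del: arrow_cat_sel)
  qed
  moreover have "dftor_eq (RAlg C W) (dcomp (forgetful fst) ?F) (forgetful fst)"
    by (simp add: dftor_eq_def dcomp_def forgetful_def underlying_def)
  moreover have "is_double_functor (RAlg C W) (Sq_dblcat C) (forgetful fst)"
    using A.forgetful_double_functor by (simp add: RAlg_def)
  moreover have "is_double_functor (lift_dblcat C J u) (Sq_dblcat C) (forgetful fst)"
    using B.forgetful_double_functor by (simp add: lift_dblcat_def)
  ultimately show ?thesis unfolding cofibrantly_generated_def by blast
qed

end

theorem theorem3p2p12:
  fixes \<kappa> :: "'k rel"
    and E :: "('o, 'm) category"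
    and M :: "'m set"
    and J :: "('i, 't) category"
    and u :: "('i, 't, 'm, ('m, 'm) sq) ftor"
  assumes "limit_ordinal \<kappa>"
    and "Field \<kappa> \<noteq> {}"
    and "is_category E"
    and "is_backdrop \<kappa> E M"
    and "is_category J"
    and "is_functor J (arrow_cat E) u"
    and "compatible E M J u"
    and "\<forall>i \<in> Obj J. is_small \<kappa> E M (Dom E (omap u i))"
  shows "\<exists>W. is_awfs E W \<and> cofibrantly_generated E W J u"
proof -
  obtain D \<iota> where dens: "is_density J (arrow_cat E) u D \<iota>" and D_M: "\<forall>f \<in> Arr E. omap D f \<in> M"
    and gap: "\<forall>\<sigma> \<in> squares E. upper \<sigma> \<in> M \<and> lower \<sigma> \<in> M \<longrightarrow>
           (\<forall>p q w. is_pushout E (omap D (src \<sigma>)) (upper (amap D \<sigma>)) p q \<and> q \<in> M \<and>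
              w \<in> hom E (Cod E p) (Cod E (omap D (tgt \<sigma>))) \<and>
              w \<cdot>\<^bsub>E\<^esub> p = lower (amap D \<sigma>) \<and> w \<cdot>\<^bsub>E\<^esub> q = omap D (tgt \<sigma>) \<longrightarrow>
              w \<in> M)"
    using assms(7) unfolding compatible_def by blast
  interpret small_density E J u D \<iota> \<kappa> M
  proof
    show "Well_order \<kappa>" using assms(1) by (simp add: limit_ordinal_def)
    fix \<sigma> p q w
    assume "\<sigma> \<in> squares E" "upper \<sigma> \<in> M" "lower \<sigma> \<in> M"
      "is_pushout E (omap D (src \<sigma>)) (upper (amap D \<sigma>)) p q" "q \<in> M"
      "w \<in> hom E (Cod E p) (Cod E (omap D (tgt \<sigma>)))" "w \<cdot>\<^bsub>E\<^esub> p = lower (amap D \<sigma>)"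
      "w \<cdot>\<^bsub>E\<^esub> q = omap D (tgt \<sigma>)"
    then show "w \<in> M" using gap by blast
  qed (use assms dens D_M in simp_all)
  interpret free_liftings E J u
    by unfold_locales (rule free_lifting_exists)
  show ?thesis using awfs cofibrantly_generated by blast
qed

end
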